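(* Let $(X_i)_{i=1}^\infty$ be i.i.d. random variables uniformly distributed on $(0,1)^2$. Then $$\lim_{n \to \infty} \frac{n}{\log n}\, \mathbb{E}\left[ Wb_{(0,1)^2,2}^2\left( \frac 1 n \sum_{i=1}^n \delta_{X_i}, 1 \right)\right] = \frac{1}{4\pi}.$$
   Context: Here $1$ denotes Lebesgue measure on $(0,1)^2$. For an open set $\Omega\subseteq\mathbb{R}^d$, $p\ge 1$, and finite positive measures $\mu,\lambda$ with finite $p$-th moment, the "boundary" optimal transport cost is $$Wb_{\Omega,p}(\mu,\lambda) = \left( \min_{\pi \in \mathcal{C}b_\Omega(\mu,\lambda)} \int_{\overline\Omega\times\overline\Omega} |x-y|^p\, d\pi(x,y) \right)^{1/p},$$ where $\mathcal{C}b_\Omega(\mu,\lambda)$ is the set of positive measures $\pi$ on $\overline\Omega\times\overline\Omega$ whose first and second marginals $\pi_1,\pi_2$ satisfy $\pi_1\llcorner\Omega = \mu\llcorner\Omega$ and $\pi_2\llcorner\Omega = \lambda\llcorner\Omega$ (restrictions to $\Omega$; the marginals are unconstrained on $\partial\Omega$). $|\cdot|$ is the Euclidean norm. *)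

theory Defs
  imports "HOL-Probability.Probability"
begin

text \<open>
  Measures on subsets of the Euclidean space are Borel measures on the whole space.
  A plan is a Borel measure on the square of the closure of the open set; no finiteness is
  imposed on it, and its marginals are compared with the data only on the open set itself,
  so they are unconstrained on the boundary.
\<close>

definition boundary_couplings ::
    "'a::euclidean_space set \<Rightarrow> 'a measure \<Rightarrow> 'a measure \<Rightarrow> ('a \<times> 'a) measure set"
  where "boundary_couplings \<Omega> \<mu> \<nu> =
    {\<pi>. sets \<pi> = sets (restrict_space borel (closure \<Omega> \<times> closure \<Omega>)) \<and>
        restrict_space (distr \<pi> borel fst) \<Omega> = restrict_space \<mu> \<Omega> \<and>
        restrict_space (distr \<pi> borel snd) \<Omega> = restrict_space \<nu> \<Omega>}"

definition boundary_cost ::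
    "'a::euclidean_space set \<Rightarrow> real \<Rightarrow> 'a measure \<Rightarrow> 'a measure \<Rightarrow> ennreal"
  where "boundary_cost \<Omega> p \<mu> \<nu> =
    (INF \<pi>\<in>boundary_couplings \<Omega> \<mu> \<nu>. \<integral>\<^sup>+(x, y). ennreal (norm (x - y) powr p) \<partial>\<pi>)"

text \<open>
  The minimum over plans is written as an infimum; it is infinite if there is no plan of
  finite cost.
\<close>

definition Wb :: "'a::euclidean_space set \<Rightarrow> real \<Rightarrow> 'a measure \<Rightarrow> 'a measure \<Rightarrow> ennreal"
  where "Wb \<Omega> p \<mu> \<nu> =
    (if boundary_cost \<Omega> p \<mu> \<nu> = \<top> then \<top>
     else ennreal (enn2real (boundary_cost \<Omega> p \<mu> \<nu>) powr (1 / p)))"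

definition unit_square :: "(real^2) set"
  where "unit_square = {x. \<forall>k. 0 < x $ k \<and> x $ k < 1}"

definition lebesgue_square :: "(real^2) measure"
  where "lebesgue_square = density lborel (indicator unit_square)"

definition empirical_measure :: "nat \<Rightarrow> (nat \<Rightarrow> 'a::topological_space) \<Rightarrow> 'a measure"
  where "empirical_measure n x =
    measure_of UNIV (sets borel)
      (\<lambda>A. ennreal (1 / real n) * (\<Sum>i=1..n. emeasure (return borel (x i)) A))"

lemma sets_empirical_measure [simp]: "sets (empirical_measure n x) = sets borel"
  unfolding empirical_measure_def by (metis sets.sets_measure_of_eq space_borel)

text \<open>The set function above is a measure, so that \<^const>\<open>measure_of\<close> does not replace it by zero.\<close>

lemma emeasure_empirical_measure:
  assumes "A \<in> sets borel"
  shows "emeasure (empirical_measure n x) A =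
    ennreal (1 / real n) * (\<Sum>i=1..n. indicator A (x i))"
proof -
  let ?f = "\<lambda>A. ennreal (1 / real n) * (\<Sum>i=1..n. emeasure (return borel (x i)) A)"
  have "countably_additive (sets borel) ?f"
  proof (rule countably_additiveI)
    fix F :: "nat \<Rightarrow> 'a set"
    assume F: "range F \<subseteq> sets borel" "disjoint_family F"
    have "(\<Sum>k. ?f (F k)) =
        ennreal (1 / real n) * (\<Sum>i=1..n. \<Sum>k. emeasure (return borel (x i)) (F k))"
      by (simp add: suminf_sum)
    also have "\<dots> = ?f (\<Union>k. F k)"
      using F by (subst suminf_emeasure) auto
    finally show "(\<Sum>k. ?f (F k)) = ?f (\<Union>k. F k)" .
  qed
  then have "emeasure (empirical_measure n x) A = ?f A"
    using assms
    by (intro emeasure_measure_of[OF empirical_measure_def]) (auto simp: positive_def)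
  then show ?thesis
    using assms by simp
qed

end

theory Submission
  imports Defs "HOL-Analysis.Harmonic_Numbers" "HOL-Real_Asymp.Real_Asymp"
begin

text \<open>
  Let \<open>m\<^sup>2 = n / (ln n)\<^bsup>5/4\<^esup>\<close> up to rounding; then a Bernstein bound for all scales up to \<open>1 / m\<close>
  has a probability of failure smaller than any power of \<open>n\<close>, while still \<open>ln m \<sim> ln n / 2\<close>.

  Upper bound. The sample is first spread out to the density that is constant on the \<open>m \<times> m\<close> grid
  cells, at a cost \<open>o(ln n / n)\<close>. This density is moved to \<open>1\<close> by monotone rearrangement along the
  rows, to an intermediate density, followed by monotone rearrangement along the columns. In the
  discrete cosine basis, the intermediate density splits each mode \<open>(j, k)\<close> between the two steps in
  proportion to the eigenvalues of the two directions; the cost is then the discrete \<open>H\<^sup>-\<^sup>1\<close> norm of the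
  fluctuation, whose expectation is \<open>1 / n\<close> times the sum of the inverse Neumann eigenvalues,
  asymptotically \<open>ln m / (2 \<pi> n)\<close>.

  Lower bound. By duality it suffices to use \<open>f\<close> and \<open>- f - |\<nabla>f|\<^sup>2 / (4 (1 - t))\<close>, where \<open>f\<close> is the
  sum of the Dirichlet modes up to \<open>m\<close>, weighted by the fluctuations divided by the eigenvalues, with
  each mode multiplied by a cutoff that makes \<open>f\<close> and \<open>\<nabla>f\<close> vanish on the boundary. This pair is
  admissible as soon as the second derivatives of \<open>f\<close> are bounded by \<open>t\<close>.
\<close>

section \<open>The discrete cosine basis\<close>

text \<open>The two bounds meet because the Neumann sum, over the closed quadrant of frequencies,
  and the Dirichlet sum, over the open one, have the same leading term; \<open>ln m\<close> is then
  about half of \<open>ln n\<close>, which gives the constant. Hence the upper bound can use plans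
  that ignore the freedom at the boundary. The Dirichlet modes vanish on the boundary but their
  gradients do not, and the second potential must vanish there too; this is why each mode is cut
  off. The obstacle in the upper bound is the choice of scale. With
  \<open>m\<^sup>2 = n / (ln n) powr a\<close>, failure probabilities below every power of
  \<open>n\<close> need \<open>a > 1\<close>, but then moving all mass across cells of side
  \<open>1 / m\<close> costs about \<open>1 / m\<^sup>2\<close>, more than \<open>ln n / n\<close>.
  So the spreading uses a second grid, finer by a factor \<open>k\<close>: mass stays in its fine
  cell, at cost \<open>1 / (m * k)\<^sup>2\<close>, except for the mismatch between fine and coarse
  frequencies, which moves within a coarse cell at an expected cost of order
  \<open>k / (m * sqrt n)\<close>. For \<open>a = 5 / 4\<close> and \<open>k\<close> about
  \<open>(ln n) powr (1 / 4)\<close> both are negligible against \<open>ln n / n\<close>.\<close>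

lemma sum_cos_odd_multiples:
  fixes \<theta> :: real
  shows "2 * sin \<theta> * (\<Sum>a<n. cos ((2 * real a + 1) * \<theta>)) = sin (2 * real n * \<theta>)"
proof (induction n)
  case 0 show ?case by simp
next
  case (Suc n)
  have "2 * sin \<theta> * cos ((2 * real n + 1) * \<theta>) = sin (2 * real (Suc n) * \<theta>) - sin (2 * real n * \<theta>)"
  proof -
    have "2 * real (Suc n) * \<theta> = (2 * real n + 1) * \<theta> + \<theta>" "2 * real n * \<theta> = (2 * real n + 1) * \<theta> - \<theta>"
      by (simp_all add: algebra_simps)
    then show ?thesis by (simp only: sin_add sin_diff) simp
  qed
  then show ?case using Suc by (simp add: distrib_left)
qed

lemma sum_cos_multiples:
  fixes \<theta> :: real
  shows "2 * sin \<theta> * (\<Sum>j<n. cos (2 * real j * \<theta>)) = sin ((2 * real n - 1) * \<theta>) + sin \<theta>"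
proof (induction n)
  case 0 show ?case by simp
next
  case (Suc n)
  have "2 * sin \<theta> * cos (2 * real n * \<theta>) = sin ((2 * real (Suc n) - 1) * \<theta>) - sin ((2 * real n - 1) * \<theta>)"
  proof -
    have "(2 * real (Suc n) - 1) * \<theta> = 2 * real n * \<theta> + \<theta>" "(2 * real n - 1) * \<theta> = 2 * real n * \<theta> - \<theta>"
      by (simp_all add: algebra_simps)
    then show ?thesis by (simp only: sin_add sin_diff) simp
  qed
  then show ?case using Suc by (simp add: distrib_left)
qed

lemma sin_pi_frac_pos:
  assumes "0 < l" "l < 2 * m"
  shows "sin (pi * real l / (2 * real m)) > 0"
proof (rule sin_gt_zero)
  show "0 < pi * real l / (2 * real m)" using assms by simp
  have "real l < 2 * real m" using assms by linarith
  then show "pi * real l / (2 * real m) < pi" using assms by (simp add: field_simps)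
qed

text \<open>The telescoped sum ends in the sine of a multiple of pi, while the sine in front of the
  sum is positive.\<close>

lemma sum_cos_odd_pi_frac:
  assumes "0 < l" "l < 2 * m"
  shows "(\<Sum>a<m. cos ((2 * real a + 1) * (pi * real l / (2 * real m)))) = 0"
proof -
  have "2 * real m * (pi * real l / (2 * real m)) = real l * pi" using assms by simp
  then show ?thesis
    using sum_cos_odd_multiples[of "pi * real l / (2 * real m)" m] sin_pi_frac_pos[OF assms] by simp
qed

text \<open>The telescoped sum ends at \<open>l * pi\<close> minus the angle, so only the parity of
  \<open>l\<close> survives.\<close>

lemma sum_cos_pi_frac:
  assumes "0 < l" "l < 2 * m"
  shows "(\<Sum>j<m. cos (2 * real j * (pi * real l / (2 * real m)))) = (1 - (-1) ^ l) / 2"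
proof -
  let ?t = "pi * real l / (2 * real m)"
  have "(2 * real m - 1) * ?t = real l * pi - ?t" using assms by (simp add: field_simps)
  then have "sin ((2 * real m - 1) * ?t) = - ((-1) ^ l * sin ?t)"
    by (simp add: sin_diff)
  then have "2 * sin ?t * (\<Sum>j<m. cos (2 * real j * ?t)) = 2 * sin ?t * ((1 - (-1) ^ l) / 2)"
    using sum_cos_multiples[of ?t m] by (simp add: algebra_simps)
  then show ?thesis using sin_pi_frac_pos[OF assms] by (simp del: mult_cancel_left add: mult_cancel_left)
qed

text \<open>The orthonormal discrete cosine basis (DCT-II): the Neumann mode
  \<open>cos (pi * j * x)\<close> sampled at the cell midpoints
  \<open>(2 * a + 1) / (2 * m)\<close>, with its own normalisation for the constant mode.\<close>

definition dct :: "nat \<Rightarrow> nat \<Rightarrow> nat \<Rightarrow> real" where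
  "dct m j a = (if j = 0 then sqrt (1 / real m) else sqrt (2 / real m)) *
     cos ((2 * real a + 1) * (pi * real j / (2 * real m)))"

lemma abs_dct_le: "m > 0 \<Longrightarrow> \<bar>dct m j a\<bar> \<le> sqrt (2 / real m)"
  unfolding dct_def abs_mult
  by (rule order_trans[OF mult_left_mono[OF abs_cos_le_one]]) (auto simp: divide_right_mono)

lemma dct_0: "dct m 0 a = sqrt (1 / real m)"
  by (simp add: dct_def)

text \<open>The product of two cosines splits into the frequencies \<open>i - j\<close> and
  \<open>i + j\<close>. Both are below \<open>2 * m\<close>, where every nonzero frequency sums to
  zero. The order of the indices makes the subtraction of naturals exact.\<close>

lemma dct_product_sum:
  assumes "j \<le> i" "i < m"
  shows "(\<Sum>a<m. cos ((2 * real a + 1) * (pi * real i / (2 * real m))) * cos ((2 * real a + 1) * (pi * real j / (2 * real m))))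
     = (if i = j then if i = 0 then real m else real m / 2 else 0)"
proof -
  have *: "cos ((2 * real a + 1) * (pi * real i / (2 * real m))) * cos ((2 * real a + 1) * (pi * real j / (2 * real m)))
    = (cos ((2 * real a + 1) * (pi * real (i - j) / (2 * real m))) +
       cos ((2 * real a + 1) * (pi * real (i + j) / (2 * real m)))) / 2" for a
  proof -
    have "(2 * real a + 1) * (pi * real (i - j) / (2 * real m)) =
       (2 * real a + 1) * (pi * real i / (2 * real m)) - (2 * real a + 1) * (pi * real j / (2 * real m))"
      using assms by (simp add: of_nat_diff diff_divide_distrib[symmetric] algebra_simps)
    moreover have "(2 * real a + 1) * (pi * real (i + j) / (2 * real m)) =
       (2 * real a + 1) * (pi * real i / (2 * real m)) + (2 * real a + 1) * (pi * real j / (2 * real m))"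
      by (simp add: add_divide_distrib[symmetric] algebra_simps)
    ultimately show ?thesis by (simp only: cos_times_cos)
  qed
  have s: "(\<Sum>a<m. cos ((2 * real a + 1) * (pi * real l / (2 * real m)))) = (if l = 0 then real m else 0)"
    if "l < 2 * m" for l
    using sum_cos_odd_pi_frac[of l m] that by auto
  show ?thesis unfolding * sum_divide_distrib[symmetric] sum.distrib
    using assms by (subst s, simp, subst s, simp) auto
qed

lemma dct_orthonormal:
  assumes "i < m" "j < m"
  shows "(\<Sum>a<m. dct m i a * dct m j a) = of_bool (i = j)"
proof -
  define \<gamma> where "\<gamma> j = (if j = 0 then sqrt (1 / real m) else sqrt (2 / real m))" for j :: nat
  define C where "C j a = cos ((2 * real a + 1) * (pi * real j / (2 * real m)))" for j a
  have d: "dct m j a = \<gamma> j * C j a" for j a by (simp add: dct_def \<gamma>_def C_def)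
  have "(\<Sum>a<m. C i a * C j a) = (if i = j then if i = 0 then real m else real m / 2 else 0)"
  proof (cases "j \<le> i")
    case True then show ?thesis using dct_product_sum[of j i m] assms by (simp add: C_def)
  next
    case False then show ?thesis using dct_product_sum[of i j m] assms by (simp add: C_def mult.commute)
  qed
  moreover have "(\<Sum>a<m. dct m i a * dct m j a) = \<gamma> i * \<gamma> j * (\<Sum>a<m. C i a * C j a)"
    by (simp add: d sum_distrib_left mult_ac)
  ultimately show ?thesis using assms by (auto simp: \<gamma>_def)
qed

text \<open>All modes get the weight \<open>2 / m\<close> and the excess of the constant mode is
  subtracted. The two frequencies \<open>a - b\<close> and \<open>a + b + 1\<close> have opposite
  parity, so their boundary terms add up to exactly this excess when \<open>a\<close> and
  \<open>b\<close> differ.\<close>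

lemma dct_complete_le:
  assumes "b \<le> a" "a < m"
  shows "(\<Sum>j<m. dct m j a * dct m j b) = of_bool (a = b)"
proof -
  have m: "m > 0" using assms by simp
  have *: "dct m j a * dct m j b = (cos (2 * real j * (pi * real (a - b) / (2 * real m))) +
      cos (2 * real j * (pi * real (a + b + 1) / (2 * real m)))) / real m - of_bool (j = 0) / real m" for j
  proof -
    have e1: "2 * real j * (pi * real (a - b) / (2 * real m)) =
       (2 * real a + 1) * (pi * real j / (2 * real m)) - (2 * real b + 1) * (pi * real j / (2 * real m))"
      using assms m by (simp add: of_nat_diff field_simps)
    have e2: "2 * real j * (pi * real (a + b + 1) / (2 * real m)) =
       (2 * real a + 1) * (pi * real j / (2 * real m)) + (2 * real b + 1) * (pi * real j / (2 * real m))"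
      using m by (simp add: field_simps)
    have "dct m j a * dct m j b = (if j = 0 then 1 / real m else 2 / real m) *
        (cos ((2 * real a + 1) * (pi * real j / (2 * real m))) * cos ((2 * real b + 1) * (pi * real j / (2 * real m))))"
      using m by (simp add: dct_def)
    also have "\<dots> = (if j = 0 then 1 / real m else 2 / real m) *
        ((cos (2 * real j * (pi * real (a - b) / (2 * real m))) + cos (2 * real j * (pi * real (a + b + 1) / (2 * real m)))) / 2)"
      by (simp only: e1 e2 cos_times_cos)
    finally show ?thesis using m by (cases "j = 0") (auto simp: add_divide_distrib)
  qed
  have s: "(\<Sum>j<m. cos (2 * real j * (pi * real l / (2 * real m)))) = (if l = 0 then real m else (1 - (-1) ^ l) / 2)"
    if "l < 2 * m" for l
    using sum_cos_pi_frac[of l m] that by auto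
  have z: "(\<Sum>j<m. of_bool (j = 0) / real m) = 1 / real m"
    using m by (subst sum.remove[of _ 0]) auto
  have par: "(- 1::real) ^ (a - b) = - ((-1) ^ (a + b + 1))"
  proof -
    have "even (a - b) \<longleftrightarrow> odd (a + b + 1)" using assms by auto
    then show ?thesis by (cases "even (a - b)") (auto simp: minus_one_power_iff)
  qed
  show ?thesis unfolding * sum_divide_distrib[symmetric] sum.distrib sum_subtractf z
    using assms m par by (subst s, simp, subst s, simp) (auto simp: field_simps)
qed

lemma dct_complete:
  assumes "a < m" "b < m"
  shows "(\<Sum>j<m. dct m j a * dct m j b) = of_bool (a = b)"
proof (cases "b \<le> a")
  case True then show ?thesis using dct_complete_le[of b a m] assms by simp
next
  case False then show ?thesis using dct_complete_le[of a b m] assms by (simp add: mult.commute)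
qed

text \<open>Prefix sums are discrete antiderivatives: the cosine modes become sine modes that vanish
  at both ends. They enter because the displacement of a monotone rearrangement is governed by
  cumulative masses.\<close>

lemma sum_dct_prefix:
  assumes "0 < j" "j < m"
  shows "(\<Sum>a<n. dct m j a) = sqrt (2 / real m) * sin (pi * real j * real n / real m) / (2 * sin (pi * real j / (2 * real m)))"
proof -
  let ?t = "pi * real j / (2 * real m)"
  have "sin ?t > 0" using sin_pi_frac_pos[of j m] assms by simp
  moreover have "2 * real n * ?t = pi * real j * real n / real m" by simp
  ultimately have "(\<Sum>a<n. cos ((2 * real a + 1) * ?t)) = sin (pi * real j * real n / real m) / (2 * sin ?t)"
    using sum_cos_odd_multiples[of ?t n] by (simp add: field_simps)
  then show ?thesis using assms by (simp add: dct_def sum_distrib_left[symmetric])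
qed

lemma sum_sin_squared_pi_frac:
  assumes "0 < j" "j < m"
  shows "(\<Sum>a<m. (sin (pi * real j * real a / real m))\<^sup>2) = real m / 2"
proof -
  have "(sin (pi * real j * real a / real m))\<^sup>2 = (1 - cos (2 * real a * (pi * real (2 * j) / (2 * real m)))) / 2" for a
  proof -
    have "2 * real a * (pi * real (2 * j) / (2 * real m)) = 2 * (pi * real j * real a / real m)"
      using assms by (simp add: field_simps)
    then show ?thesis by (simp only: cos_double_sin) simp
  qed
  moreover have "(\<Sum>a<m. cos (2 * real a * (pi * real (2 * j) / (2 * real m)))) = 0"
    using sum_cos_pi_frac[of "2 * j" m] assms by simp
  ultimately show ?thesis
    by (simp only: sum_divide_distrib[symmetric] sum_subtractf) simp
qed

section \<open>Sums of inverse eigenvalues\<close>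

text \<open>Both eigenvalue sums are compared with this one: divided by \<open>pi\<^sup>2\<close> it
  is the sum of the inverse Dirichlet eigenvalues, and the two axes, present only for Neumann, add a
  bounded amount.\<close>

definition lattice_sum :: "nat \<Rightarrow> real" where
  "lattice_sum m = (\<Sum>j=1..m. \<Sum>k=1..m. 1 / ((real j)\<^sup>2 + (real k)\<^sup>2))"

text \<open>The derivative of \<open>arctan (x / j)\<close> is
  \<open>j / (j\<^sup>2 + x\<^sup>2)\<close>, which decreases for nonnegative \<open>x\<close>; its
  mean over a unit step lies between the values at the two ends.\<close>

lemma arctan_step:
  fixes j x :: real
  assumes "j > 0" "x \<ge> 0"
  shows "j / (j\<^sup>2 + (x + 1)\<^sup>2) \<le> arctan ((x + 1) / j) - arctan (x / j)"
    and "arctan ((x + 1) / j) - arctan (x / j) \<le> j / (j\<^sup>2 + x\<^sup>2)"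
proof -
  have "\<exists>z>x. z < x + 1 \<and> arctan ((x + 1) / j) - arctan (x / j) = (x + 1 - x) * (j / (j\<^sup>2 + z\<^sup>2))"
  proof (rule MVT2)
    fix z assume "x \<le> z" "z \<le> x + 1"
    have "((\<lambda>z. arctan (z / j)) has_real_derivative inverse (1 + (z / j)\<^sup>2) * (1 / j)) (at z)"
      by (use assms in \<open>auto intro!: derivative_eq_intros\<close>)
    moreover have "inverse (1 + (z / j)\<^sup>2) * (1 / j) = j / (j\<^sup>2 + z\<^sup>2)"
    proof -
      have "1 + (z / j)\<^sup>2 = (j\<^sup>2 + z\<^sup>2) / j\<^sup>2" using assms by (simp add: field_simps power2_eq_square)
      then show ?thesis using assms by (simp add: power2_eq_square)
    qed
    ultimately show "((\<lambda>z. arctan (z / j)) has_real_derivative j / (j\<^sup>2 + z\<^sup>2)) (at z)" by simp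
  qed simp
  then obtain z where z: "x < z" "z < x + 1" "arctan ((x + 1) / j) - arctan (x / j) = j / (j\<^sup>2 + z\<^sup>2)"
    by auto
  have "x\<^sup>2 \<le> z\<^sup>2" "z\<^sup>2 \<le> (x + 1)\<^sup>2" using z assms by (auto intro!: power_mono)
  then show "j / (j\<^sup>2 + (x + 1)\<^sup>2) \<le> arctan ((x + 1) / j) - arctan (x / j)"
    "arctan ((x + 1) / j) - arctan (x / j) \<le> j / (j\<^sup>2 + x\<^sup>2)"
    unfolding z(3) using assms by (auto intro!: divide_left_mono add_pos_nonneg mult_pos_pos)
qed

lemma row_sum_bounds:
  fixes j :: real
  assumes "j > 0"
  shows "j * (\<Sum>k=1..m. 1 / (j\<^sup>2 + (real k)\<^sup>2)) \<le> arctan (real m / j)"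
    and "arctan ((real m + 1) / j) - arctan (1 / j) \<le> j * (\<Sum>k=1..m. 1 / (j\<^sup>2 + (real k)\<^sup>2))"
proof (induction m)
  case (Suc m)
  { case 1 show ?case
      using Suc(1) arctan_step(1)[of j "real m"] assms by (simp add: distrib_left add_ac) }
  { case 2 show ?case
      using Suc(2) arctan_step(2)[of j "real m + 1"] assms by (simp add: distrib_left add_ac) }
qed auto

text \<open>Every row contributes at most \<open>pi / 2\<close> divided by its index, which leaves a
  harmonic sum.\<close>

lemma lattice_sum_le:
  assumes "m \<ge> 1"
  shows "lattice_sum m \<le> pi / 2 * (1 + ln (real m))"
proof -
  have "lattice_sum m \<le> (\<Sum>j=1..m. pi / 2 * (1 / real j))"
    unfolding lattice_sum_def
  proof (rule sum_mono)
    fix j assume "j \<in> {1..m}"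
    then have j: "real j > 0" by simp
    have "real j * (\<Sum>k=1..m. 1 / ((real j)\<^sup>2 + (real k)\<^sup>2)) \<le> pi / 2"
      using row_sum_bounds(1)[OF j, of m] arctan_ubound[of "real m / real j"] by simp
    then show "(\<Sum>k=1..m. 1 / ((real j)\<^sup>2 + (real k)\<^sup>2)) \<le> pi / 2 * (1 / real j)"
      using j by (simp add: field_simps)
  qed
  also have "\<dots> = pi / 2 * harm m"
    by (simp add: harm_def sum_distrib_left field_simps)
  also have "\<dots> \<le> pi / 2 * (1 + ln (real m))"
    using decseqD[OF decseq_harm_diff_ln, of 0 "m - 1"] assms by (intro mult_left_mono) (auto simp: harm_expand)
  finally show ?thesis .
qed

lemma sum_inverse_squares_le: "(\<Sum>j=1..m. 1 / (real j)\<^sup>2) \<le> 2"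
proof -
  have "(\<Sum>j=1..Suc m. 1 / (real j)\<^sup>2) \<le> 2 - 1 / real (Suc m)" for m
  proof (induction m)
    case (Suc m)
    have "1 / (real (Suc (Suc m)))\<^sup>2 \<le> 1 / real (Suc m) - 1 / real (Suc (Suc m))"
      by (simp add: divide_simps power2_eq_square)
    then show ?case using Suc by simp
  qed simp
  from this[of "m - 1"] show ?thesis by (cases m) (auto intro: order_trans)
qed

lemma arctan_le_self: "x \<ge> 0 \<Longrightarrow> arctan x \<le> (x::real)"
  using abs_arctan_le[of x] by simp

text \<open>Against \<open>pi / 2\<close>, the row bound loses \<open>arctan (j / (m + 1))\<close>
  and \<open>arctan (1 / j)\<close>. After division by \<open>j\<close> the losses are at most
  \<open>1 / (m + 1)\<close> and \<open>1 / j\<^sup>2\<close>, with sums at most 1 and 2; this is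
  the 3.\<close>

lemma lattice_sum_ge: "lattice_sum m \<ge> pi / 2 * ln (real m + 1) - 3"
proof -
  have "(\<Sum>j=1..m. pi / 2 * (1 / real j) - 1 / (real m + 1) - 1 / (real j)\<^sup>2) \<le> lattice_sum m"
    unfolding lattice_sum_def
  proof (rule sum_mono)
    fix j assume "j \<in> {1..m}"
    then have j: "real j > 0" by simp
    have "arctan ((real m + 1) / real j) = pi / 2 - arctan (real j / (real m + 1))"
      using arctan_inverse[of "(real m + 1) / real j"] j by (simp add: sgn_if inverse_eq_divide)
    then have "pi / 2 - real j / (real m + 1) - 1 / real j \<le> real j * (\<Sum>k=1..m. 1 / ((real j)\<^sup>2 + (real k)\<^sup>2))"
      using row_sum_bounds(2)[OF j, of m] arctan_le_self[of "real j / (real m + 1)"] arctan_le_self[of "1 / real j"] by simp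
    then have "(pi / 2 - real j / (real m + 1) - 1 / real j) / real j \<le> (\<Sum>k=1..m. 1 / ((real j)\<^sup>2 + (real k)\<^sup>2))"
      using j by (simp add: divide_le_eq mult.commute)
    moreover have "(pi / 2 - real j / (real m + 1) - 1 / real j) / real j = pi / 2 * (1 / real j) - 1 / (real m + 1) - 1 / (real j)\<^sup>2"
      using j by (simp add: diff_divide_distrib power2_eq_square)
    ultimately show "pi / 2 * (1 / real j) - 1 / (real m + 1) - 1 / (real j)\<^sup>2 \<le> (\<Sum>k=1..m. 1 / ((real j)\<^sup>2 + (real k)\<^sup>2))"
      by simp
  qed
  moreover have "(\<Sum>j=1..m. pi / 2 * (1 / real j) - 1 / (real m + 1) - 1 / (real j)\<^sup>2)
     = pi / 2 * harm m - real m / (real m + 1) - (\<Sum>j=1..m. 1 / (real j)\<^sup>2)"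
    by (simp add: sum_subtractf harm_def sum_distrib_left inverse_eq_divide)
  moreover have "real m / (real m + 1) \<le> 1" by simp
  moreover have "pi / 2 * ln (real m + 1) \<le> pi / 2 * harm m"
    using ln_le_harm[of m] by (intro mult_left_mono) (auto simp: add.commute)
  ultimately show ?thesis using sum_inverse_squares_le[of m] by linarith
qed

text \<open>The eigenvalue \<open>2 - 2 * cos (pi * j / m)\<close> of the discrete Neumann Laplacian
  on \<open>m\<close> points; times \<open>m\<^sup>2\<close> it approximates
  \<open>(pi * j)\<^sup>2\<close>.\<close>

definition dct_eigenvalue :: "nat \<Rightarrow> nat \<Rightarrow> real" where
  "dct_eigenvalue m j = 4 * (sin (pi * real j / (2 * real m)))\<^sup>2"

lemma dct_eigenvalue_0 [simp]: "dct_eigenvalue m 0 = 0"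
  by (simp add: dct_eigenvalue_def)

lemma sin_ge_cubic:
  fixes x :: real
  assumes "0 \<le> x"
  shows "x * (1 - x\<^sup>2 / 6) \<le> sin x"
proof -
  have "\<bar>sin x - x\<bar> \<le> x ^ 3 / 6"
    using Maclaurin_sin_bound[of x 3] assms
    by (simp add: numeral_3_eq_3 sin_coeff_def inverse_eq_divide fact_numeral)
  then have "x - x ^ 3 / 6 \<le> sin x" by linarith
  then show ?thesis by (simp add: algebra_simps power2_eq_square power3_eq_cube)
qed

text \<open>For frequencies up to \<open>\<delta> * m\<close> the angle satisfies
  \<open>x\<^sup>2 \<le> 3 * \<delta>\<^sup>2\<close>, because \<open>pi\<^sup>2 \<le> 12\<close>;
  the cubic lower bound on the sine then loses at most the factor
  \<open>1 - \<delta>\<^sup>2 / 2\<close>.\<close>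

lemma dct_eigenvalue_ge:
  assumes "m > 0" "0 \<le> \<delta>" "\<delta> \<le> 1" "real j \<le> \<delta> * real m"
  shows "(1 - \<delta>\<^sup>2 / 2)\<^sup>2 * (pi\<^sup>2 * (real j)\<^sup>2) \<le> (real m)\<^sup>2 * dct_eigenvalue m j"
proof -
  define x where "x = pi * real j / (2 * real m)"
  have x: "0 \<le> x" "x \<le> pi / 2 * \<delta>"
    using assms by (auto simp: x_def field_simps)
  have pi2: "pi\<^sup>2 \<le> 12"
  proof -
    have "pi\<^sup>2 \<le> (3.2)\<^sup>2" using pi_approx by (intro power_mono) auto
    then show ?thesis by (simp add: power2_eq_square)
  qed
  have "x\<^sup>2 \<le> (pi / 2 * \<delta>)\<^sup>2" using x by (intro power_mono)
  also have "\<dots> \<le> 3 * \<delta>\<^sup>2"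
    using mult_right_mono[OF pi2, of "\<delta>\<^sup>2"] by (simp add: power_mult_distrib power_divide)
  finally have "1 - \<delta>\<^sup>2 / 2 \<le> 1 - x\<^sup>2 / 6" by simp
  then have "x * (1 - \<delta>\<^sup>2 / 2) \<le> sin x"
    using sin_ge_cubic[OF x(1)] mult_left_mono[OF _ x(1)] by (meson order_trans)
  moreover have "0 \<le> x * (1 - \<delta>\<^sup>2 / 2)"
    using x assms power_le_one[of \<delta> 2] by (intro mult_nonneg_nonneg) auto
  ultimately have "(x * (1 - \<delta>\<^sup>2 / 2))\<^sup>2 \<le> (sin x)\<^sup>2" by (intro power_mono)
  then have "4 * (real m)\<^sup>2 * (x * (1 - \<delta>\<^sup>2 / 2))\<^sup>2 \<le> 4 * (real m)\<^sup>2 * (sin x)\<^sup>2"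
    by (intro mult_left_mono) auto
  moreover have "4 * (real m)\<^sup>2 * (x * (1 - \<delta>\<^sup>2 / 2))\<^sup>2 = (1 - \<delta>\<^sup>2 / 2)\<^sup>2 * (pi\<^sup>2 * (real j)\<^sup>2)"
    using assms(1) by (simp add: x_def power_mult_distrib power_divide)
  ultimately show ?thesis by (simp add: dct_eigenvalue_def x_def)
qed

text \<open>A crude bound for all frequencies: at \<open>\<delta> = 1\<close> the factor is
  \<open>pi\<^sup>2 / 4\<close>, which exceeds 1.\<close>

lemma dct_eigenvalue_ge_square:
  assumes "j < m"
  shows "(real j)\<^sup>2 \<le> (real m)\<^sup>2 * dct_eigenvalue m j"
proof -
  have "1 * (real j)\<^sup>2 \<le> (1 - 1\<^sup>2 / 2)\<^sup>2 * pi\<^sup>2 * (real j)\<^sup>2"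
  proof (rule mult_right_mono)
    have "pi\<^sup>2 \<ge> 3\<^sup>2" using pi_gt3 by (intro power_mono) auto
    then show "1 \<le> (1 - 1\<^sup>2 / 2)\<^sup>2 * pi\<^sup>2" by (simp add: power2_eq_square)
  qed simp
  then show ?thesis using dct_eigenvalue_ge[of m 1 j] assms by simp
qed

definition neumann_sum :: "nat \<Rightarrow> real" where
  "neumann_sum m = (\<Sum>(j, k)\<in>{..<m} \<times> {..<m} - {(0, 0)}.
     1 / ((real m)\<^sup>2 * (dct_eigenvalue m j + dct_eigenvalue m k)))"

lemma sum_punctured_quadrant_le:
  "(\<Sum>(j, k)\<in>{..<m} \<times> {..<m} - {(0, 0)}. 1 / ((real j)\<^sup>2 + (real k)\<^sup>2)) \<le> lattice_sum m + 4"
proof -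
  let ?f = "\<lambda>(j, k). 1 / ((real j)\<^sup>2 + (real k)\<^sup>2)"
  have "sum ?f ({..<m} \<times> {..<m} - {(0, 0)}) \<le> sum ?f ({1..m} \<times> {1..m} \<union> ({0} \<times> {1..m} \<union> {1..m} \<times> {0}))"
    by (rule sum_mono2) (auto simp: not_less_eq_eq Suc_le_eq)
  also have "\<dots> = sum ?f ({1..m} \<times> {1..m}) + (sum ?f ({0} \<times> {1..m}) + sum ?f ({1..m} \<times> {0}))"
    by (subst sum.union_disjoint; auto intro: sum.union_disjoint)
  also have "\<dots> = lattice_sum m + 2 * (\<Sum>j=1..m. 1 / (real j)\<^sup>2)"
    by (simp add: lattice_sum_def sum.cartesian_product[symmetric])
  also have "\<dots> \<le> lattice_sum m + 4" using sum_inverse_squares_le[of m] by simp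
  finally show ?thesis .
qed

text \<open>The frequencies are split at \<open>\<delta> * m\<close>. Below, the eigenvalues are
  sharp up to a factor close to 1. Above, each of the at most \<open>m\<^sup>2\<close> terms is at
  most \<open>1 / (\<delta> * m)\<^sup>2\<close>, which adds up to a constant independent of
  \<open>m\<close>.\<close>

lemma neumann_sum_le_aux:
  assumes "m > 0" "0 < \<delta>" "\<delta> \<le> 1"
  shows "neumann_sum m \<le> (1 / (1 - \<delta>\<^sup>2 / 2)\<^sup>2 / pi\<^sup>2) * (lattice_sum m + 4) + 1 / \<delta>\<^sup>2"
proof -
  define c where "c = 1 / (1 - \<delta>\<^sup>2 / 2)\<^sup>2 / pi\<^sup>2"
  have d: "\<delta>\<^sup>2 \<le> 1" using assms by (simp add: power_le_one)
  have c: "c \<ge> 0" by (simp add: c_def)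
  have "neumann_sum m \<le> (\<Sum>(j, k)\<in>{..<m} \<times> {..<m} - {(0, 0)}. c * (1 / ((real j)\<^sup>2 + (real k)\<^sup>2)) + 1 / (\<delta>\<^sup>2 * (real m)\<^sup>2))"
    unfolding neumann_sum_def
  proof (rule sum_mono)
    fix x assume "x \<in> {..<m} \<times> {..<m} - {(0::nat, 0::nat)}"
    then obtain j k where x: "x = (j, k)" and jk: "(j, k) \<noteq> (0, 0)" "j < m" "k < m" by (cases x) auto
    have pos: "(real j)\<^sup>2 + (real k)\<^sup>2 > 0" using jk by (auto simp: sum_power2_gt_zero_iff)
    let ?L = "(real m)\<^sup>2 * (dct_eigenvalue m j + dct_eigenvalue m k)"
    have "1 / ?L \<le> c * (1 / ((real j)\<^sup>2 + (real k)\<^sup>2)) + 1 / (\<delta>\<^sup>2 * (real m)\<^sup>2)"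
    proof (cases "real j \<le> \<delta> * real m \<and> real k \<le> \<delta> * real m")
      case True
      then have "(1 - \<delta>\<^sup>2 / 2)\<^sup>2 * pi\<^sup>2 * ((real j)\<^sup>2 + (real k)\<^sup>2) \<le> ?L"
        using dct_eigenvalue_ge[of m \<delta> j] dct_eigenvalue_ge[of m \<delta> k] assms by (simp add: algebra_simps)
      moreover have "0 < (1 - \<delta>\<^sup>2 / 2)\<^sup>2 * pi\<^sup>2 * ((real j)\<^sup>2 + (real k)\<^sup>2)"
        using pos d by (intro mult_pos_pos) auto
      ultimately have "1 / ?L \<le> 1 / ((1 - \<delta>\<^sup>2 / 2)\<^sup>2 * pi\<^sup>2 * ((real j)\<^sup>2 + (real k)\<^sup>2))"
        by (intro frac_le) linarith+
      also have "\<dots> = c * (1 / ((real j)\<^sup>2 + (real k)\<^sup>2))" by (simp add: c_def)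
      finally show ?thesis by (simp add: add_increasing2)
    next
      case False
      then have "(\<delta> * real m)\<^sup>2 \<le> (real j)\<^sup>2 \<or> (\<delta> * real m)\<^sup>2 \<le> (real k)\<^sup>2"
        using assms by (auto intro!: power_mono simp: not_le)
      then have "\<delta>\<^sup>2 * (real m)\<^sup>2 \<le> (real j)\<^sup>2 + (real k)\<^sup>2"
        by (auto simp: power_mult_distrib add_increasing add_increasing2)
      also have "\<dots> \<le> ?L"
        using dct_eigenvalue_ge_square[OF jk(2)] dct_eigenvalue_ge_square[OF jk(3)] by (simp add: algebra_simps)
      finally have "\<delta>\<^sup>2 * (real m)\<^sup>2 \<le> ?L" .
      moreover have "0 < \<delta>\<^sup>2 * (real m)\<^sup>2" using assms by simp
      ultimately have "1 / ?L \<le> 1 / (\<delta>\<^sup>2 * (real m)\<^sup>2)"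
        by (intro frac_le) linarith+
      moreover have "0 \<le> c * (1 / ((real j)\<^sup>2 + (real k)\<^sup>2))" using c pos by simp
      ultimately show ?thesis by linarith
    qed
    then show "(case x of (j, k) \<Rightarrow> 1 / ((real m)\<^sup>2 * (dct_eigenvalue m j + dct_eigenvalue m k)))
      \<le> (case x of (j, k) \<Rightarrow> c * (1 / ((real j)\<^sup>2 + (real k)\<^sup>2)) + 1 / (\<delta>\<^sup>2 * (real m)\<^sup>2))"
      by (simp add: x)
  qed
  also have "\<dots> = c * (\<Sum>(j, k)\<in>{..<m} \<times> {..<m} - {(0, 0)}. 1 / ((real j)\<^sup>2 + (real k)\<^sup>2))
      + real (card ({..<m} \<times> {..<m} - {(0::nat, 0::nat)})) * (1 / (\<delta>\<^sup>2 * (real m)\<^sup>2))"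
    by (simp add: sum.distrib sum_distrib_left case_prod_unfold)
  also have "\<dots> \<le> c * (lattice_sum m + 4) + (real m)\<^sup>2 * (1 / (\<delta>\<^sup>2 * (real m)\<^sup>2))"
  proof (intro add_mono mult_left_mono mult_right_mono)
    have "card ({..<m} \<times> {..<m} - {(0::nat, 0::nat)}) \<le> card ({..<m} \<times> {..<m})"
      by (intro card_mono) auto
    then show "real (card ({..<m} \<times> {..<m} - {(0::nat, 0::nat)})) \<le> (real m)\<^sup>2"
      by (simp add: power2_eq_square flip: of_nat_mult)
  qed (use c sum_punctured_quadrant_le in auto)
  finally show ?thesis using assms by (simp add: c_def)
qed

lemma neumann_sum_le:
  assumes "\<epsilon> > 0"
  shows "\<exists>C. \<forall>m>0. neumann_sum m \<le> (1 + \<epsilon>) / (2 * pi) * ln (real m) + C"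
proof -
  \<comment> \<open>Chosen so that \<open>1 - q\<close> equals
    \<open>1 / sqrt (1 + \<epsilon>)\<close>; then \<open>1 / (1 - q / 2)\<^sup>2\<close> is at most
    \<open>1 + \<epsilon>\<close>.\<close>
  define q where "q = 1 - 1 / sqrt (1 + \<epsilon>)"
  define \<delta> where "\<delta> = sqrt q"
  have s: "sqrt (1 + \<epsilon>) > 1" using assms by simp
  have q: "0 < q" "q < 1" using s by (auto simp: q_def)
  have d: "0 < \<delta>" "\<delta> \<le> 1" "\<delta>\<^sup>2 = q" using q by (auto simp: \<delta>_def)
  have "1 / sqrt (1 + \<epsilon>) = 1 - q" by (simp add: q_def)
  then have "1 / sqrt (1 + \<epsilon>) \<le> 1 - q / 2" using q by linarith
  then have "(1 / sqrt (1 + \<epsilon>))\<^sup>2 \<le> (1 - q / 2)\<^sup>2" using s by (intro power_mono) auto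
  then have "1 / (1 + \<epsilon>) \<le> (1 - q / 2)\<^sup>2" using assms by (simp add: power_divide)
  then have k: "1 / (1 - q / 2)\<^sup>2 \<le> 1 + \<epsilon>"
    using assms q by (simp add: field_simps)
  have "neumann_sum m \<le> (1 + \<epsilon>) / (2 * pi) * ln (real m) + ((1 + \<epsilon>) / pi\<^sup>2 * (pi / 2 + 4) + 1 / q)"
    if m: "m > 0" for m
  proof -
    have "lattice_sum m \<ge> 0" unfolding lattice_sum_def by (intro sum_nonneg) auto
    have "neumann_sum m \<le> (1 / (1 - q / 2)\<^sup>2 / pi\<^sup>2) * (lattice_sum m + 4) + 1 / q"
      using neumann_sum_le_aux[OF m d(1,2)] d(3) by simp
    also have "\<dots> \<le> ((1 + \<epsilon>) / pi\<^sup>2) * (pi / 2 * (1 + ln (real m)) + 4) + 1 / q"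
      using k lattice_sum_le[of m] m assms q \<open>lattice_sum m \<ge> 0\<close>
      by (intro add_mono mult_mono divide_right_mono) auto
    also have "\<dots> = (1 + \<epsilon>) / (2 * pi) * ln (real m) + ((1 + \<epsilon>) / pi\<^sup>2 * (pi / 2 + 4) + 1 / q)"
      by (simp add: field_simps power2_eq_square)
    finally show ?thesis .
  qed
  then show ?thesis by blast
qed

section \<open>Monotone rearrangement on the line\<close>

abbreviation mass_upto :: "(real \<Rightarrow> real) \<Rightarrow> real \<Rightarrow> real" where
  "mass_upto f x \<equiv> integral {0..x} f"

lemma bounded_measurable_integrable_on:
  fixes f :: "real \<Rightarrow> real"
  assumes "f \<in> borel_measurable borel" "\<And>x. \<bar>f x\<bar> \<le> B"
  shows "f integrable_on {a..b}"
proof -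
  have "set_integrable lborel {a..b} f"
    unfolding set_integrable_def real_scaleR_def
    using assms by (intro integrableI_bounded_set[where A = "{a..b}" and B = B])
      (auto simp: indicator_def emeasure_lborel_Icc_eq intro!: order_trans[OF assms(2)] abs_ge_zero)
  then show ?thesis by (rule set_borel_integral_eq_integral(1))
qed

lemma mass_upto_diff:
  fixes f :: "real \<Rightarrow> real"
  assumes "f \<in> borel_measurable borel" "\<And>x. \<bar>f x\<bar> \<le> B" "0 \<le> x" "x \<le> y"
  shows "mass_upto f y - mass_upto f x = integral {x..y} f"
  using Henstock_Kurzweil_Integration.integral_combine[OF assms(3,4) bounded_measurable_integrable_on[OF assms(1,2)]] by simp

lemma emeasure_density_interval:
  fixes f :: "real \<Rightarrow> real"
  assumes [measurable]: "f \<in> borel_measurable borel" and "\<And>x. 0 \<le> f x" "\<And>x. f x \<le> B" "0 \<le> y" "y \<le> 1"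
  shows "emeasure (density lborel (\<lambda>x. ennreal (f x) * indicator {0..1} x)) {..y} = ennreal (mass_upto f y)"
proof -
  have "emeasure (density lborel (\<lambda>x. ennreal (f x) * indicator {0..1} x)) {..y} =
     (\<integral>\<^sup>+ x. ennreal (f x) * indicator {0..1} x * indicator {..y} x \<partial>lborel)"
    by (subst emeasure_density) auto
  also have "\<dots> = (\<integral>\<^sup>+ x. ennreal (if x \<in> {0..y} then f x else 0) \<partial>lborel)"
    using assms by (intro nn_integral_cong) (auto simp: indicator_def)
  also have "\<dots> = ennreal (mass_upto f y)"
  proof (rule nn_integral_has_integral_lborel)
    have "\<bar>f x\<bar> \<le> B" for x using assms(2,3)[of x] by auto
    then have "f integrable_on {0..y}" by (rule bounded_measurable_integrable_on[OF assms(1)])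
    then show "((\<lambda>x. if x \<in> {0..y} then f x else 0) has_integral mass_upto f y) UNIV"
      unfolding has_integral_restrict_UNIV by (rule integrable_integral)
  qed (use assms in auto)
  finally show ?thesis .
qed

lemma finite_borel_measure_density_interval:
  fixes f :: "real \<Rightarrow> real"
  assumes [measurable]: "f \<in> borel_measurable borel" and "\<And>x. 0 \<le> f x" "\<And>x. f x \<le> B"
  shows "finite_borel_measure (density lborel (\<lambda>x. ennreal (f x) * indicator {0..1} x))" (is "finite_borel_measure ?M")
proof (intro finite_borel_measure.intro finite_borel_measure_axioms.intro finite_measureI)
  have "emeasure ?M (space ?M) = (\<integral>\<^sup>+ x. ennreal (f x) * indicator {0..1} x \<partial>lborel)"
    by (subst emeasure_density) auto
  also have "\<dots> \<le> (\<integral>\<^sup>+ x. ennreal B * indicator {0..1::real} x \<partial>lborel)"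
    using assms by (intro nn_integral_mono mult_right_mono ennreal_leI) auto
  also have "\<dots> < \<infinity>" by (simp add: nn_integral_cmult_indicator ennreal_mult_less_top)
  finally show "emeasure ?M (space ?M) \<noteq> \<infinity>" by simp
qed simp

lemma emeasure_density_atMost_ge_1:
  fixes f :: "real \<Rightarrow> real"
  assumes [measurable]: "f \<in> borel_measurable borel" and "\<And>x. 0 \<le> f x" "\<And>x. f x \<le> B" "1 \<le> y"
  shows "emeasure (density lborel (\<lambda>x. ennreal (f x) * indicator {0..1} x)) {..y} = ennreal (mass_upto f 1)"
proof -
  have "emeasure (density lborel (\<lambda>x. ennreal (f x) * indicator {0..1} x)) {..y} =
      emeasure (density lborel (\<lambda>x. ennreal (f x) * indicator {0..1} x)) {..1}"
    using assms by (subst (1 2) emeasure_density) (auto intro!: nn_integral_cong simp: indicator_def)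
  then show ?thesis using emeasure_density_interval[of f B 1] assms by simp
qed

lemma emeasure_density_atMost_neg:
  fixes f :: "real \<Rightarrow> real"
  assumes [measurable]: "f \<in> borel_measurable borel" and "y < 0"
  shows "emeasure (density lborel (\<lambda>x. ennreal (f x) * indicator {0..1} x)) {..y} = 0"
  using assms by (subst emeasure_density) (auto simp: nn_integral_0_iff_AE indicator_def)

text \<open>The map sends \<open>x\<close> to the point where \<open>q\<close> has the cumulative
  mass that \<open>p\<close> has at \<open>x\<close>. Since \<open>q\<close> is at least
  \<open>c\<close>, its cumulative mass grows at rate at least \<open>c\<close>, so the displacement
  is at most the difference of the two cumulative masses at \<open>x\<close>, divided by
  \<open>c\<close>. Equality of the measures is read off from the distribution functions.\<close>

proposition monotone_rearrangement:
  fixes p q :: "real \<Rightarrow> real"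
  assumes p [measurable]: "p \<in> borel_measurable borel" and p0: "\<And>x. 0 \<le> p x" and pB: "\<And>x. p x \<le> B"
    and q [measurable]: "q \<in> borel_measurable borel" and q0: "\<And>x. c \<le> q x" and qB: "\<And>x. q x \<le> B"
    and c: "0 < c" and mass: "mass_upto p 1 = mass_upto q 1"
  obtains T where "T \<in> borel_measurable borel" "\<And>x. T x \<in> {0..1}"
    "distr (density lborel (\<lambda>x. ennreal (p x) * indicator {0..1} x)) borel T
       = density lborel (\<lambda>x. ennreal (q x) * indicator {0..1} x)"
    "\<And>x. x \<in> {0..1} \<Longrightarrow> \<bar>T x - x\<bar> \<le> \<bar>mass_upto p x - mass_upto q x\<bar> / c"
proof -
  have B: "\<bar>p x\<bar> \<le> B" "\<bar>q x\<bar> \<le> B" for x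
    using p0[of x] pB[of x] q0[of x] qB[of x] c by auto
  note pint = bounded_measurable_integrable_on[OF p B(1)]
  note qint = bounded_measurable_integrable_on[OF q B(2)]
  have Pmono: "mass_upto p x \<le> mass_upto p y" if "0 \<le> x" "x \<le> y" for x y
  proof -
    have "integral {x..y} p \<ge> 0" using p0 by (intro Henstock_Kurzweil_Integration.integral_nonneg pint) auto
    then show ?thesis using mass_upto_diff[OF p B(1) that] by simp
  qed
  have Qmono: "c * (y - x) \<le> mass_upto q y - mass_upto q x" if "0 \<le> x" "x \<le> y" for x y
  proof -
    have "integral {x..y} (\<lambda>_. c) \<le> integral {x..y} q" using q0 by (intro integral_le qint) auto
    then show ?thesis using mass_upto_diff[OF q B(2) that] that by (simp add: mult.commute)
  qed
  have Qless: "mass_upto q x < mass_upto q y" if "0 \<le> x" "x < y" for x y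
    using Qmono[of x y] that c by (smt (verit) mult_pos_pos)
  have P0: "mass_upto p 0 = 0" "mass_upto q 0 = 0" by auto
  have Pcont: "continuous_on {0..1} (mass_upto p)" and Qcont: "continuous_on {0..1} (mass_upto q)"
    by (intro indefinite_integral_continuous_1 pint qint)+
  have "\<exists>z\<in>{0..1}. mass_upto q z = mass_upto p x" if "x \<in> {0..1}" for x
  proof -
    have "mass_upto q 0 \<le> mass_upto p x" "mass_upto p x \<le> mass_upto q 1"
      using Pmono[of 0 x] Pmono[of x 1] that mass P0 by auto
    from IVT'[OF this _ Qcont] show ?thesis by auto
  qed
  then obtain t where t: "\<And>x. x \<in> {0..1} \<Longrightarrow> t x \<in> {0..1}" "\<And>x. x \<in> {0..1} \<Longrightarrow> mass_upto q (t x) = mass_upto p x"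
    by metis
  \<comment> \<open>Clamping extends the map to a monotone function on the whole line, and monotone
    functions are Borel.\<close>
  define T where "T x = t (max 0 (min 1 x))" for x
  have cl: "max 0 (min 1 x) \<in> {0..1}" for x :: real by auto
  have T01: "T x \<in> {0..1}" for x unfolding T_def by (rule t(1)[OF cl])
  have Tt: "T x = t x" if "x \<in> {0..1}" for x using that by (auto simp: T_def)
  have "mono T"
  proof
    fix x y :: real assume "x \<le> y"
    then have "max 0 (min 1 x) \<le> max 0 (min 1 y)" by auto
    then have "mass_upto p (max 0 (min 1 x)) \<le> mass_upto p (max 0 (min 1 y))" using Pmono by auto
    then have "mass_upto q (T x) \<le> mass_upto q (T y)" unfolding T_def using t(2)[OF cl] by metis
    then show "T x \<le> T y" using Qless[of "T y" "T x"] T01[of y] by force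
  qed
  then have Tm [measurable]: "T \<in> borel_measurable borel" by (rule borel_measurable_mono)
  define M where "M = density lborel (\<lambda>x. ennreal (p x) * indicator {0..1} x)"
  define N where "N = density lborel (\<lambda>x. ennreal (q x) * indicator {0..1} x)"
  have q0': "0 \<le> q x" for x using q0[of x] c by simp
  interpret M: finite_borel_measure M unfolding M_def by (rule finite_borel_measure_density_interval[OF p p0 pB])
  interpret N: finite_borel_measure N unfolding N_def by (rule finite_borel_measure_density_interval[OF q q0' qB])
  have sM [measurable_cong]: "sets M = sets borel" by (simp add: M_def)
  have D: "finite_borel_measure (distr M borel T)"
  proof -
    have "T \<in> measurable M borel" by measurable
    then interpret D: finite_measure "distr M borel T" by (rule M.finite_measure_distr)
    show ?thesis by standard simp
  qed
  have main: "emeasure (distr M borel T) {..a} = emeasure N {..a}" for a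
  proof -
    have e: "emeasure (distr M borel T) {..a} = emeasure M {x. T x \<le> a}"
      by (subst emeasure_distr) (auto simp: M_def vimage_def)
    consider "a < 0" | "1 \<le> a" | "0 \<le> a" "a < 1" by linarith
    then show ?thesis
    proof cases
      case 1
      then have "{x. T x \<le> a} = {}" using T01 by (auto simp: not_le intro: less_le_trans)
      then show ?thesis using 1 e emeasure_density_atMost_neg[OF q, of a] by (simp add: N_def)
    next
      case 2
      then have "{x. T x \<le> a} = UNIV" using T01 by (auto intro: order_trans)
      then have "emeasure (distr M borel T) {..a} = emeasure M UNIV" using e by simp
      also have "\<dots> = emeasure M {..1}"
        unfolding M_def by (subst (1 2) emeasure_density) (auto intro!: nn_integral_cong simp: indicator_def)
      also have "\<dots> = emeasure N {..a}"
        using emeasure_density_atMost_ge_1[OF p p0 pB, of 1] emeasure_density_atMost_ge_1[OF q q0' qB 2] mass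
        by (simp add: M_def N_def)
      finally show ?thesis .
    next
      case 3
      define v where "v = mass_upto q a"
      have v: "0 \<le> v" using order_trans[OF mult_nonneg_nonneg[of c a] Qmono[of 0 a, simplified]] 3 c by (simp add: v_def)
      have v1: "v \<le> mass_upto q 1" using Qless[of a 1] 3 by (simp add: v_def)
      \<comment> \<open>These turn out to be the points of the unit interval sent to
        \<open>{..a}\<close>. As the mass of \<open>p\<close> is monotone and continuous, the set is
        the interval from 0 to its largest point.\<close>
      define S where "S = {x \<in> {0..1}. mass_upto p x \<le> v}"
      have "closed S" unfolding S_def
        using continuous_closed_preimage[OF Pcont, of "{..v}"] by (auto simp: vimage_def Int_def conj_commute)
      moreover have "bounded S" by (rule bounded_subset[OF bounded_closed_interval[of 0 1]]) (auto simp: S_def)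
      ultimately have "compact S" by (simp add: compact_eq_bounded_closed)
      moreover have "0 \<in> S" using v by (simp add: S_def)
      ultimately obtain y where y: "y \<in> S" "\<And>s. s \<in> S \<Longrightarrow> s \<le> y" using compact_attains_sup[of S] by auto
      have y01: "0 \<le> y" "y \<le> 1" "mass_upto p y \<le> v" using y by (auto simp: S_def)
      have Seq: "S = {0..y}"
      proof
        show "S \<subseteq> {0..y}" using y(2) by (auto simp: S_def)
        show "{0..y} \<subseteq> S"
        proof
          fix x assume "x \<in> {0..y}"
          then show "x \<in> S" using Pmono[of x y] y01 by (simp add: S_def)
        qed
      qed
      \<comment> \<open>The intermediate value theorem gives a point of \<open>S\<close> at or after
        \<open>y\<close> with mass exactly \<open>v\<close>; by maximality it is
        \<open>y\<close>.\<close>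
      have "mass_upto p y = v"
      proof -
        have "\<exists>z\<ge>y. z \<le> 1 \<and> mass_upto p z = v"
          using y01 v1 mass by (intro IVT' continuous_on_subset[OF Pcont]) auto
        then obtain z where z: "y \<le> z" "z \<le> 1" "mass_upto p z = v" by auto
        then have "z \<in> S" using y01 by (simp add: S_def)
        then have "z = y" using y(2)[of z] z(1) by simp
        then show ?thesis using z by simp
      qed
      have iff: "T x \<le> a \<longleftrightarrow> x \<in> S" if "x \<in> {0..1}" for x
      proof -
        have "T x \<le> a \<longleftrightarrow> mass_upto q (T x) \<le> mass_upto q a"
          using Qless[of a "T x"] Qless[of "T x" a] T01[of x] 3 by (cases "T x" a rule: linorder_cases) auto
        then show ?thesis using that t(2)[OF that] Tt[OF that] by (simp add: S_def v_def)
      qed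
      have [measurable]: "{x. T x \<le> a} \<in> sets borel" by measurable
      have "emeasure M {x. T x \<le> a} = emeasure M {..y}"
        unfolding M_def
        by (subst (1 2) emeasure_density) (use iff Seq in \<open>auto intro!: nn_integral_cong simp: indicator_def\<close>)
      also have "\<dots> = ennreal v"
        using emeasure_density_interval[OF p p0 pB y01(1,2)] \<open>mass_upto p y = v\<close> by (simp add: M_def)
      also have "\<dots> = emeasure N {..a}"
        using emeasure_density_interval[OF q q0' qB, of a] 3 by (simp add: N_def v_def)
      finally show ?thesis using e by simp
    qed
  qed
  have "distr M borel T = N"
    using D N.finite_borel_measure_axioms
  proof (rule cdf_unique')
    show "cdf (distr M borel T) = cdf N"
      by (rule ext) (simp add: cdf_def measure_def main)
  qed
  moreover have "\<bar>T x - x\<bar> \<le> \<bar>mass_upto p x - mass_upto q x\<bar> / c" if x: "x \<in> {0..1}" for x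
  proof -
    have "mass_upto q (T x) = mass_upto p x" using t(2)[OF x] Tt[OF x] by simp
    then have "c * \<bar>T x - x\<bar> \<le> \<bar>mass_upto p x - mass_upto q x\<bar>"
      using Qmono[of x "T x"] Qmono[of "T x" x] T01[of x] x by (cases "x \<le> T x") (auto simp: algebra_simps)
    then show ?thesis using c by (simp add: field_simps)
  qed
  ultimately show ?thesis using that[OF Tm T01] by (simp add: M_def N_def)
qed

section \<open>The unit square\<close>

text \<open>Product measures and Fubini live on pairs, the statement on \<open>real^2\<close>;
  integrals over the square pass through this map.\<close>

definition vec2 :: "real \<times> real \<Rightarrow> real^2" where
  "vec2 p = (\<chi> i. if i = 1 then fst p else snd p)"

lemma vec2_nth [simp]: "vec2 p $ 1 = fst p" "vec2 p $ 2 = snd p"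
  by (simp_all add: vec2_def)

lemma norm_vec2_diff: "(norm (x - y :: real^2))\<^sup>2 = (x $ 1 - y $ 1)\<^sup>2 + (x $ 2 - y $ 2)\<^sup>2"
  by (simp add: norm_vec_def L2_set_def sum_2)

lemma measurable_vec2 [measurable]: "vec2 \<in> borel_measurable borel"
proof -
  have "continuous_on UNIV vec2"
    unfolding vec2_def
  proof (rule continuous_on_vec_lambda)
    fix i :: 2 show "continuous_on UNIV (\<lambda>p :: real \<times> real. if i = 1 then fst p else snd p)"
      by (cases "i = 1") (simp_all add: continuous_on_fst continuous_on_snd)
  qed
  then show ?thesis by (rule borel_measurable_continuous_onI)
qed

lemma measurable_vec_nth_real [measurable]: "(\<lambda>z :: real^2. z $ i) \<in> borel_measurable borel"
  by (intro borel_measurable_continuous_onI continuous_intros)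

text \<open>The space is the whole line, so that measurability is Borel measurability; the closed
  interval differs from the open one by a null set.\<close>

definition unit_interval :: "real measure" where
  "unit_interval = density lborel (indicator {0..1})"

lemma sets_unit_interval [simp, measurable_cong]: "sets unit_interval = sets borel"
  and space_unit_interval [simp]: "space unit_interval = UNIV"
  by (simp_all add: unit_interval_def)

lemma prob_space_unit_interval: "prob_space unit_interval"
  by standard (simp add: unit_interval_def emeasure_density nn_integral_indicator)

interpretation unit_interval: prob_space unit_interval
  by (rule prob_space_unit_interval)

interpretation unit_square: pair_prob_space unit_interval unit_interval ..

lemma unit_interval_integral:
  fixes f :: "real \<Rightarrow> real"
  assumes [measurable]: "f \<in> borel_measurable borel" and "\<And>x. x \<in> {0..1} \<Longrightarrow> \<bar>f x\<bar> \<le> B"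
  shows "integral\<^sup>L unit_interval f = integral {0..1} f" and "f integrable_on {0..1}"
proof -
  have i: "set_integrable lborel {0..1} f"
    unfolding set_integrable_def real_scaleR_def
    using assms by (intro integrableI_bounded_set[where A = "{0..1}" and B = B]) (auto simp: indicator_def)
  have "unit_interval = density lborel (\<lambda>x. ennreal (indicator {0..1} x))"
    by (simp add: unit_interval_def ennreal_indicator)
  then have "integral\<^sup>L unit_interval f = (LINT x:{0..1}|lborel. f x)"
    using integral_density[of f lborel "indicator {0..1}"] by (simp add: set_lebesgue_integral_def)
  then show "integral\<^sup>L unit_interval f = integral {0..1} f" "f integrable_on {0..1}"
    using set_borel_integral_eq_integral[OF i] by simp_all
qed

lemma AE_unit_interval: "AE x in unit_interval. 0 < x \<and> x < 1"
proof -
  have "AE x in lborel. x \<noteq> (0::real)" "AE x in lborel. x \<noteq> (1::real)" by (rule AE_lborel_singleton)+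
  then have "AE x in lborel. x \<in> {0..1::real} \<longrightarrow> 0 < x \<and> x < 1"
    by eventually_elim auto
  then show ?thesis unfolding unit_interval_def by (subst AE_density) auto
qed

lemma distr_lborel_vec2: "distr lborel borel vec2 = (lborel :: (real^2) measure)"
proof (rule lborel_eqI[symmetric])
  fix l u :: "real^2" assume le: "\<And>b. b \<in> Basis \<Longrightarrow> l \<bullet> b \<le> u \<bullet> b"
  have "l \<bullet> axis i 1 \<le> u \<bullet> axis i 1" for i by (intro le) (auto simp: Basis_vec_def)
  then have le': "l $ i \<le> u $ i" for i by (simp add: inner_axis)
  have "vec2 -` box l u = {l $ 1<..<u $ 1} \<times> {l $ 2<..<u $ 2}"
    by (auto simp: mem_box_cart forall_2)
  then have "emeasure (distr lborel borel vec2) (box l u) = emeasure (lborel \<Otimes>\<^sub>M lborel) ({l $ 1<..<u $ 1} \<times> {l $ 2<..<u $ 2})"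
    by (subst emeasure_distr) (auto simp: lborel_prod)
  also have "\<dots> = ennreal ((u $ 1 - l $ 1) * (u $ 2 - l $ 2))"
    using le' by (subst lborel.emeasure_pair_measure_Times) (auto simp: ennreal_mult)
  also have "(u $ 1 - l $ 1) * (u $ 2 - l $ 2) = (\<Prod>b\<in>Basis. (u - l) \<bullet> b)"
  proof -
    have B: "Basis = (\<lambda>i. axis i (1::real) :: real^2) ` UNIV" by (auto simp: Basis_vec_def)
    show ?thesis unfolding B
      by (subst prod.reindex) (auto simp: inj_on_def axis_eq_axis inner_axis prod_2 UNIV_2)
  qed
  finally show "emeasure (distr lborel borel vec2) (box l u) = (\<Prod>b\<in>Basis. (u - l) \<bullet> b)" .
qed simp

lemma unit_square_iff: "z \<in> unit_square \<longleftrightarrow> 0 < z $ 1 \<and> z $ 1 < 1 \<and> 0 < z $ 2 \<and> z $ 2 < 1"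
  by (auto simp: unit_square_def forall_2)

lemma open_unit_square: "open unit_square"
proof -
  have "unit_square = box 0 1" by (auto simp: unit_square_iff mem_box_cart forall_2)
  then show ?thesis by (metis open_box)
qed

lemma closure_unit_square: "closure unit_square = {z. \<forall>k. 0 \<le> z $ k \<and> z $ k \<le> 1}"
proof -
  have "unit_square = box 0 1" by (auto simp: unit_square_iff mem_box_cart forall_2)
  moreover have "(1/2 :: real) *\<^sub>R 1 \<in> box 0 (1::real^2)" by (auto simp: mem_box_cart)
  then have "box 0 (1::real^2) \<noteq> {}" by blast
  ultimately have "closure unit_square = cbox 0 1" by (metis closure_box)
  then show ?thesis by (auto simp: mem_box_cart)
qed

lemma closure_unit_square_iff: "z \<in> closure unit_square \<longleftrightarrow> 0 \<le> z $ 1 \<and> z $ 1 \<le> 1 \<and> 0 \<le> z $ 2 \<and> z $ 2 \<le> 1"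
  by (auto simp: closure_unit_square forall_2)

lemma measurable_unit_square [measurable]: "unit_square \<in> sets borel"
  by (simp add: open_unit_square)

text \<open>The open square and the product of the closed intervals differ by a null set; it is
  removed in each variable separately.\<close>

lemma lebesgue_square_eq: "lebesgue_square = distr (unit_interval \<Otimes>\<^sub>M unit_interval) borel vec2"
proof (rule measure_eqI)
  fix A assume "A \<in> sets lebesgue_square"
  then have A [measurable]: "A \<in> sets borel" by (simp add: lebesgue_square_def)
  have [measurable]: "vec2 \<in> lborel \<Otimes>\<^sub>M lborel \<rightarrow>\<^sub>M borel" by (simp add: lborel_prod)
  have "emeasure lebesgue_square A = (\<integral>\<^sup>+ z. indicator unit_square z * indicator A z \<partial>distr lborel borel vec2)"
    by (simp add: lebesgue_square_def emeasure_density distr_lborel_vec2)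
  also have "\<dots> = (\<integral>\<^sup>+ p. indicator unit_square (vec2 p) * indicator A (vec2 p) \<partial>(lborel \<Otimes>\<^sub>M lborel))"
    by (subst nn_integral_distr) (auto simp: lborel_prod)
  also have "\<dots> = (\<integral>\<^sup>+ x. \<integral>\<^sup>+ y. indicator unit_square (vec2 (x, y)) * indicator A (vec2 (x, y)) \<partial>lborel \<partial>lborel)"
    by (subst lborel.nn_integral_fst[symmetric]) auto
  also have "\<dots> = (\<integral>\<^sup>+ x. \<integral>\<^sup>+ y. indicator {0..1} x * (indicator {0..1} y * indicator A (vec2 (x, y))) \<partial>lborel \<partial>lborel)"
  proof (rule nn_integral_cong_AE)
    have *: "AE x in lborel. x \<noteq> 0 \<and> x \<noteq> (1::real)"
      using AE_lborel_singleton[of "0::real"] AE_lborel_singleton[of "1::real"] by eventually_elim auto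
    show "AE x in lborel. (\<integral>\<^sup>+ y. indicator unit_square (vec2 (x, y)) * indicator A (vec2 (x, y)) \<partial>lborel) =
       (\<integral>\<^sup>+ y. indicator {0..1} x * (indicator {0..1} y * indicator A (vec2 (x, y))) \<partial>lborel)"
      using *
    proof eventually_elim
      fix x :: real assume x: "x \<noteq> 0 \<and> x \<noteq> 1"
      show "(\<integral>\<^sup>+ y. indicator unit_square (vec2 (x, y)) * indicator A (vec2 (x, y)) \<partial>lborel) =
         (\<integral>\<^sup>+ y. indicator {0..1} x * (indicator {0..1} y * indicator A (vec2 (x, y))) \<partial>lborel)"
        by (rule nn_integral_cong_AE, use * in eventually_elim) (use x in \<open>auto simp: indicator_def unit_square_iff\<close>)
    qed
  qed
  also have "\<dots> = (\<integral>\<^sup>+ x. \<integral>\<^sup>+ y. indicator A (vec2 (x, y)) \<partial>unit_interval \<partial>unit_interval)"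
    by (simp add: unit_interval_def nn_integral_density nn_integral_cmult)
  also have "\<dots> = (\<integral>\<^sup>+ p. indicator A (vec2 p) \<partial>(unit_interval \<Otimes>\<^sub>M unit_interval))"
    by (subst unit_interval.nn_integral_fst[symmetric]) auto
  also have "\<dots> = emeasure (distr (unit_interval \<Otimes>\<^sub>M unit_interval) borel vec2) A"
    by (subst nn_integral_indicator[symmetric], simp, subst nn_integral_distr) auto
  finally show "emeasure lebesgue_square A = emeasure (distr (unit_interval \<Otimes>\<^sub>M unit_interval) borel vec2) A" .
qed (simp add: lebesgue_square_def)

lemma sets_lebesgue_square [simp, measurable_cong]: "sets lebesgue_square = sets borel"
  and space_lebesgue_square [simp]: "space lebesgue_square = UNIV"
  by (simp_all add: lebesgue_square_def)

lemma measurable_vec2_pair [measurable]: "vec2 \<in> unit_interval \<Otimes>\<^sub>M unit_interval \<rightarrow>\<^sub>M borel"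
proof -
  have "sets (unit_interval \<Otimes>\<^sub>M unit_interval) = sets (borel :: (real \<times> real) measure)"
    by (simp add: borel_prod[symmetric] cong: sets_pair_measure_cong)
  then show ?thesis using measurable_vec2 by (simp cong: measurable_cong_sets)
qed

lemma prob_space_lebesgue_square: "prob_space lebesgue_square"
  unfolding lebesgue_square_eq by (intro unit_square.prob_space_distr) simp

interpretation lebesgue_square: prob_space lebesgue_square
  by (rule prob_space_lebesgue_square)

lemma uniform_measure_unit_square: "uniform_measure lborel unit_square = lebesgue_square"
proof -
  have "emeasure lborel unit_square = 1"
    using lebesgue_square.emeasure_space_1 by (simp add: lebesgue_square_def emeasure_density)
  then have "(\<lambda>x. indicator unit_square x / emeasure lborel unit_square) = indicator unit_square"
    by (simp add: fun_eq_iff divide_ennreal_def)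
  then show ?thesis by (simp add: uniform_measure_def lebesgue_square_def)
qed

lemma AE_lebesgue_square: "AE z in lebesgue_square. z \<in> unit_square"
  unfolding lebesgue_square_def by (subst AE_density) (auto simp: indicator_def)

lemma integral_square_mult:
  fixes f g :: "real \<Rightarrow> real"
  assumes [measurable]: "f \<in> borel_measurable borel" "g \<in> borel_measurable borel"
    and "\<And>x. x \<in> {0..1} \<Longrightarrow> \<bar>f x\<bar> \<le> B" "\<And>x. x \<in> {0..1} \<Longrightarrow> \<bar>g x\<bar> \<le> B"
  shows "(\<integral>z. f (z $ 1) * g (z $ 2) \<partial>lebesgue_square) = integral {0..1} f * integral {0..1} g"
proof -
  have B: "B \<ge> 0" using order_trans[OF abs_ge_zero assms(3)[of 0]] by simp
  have fi: "integrable unit_interval f" and gi: "integrable unit_interval g"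
    by (auto intro!: unit_interval.integrable_const_bound[where B = B] eventually_mono[OF AE_unit_interval] assms(3,4))
  have "(\<integral>z. f (z $ 1) * g (z $ 2) \<partial>lebesgue_square) = (\<integral>p. f (fst p) * g (snd p) \<partial>(unit_interval \<Otimes>\<^sub>M unit_interval))"
    unfolding lebesgue_square_eq by (subst integral_distr) auto
  also have "\<dots> = (\<integral>x. \<integral>y. f x * g y \<partial>unit_interval \<partial>unit_interval)"
    using fi gi by (subst unit_square.integral_fst'[symmetric]) (auto intro!: unit_square.Fubini_integrable simp: abs_mult)
  also have "\<dots> = integral {0..1} f * integral {0..1} g"
    using unit_interval_integral(1)[OF assms(1,3)] unit_interval_integral(1)[OF assms(2,4)] by simp
  finally show ?thesis .
qed

section \<open>Fluctuations of the empirical measure\<close>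

text \<open>Boundedness is asked on the open square only: the test functions include polynomial
  cutoffs, which are unbounded on the plane, and the sample lies in the square almost
  surely.\<close>

definition square_bounded :: "(real^2 \<Rightarrow> real) \<Rightarrow> bool" where
  "square_bounded \<phi> \<longleftrightarrow> \<phi> \<in> borel_measurable borel \<and> (\<exists>B. \<forall>z\<in>unit_square. \<bar>\<phi> z\<bar> \<le> B)"

lemma square_boundedI:
  "\<phi> \<in> borel_measurable borel \<Longrightarrow> (\<And>z. z \<in> unit_square \<Longrightarrow> \<bar>\<phi> z\<bar> \<le> B) \<Longrightarrow> square_bounded \<phi>"
  by (auto simp: square_bounded_def)

lemma square_bounded_measurable [measurable_dest]: "square_bounded \<phi> \<Longrightarrow> \<phi> \<in> borel_measurable borel"
  by (simp add: square_bounded_def)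

lemma square_bounded_const [simp]: "square_bounded (\<lambda>_. c)"
  by (auto simp: square_bounded_def)

lemma square_bounded_add: "square_bounded \<phi> \<Longrightarrow> square_bounded \<psi> \<Longrightarrow> square_bounded (\<lambda>z. \<phi> z + \<psi> z)"
proof -
  assume "square_bounded \<phi>" "square_bounded \<psi>"
  then obtain A B where [measurable]: "\<phi> \<in> borel_measurable borel" "\<psi> \<in> borel_measurable borel"
    and "\<forall>z\<in>unit_square. \<bar>\<phi> z\<bar> \<le> A" "\<forall>z\<in>unit_square. \<bar>\<psi> z\<bar> \<le> B" by (auto simp: square_bounded_def)
  then show ?thesis by (intro square_boundedI[where B = "A + B"]) (auto intro!: order_trans[OF abs_triangle_ineq] add_mono)
qed

lemma square_bounded_mult: "square_bounded \<phi> \<Longrightarrow> square_bounded \<psi> \<Longrightarrow> square_bounded (\<lambda>z. \<phi> z * \<psi> z)"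
proof -
  assume "square_bounded \<phi>" "square_bounded \<psi>"
  then obtain A B where [measurable]: "\<phi> \<in> borel_measurable borel" "\<psi> \<in> borel_measurable borel"
    and "\<forall>z\<in>unit_square. \<bar>\<phi> z\<bar> \<le> A" "\<forall>z\<in>unit_square. \<bar>\<psi> z\<bar> \<le> B" by (auto simp: square_bounded_def)
  then show ?thesis
    by (intro square_boundedI[where B = "A * B"]) (auto simp: abs_mult intro!: mult_mono order_trans[OF abs_ge_zero])
qed

lemma square_bounded_diff: "square_bounded \<phi> \<Longrightarrow> square_bounded \<psi> \<Longrightarrow> square_bounded (\<lambda>z. \<phi> z - \<psi> z)"
  using square_bounded_add[of \<phi> "\<lambda>z. -1 * \<psi> z"] square_bounded_mult[of "\<lambda>_. -1" \<psi>] by simp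

lemma square_bounded_power2: "square_bounded \<phi> \<Longrightarrow> square_bounded (\<lambda>z. (\<phi> z)\<^sup>2)"
  unfolding power2_eq_square by (rule square_bounded_mult)

lemma square_bounded_divide: "square_bounded \<phi> \<Longrightarrow> square_bounded (\<lambda>z. \<phi> z / c)"
  using square_bounded_mult[of \<phi> "\<lambda>_. 1 / c"] by simp

lemma square_bounded_sum: "(\<And>i. i \<in> I \<Longrightarrow> square_bounded (\<phi> i)) \<Longrightarrow> square_bounded (\<lambda>z. \<Sum>i\<in>I. \<phi> i z)"
  by (induction I rule: infinite_finite_induct) (auto intro: square_bounded_add)

lemmas square_bounded_intros = square_bounded_const square_bounded_add square_bounded_mult square_bounded_diff
  square_bounded_power2 square_bounded_divide square_bounded_sum

lemma integrable_square_bounded: "square_bounded \<phi> \<Longrightarrow> integrable lebesgue_square \<phi>"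
proof -
  assume "square_bounded \<phi>"
  then obtain B where B: "\<forall>z\<in>unit_square. \<bar>\<phi> z\<bar> \<le> B" and [measurable]: "\<phi> \<in> borel_measurable borel"
    by (auto simp: square_bounded_def)
  show ?thesis
    by (rule lebesgue_square.integrable_const_bound[where B = B])
      (use B in \<open>auto intro: eventually_mono[OF AE_lebesgue_square]\<close>)
qed

lemma (in prob_space) expectation_mult_indep:
  assumes "indep_vars (\<lambda>_. borel) Y I" "i \<in> I" "j \<in> I" "i \<noteq> j"
    and "integrable M (Y i)" "integrable M (Y j :: _ \<Rightarrow> real)"
  shows "expectation (\<lambda>\<omega>. Y i \<omega> * Y j \<omega>) = expectation (Y i) * expectation (Y j)"
    and "integrable M (\<lambda>\<omega>. Y i \<omega> * Y j \<omega>)"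
  using indep_vars_lebesgue_integral[of "{i, j}" Y] indep_vars_integrable[of "{i, j}" Y]
    indep_vars_subset[OF assms(1), of "{i, j}"] assms by (auto simp: mult.commute)

locale uniform_sample = prob_space M for M :: "'w measure" +
  fixes X :: "nat \<Rightarrow> 'w \<Rightarrow> real^2"
  assumes indep: "indep_vars (\<lambda>_. borel) X {1..}"
    and distr: "\<And>i. i \<ge> 1 \<Longrightarrow> distr M borel (X i) = lebesgue_square"
begin

lemma measurable_sample: "i \<ge> 1 \<Longrightarrow> X i \<in> borel_measurable M"
  using indep by (auto simp: indep_vars_def)

lemma AE_sample: "i \<ge> 1 \<Longrightarrow> AE \<omega> in M. X i \<omega> \<in> unit_square"
  by (rule AE_distrD[OF measurable_sample]) (simp_all only: distr AE_lebesgue_square)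

lemma AE_sample_all: "AE \<omega> in M. \<forall>i\<in>{1..}. X i \<omega> \<in> unit_square"
  by (subst AE_ball_countable) (auto intro: AE_sample)

lemma integrable_sample: "square_bounded \<phi> \<Longrightarrow> i \<ge> 1 \<Longrightarrow> integrable M (\<lambda>\<omega>. \<phi> (X i \<omega>))"
  using integrable_square_bounded[of \<phi>] integrable_distr[OF measurable_sample[of i], of \<phi>] distr[of i] by simp

lemma expectation_sample:
  "square_bounded \<phi> \<Longrightarrow> i \<ge> 1 \<Longrightarrow> expectation (\<lambda>\<omega>. \<phi> (X i \<omega>)) = integral\<^sup>L lebesgue_square \<phi>"
  using integral_distr[OF measurable_sample[of i], of \<phi>] distr[of i] by (simp add: square_bounded_measurable)

text \<open>The integral of \<open>\<phi>\<close> against the empirical measure minus the uniform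
  one; both bounds on the cost are expressed through such integrals.\<close>

definition fluctuation :: "nat \<Rightarrow> (real^2 \<Rightarrow> real) \<Rightarrow> 'w \<Rightarrow> real" where
  "fluctuation n \<phi> \<omega> = (\<Sum>i=1..n. \<phi> (X i \<omega>)) / real n - integral\<^sup>L lebesgue_square \<phi>"

lemma measurable_fluctuation [measurable]:
  assumes [measurable]: "\<phi> \<in> borel_measurable borel"
  shows "fluctuation n \<phi> \<in> borel_measurable M"
proof -
  have "(\<lambda>\<omega>. \<phi> (X i \<omega>)) \<in> borel_measurable M" if "i \<in> {1..n}" for i
    using measurable_compose[OF measurable_sample[of i] assms] that by simp
  then show ?thesis unfolding fluctuation_def by (intro borel_measurable_diff borel_measurable_divide borel_measurable_sum) auto
qed

lemma fluctuation_add: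
  "square_bounded \<phi> \<Longrightarrow> square_bounded \<psi> \<Longrightarrow> fluctuation n (\<lambda>z. \<phi> z + \<psi> z) \<omega> = fluctuation n \<phi> \<omega> + fluctuation n \<psi> \<omega>"
  by (simp add: fluctuation_def sum.distrib add_divide_distrib integrable_square_bounded)

lemma fluctuation_cmult: "fluctuation n (\<lambda>z. c * \<phi> z) \<omega> = c * fluctuation n \<phi> \<omega>"
  by (simp add: fluctuation_def sum_distrib_left[symmetric] right_diff_distrib)

lemma fluctuation_sum:
  assumes "\<And>i. i \<in> I \<Longrightarrow> square_bounded (\<phi> i)"
  shows "fluctuation n (\<lambda>z. \<Sum>i\<in>I. \<phi> i z) \<omega> = (\<Sum>i\<in>I. fluctuation n (\<phi> i) \<omega>)"
  using assms
proof (induction I rule: infinite_finite_induct)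
  case (insert i I)
  then show ?case by (simp add: fluctuation_add square_bounded_sum)
qed (simp_all add: fluctuation_def)

lemma fluctuation_lincomb:
  assumes "\<And>i. i \<in> I \<Longrightarrow> square_bounded (\<phi> i)"
  shows "fluctuation n (\<lambda>z. \<Sum>i\<in>I. c i * \<phi> i z) \<omega> = (\<Sum>i\<in>I. c i * fluctuation n (\<phi> i) \<omega>)"
  using fluctuation_sum[of I "\<lambda>i z. c i * \<phi> i z"] assms by (simp add: fluctuation_cmult square_bounded_intros)

lemma abs_fluctuation_le:
  assumes "square_bounded \<phi>" "\<And>z. z \<in> unit_square \<Longrightarrow> \<bar>\<phi> z\<bar> \<le> B" "\<And>i. i \<in> {1..n} \<Longrightarrow> X i \<omega> \<in> unit_square" "n > 0"
  shows "\<bar>fluctuation n \<phi> \<omega>\<bar> \<le> 2 * B"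
proof -
  have "\<bar>\<Sum>i=1..n. \<phi> (X i \<omega>)\<bar> \<le> real n * B"
    using assms sum_norm_bound[of "{1..n}" "\<lambda>i. \<phi> (X i \<omega>)" B] by auto
  then have 1: "\<bar>(\<Sum>i=1..n. \<phi> (X i \<omega>)) / real n\<bar> \<le> B"
    using assms by (simp add: field_simps)
  have "\<bar>integral\<^sup>L lebesgue_square \<phi>\<bar> \<le> (\<integral>z. \<bar>\<phi> z\<bar> \<partial>lebesgue_square)"
    using integral_norm_bound[of lebesgue_square \<phi>] by simp
  also have "\<dots> \<le> (\<integral>z. B \<partial>lebesgue_square)"
    using assms integrable_square_bounded[OF assms(1)]
    by (intro integral_mono_AE) (auto intro: eventually_mono[OF AE_lebesgue_square])
  finally have 2: "\<bar>integral\<^sup>L lebesgue_square \<phi>\<bar> \<le> B" using lebesgue_square.prob_space by simp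
  show ?thesis using 1 2 unfolding fluctuation_def by linarith
qed

lemma centered_facts:
  assumes "square_bounded \<phi>" "\<mu> = integral\<^sup>L lebesgue_square \<phi>"
  shows "indep_vars (\<lambda>_. borel) (\<lambda>i \<omega>. \<phi> (X i \<omega>) - \<mu>) {1..}"
    and "\<And>i. i \<ge> 1 \<Longrightarrow> integrable M (\<lambda>\<omega>. \<phi> (X i \<omega>) - \<mu>)"
    and "\<And>i. i \<ge> 1 \<Longrightarrow> expectation (\<lambda>\<omega>. \<phi> (X i \<omega>) - \<mu>) = 0"
    and "\<And>i. i \<ge> 1 \<Longrightarrow> expectation (\<lambda>\<omega>. (\<phi> (X i \<omega>) - \<mu>)\<^sup>2) = (\<integral>z. (\<phi> z)\<^sup>2 \<partial>lebesgue_square) - \<mu>\<^sup>2"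
    and "\<And>i. i \<ge> 1 \<Longrightarrow> integrable M (\<lambda>\<omega>. (\<phi> (X i \<omega>) - \<mu>)\<^sup>2)"
proof -
  note [measurable] = square_bounded_measurable[OF assms(1)]
  show "indep_vars (\<lambda>_. borel) (\<lambda>i \<omega>. \<phi> (X i \<omega>) - \<mu>) {1..}"
    by (rule indep_vars_compose2[OF indep, where Y = "\<lambda>_ z. \<phi> z - \<mu>"]) measurable
  fix i :: nat assume i: "i \<ge> 1"
  show "integrable M (\<lambda>\<omega>. \<phi> (X i \<omega>) - \<mu>)"
    using integrable_sample[OF assms(1) i] by simp
  show "expectation (\<lambda>\<omega>. \<phi> (X i \<omega>) - \<mu>) = 0"
    using integrable_sample[OF assms(1) i] expectation_sample[OF assms(1) i] assms(2) by (simp add: prob_space)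
  have sq: "(\<lambda>\<omega>. (\<phi> (X i \<omega>) - \<mu>)\<^sup>2) = (\<lambda>\<omega>. (\<phi> (X i \<omega>))\<^sup>2 - 2 * \<mu> * \<phi> (X i \<omega>) + \<mu>\<^sup>2)"
    by (simp add: power2_diff algebra_simps)
  note i2 = integrable_sample[OF square_bounded_power2[OF assms(1)] i]
  note i1 = integrable_sample[OF assms(1) i]
  show "integrable M (\<lambda>\<omega>. (\<phi> (X i \<omega>) - \<mu>)\<^sup>2)" unfolding sq using i1 i2 by simp
  show "expectation (\<lambda>\<omega>. (\<phi> (X i \<omega>) - \<mu>)\<^sup>2) = (\<integral>z. (\<phi> z)\<^sup>2 \<partial>lebesgue_square) - \<mu>\<^sup>2"
    unfolding sq using i1 i2 expectation_sample[OF assms(1) i] expectation_sample[OF square_bounded_power2[OF assms(1)] i]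
    by (simp add: prob_space assms(2) power2_eq_square)
qed

lemma fluctuation_eq_centered:
  assumes "n > 0"
  shows "fluctuation n \<phi> \<omega> = (\<Sum>i=1..n. \<phi> (X i \<omega>) - integral\<^sup>L lebesgue_square \<phi>) / real n"
  using assms by (simp add: fluctuation_def sum_subtractf diff_divide_distrib)

lemma variance_fluctuation:
  assumes "square_bounded \<phi>" "n > 0"
  shows "expectation (\<lambda>\<omega>. (fluctuation n \<phi> \<omega>)\<^sup>2) = ((\<integral>z. (\<phi> z)\<^sup>2 \<partial>lebesgue_square) - (integral\<^sup>L lebesgue_square \<phi>)\<^sup>2) / real n"
    and "integrable M (\<lambda>\<omega>. (fluctuation n \<phi> \<omega>)\<^sup>2)"
proof -
  define \<mu> where "\<mu> = integral\<^sup>L lebesgue_square \<phi>"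
  define Y where "Y i \<omega> = \<phi> (X i \<omega>) - \<mu>" for i \<omega>
  note c = centered_facts[OF assms(1) \<mu>_def, folded Y_def]
  have prod: "expectation (\<lambda>\<omega>. Y i \<omega> * Y j \<omega>) = (if i = j then (\<integral>z. (\<phi> z)\<^sup>2 \<partial>lebesgue_square) - \<mu>\<^sup>2 else 0)"
    "integrable M (\<lambda>\<omega>. Y i \<omega> * Y j \<omega>)"
    if "i \<in> {1..n}" "j \<in> {1..n}" for i j
    using expectation_mult_indep[OF c(1), of i j] c(2-5)[of i] c(2,3)[of j] that
    by (cases "i = j"; auto simp: power2_eq_square)+
  have sq: "(fluctuation n \<phi> \<omega>)\<^sup>2 = (\<Sum>i=1..n. \<Sum>j=1..n. Y i \<omega> * Y j \<omega>) / (real n)\<^sup>2" for \<omega>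
    using assms(2) by (simp add: fluctuation_eq_centered Y_def \<mu>_def power_divide sum_product power2_eq_square)
  show "integrable M (\<lambda>\<omega>. (fluctuation n \<phi> \<omega>)\<^sup>2)"
    unfolding sq using prod(2) by (intro integrable_divide Bochner_Integration.integrable_sum) auto
  have "expectation (\<lambda>\<omega>. (fluctuation n \<phi> \<omega>)\<^sup>2) = (\<Sum>i=1..n. \<Sum>j=1..n. expectation (\<lambda>\<omega>. Y i \<omega> * Y j \<omega>)) / (real n)\<^sup>2"
  proof -
    have "expectation (\<lambda>\<omega>. \<Sum>i=1..n. \<Sum>j=1..n. Y i \<omega> * Y j \<omega>) = (\<Sum>i=1..n. expectation (\<lambda>\<omega>. \<Sum>j=1..n. Y i \<omega> * Y j \<omega>))"
      using prod(2) by (intro Bochner_Integration.integral_sum Bochner_Integration.integrable_sum)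
    also have "\<dots> = (\<Sum>i=1..n. \<Sum>j=1..n. expectation (\<lambda>\<omega>. Y i \<omega> * Y j \<omega>))"
      using prod(2) by (intro sum.cong refl Bochner_Integration.integral_sum)
    finally show ?thesis unfolding sq by simp
  qed
  also have "\<dots> = (\<Sum>i=1..n. (\<integral>z. (\<phi> z)\<^sup>2 \<partial>lebesgue_square) - \<mu>\<^sup>2) / (real n)\<^sup>2"
  proof -
    have "(\<Sum>j=1..n. expectation (\<lambda>\<omega>. Y i \<omega> * Y j \<omega>)) = (\<integral>z. (\<phi> z)\<^sup>2 \<partial>lebesgue_square) - \<mu>\<^sup>2" if i: "i \<in> {1..n}" for i
    proof -
      have "(\<Sum>j=1..n. expectation (\<lambda>\<omega>. Y i \<omega> * Y j \<omega>)) = (\<Sum>j=1..n. if i = j then (\<integral>z. (\<phi> z)\<^sup>2 \<partial>lebesgue_square) - \<mu>\<^sup>2 else 0)"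
        using prod(1)[OF i] by (intro sum.cong refl)
      then show ?thesis using i by simp
    qed
    then show ?thesis by (intro arg_cong2[where f = "(/)"] sum.cong refl)
  qed
  also have "\<dots> = ((\<integral>z. (\<phi> z)\<^sup>2 \<partial>lebesgue_square) - \<mu>\<^sup>2) / real n"
    using assms(2) by (simp add: power2_eq_square)
  finally show "expectation (\<lambda>\<omega>. (fluctuation n \<phi> \<omega>)\<^sup>2) = ((\<integral>z. (\<phi> z)\<^sup>2 \<partial>lebesgue_square) - (integral\<^sup>L lebesgue_square \<phi>)\<^sup>2) / real n"
    by (simp add: \<mu>_def)
qed

lemma variance_fluctuation_le:
  assumes "square_bounded \<phi>" "n > 0"
  shows "expectation (\<lambda>\<omega>. (fluctuation n \<phi> \<omega>)\<^sup>2) \<le> (\<integral>z. (\<phi> z)\<^sup>2 \<partial>lebesgue_square) / real n"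
  using variance_fluctuation(1)[OF assms] by (simp add: divide_right_mono)

text \<open>Polarisation of the variance formula.\<close>

lemma covariance_fluctuation:
  assumes "square_bounded \<phi>" "square_bounded \<psi>" "n > 0"
  shows "expectation (\<lambda>\<omega>. fluctuation n \<phi> \<omega> * fluctuation n \<psi> \<omega>) =
     ((\<integral>z. \<phi> z * \<psi> z \<partial>lebesgue_square) - integral\<^sup>L lebesgue_square \<phi> * integral\<^sup>L lebesgue_square \<psi>) / real n"
    and "integrable M (\<lambda>\<omega>. fluctuation n \<phi> \<omega> * fluctuation n \<psi> \<omega>)"
proof -
  let ?v = "\<lambda>\<phi>. \<lambda>\<omega>. (fluctuation n \<phi> \<omega>)\<^sup>2"
  have s: "square_bounded (\<lambda>z. \<phi> z + \<psi> z)" using assms by (intro square_bounded_intros)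
  note v = variance_fluctuation[OF s assms(3)] variance_fluctuation[OF assms(1,3)] variance_fluctuation[OF assms(2,3)]
  have eq: "(\<lambda>\<omega>. fluctuation n \<phi> \<omega> * fluctuation n \<psi> \<omega>) = (\<lambda>\<omega>. (?v (\<lambda>z. \<phi> z + \<psi> z) \<omega> - ?v \<phi> \<omega> - ?v \<psi> \<omega>) / 2)"
    using assms by (simp add: fluctuation_add power2_sum)
  show "integrable M (\<lambda>\<omega>. fluctuation n \<phi> \<omega> * fluctuation n \<psi> \<omega>)" unfolding eq using v by simp
  note i = integrable_square_bounded[OF assms(1)] integrable_square_bounded[OF assms(2)]
    integrable_square_bounded[OF square_bounded_power2[OF assms(1)]] integrable_square_bounded[OF square_bounded_power2[OF assms(2)]]
    integrable_square_bounded[OF square_bounded_mult[OF assms(1,2)]]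
  have "(\<integral>z. (\<phi> z + \<psi> z)\<^sup>2 \<partial>lebesgue_square) = (\<integral>z. (\<phi> z)\<^sup>2 + (\<psi> z)\<^sup>2 + 2 * (\<phi> z * \<psi> z) \<partial>lebesgue_square)"
    by (simp add: power2_sum algebra_simps)
  also have "\<dots> = (\<integral>z. (\<phi> z)\<^sup>2 \<partial>lebesgue_square) + (\<integral>z. (\<psi> z)\<^sup>2 \<partial>lebesgue_square) + 2 * (\<integral>z. \<phi> z * \<psi> z \<partial>lebesgue_square)"
    using i by simp
  finally have sq: "(\<integral>z. (\<phi> z + \<psi> z)\<^sup>2 \<partial>lebesgue_square) = \<dots>" .
  show "expectation (\<lambda>\<omega>. fluctuation n \<phi> \<omega> * fluctuation n \<psi> \<omega>) =
     ((\<integral>z. \<phi> z * \<psi> z \<partial>lebesgue_square) - integral\<^sup>L lebesgue_square \<phi> * integral\<^sup>L lebesgue_square \<psi>) / real n"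
    unfolding eq using v unfolding sq using i by (simp add: power2_sum diff_divide_distrib add_divide_distrib)
qed

end

section \<open>A Bernstein bound for fluctuations\<close>

lemma exp_le_quadratic:
  fixes x :: real
  assumes "\<bar>x\<bar> \<le> 1"
  shows "exp x \<le> 1 + x + x\<^sup>2"
proof (cases "x \<ge> 0")
  case True
  then show ?thesis using exp_bound[of x] assms by simp
next
  case False
  \<comment> \<open>For negative \<open>x\<close> the bound passes through
    \<open>exp x \<le> 1 / (1 - x)\<close>; this identity compares the right-hand side with the
    quadratic polynomial.\<close>
  have "(1 - x) * (1 + x + x\<^sup>2) = 1 - x ^ 3" by (simp add: algebra_simps power2_eq_square power3_eq_cube)
  moreover have "x ^ 3 \<le> 0" using False by (simp add: power_le_zero_eq)
  ultimately have "1 \<le> (1 - x) * (1 + x + x\<^sup>2)" by simp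
  then have "1 / (1 - x) \<le> 1 + x + x\<^sup>2" using False by (simp add: divide_le_eq mult.commute)
  moreover have "exp x \<le> 1 / (1 - x)"
  proof -
    have "1 - x \<le> exp (- x)" using exp_ge_add_one_self[of "- x"] by simp
    then have "1 / exp (- x) \<le> 1 / (1 - x)" using False by (intro divide_left_mono) auto
    then show ?thesis by (simp add: exp_minus divide_inverse)
  qed
  ultimately show ?thesis by simp
qed

context uniform_sample begin

text \<open>Chernoff's method. A single constant bounds the supremum and the second moment, because
  both are of order \<open>m\<^sup>2\<close> for the functions to which the bound is applied; the
  exponent is then of order \<open>n * t\<^sup>2 / m\<^sup>2\<close>.\<close>

lemma bernstein_one_sided:
  assumes \<phi>: "square_bounded \<phi>" and bound: "\<And>z. z \<in> unit_square \<Longrightarrow> \<bar>\<phi> z\<bar> \<le> A"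
    and var: "(\<integral>z. (\<phi> z)\<^sup>2 \<partial>lebesgue_square) \<le> A" and A: "A > 0" and t: "0 < t" "t \<le> 1" and n: "n > 0"
  shows "prob {\<omega> \<in> space M. fluctuation n \<phi> \<omega> \<ge> t} \<le> exp (- real n * t\<^sup>2 / (4 * A))"
proof -
  note [measurable] = square_bounded_measurable[OF \<phi>]
  define \<mu> where "\<mu> = integral\<^sup>L lebesgue_square \<phi>"
  define Y where "Y i \<omega> = \<phi> (X i \<omega>) - \<mu>" for i \<omega>
  \<comment> \<open>This minimises \<open>s\<^sup>2 * A - s * t\<close>. Since \<open>Y\<close> is
    bounded by \<open>2 * A\<close> and \<open>t \<le> 1\<close>, the product \<open>s * Y\<close>
    stays in the range where the quadratic bound on the exponential holds.\<close>
  define s where "s = t / (2 * A)"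
  have s: "s > 0" using t A by (simp add: s_def)
  note c = centered_facts[OF \<phi> \<mu>_def, folded Y_def]
  have "\<bar>\<mu>\<bar> \<le> (\<integral>z. \<bar>\<phi> z\<bar> \<partial>lebesgue_square)"
    using integral_norm_bound[of lebesgue_square \<phi>] by (simp add: \<mu>_def)
  also have "\<dots> \<le> (\<integral>z. A \<partial>lebesgue_square)"
    using integrable_square_bounded[OF \<phi>] bound
    by (intro integral_mono_AE) (auto intro: eventually_mono[OF AE_lebesgue_square])
  finally have \<mu>: "\<bar>\<mu>\<bar> \<le> A" using lebesgue_square.prob_space by simp
  have Ym [measurable]: "Y i \<in> borel_measurable M" if "i \<ge> 1" for i
    using c(2)[OF that] by (rule borel_measurable_integrable)
  have Yb: "AE \<omega> in M. \<bar>Y i \<omega>\<bar> \<le> 2 * A" if "i \<ge> 1" for i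
    using AE_sample[OF that]
  proof eventually_elim
    case (elim \<omega>)
    then show ?case using bound[of "X i \<omega>"] \<mu> by (simp add: Y_def)
  qed
  have sYb: "AE \<omega> in M. \<bar>s * Y i \<omega>\<bar> \<le> 1" if "i \<ge> 1" for i
    using Yb[OF that]
  proof eventually_elim
    case (elim \<omega>)
    have "\<bar>s * Y i \<omega>\<bar> \<le> s * (2 * A)" using elim s by (simp add: abs_mult)
    also have "\<dots> \<le> 1" using A t by (simp add: s_def)
    finally show ?case .
  qed
  have ei: "integrable M (\<lambda>\<omega>. exp (s * Y i \<omega>))" if "i \<ge> 1" for i
  proof (rule integrable_const_bound[where B = "exp 1"])
    show "AE \<omega> in M. norm (exp (s * Y i \<omega>)) \<le> exp 1"
      using sYb[OF that] by eventually_elim auto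
  qed (use that in measurable)
  have mgf: "expectation (\<lambda>\<omega>. exp (s * Y i \<omega>)) \<le> exp (s\<^sup>2 * A)" if i: "i \<ge> 1" for i
  proof -
    have "expectation (\<lambda>\<omega>. exp (s * Y i \<omega>)) \<le> expectation (\<lambda>\<omega>. 1 + s * Y i \<omega> + s\<^sup>2 * (Y i \<omega>)\<^sup>2)"
    proof (rule integral_mono_AE)
      show "AE \<omega> in M. exp (s * Y i \<omega>) \<le> 1 + s * Y i \<omega> + s\<^sup>2 * (Y i \<omega>)\<^sup>2"
        using sYb[OF i] by eventually_elim (drule exp_le_quadratic, simp add: power_mult_distrib)
    qed (use ei[OF i] c(2,5)[OF i] in auto)
    also have "\<dots> = 1 + s\<^sup>2 * ((\<integral>z. (\<phi> z)\<^sup>2 \<partial>lebesgue_square) - \<mu>\<^sup>2)"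
      using c(2-5)[OF i] by (simp add: prob_space)
    also have "\<dots> \<le> 1 + s\<^sup>2 * A"
    proof -
      have "(\<integral>z. (\<phi> z)\<^sup>2 \<partial>lebesgue_square) - \<mu>\<^sup>2 \<le> A" using var zero_le_power2[of \<mu>] by linarith
      then show ?thesis by (simp add: mult_left_mono)
    qed
    also have "\<dots> \<le> exp (s\<^sup>2 * A)" by (rule exp_ge_add_one_self)
    finally show ?thesis .
  qed
  have ind: "indep_vars (\<lambda>_. borel) (\<lambda>i \<omega>. exp (s * Y i \<omega>)) {1..n}"
    by (rule indep_vars_compose2[where Y = "\<lambda>_ y. exp (s * y)", OF indep_vars_subset[OF c(1)]]) auto
  have E: "expectation (\<lambda>\<omega>. \<Prod>i=1..n. exp (s * Y i \<omega>)) \<le> exp (real n * (s\<^sup>2 * A))"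
  proof -
    have "expectation (\<lambda>\<omega>. \<Prod>i=1..n. exp (s * Y i \<omega>)) = (\<Prod>i=1..n. expectation (\<lambda>\<omega>. exp (s * Y i \<omega>)))"
      using ei by (intro indep_vars_lebesgue_integral[OF _ ind]) auto
    also have "\<dots> \<le> (\<Prod>i=1..n. exp (s\<^sup>2 * A))"
      using mgf by (intro prod_mono) (auto intro!: Bochner_Integration.integral_nonneg)
    finally show ?thesis by (simp add: exp_of_nat_mult)
  qed
  have Ei: "integrable M (\<lambda>\<omega>. \<Prod>i=1..n. exp (s * Y i \<omega>))"
    using ei by (intro indep_vars_integrable[OF _ ind]) auto
  have "{\<omega> \<in> space M. fluctuation n \<phi> \<omega> \<ge> t} \<subseteq> {\<omega> \<in> space M. (\<Prod>i=1..n. exp (s * Y i \<omega>)) \<ge> exp (s * (real n * t))}"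
  proof safe
    fix \<omega> assume "t \<le> fluctuation n \<phi> \<omega>"
    then have "real n * t \<le> (\<Sum>i=1..n. Y i \<omega>)"
      using n by (simp add: fluctuation_eq_centered Y_def \<mu>_def field_simps)
    then have "s * (real n * t) \<le> (\<Sum>i=1..n. s * Y i \<omega>)" using s by (simp add: sum_distrib_left[symmetric])
    then show "exp (s * (real n * t)) \<le> (\<Prod>i=1..n. exp (s * Y i \<omega>))" by (simp add: exp_sum[symmetric])
  qed
  then have "prob {\<omega> \<in> space M. fluctuation n \<phi> \<omega> \<ge> t} \<le> prob {\<omega> \<in> space M. (\<Prod>i=1..n. exp (s * Y i \<omega>)) \<ge> exp (s * (real n * t))}"
    using borel_measurable_integrable[OF Ei] by (intro finite_measure_mono) auto
  also have "\<dots> \<le> expectation (\<lambda>\<omega>. \<Prod>i=1..n. exp (s * Y i \<omega>)) / exp (s * (real n * t))"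
    by (rule integral_Markov_inequality_measure[OF Ei, where A = "{}"]) (auto intro!: prod_nonneg)
  also have "\<dots> \<le> exp (real n * (s\<^sup>2 * A)) / exp (s * (real n * t))"
    using E by (rule divide_right_mono) simp
  also have "\<dots> = exp (- real n * t\<^sup>2 / (4 * A))"
  proof -
    have "real n * (s\<^sup>2 * A) - s * (real n * t) = - real n * t\<^sup>2 / (4 * A)"
      using A by (simp add: s_def power2_eq_square field_simps)
    then show ?thesis by (simp add: exp_diff[symmetric])
  qed
  finally show ?thesis .
qed

proposition bernstein:
  assumes \<phi>: "square_bounded \<phi>" and bound: "\<And>z. z \<in> unit_square \<Longrightarrow> \<bar>\<phi> z\<bar> \<le> A"
    and var: "(\<integral>z. (\<phi> z)\<^sup>2 \<partial>lebesgue_square) \<le> A" and A: "A > 0" and t: "0 < t" "t \<le> 1" and n: "n > 0"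
  shows "prob {\<omega> \<in> space M. \<bar>fluctuation n \<phi> \<omega>\<bar> \<ge> t} \<le> 2 * exp (- real n * t\<^sup>2 / (4 * A))"
proof -
  note [measurable] = square_bounded_measurable[OF \<phi>]
  have m: "square_bounded (\<lambda>z. - 1 * \<phi> z)" using \<phi> by (intro square_bounded_intros)
  have neg: "fluctuation n (\<lambda>z. - 1 * \<phi> z) \<omega> = - fluctuation n \<phi> \<omega>" for \<omega>
    unfolding fluctuation_cmult by simp
  have "{\<omega> \<in> space M. \<bar>fluctuation n \<phi> \<omega>\<bar> \<ge> t} = {\<omega> \<in> space M. fluctuation n \<phi> \<omega> \<ge> t} \<union> {\<omega> \<in> space M. fluctuation n (\<lambda>z. - 1 * \<phi> z) \<omega> \<ge> t}"
    unfolding neg by auto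
  then have "prob {\<omega> \<in> space M. \<bar>fluctuation n \<phi> \<omega>\<bar> \<ge> t} \<le> prob {\<omega> \<in> space M. fluctuation n \<phi> \<omega> \<ge> t} + prob {\<omega> \<in> space M. fluctuation n (\<lambda>z. - 1 * \<phi> z) \<omega> \<ge> t}"
    by (simp add: measure_Un_le)
  then show ?thesis
    using bernstein_one_sided[OF \<phi> bound var A t n] bernstein_one_sided[OF m _ _ A t n] bound var by fastforce
qed

end

section \<open>Plans, duality and measurability of the cost\<close>

lemma boundary_cost_2_le:
  assumes "\<pi> \<in> boundary_couplings \<Omega> \<mu> \<nu>"
  shows "boundary_cost \<Omega> 2 \<mu> \<nu> \<le> (\<integral>\<^sup>+p. ennreal ((norm (fst p - snd p))\<^sup>2) \<partial>\<pi>)"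
proof -
  have "boundary_cost \<Omega> 2 \<mu> \<nu> \<le> (\<integral>\<^sup>+(x, y). ennreal (norm (x - y) powr 2) \<partial>\<pi>)"
    unfolding boundary_cost_def using assms by (rule INF_lower)
  then show ?thesis by (simp add: case_prod_unfold)
qed

lemma boundary_cost_2_greatest:
  assumes "\<And>\<pi>. \<pi> \<in> boundary_couplings \<Omega> \<mu> \<nu> \<Longrightarrow> c \<le> (\<integral>\<^sup>+p. ennreal ((norm (fst p - snd p))\<^sup>2) \<partial>\<pi>)"
  shows "c \<le> boundary_cost \<Omega> 2 \<mu> \<nu>"
  unfolding boundary_cost_def using assms by (intro INF_greatest) (simp add: case_prod_unfold)

text \<open>Plans are produced as the joint law of two maps on an auxiliary measure space; only the
  restrictions of the two laws to \<open>\<Omega>\<close> are compared with the data.\<close>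

lemma boundary_couplingI:
  fixes Y Z :: "'s \<Rightarrow> 'a::euclidean_space"
  assumes [measurable]: "Y \<in> borel_measurable P" "Z \<in> borel_measurable P"
    and cl: "\<And>s. s \<in> space P \<Longrightarrow> Y s \<in> closure \<Omega>" "\<And>s. s \<in> space P \<Longrightarrow> Z s \<in> closure \<Omega>"
    and Y: "restrict_space (distr P borel Y) \<Omega> = restrict_space \<mu> \<Omega>"
    and Z: "restrict_space (distr P borel Z) \<Omega> = restrict_space \<nu> \<Omega>"
  shows "distr P (restrict_space borel (closure \<Omega> \<times> closure \<Omega>)) (\<lambda>s. (Y s, Z s)) \<in> boundary_couplings \<Omega> \<mu> \<nu>"
    and "(\<lambda>s. (Y s, Z s)) \<in> P \<rightarrow>\<^sub>M restrict_space borel (closure \<Omega> \<times> closure \<Omega>)"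
proof -
  have "(\<lambda>s. (Y s, Z s)) \<in> borel_measurable P" by (intro borel_measurable_Pair assms)
  then show m [measurable]: "(\<lambda>s. (Y s, Z s)) \<in> P \<rightarrow>\<^sub>M restrict_space borel (closure \<Omega> \<times> closure \<Omega>)"
    using cl by (intro measurable_restrict_space2) auto
  have [measurable]: "fst \<in> restrict_space borel (closure \<Omega> \<times> closure \<Omega>) \<rightarrow>\<^sub>M borel"
    "snd \<in> restrict_space borel (closure \<Omega> \<times> closure \<Omega>) \<rightarrow>\<^sub>M borel"
    by (auto intro!: measurable_restrict_space1 borel_measurable_continuous_onI continuous_intros)
  show "distr P (restrict_space borel (closure \<Omega> \<times> closure \<Omega>)) (\<lambda>s. (Y s, Z s)) \<in> boundary_couplings \<Omega> \<mu> \<nu>"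
    unfolding boundary_couplings_def using Y Z by (simp add: distr_distr comp_def)
qed

lemma boundary_cost_2_le_plan:
  fixes Y Z :: "'s \<Rightarrow> 'a::euclidean_space"
  assumes [measurable]: "Y \<in> borel_measurable P" "Z \<in> borel_measurable P"
    and cl: "\<And>s. s \<in> space P \<Longrightarrow> Y s \<in> closure \<Omega>" "\<And>s. s \<in> space P \<Longrightarrow> Z s \<in> closure \<Omega>"
    and Y: "restrict_space (distr P borel Y) \<Omega> = restrict_space \<mu> \<Omega>"
    and Z: "restrict_space (distr P borel Z) \<Omega> = restrict_space \<nu> \<Omega>"
  shows "boundary_cost \<Omega> 2 \<mu> \<nu> \<le> (\<integral>\<^sup>+s. ennreal ((norm (Y s - Z s))\<^sup>2) \<partial>P)"
proof -
  have c: "distr P (restrict_space borel (closure \<Omega> \<times> closure \<Omega>)) (\<lambda>s. (Y s, Z s)) \<in> boundary_couplings \<Omega> \<mu> \<nu>"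
    "(\<lambda>s. (Y s, Z s)) \<in> P \<rightarrow>\<^sub>M restrict_space borel (closure \<Omega> \<times> closure \<Omega>)"
    using boundary_couplingI[of Y P Z \<Omega> \<mu> \<nu>] assms by blast+
  have "(\<lambda>p. ennreal ((norm (fst p - snd p))\<^sup>2)) \<in> borel_measurable (restrict_space borel (closure \<Omega> \<times> closure \<Omega>))"
    by (auto intro!: measurable_restrict_space1 measurable_compose[OF _ measurable_ennreal] borel_measurable_continuous_onI continuous_intros)
  then show ?thesis
    using boundary_cost_2_le[OF c(1)] by (subst (asm) nn_integral_distr[OF c(2)]) simp_all
qed

text \<open>Weak Kantorovich duality. Since the marginals are free on the boundary, the potentials
  have to vanish there; whatever mass the plan places on the boundary, even an infinite amount, then
  contributes nothing.\<close>

lemma boundary_cost_2_duality: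
  fixes f g :: "'a::euclidean_space \<Rightarrow> real"
  assumes \<Omega> [measurable]: "\<Omega> \<in> sets borel" and [measurable]: "f \<in> borel_measurable borel" "g \<in> borel_measurable borel"
    and f0: "\<And>x. x \<in> closure \<Omega> - \<Omega> \<Longrightarrow> f x = 0" and g0: "\<And>x. x \<in> closure \<Omega> - \<Omega> \<Longrightarrow> g x = 0"
    and fg: "\<And>x y. x \<in> closure \<Omega> \<Longrightarrow> y \<in> closure \<Omega> \<Longrightarrow> f x + g y \<le> (norm (x - y))\<^sup>2"
    and sets [measurable_cong]: "sets \<mu> = sets borel" "sets \<nu> = sets borel"
    and int: "integrable \<mu> (\<lambda>x. indicator \<Omega> x * f x)" "integrable \<nu> (\<lambda>x. indicator \<Omega> x * g x)"
  shows "ennreal ((\<integral>x. indicator \<Omega> x * f x \<partial>\<mu>) + (\<integral>x. indicator \<Omega> x * g x \<partial>\<nu>)) \<le> boundary_cost \<Omega> 2 \<mu> \<nu>"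
proof (rule boundary_cost_2_greatest)
  fix \<pi> assume \<pi>: "\<pi> \<in> boundary_couplings \<Omega> \<mu> \<nu>"
  have sp [measurable_cong]: "sets \<pi> = sets (restrict_space borel (closure \<Omega> \<times> closure \<Omega>))"
    and m1: "restrict_space (distr \<pi> borel fst) \<Omega> = restrict_space \<mu> \<Omega>"
    and m2: "restrict_space (distr \<pi> borel snd) \<Omega> = restrict_space \<nu> \<Omega>"
    using \<pi> by (auto simp: boundary_couplings_def)
  have space: "space \<pi> = closure \<Omega> \<times> closure \<Omega>" using sets_eq_imp_space_eq[OF sp] by (simp add: space_restrict_space)
  have meas [measurable]: "fst \<in> \<pi> \<rightarrow>\<^sub>M borel" "snd \<in> \<pi> \<rightarrow>\<^sub>M borel"
    unfolding measurable_cong_sets[OF sp refl]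
    by (auto intro!: measurable_restrict_space1 borel_measurable_continuous_onI continuous_intros)
  \<comment> \<open>A projection that leaves \<open>\<Omega>\<close> lands on the boundary, where
    the potential is 0. Inserting the indicator of \<open>\<Omega>\<close> therefore changes
    nothing, and the integral sees only the prescribed part of the marginal.\<close>
  have marg: "integrable \<pi> (\<lambda>p. f (pr p)) \<and> (\<integral>p. f (pr p) \<partial>\<pi>) = (\<integral>x. indicator \<Omega> x * f x \<partial>\<mu>)"
    if [measurable]: "pr \<in> \<pi> \<rightarrow>\<^sub>M borel" and pr: "\<And>p. p \<in> space \<pi> \<Longrightarrow> pr p \<in> closure \<Omega>" and [measurable]: "f \<in> borel_measurable borel"
      and "\<And>x. x \<in> closure \<Omega> - \<Omega> \<Longrightarrow> f x = 0" and eq: "restrict_space (distr \<pi> borel pr) \<Omega> = restrict_space \<mu> \<Omega>"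
      and int: "integrable \<mu> (\<lambda>x. indicator \<Omega> x * f x)" and sets: "sets \<mu> = sets borel"
    for pr and f :: "'a \<Rightarrow> real" and \<mu>
  proof -
    have \<Omega>': "\<Omega> \<inter> space \<mu> \<in> sets \<mu>" "\<Omega> \<inter> space (distr \<pi> borel pr) \<in> sets (distr \<pi> borel pr)"
      using sets sets_eq_imp_space_eq[OF sets] \<Omega> by auto
    have "integrable (restrict_space (distr \<pi> borel pr) \<Omega>) f"
      unfolding eq using int by (subst integrable_restrict_space[OF \<Omega>'(1)]) (simp add: set_integrable_def)
    then have "integrable (distr \<pi> borel pr) (\<lambda>x. indicator \<Omega> x * f x)"
      by (subst (asm) integrable_restrict_space[OF \<Omega>'(2)]) (simp add: set_integrable_def)
    then have "integrable \<pi> (\<lambda>p. indicator \<Omega> (pr p) * f (pr p))"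
      by (subst (asm) integrable_distr_eq) auto
    moreover have "(\<integral>p. indicator \<Omega> (pr p) * f (pr p) \<partial>\<pi>) = (\<integral>x. indicator \<Omega> x * f x \<partial>distr \<pi> borel pr)"
      by (subst integral_distr) auto
    moreover have "(\<integral>x. indicator \<Omega> x * f x \<partial>distr \<pi> borel pr) = (\<integral>x. indicator \<Omega> x * f x \<partial>\<mu>)"
      using integral_restrict_space[OF \<Omega>'(1), of f] integral_restrict_space[OF \<Omega>'(2), of f] eq by simp
    moreover have "indicator \<Omega> (pr p) * f (pr p) = f (pr p)" if "p \<in> space \<pi>" for p
      using pr[OF that] that \<open>\<And>x. x \<in> closure \<Omega> - \<Omega> \<Longrightarrow> f x = 0\<close> by (auto simp: indicator_def)
    ultimately show ?thesis
      using Bochner_Integration.integrable_cong[OF refl, of \<pi> "\<lambda>p. indicator \<Omega> (pr p) * f (pr p)" "\<lambda>p. f (pr p)"]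
        Bochner_Integration.integral_cong[OF refl, of \<pi> "\<lambda>p. indicator \<Omega> (pr p) * f (pr p)" "\<lambda>p. f (pr p)"] by simp
  qed
  have F: "integrable \<pi> (\<lambda>p. f (fst p)) \<and> (\<integral>p. f (fst p) \<partial>\<pi>) = (\<integral>x. indicator \<Omega> x * f x \<partial>\<mu>)"
    using f0 m1 int sets by (intro marg) (auto simp: space)
  have G: "integrable \<pi> (\<lambda>p. g (snd p)) \<and> (\<integral>p. g (snd p) \<partial>\<pi>) = (\<integral>x. indicator \<Omega> x * g x \<partial>\<nu>)"
    using g0 m2 int sets by (intro marg) (auto simp: space)
  let ?F = "\<lambda>p. f (fst p) + g (snd p)"
  have iF: "integrable \<pi> ?F" using F G by simp
  have "(\<integral>x. indicator \<Omega> x * f x \<partial>\<mu>) + (\<integral>x. indicator \<Omega> x * g x \<partial>\<nu>) = (\<integral>p. ?F p \<partial>\<pi>)" using F G by simp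
  \<comment> \<open>The sum of the potentials may be negative; its positive part can be passed to
    the extended nonnegative integral and is still below the cost.\<close>
  also have "\<dots> \<le> (\<integral>p. max (?F p) 0 \<partial>\<pi>)" using iF by (intro integral_mono) auto
  finally have "ennreal ((\<integral>x. indicator \<Omega> x * f x \<partial>\<mu>) + (\<integral>x. indicator \<Omega> x * g x \<partial>\<nu>)) \<le> ennreal (\<integral>p. max (?F p) 0 \<partial>\<pi>)"
    by (rule ennreal_leI)
  also have "\<dots> = (\<integral>\<^sup>+p. ennreal (max (?F p) 0) \<partial>\<pi>)"
    using iF by (intro nn_integral_eq_integral[symmetric]) auto
  also have "\<dots> \<le> (\<integral>\<^sup>+p. ennreal ((norm (fst p - snd p))\<^sup>2) \<partial>\<pi>)"
    using fg by (intro nn_integral_mono ennreal_leI) (auto simp: space)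
  finally show "ennreal ((\<integral>x. indicator \<Omega> x * f x \<partial>\<mu>) + (\<integral>x. indicator \<Omega> x * g x \<partial>\<nu>)) \<le> (\<integral>\<^sup>+p. ennreal ((norm (fst p - snd p))\<^sup>2) \<partial>\<pi>)" .
qed

text \<open>Young's inequality with a free parameter: a small \<open>\<eta>\<close> keeps the factor
  of the first vector close to 1 at the expense of the second.\<close>

lemma norm_add_square_le:
  fixes a b :: "'a::real_inner"
  assumes "\<eta> > 0"
  shows "(norm (a + b))\<^sup>2 \<le> (1 + \<eta>) * (norm a)\<^sup>2 + (1 + 1 / \<eta>) * (norm b)\<^sup>2"
proof -
  have "0 \<le> (norm (sqrt \<eta> *\<^sub>R a - (1 / sqrt \<eta>) *\<^sub>R b))\<^sup>2" by simp
  also have "\<dots> = \<eta> * (norm a)\<^sup>2 + (norm b)\<^sup>2 / \<eta> - 2 * (a \<bullet> b)"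
    using assms by (simp add: power2_norm_eq_inner inner_diff_left inner_diff_right inner_commute algebra_simps)
  finally have "2 * (a \<bullet> b) \<le> \<eta> * (norm a)\<^sup>2 + (norm b)\<^sup>2 / \<eta>" by simp
  moreover have "(norm (a + b))\<^sup>2 = (norm a)\<^sup>2 + (norm b)\<^sup>2 + 2 * (a \<bullet> b)"
    by (simp add: power2_norm_eq_inner inner_add_left inner_add_right inner_commute)
  ultimately show ?thesis by (simp add: algebra_simps)
qed

text \<open>This covers infinite cost as well, because \<open>enn2real\<close> sends infinity to 0
  on both sides.\<close>

lemma Wb_2_square: "(enn2real (Wb \<Omega> 2 \<mu> \<nu>))\<^sup>2 = enn2real (boundary_cost \<Omega> 2 \<mu> \<nu>)"
  by (simp add: Wb_def powr_half_sqrt)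

section \<open>Plans that start from an empirical measure\<close>

lemma nn_integral_empirical_set:
  assumes "A \<in> sets borel"
  shows "emeasure (empirical_measure n x) A = (\<Sum>i=1..n. ennreal (1 / real n) * indicator A (x i))"
  using assms by (simp add: emeasure_empirical_measure sum_distrib_left)

lemma emeasure_empirical_le_1: "A \<in> sets borel \<Longrightarrow> emeasure (empirical_measure n x) A \<le> 1"
proof -
  assume A: "A \<in> sets borel"
  have "(\<Sum>i=1..n. ennreal (1 / real n) * indicator A (x i)) \<le> (\<Sum>i=1..n. ennreal (1 / real n) * 1)"
    by (intro sum_mono mult_left_mono) (auto simp: indicator_def)
  also have "\<dots> \<le> 1"
    by (simp add: ennreal_of_nat_eq_real_of_nat ennreal_mult[symmetric])
  finally show ?thesis using A by (simp add: nn_integral_empirical_set)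
qed

text \<open>The base space is a copy of the square for each sample point: the mass leaving the \<open>i\<close>-th point has
  density \<open>h i\<close>, and \<open>T\<close> moves the resulting density \<open>\<rho>\<close> to the uniform one.\<close>

lemma boundary_cost_empirical_le:
  fixes x :: "nat \<Rightarrow> real^2" and h :: "nat \<Rightarrow> real \<times> real \<Rightarrow> real"
  defines "U \<equiv> unit_interval \<Otimes>\<^sub>M unit_interval"
  assumes n: "n > 0" and x: "\<And>i. i \<in> {1..n} \<Longrightarrow> x i \<in> closure unit_square"
    and h [measurable]: "\<And>i. i \<in> {1..n} \<Longrightarrow> h i \<in> borel_measurable U" and h0: "\<And>i y. 0 \<le> h i y"
    and T [measurable]: "T \<in> U \<rightarrow>\<^sub>M U" and T01: "\<And>y. vec2 (T y) \<in> closure unit_square"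
    and h1: "\<And>i. i \<in> {1..n} \<Longrightarrow> (\<integral>\<^sup>+y. ennreal (h i y) \<partial>U) = 1"
    and \<rho>: "\<And>y. (\<Sum>i=1..n. h i y) / real n = \<rho> y"
    and push: "distr (density U (\<lambda>y. ennreal (\<rho> y))) U T = U"
  shows "boundary_cost unit_square 2 (empirical_measure n x) lebesgue_square
     \<le> (\<Sum>i=1..n. \<integral>\<^sup>+y. ennreal (h i y / real n * (norm (x i - vec2 (T y)))\<^sup>2) \<partial>U)"
proof -
  define C where "C = count_space {1..n}"
  define P where "P = density (C \<Otimes>\<^sub>M U) (\<lambda>p. ennreal (h (fst p) (snd p) / real n))"
  interpret U: prob_space U unfolding U_def by (rule unit_square.prob_space_axioms)
  have [measurable]: "(\<lambda>p. ennreal (h (fst p) (snd p) / real n)) \<in> borel_measurable (C \<Otimes>\<^sub>M U)"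
    unfolding C_def by (rule measurable_pair_measure_countable1) (use h in auto)
  have xm [measurable]: "(\<lambda>p. x (fst p)) \<in> borel_measurable (C \<Otimes>\<^sub>M U)"
    unfolding C_def by (rule measurable_pair_measure_countable1) auto
  have [measurable]: "vec2 \<in> U \<rightarrow>\<^sub>M borel" unfolding U_def by simp
  have int: "(\<integral>\<^sup>+p. F p \<partial>P) = (\<Sum>i=1..n. \<integral>\<^sup>+y. ennreal (h i y / real n) * F (i, y) \<partial>U)"
    if [measurable]: "F \<in> borel_measurable (C \<Otimes>\<^sub>M U)" for F
  proof -
    have "(\<integral>\<^sup>+p. F p \<partial>P) = (\<integral>\<^sup>+p. ennreal (h (fst p) (snd p) / real n) * F p \<partial>(C \<Otimes>\<^sub>M U))"
      unfolding P_def by (subst nn_integral_density) auto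
    also have "\<dots> = (\<integral>\<^sup>+i. \<integral>\<^sup>+y. ennreal (h i y / real n) * F (i, y) \<partial>U \<partial>C)"
      by (subst U.nn_integral_fst[symmetric]) auto
    also have "\<dots> = (\<Sum>i=1..n. \<integral>\<^sup>+y. ennreal (h i y / real n) * F (i, y) \<partial>U)"
      unfolding C_def by (rule nn_integral_count_space_finite) simp
    finally show ?thesis .
  qed
  have sP [measurable_cong]: "sets P = sets (C \<Otimes>\<^sub>M U)" by (simp add: P_def)
  have spP: "space P = {1..n} \<times> UNIV" by (simp add: P_def C_def U_def space_pair_measure)
  have Y: "distr P borel (\<lambda>p. x (fst p)) = empirical_measure n x"
  proof (rule measure_eqI)
    fix A assume "A \<in> sets (distr P borel (\<lambda>p. x (fst p)))"
    then have A [measurable]: "A \<in> sets borel" by simp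
    have "emeasure (distr P borel (\<lambda>p. x (fst p))) A = (\<integral>\<^sup>+p. indicator A (x (fst p)) \<partial>P)"
      by (subst nn_integral_indicator[symmetric], simp, subst nn_integral_distr) auto
    also have "\<dots> = (\<Sum>i=1..n. \<integral>\<^sup>+y. ennreal (h i y / real n) * indicator A (x i) \<partial>U)"
      by (subst int) auto
    also have "\<dots> = (\<Sum>i=1..n. ennreal (1 / real n) * indicator A (x i))"
    proof (rule sum.cong[OF refl])
      fix i assume i: "i \<in> {1..n}"
      have "(\<integral>\<^sup>+y. ennreal (h i y / real n) * indicator A (x i) \<partial>U) = (\<integral>\<^sup>+y. ennreal (h i y) * (ennreal (1 / real n) * indicator A (x i)) \<partial>U)"
        using h0 by (intro nn_integral_cong) (simp add: ennreal_mult[symmetric] mult.assoc[symmetric])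
      also have "\<dots> = ennreal (1 / real n) * indicator A (x i)"
        using h[OF i] h1[OF i] by (subst nn_integral_multc) auto
      finally show "(\<integral>\<^sup>+y. ennreal (h i y / real n) * indicator A (x i) \<partial>U) = ennreal (1 / real n) * indicator A (x i)" .
    qed
    finally show "emeasure (distr P borel (\<lambda>p. x (fst p))) A = emeasure (empirical_measure n x) A"
      by (simp add: nn_integral_empirical_set)
  qed simp
  have Z: "distr P borel (\<lambda>p. vec2 (T (snd p))) = lebesgue_square"
  proof (rule measure_eqI)
    fix A assume "A \<in> sets (distr P borel (\<lambda>p. vec2 (T (snd p))))"
    then have A [measurable]: "A \<in> sets borel" by simp
    have "emeasure (distr P borel (\<lambda>p. vec2 (T (snd p)))) A = (\<integral>\<^sup>+p. indicator A (vec2 (T (snd p))) \<partial>P)"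
      by (subst nn_integral_indicator[symmetric], simp, subst nn_integral_distr) auto
    also have "\<dots> = (\<Sum>i=1..n. \<integral>\<^sup>+y. ennreal (h i y / real n) * indicator A (vec2 (T y)) \<partial>U)"
      by (subst int) auto
    also have "\<dots> = (\<integral>\<^sup>+y. (\<Sum>i=1..n. ennreal (h i y / real n) * indicator A (vec2 (T y))) \<partial>U)"
      by (subst nn_integral_sum) (use h in auto)
    also have "\<dots> = (\<integral>\<^sup>+y. ennreal (\<rho> y) * indicator A (vec2 (T y)) \<partial>U)"
      using h0 by (intro nn_integral_cong) (simp add: \<rho>[symmetric] sum_divide_distrib sum_distrib_right[symmetric])
    also have "\<dots> = (\<integral>\<^sup>+y. indicator A (vec2 (T y)) \<partial>density U (\<lambda>y. ennreal (\<rho> y)))"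
    proof -
      have [measurable]: "\<rho> \<in> borel_measurable U"
        unfolding \<rho>[symmetric] by (intro borel_measurable_divide borel_measurable_sum) (use h in auto)
      show ?thesis by (subst nn_integral_density) auto
    qed
    also have "\<dots> = (\<integral>\<^sup>+y. indicator A (vec2 y) \<partial>distr (density U (\<lambda>y. ennreal (\<rho> y))) U T)"
      by (subst nn_integral_distr) auto
    also have "\<dots> = emeasure (distr U borel vec2) A"
      unfolding push by (subst nn_integral_indicator[symmetric], simp, subst nn_integral_distr) auto
    finally show "emeasure (distr P borel (\<lambda>p. vec2 (T (snd p)))) A = emeasure lebesgue_square A"
      by (simp add: lebesgue_square_eq U_def)
  qed simp
  have "boundary_cost unit_square 2 (empirical_measure n x) lebesgue_square \<le>
     (\<integral>\<^sup>+p. ennreal ((norm (x (fst p) - vec2 (T (snd p))))\<^sup>2) \<partial>P)"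
    by (rule boundary_cost_2_le_plan) (use x T01 in \<open>auto simp: Y Z spP\<close>)
  also have "\<dots> = (\<Sum>i=1..n. \<integral>\<^sup>+y. ennreal (h i y / real n) * ennreal ((norm (x i - vec2 (T y)))\<^sup>2) \<partial>U)"
    by (subst int) auto
  also have "\<dots> = (\<Sum>i=1..n. \<integral>\<^sup>+y. ennreal (h i y / real n * (norm (x i - vec2 (T y)))\<^sup>2) \<partial>U)"
    by (intro sum.cong nn_integral_cong refl) (subst ennreal_mult', use h0 in auto)
  finally show ?thesis .
qed

lemma AE_unit_square_pair: "AE y in unit_interval \<Otimes>\<^sub>M unit_interval. vec2 y \<in> unit_square"
  using AE_lebesgue_square unfolding lebesgue_square_eq by (subst (asm) AE_distr_iff) auto

lemma norm_diff_closure_unit_square_le: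
  assumes "x \<in> closure unit_square" "y \<in> closure unit_square"
  shows "(norm (x - y :: real^2))\<^sup>2 \<le> 2"
proof -
  have "\<bar>x $ 1 - y $ 1\<bar> \<le> 1" "\<bar>x $ 2 - y $ 2\<bar> \<le> 1"
    using assms by (auto simp: closure_unit_square_iff)
  then have "(x $ 1 - y $ 1)\<^sup>2 \<le> 1" "(x $ 2 - y $ 2)\<^sup>2 \<le> 1"
    by (simp_all add: abs_square_le_1)
  then show ?thesis by (simp add: norm_vec2_diff)
qed

text \<open>Almost everywhere the identity on the unit square, but with values in the closed square
  at every point, as is required of the second coordinate of a plan.\<close>

definition clamp_pair :: "real \<times> real \<Rightarrow> real \<times> real" where
  "clamp_pair y = (max 0 (min 1 (fst y)), max 0 (min 1 (snd y)))"

text \<open>Every sample point is spread uniformly over the square, whose squared diameter is 2.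
  This provides finiteness of the cost and a bound on exceptional events.\<close>

lemma boundary_cost_empirical_le_2:
  assumes n: "n > 0" and x: "\<And>i. i \<in> {1..n} \<Longrightarrow> x i \<in> closure unit_square"
  shows "boundary_cost unit_square 2 (empirical_measure n x) lebesgue_square \<le> 2"
proof -
  let ?U = "unit_interval \<Otimes>\<^sub>M unit_interval"
  have T: "clamp_pair \<in> ?U \<rightarrow>\<^sub>M ?U" unfolding clamp_pair_def by measurable
  have id: "AE y in ?U. clamp_pair y = y"
    using AE_unit_square_pair by eventually_elim (auto simp: clamp_pair_def unit_square_iff)
  have cl: "vec2 (clamp_pair y) \<in> closure unit_square" for y
    by (auto simp: closure_unit_square_iff clamp_pair_def)
  have push: "distr (density ?U (\<lambda>y. ennreal 1)) ?U clamp_pair = ?U"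
  proof -
    have "distr ?U ?U clamp_pair = distr ?U ?U (\<lambda>y. y)"
      using id T by (intro distr_cong_AE) auto
    then show ?thesis by (simp add: density_1 distr_id2)
  qed
  have "boundary_cost unit_square 2 (empirical_measure n x) lebesgue_square
     \<le> (\<Sum>i=1..n. \<integral>\<^sup>+y. ennreal (1 / real n * (norm (x i - vec2 (clamp_pair y)))\<^sup>2) \<partial>?U)"
    using n x T cl push unit_square.emeasure_space_1
    by (intro boundary_cost_empirical_le[where \<rho> = "\<lambda>_. 1"]) auto
  also have "\<dots> \<le> (\<Sum>i=1..n. \<integral>\<^sup>+y. ennreal (1 / real n * 2) \<partial>?U)"
    using norm_diff_closure_unit_square_le[OF x cl]
    by (intro sum_mono nn_integral_mono ennreal_leI mult_left_mono) auto
  also have "\<dots> = (\<Sum>i=1..n. ennreal (1 / real n * 2))"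
    using unit_square.emeasure_space_1 by simp
  also have "\<dots> = ennreal 2" using n by (simp add: ennreal_of_nat_eq_real_of_nat ennreal_mult[symmetric])
  finally show ?thesis by simp
qed

text \<open>Continuity in the sample can only hold while coinciding points and points outside the open square
  keep their status; since there are finitely many patterns, this is enough for measurability.\<close>

definition same_pattern :: "nat \<Rightarrow> (nat \<Rightarrow> real^2) \<Rightarrow> (nat \<Rightarrow> real^2) \<Rightarrow> bool" where
  "same_pattern n x x' \<longleftrightarrow> (\<forall>i\<in>{1..n}. x i \<in> unit_square \<longleftrightarrow> x' i \<in> unit_square) \<and>
     (\<forall>i\<in>{1..n}. \<forall>j\<in>{1..n}. x i = x j \<longleftrightarrow> x' i = x' j)"

text \<open>A plan for \<open>x\<close> becomes a plan for \<open>x'\<close> by relocating the atoms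
  inside the square. The common pattern makes the relocation a well-defined map that preserves the
  square. Young's inequality with parameter \<open>\<delta>\<close> turns a displacement
  \<open>\<delta>\<close> into the error
  \<open>(1 + 1 / \<delta>) * \<delta>\<^sup>2\<close>.\<close>

lemma boundary_cost_perturb:
  fixes x x' :: "nat \<Rightarrow> real^2"
  assumes same: "same_pattern n x x'" and close: "\<And>i. i \<in> {1..n} \<Longrightarrow> norm (x i - x' i) \<le> \<delta>"
    and \<delta>: "\<delta> > 0" and sets: "sets \<nu> = sets borel"
  shows "boundary_cost unit_square 2 (empirical_measure n x') \<nu>
     \<le> ennreal (1 + \<delta>) * boundary_cost unit_square 2 (empirical_measure n x) \<nu> + ennreal (\<delta>\<^sup>2 + \<delta>)"
proof -
  let ?\<Omega> = "unit_square"
  let ?R = "restrict_space borel (closure ?\<Omega> \<times> closure ?\<Omega>) :: ((real^2) \<times> (real^2)) measure"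
  define J where "J = {i \<in> {1..n}. x i \<in> ?\<Omega>}"
  \<comment> \<open>The choice of the index is immaterial, because points that coincide in
    \<open>x\<close> coincide in \<open>x'\<close>. All other points are fixed, which keeps the map
    Borel.\<close>
  define S where "S z = (if z \<in> x ` J then x' (SOME i. i \<in> J \<and> x i = z) else z)" for z
  have Sx: "S (x i) = x' i" if "i \<in> J" for i
  proof -
    let ?k = "SOME k. k \<in> J \<and> x k = x i"
    have "?k \<in> J \<and> x ?k = x i" using that by (intro someI[of "\<lambda>k. k \<in> J \<and> x k = x i" i]) auto
    then have "x' ?k = x' i" using same that by (auto simp: same_pattern_def J_def)
    then show ?thesis using that by (simp add: S_def)
  qed
  have fin: "finite (x ` J)" by (simp add: J_def)
  have xJ: "x ` J \<subseteq> ?\<Omega>" by (auto simp: J_def)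
  have S\<Omega>: "S z \<in> ?\<Omega> \<longleftrightarrow> z \<in> ?\<Omega>" for z
  proof (cases "z \<in> x ` J")
    case True
    then obtain i where "i \<in> J" "z = x i" by auto
    then show ?thesis using Sx same by (auto simp: J_def same_pattern_def)
  qed (simp add: S_def)
  have Scl: "S z \<in> closure ?\<Omega>" if "z \<in> closure ?\<Omega>" for z
  proof (cases "z \<in> x ` J")
    case True
    then show ?thesis using S\<Omega>[of z] xJ closure_subset by auto
  qed (simp add: S_def that)
  have Sm [measurable]: "S \<in> borel_measurable borel"
  proof (rule measurable_discrete_difference[where f = "\<lambda>z. z"])
    show "countable (x ` J)" using fin by (rule countable_finite)
  qed (auto simp: S_def)
  have Sdist: "norm (S z - z) \<le> (if z \<in> ?\<Omega> then \<delta> else 0)" for z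
  proof (cases "z \<in> x ` J")
    case True
    then obtain i where i: "i \<in> J" "z = x i" by auto
    then show ?thesis using Sx[OF i(1)] close[of i] by (auto simp: J_def norm_minus_commute)
  qed (use \<delta> in \<open>simp add: S_def\<close>)
  have emp: "emeasure (empirical_measure n x') A = emeasure (empirical_measure n x) (S -` A)" if "A \<in> sets borel" "A \<subseteq> ?\<Omega>" for A
  proof -
    have "S -` A \<in> sets borel" using measurable_sets[OF Sm that(1)] by simp
    moreover have "(indicator A (x' i) :: ennreal) = indicator (S -` A) (x i)" if "i \<in> {1..n}" for i
    proof (cases "i \<in> J")
      case True
      then show ?thesis using Sx by (simp add: indicator_def)
    next
      case False
      then have "x i \<notin> ?\<Omega>" "x' i \<notin> ?\<Omega>" using that same by (auto simp: J_def same_pattern_def)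
      then show ?thesis using S\<Omega>[of "x i"] \<open>A \<subseteq> ?\<Omega>\<close> by (auto simp: indicator_def)
    qed
    ultimately show ?thesis
      unfolding nn_integral_empirical_set[OF that(1)] nn_integral_empirical_set[OF \<open>S -` A \<in> sets borel\<close>]
      by (intro sum.cong refl) simp
  qed
  have "boundary_cost ?\<Omega> 2 (empirical_measure n x') \<nu> \<le> ennreal (1 + \<delta>) * (\<integral>\<^sup>+p. ennreal ((norm (fst p - snd p))\<^sup>2) \<partial>\<pi>) + ennreal (\<delta>\<^sup>2 + \<delta>)"
    if \<pi>: "\<pi> \<in> boundary_couplings ?\<Omega> (empirical_measure n x) \<nu>" for \<pi>
  proof -
    have sp [measurable_cong]: "sets \<pi> = sets ?R"
      and m1: "restrict_space (distr \<pi> borel fst) ?\<Omega> = restrict_space (empirical_measure n x) ?\<Omega>"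
      and m2: "restrict_space (distr \<pi> borel snd) ?\<Omega> = restrict_space \<nu> ?\<Omega>"
      using \<pi> by (auto simp: boundary_couplings_def)
    have space: "space \<pi> = closure ?\<Omega> \<times> closure ?\<Omega>" using sets_eq_imp_space_eq[OF sp] by (simp add: space_restrict_space)
    have [measurable]: "fst \<in> \<pi> \<rightarrow>\<^sub>M borel" "snd \<in> \<pi> \<rightarrow>\<^sub>M borel"
      unfolding measurable_cong_sets[OF sp refl]
      by (auto intro!: measurable_restrict_space1 borel_measurable_continuous_onI continuous_intros)
    have e1: "emeasure (distr \<pi> borel fst) A = emeasure (empirical_measure n x) A" if "A \<in> sets borel" "A \<subseteq> ?\<Omega>" for A
    proof -
      have "emeasure (restrict_space (distr \<pi> borel fst) ?\<Omega>) A = emeasure (restrict_space (empirical_measure n x) ?\<Omega>) A" by (simp add: m1)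
      then show ?thesis
        using that sets_eq_imp_space_eq[OF sets_empirical_measure[of n x]] by (simp add: emeasure_restrict_space)
    qed
    have r: "restrict_space (distr \<pi> borel (\<lambda>p. S (fst p))) ?\<Omega> = restrict_space (empirical_measure n x') ?\<Omega>"
    proof (rule measure_eqI)
      show "sets (restrict_space (distr \<pi> borel (\<lambda>p. S (fst p))) ?\<Omega>) = sets (restrict_space (empirical_measure n x') ?\<Omega>)"
        by (intro sets_restrict_space_cong) simp
      fix A assume "A \<in> sets (restrict_space (distr \<pi> borel (\<lambda>p. S (fst p))) ?\<Omega>)"
      then have A [measurable]: "A \<in> sets borel" and A\<Omega>: "A \<subseteq> ?\<Omega>"
        by (auto simp: sets_restrict_space_iff)
      have SA: "S -` A \<in> sets borel" "S -` A \<subseteq> ?\<Omega>"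
        using measurable_sets[OF Sm A] A\<Omega> S\<Omega> by auto
      have "emeasure (distr \<pi> borel (\<lambda>p. S (fst p))) A = emeasure (distr \<pi> borel fst) (S -` A)"
        using SA by (simp add: emeasure_distr vimage_def)
      also have "\<dots> = emeasure (empirical_measure n x') A"
        using e1[OF SA] emp[OF A A\<Omega>] by simp
      finally show "emeasure (restrict_space (distr \<pi> borel (\<lambda>p. S (fst p))) ?\<Omega>) A = emeasure (restrict_space (empirical_measure n x') ?\<Omega>) A"
        using A\<Omega> sets_eq_imp_space_eq[OF sets_empirical_measure[of n x']] by (simp add: emeasure_restrict_space)
    qed
    have "boundary_cost ?\<Omega> 2 (empirical_measure n x') \<nu> \<le> (\<integral>\<^sup>+p. ennreal ((norm (S (fst p) - snd p))\<^sup>2) \<partial>\<pi>)"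
      by (rule boundary_cost_2_le_plan) (use Scl r m2 in \<open>auto simp: space\<close>)
    also have "\<dots> \<le> (\<integral>\<^sup>+p. ennreal (1 + \<delta>) * ennreal ((norm (fst p - snd p))\<^sup>2) + ennreal (\<delta>\<^sup>2 + \<delta>) * indicator ?\<Omega> (fst p) \<partial>\<pi>)"
    proof (intro nn_integral_mono)
      fix p
      have "(norm (S (fst p) - snd p))\<^sup>2 \<le> (1 + \<delta>) * (norm (fst p - snd p))\<^sup>2 + (1 + 1 / \<delta>) * (norm (S (fst p) - fst p))\<^sup>2"
        using norm_add_square_le[OF \<delta>, of "fst p - snd p" "S (fst p) - fst p"] by simp
      also have "(1 + 1 / \<delta>) * (norm (S (fst p) - fst p))\<^sup>2 \<le> (1 + 1 / \<delta>) * (if fst p \<in> ?\<Omega> then \<delta> else 0)\<^sup>2"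
        using \<delta> Sdist by (intro mult_left_mono power_mono) auto
      also have "\<dots> = (\<delta>\<^sup>2 + \<delta>) * indicator ?\<Omega> (fst p)"
        using \<delta> by (simp add: field_simps power2_eq_square)
      finally have "ennreal ((norm (S (fst p) - snd p))\<^sup>2) \<le> ennreal ((1 + \<delta>) * (norm (fst p - snd p))\<^sup>2 + (\<delta>\<^sup>2 + \<delta>) * indicator ?\<Omega> (fst p))"
        by (intro ennreal_leI) simp
      then show "ennreal ((norm (S (fst p) - snd p))\<^sup>2) \<le> ennreal (1 + \<delta>) * ennreal ((norm (fst p - snd p))\<^sup>2) + ennreal (\<delta>\<^sup>2 + \<delta>) * indicator ?\<Omega> (fst p)"
        using \<delta> by (simp add: ennreal_plus ennreal_mult ennreal_indicator)
    qed
    also have "\<dots> = ennreal (1 + \<delta>) * (\<integral>\<^sup>+p. ennreal ((norm (fst p - snd p))\<^sup>2) \<partial>\<pi>) + ennreal (\<delta>\<^sup>2 + \<delta>) * (\<integral>\<^sup>+p. indicator ?\<Omega> (fst p) \<partial>\<pi>)"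
      by (subst nn_integral_add; (subst nn_integral_cmult)?; (subst nn_integral_cmult)?; simp)
    \<comment> \<open>The error is charged only to mass that starts inside the square; that mass is
      at most 1 although the plan itself may be infinite.\<close>
    also have "(\<integral>\<^sup>+p. indicator ?\<Omega> (fst p) \<partial>\<pi>) = emeasure (empirical_measure n x) ?\<Omega>"
    proof -
      have "(\<integral>\<^sup>+p. indicator ?\<Omega> (fst p) \<partial>\<pi>) = (\<integral>\<^sup>+z. indicator ?\<Omega> z \<partial>distr \<pi> borel fst)"
        by (subst nn_integral_distr) auto
      then show ?thesis using e1[of ?\<Omega>] by simp
    qed
    finally have "boundary_cost ?\<Omega> 2 (empirical_measure n x') \<nu> \<le> ennreal (1 + \<delta>) * (\<integral>\<^sup>+p. ennreal ((norm (fst p - snd p))\<^sup>2) \<partial>\<pi>)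
       + ennreal (\<delta>\<^sup>2 + \<delta>) * emeasure (empirical_measure n x) ?\<Omega>" .
    also have "\<dots> \<le> ennreal (1 + \<delta>) * (\<integral>\<^sup>+p. ennreal ((norm (fst p - snd p))\<^sup>2) \<partial>\<pi>) + ennreal (\<delta>\<^sup>2 + \<delta>) * 1"
      by (intro add_left_mono mult_left_mono emeasure_empirical_le_1) auto
    finally show ?thesis by simp
  qed
  \<comment> \<open>The bound is solved for the cost of the plan so that it becomes a lower bound
    valid for every plan, hence for the infimum.\<close>
  then have "(boundary_cost ?\<Omega> 2 (empirical_measure n x') \<nu> - ennreal (\<delta>\<^sup>2 + \<delta>)) / ennreal (1 + \<delta>) \<le> boundary_cost ?\<Omega> 2 (empirical_measure n x) \<nu>"
  proof (intro boundary_cost_2_greatest divide_le_posI_ennreal)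
    show "0 < ennreal (1 + \<delta>)" using \<delta> by (simp del: ennreal_plus)
  qed (auto simp: ennreal_minus_le_iff add.commute)
  then have "ennreal (1 + \<delta>) * ((boundary_cost ?\<Omega> 2 (empirical_measure n x') \<nu> - ennreal (\<delta>\<^sup>2 + \<delta>)) / ennreal (1 + \<delta>)) \<le> ennreal (1 + \<delta>) * boundary_cost ?\<Omega> 2 (empirical_measure n x) \<nu>"
    by (intro mult_left_mono) auto
  moreover have "ennreal (1 + \<delta>) * (z / ennreal (1 + \<delta>)) = z" for z
    using \<delta> by (simp add: ennreal_times_divide mult.commute ennreal_mult_divide_eq)
  ultimately have "boundary_cost ?\<Omega> 2 (empirical_measure n x') \<nu> - ennreal (\<delta>\<^sup>2 + \<delta>) \<le> ennreal (1 + \<delta>) * boundary_cost ?\<Omega> 2 (empirical_measure n x) \<nu>"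
    by simp
  then show ?thesis by (auto simp: ennreal_minus_le_iff add.commute)
qed

lemma same_pattern_sym: "same_pattern n x x' \<Longrightarrow> same_pattern n x' x"
  by (auto simp: same_pattern_def)

definition square_cost :: "nat \<Rightarrow> (nat \<Rightarrow> real^2) \<Rightarrow> real" where
  "square_cost n x = enn2real (boundary_cost unit_square 2 (empirical_measure n x) lebesgue_square)"

lemma square_cost_nonneg [simp]: "0 \<le> square_cost n x"
  by (simp add: square_cost_def)

lemma square_cost_perturb:
  assumes "same_pattern n x x'" "\<And>i. i \<in> {1..n} \<Longrightarrow> norm (x i - x' i) \<le> \<delta>" "0 < \<delta>" "\<delta> \<le> 1"
  shows "square_cost n x' \<le> (1 + \<delta>) * square_cost n x + 2 * \<delta>"
proof -
  let ?c = "\<lambda>x. boundary_cost unit_square 2 (empirical_measure n x) lebesgue_square"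
  note 1 = boundary_cost_perturb[OF assms(1-3) sets_lebesgue_square]
  note 2 = boundary_cost_perturb[OF same_pattern_sym[OF assms(1)] _ assms(3) sets_lebesgue_square, OF assms(2)[unfolded norm_minus_commute[of "x _"]]]
  have \<delta>2: "\<delta>\<^sup>2 \<le> \<delta>" using assms by (simp add: power2_eq_square mult_left_le)
  show ?thesis
  proof (cases "?c x' = \<top>")
    case True
    then show ?thesis using assms by (simp add: square_cost_def)
  next
    case False
    \<comment> \<open>The perturbation bound in the opposite direction transfers finiteness; without
      it \<open>enn2real\<close> could turn an infinite cost into 0.\<close>
    have fin: "?c x \<noteq> \<top>"
    proof
      assume "?c x = \<top>"
      then have "\<top> \<le> ennreal (1 + \<delta>) * ?c x' + ennreal (\<delta>\<^sup>2 + \<delta>)" using 2 by simp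
      then show False using False by (simp add: ennreal_mult_eq_top_iff top_unique)
    qed
    have "ennreal (square_cost n x') \<le> ennreal ((1 + \<delta>) * square_cost n x + (\<delta>\<^sup>2 + \<delta>))"
      using 1 fin False assms by (simp add: square_cost_def ennreal_plus ennreal_mult less_top)
    then have "square_cost n x' \<le> (1 + \<delta>) * square_cost n x + (\<delta>\<^sup>2 + \<delta>)"
      using assms by (subst (asm) ennreal_le_iff) auto
    then show ?thesis using \<delta>2 by simp
  qed
qed

lemma square_cost_perturb_abs:
  assumes "same_pattern n x x'" "\<And>i. i \<in> {1..n} \<Longrightarrow> norm (x i - x' i) \<le> \<delta>" "0 < \<delta>" "\<delta> \<le> 1"
  shows "\<bar>square_cost n x' - square_cost n x\<bar> \<le> \<delta> * (2 * square_cost n x + 4)"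
proof -
  have 1: "square_cost n x' \<le> (1 + \<delta>) * square_cost n x + 2 * \<delta>" by (rule square_cost_perturb[OF assms])
  have 2: "square_cost n x \<le> (1 + \<delta>) * square_cost n x' + 2 * \<delta>"
    using same_pattern_sym[OF assms(1)] assms(2-4) by (intro square_cost_perturb) (auto simp: norm_minus_commute)
  have "(1 + \<delta>) * square_cost n x \<le> 2 * square_cost n x" using assms by (intro mult_right_mono) auto
  then have "square_cost n x' \<le> 2 * square_cost n x + 2" using 1 assms by linarith
  then have "\<delta> * square_cost n x' \<le> \<delta> * (2 * square_cost n x + 2)" using assms by (intro mult_left_mono) auto
  then have "square_cost n x - square_cost n x' \<le> \<delta> * (2 * square_cost n x + 4)"
    using 2 by (simp add: algebra_simps)
  moreover have "square_cost n x' - square_cost n x \<le> \<delta> * (2 * square_cost n x + 4)"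
    using 1 mult_nonneg_nonneg[of \<delta> "square_cost n x"] assms square_cost_nonneg[of n x] unfolding distrib_left distrib_right by linarith
  ultimately show ?thesis by simp
qed

lemma continuous_on_square_cost:
  assumes "\<And>x x'. x \<in> D \<Longrightarrow> x' \<in> D \<Longrightarrow> same_pattern n x x'"
  shows "continuous_on D (square_cost n)"
  unfolding continuous_on_def
proof (intro ballI)
  fix x assume x: "x \<in> D"
  show "(square_cost n \<longlongrightarrow> square_cost n x) (at x within D)"
  proof (rule tendstoI)
    fix e :: real assume e: "e > 0"
    define \<delta> where "\<delta> = min 1 (e / (2 * square_cost n x + 5))"
    have \<delta>: "0 < \<delta>" "\<delta> \<le> 1" using e by (auto simp: \<delta>_def add_nonneg_pos)
    have "\<delta> * (2 * square_cost n x + 4) < \<delta> * (2 * square_cost n x + 5)" using \<delta> by simp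
    also have "\<dots> \<le> e / (2 * square_cost n x + 5) * (2 * square_cost n x + 5)"
      by (intro mult_right_mono) (auto simp: \<delta>_def add_nonneg_nonneg)
    also have "\<dots> = e" using square_cost_nonneg[of n x] by (simp add: add_nonneg_eq_0_iff)
    finally have small: "\<delta> * (2 * square_cost n x + 4) < e" .
    have "\<forall>\<^sub>F x' in at x within D. norm (x i - x' i) \<le> \<delta>" for i
    proof -
      have "((\<lambda>x'. x' i) \<longlongrightarrow> x i) (at x within D)"
        using continuous_on_product_coordinates[of i] x by (metis continuous_on_def UNIV_I tendsto_within_subset subset_UNIV)
      then have "\<forall>\<^sub>F x' in at x within D. dist (x' i) (x i) < \<delta>" using \<delta>(1) by (rule tendstoD)
      then show ?thesis by eventually_elim (simp add: dist_norm norm_minus_commute)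
    qed
    then have "\<forall>\<^sub>F x' in at x within D. \<forall>i\<in>{1..n}. norm (x i - x' i) \<le> \<delta>"
      by (intro eventually_ball_finite) auto
    moreover have "\<forall>\<^sub>F x' in at x within D. x' \<in> D" by (simp add: eventually_at_filter)
    ultimately show "\<forall>\<^sub>F x' in at x within D. dist (square_cost n x') (square_cost n x) < e"
    proof eventually_elim
      case (elim x')
      then show ?case
        using square_cost_perturb_abs[OF assms[OF x], of x' \<delta>] \<delta> small by (auto simp: dist_real_def)
    qed
  qed
qed

lemma measurable_square_cost: "square_cost n \<in> borel_measurable borel"
proof -
  define I where "I = {1..n}"
  \<comment> \<open>The pattern of a sample: which points lie in the square, and which of them
    coincide. Each pattern is attained on a Borel set on which the cost is continuous.\<close>
  define p where "p x = ({i \<in> I. x i \<in> unit_square}, {(i, j) \<in> I \<times> I. x i = x j})" for x :: "nat \<Rightarrow> real^2"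
  define D where "D = (\<lambda>q. {x. p x = q}) ` (Pow I \<times> Pow (I \<times> I))"
  have pm: "p x \<in> Pow I \<times> Pow (I \<times> I)" for x by (auto simp: p_def)
  have coord [measurable]: "(\<lambda>x. x i) \<in> borel_measurable (borel :: (nat \<Rightarrow> real^2) measure)" for i
    by (intro borel_measurable_continuous_onI continuous_on_product_coordinates)
  have Dset: "{x. p x = q} \<in> sets borel" for q
  proof -
    have "{x. p x = q} = {x \<in> space borel. (\<forall>i\<in>I. x i \<in> unit_square \<longleftrightarrow> i \<in> fst q) \<and> (\<forall>i\<in>I. \<forall>j\<in>I. x i = x j \<longleftrightarrow> (i, j) \<in> snd q)}"
      if "fst q \<subseteq> I" "snd q \<subseteq> I \<times> I"
      using that by (cases q) (auto simp: p_def)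
    moreover have "{x \<in> space borel. (\<forall>i\<in>I. x i \<in> unit_square \<longleftrightarrow> i \<in> fst q) \<and> (\<forall>i\<in>I. \<forall>j\<in>I. x i = x j \<longleftrightarrow> (i, j) \<in> snd q)} \<in> sets borel"
    proof -
      have "{x \<in> space borel. x i = x j} \<in> sets (borel :: (nat \<Rightarrow> real^2) measure)" for i j
        using measurable_equality_set[OF coord[of i] coord[of j]] by simp
      then have [measurable]: "Measurable.pred borel (\<lambda>x :: nat \<Rightarrow> real^2. x i = x j)" for i j by (simp add: pred_def)
      have [measurable]: "Measurable.pred borel (\<lambda>x :: nat \<Rightarrow> real^2. c)" for c by simp
      show ?thesis unfolding I_def by measurable
    qed
    moreover have "{x. p x = q} = {}" if "\<not> (fst q \<subseteq> I \<and> snd q \<subseteq> I \<times> I)"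
      using that by (cases q) (auto simp: p_def)
    ultimately show ?thesis by (cases "fst q \<subseteq> I \<and> snd q \<subseteq> I \<times> I") auto
  qed
  show ?thesis
  proof (rule measurable_piecewise_restrict[where C = D])
    show "countable D" unfolding D_def I_def by (intro countable_finite finite_imageI) auto
    show "space borel \<subseteq> \<Union>D" using pm by (auto simp: D_def)
    fix \<Omega> assume "\<Omega> \<in> D"
    then obtain q where q: "\<Omega> = {x. p x = q}" by (auto simp: D_def)
    show "\<Omega> \<inter> space borel \<in> sets borel" using Dset q by simp
    have "continuous_on \<Omega> (square_cost n)"
    proof (rule continuous_on_square_cost)
      fix x x' assume "x \<in> \<Omega>" "x' \<in> \<Omega>"
      then have "p x = p x'" using q by simp
      then show "same_pattern n x x'"
        unfolding same_pattern_def I_def[symmetric] by (auto simp: p_def set_eq_iff)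
    qed
    then show "square_cost n \<in> restrict_space borel \<Omega> \<rightarrow>\<^sub>M borel"
      by (rule borel_measurable_continuous_on_restrict)
  qed
qed

lemma square_cost_cong: "(\<And>i. i \<in> {1..n} \<Longrightarrow> x i = x' i) \<Longrightarrow> square_cost n x = square_cost n x'"
proof -
  assume "\<And>i. i \<in> {1..n} \<Longrightarrow> x i = x' i"
  then have "empirical_measure n x = empirical_measure n x'"
    by (intro measure_eqI) (auto simp: nn_integral_empirical_set intro!: sum.cong)
  then show ?thesis by (simp add: square_cost_def)
qed

lemma (in uniform_sample) measurable_square_cost_sample [measurable]:
  "(\<lambda>\<omega>. square_cost n (\<lambda>i. X i \<omega>)) \<in> borel_measurable M"
proof -
  \<comment> \<open>Coordinates outside \<open>1..n\<close> are replaced by 0: measurability of the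
    sample is known from index 1 on, and the cost depends only on these \<open>n\<close>
    points.\<close>
  have "(\<lambda>\<omega> i. if i \<in> {1..n} then X i \<omega> else 0) \<in> borel_measurable M"
  proof (rule measurable_coordinatewise_then_product)
    fix i show "(\<lambda>\<omega>. if i \<in> {1..n} then X i \<omega> else 0) \<in> borel_measurable M"
      using measurable_sample by (cases "i \<in> {1..n}") auto
  qed
  from measurable_compose[OF this measurable_square_cost[of n]]
  show ?thesis
    by (rule measurable_cong[THEN iffD1, rotated]) (rule square_cost_cong, simp)
qed

lemma square_cost_le:
  assumes "boundary_cost unit_square 2 (empirical_measure n x) lebesgue_square \<le> ennreal c" "0 \<le> c"
  shows "square_cost n x \<le> c"
  unfolding square_cost_def using assms by (metis enn2real_mono enn2real_ennreal ennreal_less_top)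

lemma square_cost_le_2:
  assumes "n > 0" "\<And>i. i \<in> {1..n} \<Longrightarrow> x i \<in> closure unit_square"
  shows "square_cost n x \<le> 2"
  by (rule square_cost_le) (use boundary_cost_empirical_le_2[OF assms] in auto)

section \<open>Transport between densities constant on grid cells\<close>

text \<open>The cap puts \<open>t = 1\<close> into the last cell, and the conversion to a natural
  number puts negative \<open>t\<close> into the first, so that every real number has a
  cell.\<close>

definition cell :: "nat \<Rightarrow> real \<Rightarrow> nat" where
  "cell m t = min (m - 1) (nat \<lfloor>real m * t\<rfloor>)"

lemma cell_less: "m > 0 \<Longrightarrow> cell m t < m"
  by (auto simp: cell_def)

lemma measurable_cell [measurable]: "cell m \<in> borel \<rightarrow>\<^sub>M count_space UNIV"
  unfolding cell_def by measurable

lemma cell_eq: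
  assumes "m > 0" "a < m" "real a / real m \<le> t" "t < (real a + 1) / real m"
  shows "cell m t = a"
proof -
  have "real a \<le> real m * t" "real m * t < real a + 1"
    using assms by (auto simp: field_simps)
  then have "\<lfloor>real m * t\<rfloor> = int a" by (simp add: floor_eq_iff)
  then show ?thesis using assms by (simp add: cell_def)
qed

lemma cell_bounds:
  assumes "m > 0" "0 \<le> t" "t \<le> 1"
  shows "real (cell m t) \<le> real m * t" "real m * t \<le> real (cell m t) + 1"
proof -
  have f: "real (nat \<lfloor>real m * t\<rfloor>) \<le> real m * t" "real m * t < real (nat \<lfloor>real m * t\<rfloor>) + 1"
  proof -
    have "0 \<le> real m * t" using assms by simp
    then have e: "real (nat \<lfloor>real m * t\<rfloor>) = of_int \<lfloor>real m * t\<rfloor>" by simp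
    show "real (nat \<lfloor>real m * t\<rfloor>) \<le> real m * t" "real m * t < real (nat \<lfloor>real m * t\<rfloor>) + 1"
      unfolding e by linarith+
  qed
  show "real (cell m t) \<le> real m * t" using f(1) by (simp add: cell_def)
  have "real m * t \<le> real m" using assms by (simp add: mult_left_le)
  then show "real m * t \<le> real (cell m t) + 1" using f(2) assms by (auto simp: cell_def min_def of_nat_diff)
qed

text \<open>Nested floors give compatibility of the two grids; the cap is compatible too, since the
  last fine cell belongs to the last coarse one.\<close>

lemma cell_refine:
  assumes "m > 0" "k > 0"
  shows "cell (m * k) t div k = cell m t"
proof (cases "0 \<le> t")
  case True
  have "\<lfloor>real m * t\<rfloor> = \<lfloor>real (m * k) * t / real k\<rfloor>" using assms by simp
  also have "\<dots> = \<lfloor>real (m * k) * t\<rfloor> div int k" using floor_divide_real_eq_div[of "int k" "real (m * k) * t"] by simp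
  finally have "nat \<lfloor>real m * t\<rfloor> = nat \<lfloor>real (m * k) * t\<rfloor> div k"
    using assms True by (simp add: nat_div_distrib)
  moreover have "min a b div k = min (a div k) (b div k)" for a b
    by (simp add: min_def div_le_mono) (metis div_le_mono le_antisym nat_le_linear)
  moreover have "(m * k - 1) div k = m - 1"
  proof -
    have "m * k - 1 = (m - 1) * k + (k - 1)" using assms by (cases m; cases k) auto
    moreover have "((m - 1) * k + (k - 1)) div k = m - 1"
      by (rule div_nat_eqI) (use assms in \<open>auto simp: algebra_simps\<close>)
    ultimately show ?thesis by simp
  qed
  ultimately show ?thesis by (simp add: cell_def)
next
  case False
  then have "real (m * k) * t \<le> 0" "real m * t \<le> 0" using assms by (auto simp: mult_nonneg_nonpos)
  then show ?thesis by (simp add: cell_def)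
qed

section \<open>Integrals of functions constant on cells\<close>

lemma has_integral_cell:
  fixes G :: "nat \<Rightarrow> real"
  assumes "m > 0" "a < m" "real a / real m \<le> y" "y \<le> (real a + 1) / real m"
  shows "((\<lambda>t. G (cell m t)) has_integral G a * (y - real a / real m)) {real a / real m..y}"
proof (rule has_integral_spike_finite[where S = "{y}" and f = "\<lambda>_. G a"])
  fix t assume "t \<in> {real a / real m..y} - {y}"
  then show "G (cell m t) = G a" using assms by (subst cell_eq[of m a]) auto
next
  show "((\<lambda>_. G a) has_integral G a * (y - real a / real m)) {real a / real m..y}"
    using has_integral_const_real[of "G a" "real a / real m" y] assms by (simp add: mult.commute)
qed simp

lemma has_integral_cells:
  fixes f :: "real \<Rightarrow> real"
  assumes m: "m > 0" and f: "\<And>i. i < m \<Longrightarrow> (f has_integral I i) {real i / real m..(real i + 1) / real m}" and "a \<le> m"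
  shows "(f has_integral (\<Sum>i<a. I i)) {0..real a / real m}"
  using assms(3)
proof (induction a)
  case 0
  then show ?case using has_integral_refl(2)[of f 0] by simp
next
  case (Suc a)
  have "(f has_integral (\<Sum>i<a. I i) + I a) {0..(real a + 1) / real m}"
    using Suc m by (intro has_integral_combine[OF _ _ Suc.IH f]) (auto simp: divide_right_mono)
  then show ?case by (simp add: add.commute)
qed

lemma mass_upto_knot:
  assumes "m > 0" "a \<le> m"
  shows "mass_upto (\<lambda>t. G (cell m t)) (real a / real m) = (\<Sum>i<a. G i) / real m"
proof -
  have "((\<lambda>t. G (cell m t)) has_integral G i / real m) {real i / real m..(real i + 1) / real m}" if "i < m" for i
    using has_integral_cell[of m i "(real i + 1) / real m" G] assms that by (simp add: add_divide_distrib divide_right_mono)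
  from has_integral_cells[OF assms(1) this assms(2)]
  show ?thesis by (simp add: integral_unique sum_divide_distrib)
qed

lemma measurable_comp_cell [measurable]: "(\<lambda>t. G (cell m t)) \<in> borel_measurable borel" for G :: "nat \<Rightarrow> real"
  by (rule measurable_compose[OF measurable_cell]) simp

lemma cell_bounded:
  fixes G :: "nat \<Rightarrow> real"
  assumes "m > 0"
  shows "\<exists>B. \<forall>t. \<bar>G (cell m t)\<bar> \<le> B"
proof -
  have "\<bar>G (cell m t)\<bar> \<le> (\<Sum>a<m. \<bar>G a\<bar>)" for t
    using cell_less[OF assms, of t] by (intro member_le_sum) auto
  then show ?thesis by blast
qed

lemma integrable_on_cell:
  fixes G :: "nat \<Rightarrow> real"
  assumes "m > 0"
  shows "(\<lambda>t. G (cell m t)) integrable_on {a..b}"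
  using cell_bounded[OF assms, of G] bounded_measurable_integrable_on[OF measurable_comp_cell] by blast

lemma mass_upto_cell:
  assumes "m > 0" "a < m" "real a / real m \<le> y" "y \<le> (real a + 1) / real m"
  shows "mass_upto (\<lambda>t. G (cell m t)) y = (\<Sum>i<a. G i) / real m + G a * (y - real a / real m)"
proof -
  have "integral {0..real a / real m} (\<lambda>t. G (cell m t)) + integral {real a / real m..y} (\<lambda>t. G (cell m t)) = mass_upto (\<lambda>t. G (cell m t)) y"
    using assms by (intro Henstock_Kurzweil_Integration.integral_combine integrable_on_cell) auto
  then show ?thesis
    using mass_upto_knot[of m a G] integral_unique[OF has_integral_cell[OF assms, of G]] assms by simp
qed

lemma continuous_mass_upto_cell:
  assumes "m > 0"
  shows "continuous_on {0..1} (mass_upto (\<lambda>t. G (cell m t)))"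
  by (intro indefinite_integral_continuous_1 integrable_on_cell assms)

text \<open>Between knots the cumulative mass is linear, and by convexity the square of a linear
  interpolation lies below the interpolation of the squares. The integral is thus at most the
  trapezoidal sum over the knots; as the total mass vanishes at both ends, this is the plain sum.
  One power of \<open>m\<close> is the step, two come from the knot values.\<close>

lemma integral_mass_upto_square_le:
  assumes m: "m > 0" and zero: "(\<Sum>i<m. G i) = 0"
  shows "integral {0..1} (\<lambda>y. (mass_upto (\<lambda>t. G (cell m t)) y)\<^sup>2) \<le> (\<Sum>a<m. (\<Sum>i<a. G i)\<^sup>2) / real m ^ 3"
proof -
  define V where "V = mass_upto (\<lambda>t. G (cell m t))"
  define P where "P a = (\<Sum>i<a. G i) / real m" for a
  have cont: "continuous_on {0..1} (\<lambda>y. (V y)\<^sup>2)"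
    unfolding V_def by (intro continuous_intros continuous_mass_upto_cell m)
  have sub: "{real i / real m..(real i + 1) / real m} \<subseteq> {0..1}" if "i < m" for i
    using that m by (auto simp: field_simps)
  define I where "I i = integral {real i / real m..(real i + 1) / real m} (\<lambda>y. (V y)\<^sup>2)" for i
  have I: "((\<lambda>y. (V y)\<^sup>2) has_integral I i) {real i / real m..(real i + 1) / real m}" if "i < m" for i
    unfolding I_def by (intro integrable_integral integrable_continuous_real continuous_on_subset[OF cont] sub that)
  have le: "I i \<le> ((P i)\<^sup>2 + (P (Suc i))\<^sup>2) / (2 * real m)" if i: "i < m" for i
  proof -
    \<comment> \<open>The chord between the squared values at the ends of the cell; \<open>F\<close>
      is its antiderivative.\<close>
    define L where "L y = (1 - (real m * y - real i)) * (P i)\<^sup>2 + (real m * y - real i) * (P (Suc i))\<^sup>2" for y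
    define F where "F y = (y - (real m * y - real i)\<^sup>2 / (2 * real m)) * (P i)\<^sup>2 + (real m * y - real i)\<^sup>2 / (2 * real m) * (P (Suc i))\<^sup>2" for y
    have "(L has_integral F ((real i + 1) / real m) - F (real i / real m)) {real i / real m..(real i + 1) / real m}"
    proof (rule fundamental_theorem_of_calculus)
      show "real i / real m \<le> (real i + 1) / real m" by (simp add: divide_right_mono)
      fix y
      have "(F has_real_derivative L y) (at y)"
        unfolding F_def L_def using m by (auto intro!: derivative_eq_intros simp: field_simps power2_eq_square)
      then show "(F has_vector_derivative L y) (at y within {real i / real m..(real i + 1) / real m})"
        by (simp add: has_real_derivative_iff_has_vector_derivative has_vector_derivative_at_within)
    qed
    moreover have "F ((real i + 1) / real m) - F (real i / real m) = ((P i)\<^sup>2 + (P (Suc i))\<^sup>2) / (2 * real m)"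
      using m by (simp add: F_def field_simps)
    ultimately have "(L has_integral ((P i)\<^sup>2 + (P (Suc i))\<^sup>2) / (2 * real m)) {real i / real m..(real i + 1) / real m}" by simp
    then show ?thesis
    proof (rule has_integral_le[OF I[OF i]])
      fix y assume y: "y \<in> {real i / real m..(real i + 1) / real m}"
      define s where "s = real m * y - real i"
      have s: "0 \<le> s" "s \<le> 1" using y m by (auto simp: s_def field_simps)
      have "V y = P i + G i * (y - real i / real m)"
        unfolding V_def P_def using mass_upto_cell[OF m i, of y G] y by simp
      also have "\<dots> = (1 - s) * P i + s * P (Suc i)"
        using m by (simp add: s_def P_def field_simps)
      finally have "(V y)\<^sup>2 = ((1 - s) * P i + s * P (Suc i))\<^sup>2" by simp
      also have "\<dots> = (1 - s) * (P i)\<^sup>2 + s * (P (Suc i))\<^sup>2 - s * (1 - s) * (P i - P (Suc i))\<^sup>2"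
        by (simp add: power2_eq_square algebra_simps)
      also have "\<dots> \<le> L y" using s by (simp add: L_def s_def[symmetric])
      finally show "(V y)\<^sup>2 \<le> L y" .
    qed
  qed
  have "integral {0..1} (\<lambda>y. (V y)\<^sup>2) = (\<Sum>i<m. I i)"
    using has_integral_cells[OF m I, of m] m by (simp add: integral_unique)
  also have "\<dots> \<le> (\<Sum>i<m. ((P i)\<^sup>2 + (P (Suc i))\<^sup>2) / (2 * real m))" by (intro sum_mono le) simp
  also have "\<dots> = ((\<Sum>i<m. (P i)\<^sup>2) + (\<Sum>i<m. (P (Suc i))\<^sup>2)) / (2 * real m)"
    by (simp only: sum.distrib[symmetric] sum_divide_distrib)
  also have "(\<Sum>i<m. (P (Suc i))\<^sup>2) = (\<Sum>i<m. (P i)\<^sup>2)"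
  proof -
    have "(\<Sum>i<m. (P (Suc i))\<^sup>2) + (P 0)\<^sup>2 = (\<Sum>i<m. (P i)\<^sup>2) + (P m)\<^sup>2"
      using sum.lessThan_Suc_shift[of "\<lambda>i. (P i)\<^sup>2" m] by simp
    then show ?thesis by (simp add: P_def zero)
  qed
  also have "((\<Sum>i<m. (P i)\<^sup>2) + (\<Sum>i<m. (P i)\<^sup>2)) / (2 * real m) = (\<Sum>a<m. (\<Sum>i<a. G i)\<^sup>2) / real m ^ 3"
    by (simp add: P_def power_divide sum_divide_distrib[symmetric] power2_eq_square power3_eq_cube)
  finally show ?thesis by (simp add: V_def)
qed

lemma unit_interval_integral_cell:
  fixes G :: "nat \<Rightarrow> real"
  assumes "m > 0"
  shows "integral {0..1} (\<lambda>t. G (cell m t)) = (\<Sum>a<m. G a) / real m"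
  using mass_upto_knot[of m m G] assms by simp

section \<open>Maps acting along rows and along columns\<close>

abbreviation unit_square_pair :: "(real \<times> real) measure" where
  "unit_square_pair \<equiv> unit_interval \<Otimes>\<^sub>M unit_interval"

lemma density_unit_interval:
  fixes p :: "real \<Rightarrow> real"
  assumes [measurable]: "p \<in> borel_measurable borel"
  shows "density unit_interval (\<lambda>x. ennreal (p x)) = density lborel (\<lambda>x. ennreal (p x) * indicator {0..1} x)"
  unfolding unit_interval_def by (subst density_density_eq) (auto simp: mult.commute)

text \<open>The map changes only the first coordinate, in a way that depends on the second through a
  natural number. Fubini reduces the claim to one line at a time, and countably many cases give
  measurability.\<close>

lemma push_rows:
  fixes p q :: "nat \<Rightarrow> real \<Rightarrow> real" and \<tau> :: "nat \<Rightarrow> real \<Rightarrow> real"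
  assumes p [measurable]: "\<And>b. p b \<in> borel_measurable borel" and q [measurable]: "\<And>b. q b \<in> borel_measurable borel"
    and \<tau> [measurable]: "\<And>b. \<tau> b \<in> borel_measurable borel"
    and push: "\<And>b. distr (density unit_interval (\<lambda>x. ennreal (p b x))) borel (\<tau> b) = density unit_interval (\<lambda>x. ennreal (q b x))"
    and c [measurable]: "c \<in> borel \<rightarrow>\<^sub>M count_space UNIV"
  shows "distr (density unit_square_pair (\<lambda>y. ennreal (p (c (snd y)) (fst y)))) unit_square_pair (\<lambda>y. (\<tau> (c (snd y)) (fst y), snd y))
      = density unit_square_pair (\<lambda>y. ennreal (q (c (snd y)) (fst y)))" (is "?A = ?B")
    and "(\<lambda>y. (\<tau> (c (snd y)) (fst y), snd y)) \<in> unit_square_pair \<rightarrow>\<^sub>M unit_square_pair"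
proof -
  have [measurable]: "(\<lambda>y. p (c (snd y)) (fst y)) \<in> borel_measurable unit_square_pair"
    by (rule measurable_compose_countable[where f = "\<lambda>b y. p b (fst y)"]) measurable
  have [measurable]: "(\<lambda>y. q (c (snd y)) (fst y)) \<in> borel_measurable unit_square_pair"
    by (rule measurable_compose_countable[where f = "\<lambda>b y. q b (fst y)"]) measurable
  have [measurable]: "(\<lambda>y. \<tau> (c (snd y)) (fst y)) \<in> borel_measurable unit_square_pair"
    by (rule measurable_compose_countable[where f = "\<lambda>b y. \<tau> b (fst y)"]) measurable
  show T [measurable]: "(\<lambda>y. (\<tau> (c (snd y)) (fst y), snd y)) \<in> unit_square_pair \<rightarrow>\<^sub>M unit_square_pair"
    by measurable
  have row: "(\<integral>\<^sup>+x. ennreal (p b x) * indicator S (\<tau> b x) \<partial>unit_interval) = (\<integral>\<^sup>+x. ennreal (q b x) * indicator S x \<partial>unit_interval)"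
    if [measurable]: "S \<in> sets borel" for b S
  proof -
    have "(\<integral>\<^sup>+x. ennreal (p b x) * indicator S (\<tau> b x) \<partial>unit_interval) = (\<integral>\<^sup>+x. indicator S (\<tau> b x) \<partial>density unit_interval (\<lambda>x. ennreal (p b x)))"
      by (subst nn_integral_density) auto
    also have "\<dots> = (\<integral>\<^sup>+x. indicator S x \<partial>density unit_interval (\<lambda>x. ennreal (q b x)))"
      unfolding push[of b, symmetric] by (subst nn_integral_distr) auto
    also have "\<dots> = (\<integral>\<^sup>+x. ennreal (q b x) * indicator S x \<partial>unit_interval)"
      by (subst nn_integral_density) auto
    finally show ?thesis .
  qed
  show "?A = ?B"
  proof (rule measure_eqI)
    fix A assume "A \<in> sets ?A"
    then have A [measurable]: "A \<in> sets unit_square_pair" by simp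
    have slice: "{x. (x, y) \<in> A} \<in> sets borel" for y
      using sets_Pair2[OF A, of y] by (simp add: vimage_def)
    have "emeasure ?A A = (\<integral>\<^sup>+y. indicator A y \<partial>?A)" using \<open>A \<in> sets ?A\<close> by simp
    also have "\<dots> = (\<integral>\<^sup>+y. indicator A (\<tau> (c (snd y)) (fst y), snd y) \<partial>density unit_square_pair (\<lambda>y. ennreal (p (c (snd y)) (fst y))))"
      by (rule nn_integral_distr) measurable
    also have "\<dots> = (\<integral>\<^sup>+y. ennreal (p (c (snd y)) (fst y)) * indicator A (\<tau> (c (snd y)) (fst y), snd y) \<partial>unit_square_pair)"
      by (rule nn_integral_density) measurable
    also have "\<dots> = (\<integral>\<^sup>+y2. \<integral>\<^sup>+y1. ennreal (p (c y2) y1) * indicator A (\<tau> (c y2) y1, y2) \<partial>unit_interval \<partial>unit_interval)"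
      by (subst unit_square.nn_integral_snd[symmetric]) auto
    also have "\<dots> = (\<integral>\<^sup>+y2. \<integral>\<^sup>+y1. ennreal (p (c y2) y1) * indicator {x. (x, y2) \<in> A} (\<tau> (c y2) y1) \<partial>unit_interval \<partial>unit_interval)"
      by (intro nn_integral_cong) (simp add: indicator_def)
    also have "\<dots> = (\<integral>\<^sup>+y2. \<integral>\<^sup>+y1. ennreal (q (c y2) y1) * indicator {x. (x, y2) \<in> A} y1 \<partial>unit_interval \<partial>unit_interval)"
      by (simp add: row slice)
    also have "\<dots> = (\<integral>\<^sup>+y2. \<integral>\<^sup>+y1. ennreal (q (c y2) y1) * indicator A (y1, y2) \<partial>unit_interval \<partial>unit_interval)"
      by (intro nn_integral_cong) (simp add: indicator_def)
    also have "\<dots> = (\<integral>\<^sup>+y. ennreal (q (c (snd y)) (fst y)) * indicator A y \<partial>unit_square_pair)"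
      by (subst unit_square.nn_integral_snd[symmetric]) auto
    also have "\<dots> = emeasure ?B A" by (rule emeasure_density[symmetric]) measurable
    finally show "emeasure ?A A = emeasure ?B A" .
  qed simp
qed

lemma distr_unit_square_pair_swap: "distr unit_square_pair unit_square_pair prod.swap = unit_square_pair"
proof -
  have "prod.swap = (\<lambda>(x :: real, y :: real). (y, x))" by (auto simp: fun_eq_iff)
  then show ?thesis using unit_square.distr_pair_swap by simp
qed

lemma measurable_swap [measurable]: "prod.swap \<in> unit_square_pair \<rightarrow>\<^sub>M unit_square_pair"
proof -
  have "prod.swap = (\<lambda>y. (snd y :: real, fst y :: real))" by (auto simp: fun_eq_iff)
  show ?thesis unfolding \<open>prod.swap = _\<close> by measurable
qed

text \<open>The row version conjugated by the swap of the coordinates.\<close>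

lemma push_columns:
  fixes p q :: "nat \<Rightarrow> real \<Rightarrow> real" and \<tau> :: "nat \<Rightarrow> real \<Rightarrow> real"
  assumes p [measurable]: "\<And>b. p b \<in> borel_measurable borel" and q [measurable]: "\<And>b. q b \<in> borel_measurable borel"
    and \<tau> [measurable]: "\<And>b. \<tau> b \<in> borel_measurable borel"
    and push: "\<And>b. distr (density unit_interval (\<lambda>x. ennreal (p b x))) borel (\<tau> b) = density unit_interval (\<lambda>x. ennreal (q b x))"
    and c [measurable]: "c \<in> borel \<rightarrow>\<^sub>M count_space UNIV"
  shows "distr (density unit_square_pair (\<lambda>y. ennreal (p (c (fst y)) (snd y)))) unit_square_pair (\<lambda>y. (fst y, \<tau> (c (fst y)) (snd y)))
      = density unit_square_pair (\<lambda>y. ennreal (q (c (fst y)) (snd y)))"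
    and "(\<lambda>y. (fst y, \<tau> (c (fst y)) (snd y))) \<in> unit_square_pair \<rightarrow>\<^sub>M unit_square_pair"
proof -
  define P where "P y = ennreal (p (c (snd y)) (fst y))" for y :: "real \<times> real"
  define Q where "Q y = ennreal (q (c (snd y)) (fst y))" for y :: "real \<times> real"
  define T where "T y = (\<tau> (c (snd y)) (fst y), snd y)" for y
  have [measurable]: "(\<lambda>y. p (c (snd y)) (fst y)) \<in> borel_measurable unit_square_pair"
    by (rule measurable_compose_countable[where f = "\<lambda>b y. p b (fst y)"]) measurable
  have Pm [measurable]: "P \<in> borel_measurable unit_square_pair" unfolding P_def by measurable
  have [measurable]: "(\<lambda>y. q (c (snd y)) (fst y)) \<in> borel_measurable unit_square_pair"
    by (rule measurable_compose_countable[where f = "\<lambda>b y. q b (fst y)"]) measurable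
  have Qm [measurable]: "Q \<in> borel_measurable unit_square_pair" unfolding Q_def by measurable
  have T: "distr (density unit_square_pair P) unit_square_pair T = density unit_square_pair Q" and Tm [measurable]: "T \<in> unit_square_pair \<rightarrow>\<^sub>M unit_square_pair"
    unfolding P_def Q_def T_def by (rule push_rows[OF assms])+
  have T': "(\<lambda>y. (fst y, \<tau> (c (fst y)) (snd y))) = prod.swap \<circ> T \<circ> prod.swap" by (auto simp: T_def fun_eq_iff)
  show "(\<lambda>y. (fst y, \<tau> (c (fst y)) (snd y))) \<in> unit_square_pair \<rightarrow>\<^sub>M unit_square_pair" unfolding T' by measurable
  have swap: "density unit_square_pair (\<lambda>y. F (prod.swap y)) = distr (density unit_square_pair F) unit_square_pair prod.swap"
    if [measurable]: "F \<in> borel_measurable unit_square_pair" for F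
  proof -
    have "density unit_square_pair (\<lambda>y. F (prod.swap y)) = density (distr unit_square_pair unit_square_pair prod.swap) (\<lambda>y. F (prod.swap y))"
      by (simp only: distr_unit_square_pair_swap)
    also have "\<dots> = distr (density unit_square_pair F) unit_square_pair prod.swap"
      by (subst density_distr) (simp_all add: comp_def)
    finally show ?thesis .
  qed
  have "distr (density unit_square_pair (\<lambda>y. P (prod.swap y))) unit_square_pair (prod.swap \<circ> T \<circ> prod.swap)
     = distr (density unit_square_pair P) unit_square_pair (prod.swap \<circ> T)"
    unfolding swap[OF Pm] by (subst distr_distr) (simp_all add: comp_def)
  also have "\<dots> = distr (density unit_square_pair Q) unit_square_pair prod.swap"
    unfolding T[symmetric] by (subst distr_distr) simp_all
  also have "\<dots> = density unit_square_pair (\<lambda>y. Q (prod.swap y))" by (rule swap[OF Qm, symmetric])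
  finally show "distr (density unit_square_pair (\<lambda>y. ennreal (p (c (fst y)) (snd y)))) unit_square_pair (\<lambda>y. (fst y, \<tau> (c (fst y)) (snd y)))
      = density unit_square_pair (\<lambda>y. ennreal (q (c (fst y)) (snd y)))"
    unfolding T' by (simp add: P_def Q_def)
qed

lemma measurable_cell_cell [measurable]:
  fixes G :: "nat \<Rightarrow> nat \<Rightarrow> real"
  shows "(\<lambda>y. G (cell m (fst y)) (cell m (snd y))) \<in> borel_measurable unit_square_pair"
  by (rule measurable_compose_countable[where f = "\<lambda>a y. G a (cell m (snd y))"];
      (rule measurable_compose_countable[where f = "\<lambda>b y. G _ b"])?) measurable

lemma nn_integral_unit_interval_le:
  fixes f :: "real \<Rightarrow> real"
  assumes [measurable]: "f \<in> borel_measurable borel" and "\<And>x. 0 \<le> f x" "\<And>x. x \<in> {0..1} \<Longrightarrow> f x \<le> B"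
  shows "(\<integral>\<^sup>+x. ennreal (f x) \<partial>unit_interval) = ennreal (integral {0..1} f)"
proof -
  have b: "\<And>x. x \<in> {0..1} \<Longrightarrow> \<bar>f x\<bar> \<le> B" using assms by auto
  have i: "integrable unit_interval f"
    by (rule unit_interval.integrable_const_bound[where B = B]) (auto intro!: eventually_mono[OF AE_unit_interval] b)
  show ?thesis
    using nn_integral_eq_integral[OF i] assms(2) unit_interval_integral(1)[OF assms(1) b] by simp
qed

lemma nn_integral_displacement_le:
  fixes f w :: "real \<Rightarrow> real" and G :: "nat \<Rightarrow> real"
  assumes m: "m > 0" and zero: "(\<Sum>i<m. G i) = 0" and c: "c > 0"
    and f: "\<And>x. x \<in> {0..1} \<Longrightarrow> \<bar>f x - x\<bar> \<le> \<bar>mass_upto (\<lambda>t. G (cell m t)) x\<bar> / c"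
    and w: "\<And>x. 0 \<le> w x" "\<And>x. w x \<le> B"
  shows "(\<integral>\<^sup>+x. ennreal (w x * (x - f x)\<^sup>2) \<partial>unit_interval) \<le> ennreal (B / c\<^sup>2 * ((\<Sum>a<m. (\<Sum>i<a. G i)\<^sup>2) / real m ^ 3))"
proof -
  define V where "V = mass_upto (\<lambda>t. G (cell m t))"
  \<comment> \<open>Clamping the argument gives a function that is continuous, hence Borel, on the
    whole line.\<close>
  define W where "W x = V (max 0 (min 1 x))" for x
  have cont: "continuous_on {0..1} V" unfolding V_def by (rule continuous_mass_upto_cell[OF m])
  have W: "continuous_on UNIV W"
    unfolding W_def by (rule continuous_on_compose2[OF cont]) (auto intro!: continuous_intros)
  have B: "0 \<le> B" using w[of 0] by linarith
  obtain b where b: "\<And>x. x \<in> {0..1} \<Longrightarrow> \<bar>V x\<bar> \<le> b"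
    using compact_imp_bounded[OF compact_continuous_image[OF cont]] by (force simp: bounded_iff)
  have "(\<integral>\<^sup>+x. ennreal (w x * (x - f x)\<^sup>2) \<partial>unit_interval) \<le> (\<integral>\<^sup>+x. ennreal (B / c\<^sup>2 * (W x)\<^sup>2) \<partial>unit_interval)"
  proof (rule nn_integral_mono_AE, use AE_unit_interval in eventually_elim)
    fix x :: real assume x: "0 < x \<and> x < 1"
    then have "\<bar>x - f x\<bar> \<le> \<bar>W x\<bar> / c" using f[of x] by (simp add: W_def V_def abs_minus_commute)
    then have "(x - f x)\<^sup>2 \<le> (\<bar>W x\<bar> / c)\<^sup>2" by (metis abs_ge_zero power2_abs power_mono)
    then have "w x * (x - f x)\<^sup>2 \<le> B * (\<bar>W x\<bar> / c)\<^sup>2" using w B by (intro mult_mono) auto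
    then show "ennreal (w x * (x - f x)\<^sup>2) \<le> ennreal (B / c\<^sup>2 * (W x)\<^sup>2)"
      by (intro ennreal_leI) (simp add: power_divide)
  qed
  also have "\<dots> = ennreal (integral {0..1} (\<lambda>x. B / c\<^sup>2 * (W x)\<^sup>2))"
  proof (rule nn_integral_unit_interval_le)
    show "(\<lambda>x. B / c\<^sup>2 * (W x)\<^sup>2) \<in> borel_measurable borel"
      by (intro borel_measurable_continuous_onI continuous_intros W)
    fix x :: real assume "x \<in> {0..1}"
    then have "\<bar>W x\<bar> \<le> b" using b by (auto simp: W_def)
    then have "(W x)\<^sup>2 \<le> b\<^sup>2" by (metis abs_ge_zero power2_abs power_mono)
    then show "B / c\<^sup>2 * (W x)\<^sup>2 \<le> B / c\<^sup>2 * b\<^sup>2" using B by (intro mult_left_mono) auto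
  qed (use B in auto)
  also have "integral {0..1} (\<lambda>x. B / c\<^sup>2 * (W x)\<^sup>2) = B / c\<^sup>2 * integral {0..1} (\<lambda>x. (W x)\<^sup>2)" by simp
  also have "integral {0..1} (\<lambda>x. (W x)\<^sup>2) = integral {0..1} (\<lambda>x. (V x)\<^sup>2)"
    by (intro Henstock_Kurzweil_Integration.integral_cong) (simp add: W_def)
  also have "ennreal (B / c\<^sup>2 * integral {0..1} (\<lambda>x. (V x)\<^sup>2)) \<le> ennreal (B / c\<^sup>2 * ((\<Sum>a<m. (\<Sum>i<a. G i)\<^sup>2) / real m ^ 3))"
    unfolding V_def using B by (intro ennreal_leI mult_left_mono integral_mass_upto_square_le m zero) auto
  finally show ?thesis .
qed

lemma nn_integral_unit_interval_cell:
  fixes G :: "nat \<Rightarrow> real"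
  assumes m: "m > 0" and G: "\<And>a. 0 \<le> G a"
  shows "(\<integral>\<^sup>+x. ennreal (G (cell m x)) \<partial>unit_interval) = ennreal ((\<Sum>a<m. G a) / real m)"
proof -
  obtain B where "\<And>t. \<bar>G (cell m t)\<bar> \<le> B" using cell_bounded[OF m, of G] by auto
  then show ?thesis
    using nn_integral_unit_interval_le[OF measurable_comp_cell, of G m B] G unit_interval_integral_cell[OF m, of G] by (auto simp: abs_le_iff)
qed

lemma monotone_rearrangement_unit_interval:
  fixes p q :: "real \<Rightarrow> real"
  assumes "p \<in> borel_measurable borel" "\<And>x. 0 \<le> p x" "\<And>x. p x \<le> B"
    and "q \<in> borel_measurable borel" "\<And>x. c \<le> q x" "\<And>x. q x \<le> B" "0 < c" "mass_upto p 1 = mass_upto q 1"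
  shows "\<exists>T. T \<in> borel_measurable borel \<and> (\<forall>x. T x \<in> {0..1}) \<and>
      distr (density unit_interval (\<lambda>x. ennreal (p x))) borel T = density unit_interval (\<lambda>x. ennreal (q x)) \<and>
      (\<forall>x\<in>{0..1}. \<bar>T x - x\<bar> \<le> \<bar>mass_upto p x - mass_upto q x\<bar> / c)"
  by (rule monotone_rearrangement[OF assms]) (auto simp: density_unit_interval assms)

lemma monotone_rearrangement_family:
  fixes p q :: "nat \<Rightarrow> real \<Rightarrow> real"
  assumes "\<And>b. p b \<in> borel_measurable borel" "\<And>b x. 0 \<le> p b x" "\<And>b x. p b x \<le> B"
    and "\<And>b. q b \<in> borel_measurable borel" "\<And>b x. c \<le> q b x" "\<And>b x. q b x \<le> B" "0 < c"
    and "\<And>b. mass_upto (p b) 1 = mass_upto (q b) 1"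
  obtains T where "\<And>b. T b \<in> borel_measurable borel" "\<And>b x. T b x \<in> {0..1}"
    "\<And>b. distr (density unit_interval (\<lambda>x. ennreal (p b x))) borel (T b) = density unit_interval (\<lambda>x. ennreal (q b x))"
    "\<And>b x. x \<in> {0..1} \<Longrightarrow> \<bar>T b x - x\<bar> \<le> \<bar>mass_upto (p b) x - mass_upto (q b) x\<bar> / c"
proof -
  have "\<forall>b. \<exists>T. T \<in> borel_measurable borel \<and> (\<forall>x. T x \<in> {0..1}) \<and>
      distr (density unit_interval (\<lambda>x. ennreal (p b x))) borel T = density unit_interval (\<lambda>x. ennreal (q b x)) \<and>
      (\<forall>x\<in>{0..1}. \<bar>T x - x\<bar> \<le> \<bar>mass_upto (p b) x - mass_upto (q b) x\<bar> / c)"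
    using assms by (intro allI monotone_rearrangement_unit_interval)
  from choice[OF this] show ?thesis using that by blast
qed

text \<open>The two monotone rearrangements move mass in orthogonal directions, so that their squared costs add up.\<close>

proposition cell_transport:
  fixes \<rho> \<sigma> :: "nat \<Rightarrow> nat \<Rightarrow> real"
  assumes m: "m > 0" and t: "0 \<le> t" "t < 1"
    and \<rho>: "\<And>a b. a < m \<Longrightarrow> b < m \<Longrightarrow> 0 \<le> \<rho> a b \<and> \<rho> a b \<le> 1 + t"
    and \<sigma>: "\<And>a b. a < m \<Longrightarrow> b < m \<Longrightarrow> 1 - t \<le> \<sigma> a b \<and> \<sigma> a b \<le> 1 + t"
    and rows: "\<And>b. b < m \<Longrightarrow> (\<Sum>a<m. \<rho> a b - \<sigma> a b) = 0"
    and cols: "\<And>a. a < m \<Longrightarrow> (\<Sum>b<m. \<sigma> a b - 1) = 0"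
  obtains T where "T \<in> unit_square_pair \<rightarrow>\<^sub>M unit_square_pair" "\<And>y. vec2 (T y) \<in> closure unit_square"
    "distr (density unit_square_pair (\<lambda>y. ennreal (\<rho> (cell m (fst y)) (cell m (snd y))))) unit_square_pair T = unit_square_pair"
    "(\<integral>\<^sup>+y. ennreal (\<rho> (cell m (fst y)) (cell m (snd y)) * (norm (vec2 y - vec2 (T y)))\<^sup>2) \<partial>unit_square_pair)
       \<le> ennreal ((1 + t) / (1 - t)\<^sup>2 * ((\<Sum>a<m. \<Sum>b<m. (\<Sum>i<a. \<rho> i b - \<sigma> i b)\<^sup>2 + (\<Sum>j<b. \<sigma> a j - 1)\<^sup>2) / real m ^ 4))"
proof -
  \<comment> \<open>The index is capped at \<open>m - 1\<close>, so that the bounds, known only for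
    cells, hold for every natural number, as the family of rearrangements requires.\<close>
  define p where "p b x = \<rho> (cell m x) (min b (m - 1))" for b x
  define q where "q b x = \<sigma> (cell m x) (min b (m - 1))" for b x
  define r where "r a x = \<sigma> (min a (m - 1)) (cell m x)" for a x
  have mm: "min b (m - 1) < m" for b using m by auto
  have pm [measurable]: "p b \<in> borel_measurable borel" and qm [measurable]: "q b \<in> borel_measurable borel"
    and rm [measurable]: "r b \<in> borel_measurable borel" for b
    unfolding p_def q_def r_def by (rule measurable_comp_cell)+
  have pb: "0 \<le> p b x" "p b x \<le> 1 + t" and qb: "1 - t \<le> q b x" "q b x \<le> 1 + t" and rb: "1 - t \<le> r b x" "r b x \<le> 1 + t" for b x
    using \<rho> \<sigma> mm cell_less[OF m] by (auto simp: p_def q_def r_def)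
  have t': "0 < 1 - t" using t by simp
  have "mass_upto (p b) 1 = mass_upto (q b) 1" for b
    using rows[OF mm[of b]] unit_interval_integral_cell[OF m, of "\<lambda>a. \<rho> a (min b (m - 1))"]
      unit_interval_integral_cell[OF m, of "\<lambda>a. \<sigma> a (min b (m - 1))"]
    by (simp add: p_def[abs_def] q_def[abs_def] sum_subtractf)
  from monotone_rearrangement_family[of p "1 + t" q, OF pm pb qm qb t' this] obtain \<tau> where \<tau>m [measurable]: "\<And>b. \<tau> b \<in> borel_measurable borel" and \<tau>01: "\<And>b x. \<tau> b x \<in> {0..1}"
    and \<tau>push: "\<And>b. distr (density unit_interval (\<lambda>x. ennreal (p b x))) borel (\<tau> b) = density unit_interval (\<lambda>x. ennreal (q b x))"
    and \<tau>d: "\<And>b x. x \<in> {0..1} \<Longrightarrow> \<bar>\<tau> b x - x\<bar> \<le> \<bar>mass_upto (p b) x - mass_upto (q b) x\<bar> / (1 - t)"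
    by auto
  have "mass_upto (r a) 1 = mass_upto (\<lambda>_. 1) 1" for a
  proof -
    have "(\<Sum>b<m. \<sigma> (min a (m - 1)) b) = real m" using cols[OF mm[of a]] by (simp add: sum_subtractf)
    then show ?thesis using m unit_interval_integral_cell[OF m, of "\<sigma> (min a (m - 1))"] by (simp add: r_def[abs_def])
  qed
  from monotone_rearrangement_family[of r "1 + t" "\<lambda>_ _. 1", OF rm order_trans[OF less_imp_le[OF t'] rb(1)] rb(2) _ _ _ t' this] t
  obtain \<upsilon> where \<upsilon>m [measurable]: "\<And>a. \<upsilon> a \<in> borel_measurable borel" and \<upsilon>01: "\<And>a x. \<upsilon> a x \<in> {0..1}"
    and \<upsilon>push: "\<And>a. distr (density unit_interval (\<lambda>x. ennreal (r a x))) borel (\<upsilon> a) = density unit_interval (\<lambda>x. ennreal 1)"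
    and \<upsilon>d: "\<And>a x. x \<in> {0..1} \<Longrightarrow> \<bar>\<upsilon> a x - x\<bar> \<le> \<bar>mass_upto (r a) x - mass_upto (\<lambda>_. 1) x\<bar> / (1 - t)"
    by auto
  define T1 where "T1 y = (\<tau> (cell m (snd y)) (fst y), snd y)" for y
  define T2 where "T2 y = (fst y, \<upsilon> (cell m (fst y)) (snd y))" for y
  note R = push_rows[of p q \<tau>, OF pm qm \<tau>m \<tau>push measurable_cell[of m], folded T1_def]
  note C = push_columns[of r "\<lambda>_ _. 1" \<upsilon>, OF rm _ \<upsilon>m \<upsilon>push measurable_cell[of m], folded T2_def, simplified]
  have pe: "p (cell m s) x = \<rho> (cell m x) (cell m s)" and qe: "q (cell m s) x = \<sigma> (cell m x) (cell m s)"
    and re: "r (cell m s) x = \<sigma> (cell m s) (cell m x)" for s x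
    using cell_less[OF m, of s] by (auto simp: p_def q_def r_def min_def)
  have T1m [measurable]: "T1 \<in> unit_square_pair \<rightarrow>\<^sub>M unit_square_pair" and T2m [measurable]: "T2 \<in> unit_square_pair \<rightarrow>\<^sub>M unit_square_pair"
    using R(2) C(2) by auto
  let ?\<rho> = "\<lambda>y. \<rho> (cell m (fst y)) (cell m (snd y))"
  let ?\<sigma> = "\<lambda>y. \<sigma> (cell m (fst y)) (cell m (snd y))"
  have push1: "distr (density unit_square_pair (\<lambda>y. ennreal (?\<rho> y))) unit_square_pair T1 = density unit_square_pair (\<lambda>y. ennreal (?\<sigma> y))"
    using R(1) by (simp add: pe qe)
  have push2: "distr (density unit_square_pair (\<lambda>y. ennreal (?\<sigma> y))) unit_square_pair T2 = unit_square_pair"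
    using C(1) by (simp add: re density_1)
  define c1 where "c1 y = (fst y - \<tau> (cell m (snd y)) (fst y))\<^sup>2" for y
  define c2 where "c2 y = (snd y - \<upsilon> (cell m (fst y)) (snd y))\<^sup>2" for y
  have "fst \<circ> T1 \<in> unit_square_pair \<rightarrow>\<^sub>M unit_interval" "snd \<circ> T2 \<in> unit_square_pair \<rightarrow>\<^sub>M unit_interval" by measurable
  then have [measurable]: "(\<lambda>y. \<tau> (cell m (snd y)) (fst y)) \<in> borel_measurable unit_square_pair"
    "(\<lambda>y. \<upsilon> (cell m (fst y)) (snd y)) \<in> borel_measurable unit_square_pair"
    by (simp_all add: T1_def T2_def comp_def measurable_cong_sets[OF refl sets_unit_interval])
  have c1m [measurable]: "c1 \<in> borel_measurable unit_square_pair" and c2m [measurable]: "c2 \<in> borel_measurable unit_square_pair"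
    unfolding c1_def c2_def by measurable
  have nonneg: "0 \<le> ?\<rho> y" "0 \<le> ?\<sigma> y" for y
    using \<rho> \<sigma> t cell_less[OF m] by (meson, smt (verit))
  define K where "K = (1 + t) / (1 - t)\<^sup>2"
  have K: "K \<ge> 0" using t by (simp add: K_def)
  define A where "A b = (\<Sum>a<m. (\<Sum>i<a. \<rho> i b - \<sigma> i b)\<^sup>2)" for b
  define A' where "A' a = (\<Sum>b<m. (\<Sum>j<b. \<sigma> a j - 1)\<^sup>2)" for a
  have A0: "0 \<le> A b" "0 \<le> A' b" for b by (auto simp: A_def A'_def sum_nonneg)
  have i1: "(\<integral>\<^sup>+y. ennreal (?\<rho> y * c1 y) \<partial>unit_square_pair) \<le> ennreal (K * ((\<Sum>b<m. A b) / real m ^ 4))"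
  proof -
    have "(\<integral>\<^sup>+y. ennreal (?\<rho> y * c1 y) \<partial>unit_square_pair) = (\<integral>\<^sup>+y2. \<integral>\<^sup>+y1. ennreal (?\<rho> (y1, y2) * c1 (y1, y2)) \<partial>unit_interval \<partial>unit_interval)"
      by (subst unit_square.nn_integral_snd[symmetric]) auto
    also have "\<dots> \<le> (\<integral>\<^sup>+y2. ennreal (K * (A (cell m y2) / real m ^ 3)) \<partial>unit_interval)"
    proof (rule nn_integral_mono)
      fix y2 :: real
      let ?b = "cell m y2"
      let ?G = "\<lambda>a. \<rho> a ?b - \<sigma> a ?b"
      have b: "?b < m" by (rule cell_less[OF m])
      have V: "mass_upto (p ?b) x - mass_upto (q ?b) x = mass_upto (\<lambda>t. ?G (cell m t)) x" for x
        unfolding pe[abs_def] qe[abs_def]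
        using integrable_on_cell[OF m, of "\<lambda>a. \<rho> a ?b" 0 x] integrable_on_cell[OF m, of "\<lambda>a. \<sigma> a ?b" 0 x]
        by (simp add: Henstock_Kurzweil_Integration.integral_diff)
      have "(\<integral>\<^sup>+y1. ennreal (\<rho> (cell m y1) ?b * (y1 - \<tau> ?b y1)\<^sup>2) \<partial>unit_interval)
          \<le> ennreal ((1 + t) / (1 - t)\<^sup>2 * ((\<Sum>a<m. (\<Sum>i<a. ?G i)\<^sup>2) / real m ^ 3))"
        using \<rho> b cell_less[OF m] \<tau>d[of _ ?b] unfolding V by (intro nn_integral_displacement_le m rows t') auto
      then show "(\<integral>\<^sup>+y1. ennreal (?\<rho> (y1, y2) * c1 (y1, y2)) \<partial>unit_interval) \<le> ennreal (K * (A ?b / real m ^ 3))"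
        by (simp add: c1_def K_def A_def)
    qed
    also have "\<dots> = ennreal ((\<Sum>b<m. K * (A b / real m ^ 3)) / real m)"
      using K A0 by (intro nn_integral_unit_interval_cell m) auto
    also have "(\<Sum>b<m. K * (A b / real m ^ 3)) / real m = K * ((\<Sum>b<m. A b) / real m ^ 4)"
      by (simp add: sum_distrib_left[symmetric] sum_divide_distrib[symmetric] eval_nat_numeral)
    finally show ?thesis .
  qed
  have i2: "(\<integral>\<^sup>+y. ennreal (?\<sigma> y * c2 y) \<partial>unit_square_pair) \<le> ennreal (K * ((\<Sum>a<m. A' a) / real m ^ 4))"
  proof -
    have "(\<integral>\<^sup>+y. ennreal (?\<sigma> y * c2 y) \<partial>unit_square_pair) = (\<integral>\<^sup>+y1. \<integral>\<^sup>+y2. ennreal (?\<sigma> (y1, y2) * c2 (y1, y2)) \<partial>unit_interval \<partial>unit_interval)"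
      by (subst unit_interval.nn_integral_fst[symmetric]) auto
    also have "\<dots> \<le> (\<integral>\<^sup>+y1. ennreal (K * (A' (cell m y1) / real m ^ 3)) \<partial>unit_interval)"
    proof (rule nn_integral_mono)
      fix y1 :: real
      let ?a = "cell m y1"
      let ?G = "\<lambda>b. \<sigma> ?a b - 1"
      have a: "?a < m" by (rule cell_less[OF m])
      have V: "mass_upto (r ?a) x - mass_upto (\<lambda>_. 1) x = mass_upto (\<lambda>t. ?G (cell m t)) x" for x
        unfolding re[abs_def]
        using integrable_on_cell[OF m, of "\<sigma> ?a" 0 x]
        by (subst Henstock_Kurzweil_Integration.integral_diff[symmetric]) auto
      have "(\<integral>\<^sup>+y2. ennreal (\<sigma> ?a (cell m y2) * (y2 - \<upsilon> ?a y2)\<^sup>2) \<partial>unit_interval)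
          \<le> ennreal ((1 + t) / (1 - t)\<^sup>2 * ((\<Sum>b<m. (\<Sum>j<b. ?G j)\<^sup>2) / real m ^ 3))"
        using \<sigma> a cell_less[OF m] nonneg(2)[of "(y1, _)"] \<upsilon>d[of _ ?a] unfolding V by (intro nn_integral_displacement_le m cols t') auto
      then show "(\<integral>\<^sup>+y2. ennreal (?\<sigma> (y1, y2) * c2 (y1, y2)) \<partial>unit_interval) \<le> ennreal (K * (A' ?a / real m ^ 3))"
        by (simp add: c2_def K_def A'_def)
    qed
    also have "\<dots> = ennreal ((\<Sum>b<m. K * (A' b / real m ^ 3)) / real m)"
      using K A0 by (intro nn_integral_unit_interval_cell m) auto
    also have "(\<Sum>b<m. K * (A' b / real m ^ 3)) / real m = K * ((\<Sum>b<m. A' b) / real m ^ 4)"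
      by (simp add: sum_distrib_left[symmetric] sum_divide_distrib[symmetric] eval_nat_numeral)
    finally show ?thesis .
  qed
  \<comment> \<open>The vertical displacement is evaluated after the horizontal map, which carries
    \<open>\<rho>\<close> to \<open>\<sigma>\<close>; a change of variables weighs it with
    \<open>\<sigma>\<close>.\<close>
  have i3: "(\<integral>\<^sup>+y. ennreal (?\<rho> y * c2 (T1 y)) \<partial>unit_square_pair) = (\<integral>\<^sup>+y. ennreal (?\<sigma> y * c2 y) \<partial>unit_square_pair)"
  proof -
    have "(\<integral>\<^sup>+y. ennreal (?\<rho> y * c2 (T1 y)) \<partial>unit_square_pair) = (\<integral>\<^sup>+y. ennreal (?\<rho> y) * ennreal (c2 (T1 y)) \<partial>unit_square_pair)"
      using nonneg by (simp add: ennreal_mult' )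
    also have "\<dots> = (\<integral>\<^sup>+y. ennreal (c2 (T1 y)) \<partial>density unit_square_pair (\<lambda>y. ennreal (?\<rho> y)))"
      by (rule nn_integral_density[symmetric]) measurable
    also have "\<dots> = (\<integral>\<^sup>+y. ennreal (c2 y) \<partial>density unit_square_pair (\<lambda>y. ennreal (?\<sigma> y)))"
      unfolding push1[symmetric] by (rule nn_integral_distr[symmetric]) measurable
    also have "\<dots> = (\<integral>\<^sup>+y. ennreal (?\<sigma> y) * ennreal (c2 y) \<partial>unit_square_pair)"
      by (rule nn_integral_density) measurable
    also have "\<dots> = (\<integral>\<^sup>+y. ennreal (?\<sigma> y * c2 y) \<partial>unit_square_pair)"
      using nonneg by (simp add: ennreal_mult')
    finally show ?thesis .
  qed
  have norm: "(norm (vec2 y - vec2 (T2 (T1 y))))\<^sup>2 = c1 y + c2 (T1 y)" for y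
    by (simp add: norm_vec2_diff T1_def T2_def c1_def c2_def)
  show ?thesis
  proof (rule that[of "T2 \<circ> T1"])
    show "T2 \<circ> T1 \<in> unit_square_pair \<rightarrow>\<^sub>M unit_square_pair" by measurable
    show "vec2 ((T2 \<circ> T1) y) \<in> closure unit_square" for y
      using \<tau>01[of "cell m (snd y)" "fst y"] \<upsilon>01[of "cell m (fst (T1 y))" "snd y"]
      by (simp add: closure_unit_square_iff T1_def T2_def)
    show "distr (density unit_square_pair (\<lambda>y. ennreal (?\<rho> y))) unit_square_pair (T2 \<circ> T1) = unit_square_pair"
      using push2 unfolding push1[symmetric] by (subst (asm) distr_distr) simp_all
    have "(\<integral>\<^sup>+y. ennreal (?\<rho> y * (norm (vec2 y - vec2 ((T2 \<circ> T1) y)))\<^sup>2) \<partial>unit_square_pair)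
       = (\<integral>\<^sup>+y. ennreal (?\<rho> y * c1 y) + ennreal (?\<rho> y * c2 (T1 y)) \<partial>unit_square_pair)"
      using nonneg by (intro nn_integral_cong) (simp add: norm distrib_left c1_def c2_def)
    also have "\<dots> = (\<integral>\<^sup>+y. ennreal (?\<rho> y * c1 y) \<partial>unit_square_pair) + (\<integral>\<^sup>+y. ennreal (?\<rho> y * c2 (T1 y)) \<partial>unit_square_pair)"
      by (rule nn_integral_add) measurable
    also have "\<dots> \<le> ennreal (K * ((\<Sum>b<m. A b) / real m ^ 4)) + ennreal (K * ((\<Sum>a<m. A' a) / real m ^ 4))"
      unfolding i3 by (intro add_mono i1 i2)
    also have "\<dots> = ennreal (K * ((\<Sum>b<m. A b) / real m ^ 4) + K * ((\<Sum>a<m. A' a) / real m ^ 4))"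
      using K A0 by (intro ennreal_plus[symmetric] mult_nonneg_nonneg divide_nonneg_nonneg sum_nonneg) auto
    also have "K * ((\<Sum>b<m. A b) / real m ^ 4) + K * ((\<Sum>a<m. A' a) / real m ^ 4) = K * (((\<Sum>b<m. A b) + (\<Sum>a<m. A' a)) / real m ^ 4)"
      by (simp add: add_divide_distrib distrib_left)
    also have "(\<Sum>b<m. A b) + (\<Sum>a<m. A' a) = (\<Sum>a<m. \<Sum>b<m. (\<Sum>i<a. \<rho> i b - \<sigma> i b)\<^sup>2 + (\<Sum>j<b. \<sigma> a j - 1)\<^sup>2)"
      unfolding A_def A'_def by (subst sum.swap) (simp add: sum.distrib)
    finally show "(\<integral>\<^sup>+y. ennreal (?\<rho> y * (norm (vec2 y - vec2 ((T2 \<circ> T1) y)))\<^sup>2) \<partial>unit_square_pair)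
       \<le> ennreal ((1 + t) / (1 - t)\<^sup>2 * ((\<Sum>a<m. \<Sum>b<m. (\<Sum>i<a. \<rho> i b - \<sigma> i b)\<^sup>2 + (\<Sum>j<b. \<sigma> a j - 1)\<^sup>2) / real m ^ 4))"
      by (simp add: K_def)
  qed
qed

section \<open>From the sample to the cell densities\<close>

text \<open>The common mass \<open>min (a i) (b i)\<close> stays in place; within each class the
  excess of \<open>a\<close> is distributed over the places where \<open>b\<close> is larger, in
  proportion to the deficits there. The mass that moves is the total excess, which the total
  variation dominates.\<close>

lemma partial_transport:
  fixes a b :: "'i \<Rightarrow> real" and par :: "'i \<Rightarrow> 'p"
  assumes fin: "finite I" and a: "\<And>i. i \<in> I \<Longrightarrow> 0 \<le> a i" and b: "\<And>i. i \<in> I \<Longrightarrow> 0 \<le> b i"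
    and eq: "\<And>i. i \<in> I \<Longrightarrow> (\<Sum>j\<in>{j\<in>I. par j = par i}. a j) = (\<Sum>j\<in>{j\<in>I. par j = par i}. b j)"
  obtains t where "\<And>i j. 0 \<le> t i j" "\<And>i j. par i \<noteq> par j \<Longrightarrow> t i j = 0"
    "\<And>i. i \<in> I \<Longrightarrow> (\<Sum>j\<in>I. t i j) = a i" "\<And>j. j \<in> I \<Longrightarrow> (\<Sum>i\<in>I. t i j) = b j"
    "(\<Sum>i\<in>I. \<Sum>j\<in>I - {i}. t i j) \<le> (\<Sum>i\<in>I. \<bar>a i - b i\<bar>)"
proof -
  define d where "d i = max (a i - b i) 0" for i
  define e where "e i = max (b i - a i) 0" for i
  define J where "J i = {j \<in> I. par j = par i}" for i
  define R where "R i = (\<Sum>j\<in>J i. d j)" for i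
  define t where "t i j = (if i = j then min (a i) (b i) else 0) + (if par i = par j then d i * e j / R i else 0)" for i j
  have finJ: "finite (J i)" for i using fin by (simp add: J_def)
  have de: "0 \<le> d i" "0 \<le> e i" for i by (auto simp: d_def e_def)
  have R0: "0 \<le> R i" for i unfolding R_def by (intro sum_nonneg de)
  have Re: "(\<Sum>j\<in>J i. e j) = R i" if "i \<in> I" for i
  proof -
    have "(\<Sum>j\<in>J i. d j - e j) = (\<Sum>j\<in>J i. a j - b j)" by (intro sum.cong refl) (auto simp: d_def e_def)
    also have "\<dots> = 0" using eq[OF that] by (simp add: sum_subtractf J_def)
    finally show ?thesis by (simp add: sum_subtractf R_def)
  qed
  \<comment> \<open>A class without excess has \<open>R i = 0\<close>, and the quotient is 0 by
    convention; the identity survives because then \<open>d i\<close> is 0 too.\<close>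
  have dR: "d i * (R i / R i) = d i" if "i \<in> I" for i
  proof (cases "R i = 0")
    case True
    then have "d i = 0" using that finJ de unfolding R_def by (subst (asm) sum_nonneg_eq_0_iff) (auto simp: J_def)
    then show ?thesis by simp
  qed simp
  have eR: "e i * (R i / R i) = e i" if "i \<in> I" for i
  proof (cases "R i = 0")
    case True
    then have "(\<Sum>j\<in>J i. e j) = 0" using Re[OF that] by simp
    then have "e i = 0" using that finJ de by (subst (asm) sum_nonneg_eq_0_iff) (auto simp: J_def)
    then show ?thesis by simp
  qed simp
  have Rc: "R i = R j" if "par i = par j" for i j using that by (simp add: R_def J_def)
  have split: "(\<Sum>j\<in>I. if par i = par j then f j else 0) = (\<Sum>j\<in>J i. f j)" for i and f :: "'i \<Rightarrow> real"
    unfolding J_def using fin by (simp add: sum.inter_filter) (metis (no_types, lifting))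
  have row: "(\<Sum>j\<in>I. t i j) = a i" if i: "i \<in> I" for i
  proof -
    have "(\<Sum>j\<in>I. t i j) = min (a i) (b i) + (\<Sum>j\<in>J i. d i * e j / R i)"
      unfolding t_def sum.distrib split using i fin by simp
    also have "(\<Sum>j\<in>J i. d i * e j / R i) = d i * (R i / R i)"
      using Re[OF i] by (simp add: sum_divide_distrib[symmetric] sum_distrib_left[symmetric])
    finally have "(\<Sum>j\<in>I. t i j) = min (a i) (b i) + d i" unfolding dR[OF i] .
    then show ?thesis by (simp add: d_def)
  qed
  have col: "(\<Sum>i\<in>I. t i j) = b j" if j: "j \<in> I" for j
  proof -
    have "(\<Sum>i\<in>I. t i j) = (\<Sum>i\<in>I. (if j = i then min (a i) (b i) else 0) + (if par j = par i then d i * e j / R j else 0))"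
    proof (rule sum.cong[OF refl])
      fix i show "t i j = (if j = i then min (a i) (b i) else 0) + (if par j = par i then d i * e j / R j else 0)"
        using Rc[of i j] by (cases "par i = par j") (auto simp: t_def)
    qed
    also have "\<dots> = min (a j) (b j) + (\<Sum>i\<in>J j. d i * e j / R j)"
      unfolding sum.distrib split using j fin by simp
    also have "(\<Sum>i\<in>J j. d i * e j / R j) = e j * (R j / R j)"
      by (simp add: R_def sum_divide_distrib[symmetric] sum_distrib_right[symmetric] mult.commute)
    finally have "(\<Sum>i\<in>I. t i j) = min (a j) (b j) + e j" unfolding eR[OF j] .
    then show ?thesis by (simp add: e_def)
  qed
  have off: "(\<Sum>i\<in>I. \<Sum>j\<in>I - {i}. t i j) \<le> (\<Sum>i\<in>I. \<bar>a i - b i\<bar>)"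
  proof (rule sum_mono)
    fix i assume i: "i \<in> I"
    have "(\<Sum>j\<in>I - {i}. t i j) = (\<Sum>j\<in>I - {i}. if par i = par j then d i * e j / R i else 0)"
      by (intro sum.cong refl) (auto simp: t_def)
    also have "\<dots> \<le> (\<Sum>j\<in>I. if par i = par j then d i * e j / R i else 0)"
      using fin de R0 by (intro sum_mono2) auto
    also have "\<dots> = d i * (R i / R i)"
      unfolding split using Re[OF i] by (simp add: sum_divide_distrib[symmetric] sum_distrib_left[symmetric])
    also have "\<dots> \<le> \<bar>a i - b i\<bar>" unfolding dR[OF i] by (simp add: d_def)
    finally show "(\<Sum>j\<in>I - {i}. t i j) \<le> \<bar>a i - b i\<bar>" .
  qed
  \<comment> \<open>Truncated outside \<open>I\<close>, so that sign and support hold for all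
    indices.\<close>
  define t' where "t' i j = (if i \<in> I \<and> j \<in> I then t i j else 0)" for i j
  have t': "t' i j = t i j" if "i \<in> I" "j \<in> I" for i j using that by (simp add: t'_def)
  show ?thesis
  proof (rule that[of t'])
    show "0 \<le> t' i j" for i j using a b de R0 by (auto simp: t_def t'_def)
    show "t' i j = 0" if "par i \<noteq> par j" for i j using that by (auto simp: t_def t'_def)
    show "(\<Sum>j\<in>I. t' i j) = a i" if "i \<in> I" for i using row[OF that] that by (simp add: t' cong: sum.cong)
    show "(\<Sum>i\<in>I. t' i j) = b j" if "j \<in> I" for j using col[OF that] that by (simp add: t' cong: sum.cong)
    show "(\<Sum>i\<in>I. \<Sum>j\<in>I - {i}. t' i j) \<le> (\<Sum>i\<in>I. \<bar>a i - b i\<bar>)"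
    proof -
      have "(\<Sum>i\<in>I. \<Sum>j\<in>I - {i}. t' i j) = (\<Sum>i\<in>I. \<Sum>j\<in>I - {i}. t i j)"
        by (intro sum.cong refl t') auto
      then show ?thesis using off by simp
    qed
  qed
qed

lemma nn_integral_cell_cell:
  fixes F :: "nat \<Rightarrow> nat \<Rightarrow> real"
  assumes m: "m > 0" and F: "\<And>a b. 0 \<le> F a b"
  shows "(\<integral>\<^sup>+y. ennreal (F (cell m (fst y)) (cell m (snd y))) \<partial>unit_square_pair) = ennreal ((\<Sum>a<m. \<Sum>b<m. F a b) / (real m)\<^sup>2)"
proof -
  have "(\<integral>\<^sup>+y. ennreal (F (cell m (fst y)) (cell m (snd y))) \<partial>unit_square_pair) =
     (\<integral>\<^sup>+y1. \<integral>\<^sup>+y2. ennreal (F (cell m y1) (cell m y2)) \<partial>unit_interval \<partial>unit_interval)"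
    by (subst unit_interval.nn_integral_fst[symmetric]) auto
  also have "\<dots> = (\<integral>\<^sup>+y1. ennreal ((\<lambda>a. (\<Sum>b<m. F a b) / real m) (cell m y1)) \<partial>unit_interval)"
    by (intro nn_integral_cong) (use F in \<open>simp add: nn_integral_unit_interval_cell[OF m]\<close>)
  also have "\<dots> = ennreal ((\<Sum>a<m. (\<Sum>b<m. F a b) / real m) / real m)"
    using F by (intro nn_integral_unit_interval_cell[OF m]) (auto intro!: divide_nonneg_nonneg sum_nonneg)
  finally show ?thesis by (simp add: sum_divide_distrib[symmetric] power2_eq_square)
qed

lemma cell_dist:
  assumes "m > 0" "s \<in> {0..1}" "t \<in> {0..1}" "cell m s = cell m t"
  shows "(s - t)\<^sup>2 \<le> 1 / (real m)\<^sup>2"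
proof -
  have "\<bar>real m * s - real m * t\<bar> \<le> 1"
    using cell_bounds[of m s] cell_bounds[of m t] assms by (auto simp: abs_le_iff)
  then have "\<bar>s - t\<bar> \<le> 1 / real m"
  proof -
    have "real m * \<bar>s - t\<bar> = \<bar>real m * s - real m * t\<bar>" by (simp add: right_diff_distrib[symmetric] abs_mult)
    then show ?thesis using \<open>\<bar>real m * s - real m * t\<bar> \<le> 1\<close> assms(1) by (simp add: le_divide_eq mult.commute)
  qed
  then have "\<bar>s - t\<bar>\<^sup>2 \<le> (1 / real m)\<^sup>2" by (intro power_mono) auto
  then show ?thesis by (simp add: power_divide)
qed

lemma same_cell_dist:
  assumes "m > 0" "x \<in> closure unit_square" "y \<in> closure unit_square" "cell m (x $ 1) = cell m (y $ 1)" "cell m (x $ 2) = cell m (y $ 2)"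
  shows "(norm (x - y))\<^sup>2 \<le> 2 / (real m)\<^sup>2"
  using cell_dist[of m "x $ 1" "y $ 1"] cell_dist[of m "x $ 2" "y $ 2"] assms
  by (simp add: norm_vec2_diff closure_unit_square_iff)

definition cell_freq :: "nat \<Rightarrow> (nat \<Rightarrow> real^2) \<Rightarrow> nat \<Rightarrow> nat \<Rightarrow> nat \<Rightarrow> real" where
  "cell_freq n x m a b = (\<Sum>i=1..n. of_bool (cell m (x i $ 1) = a \<and> cell m (x i $ 2) = b)) / real n"

lemma cell_freq_nonneg: "0 \<le> cell_freq n x m a b"
  by (simp add: cell_freq_def sum_nonneg)

lemma sum_cell_freq_children:
  assumes "m > 0" "k > 0"
  shows "(\<Sum>q\<in>{q \<in> {..<m*k} \<times> {..<m*k}. fst q div k = A \<and> snd q div k = B}. cell_freq n x (m * k) (fst q) (snd q)) = cell_freq n x m A B"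
proof -
  let ?J = "{q \<in> {..<m*k} \<times> {..<m*k}. fst q div k = A \<and> snd q div k = B}"
  have fin: "finite ?J" by (rule finite_subset[of _ "{..<m*k} \<times> {..<m*k}"]) auto
  have "(\<Sum>q\<in>?J. of_bool (cell (m*k) (x i $ 1) = fst q \<and> cell (m*k) (x i $ 2) = snd q)) =
    (of_bool (cell m (x i $ 1) = A \<and> cell m (x i $ 2) = B) :: real)" for i
  proof -
    let ?q = "(cell (m*k) (x i $ 1), cell (m*k) (x i $ 2))"
    have "(\<Sum>q\<in>?J. of_bool (cell (m*k) (x i $ 1) = fst q \<and> cell (m*k) (x i $ 2) = snd q)) = (\<Sum>q\<in>?J. if ?q = q then 1 else (0::real))"
      by (intro sum.cong refl) (auto simp: prod_eq_iff)
    also have "\<dots> = of_bool (?q \<in> ?J)" using fin by simp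
    also have "?q \<in> ?J \<longleftrightarrow> cell m (x i $ 1) = A \<and> cell m (x i $ 2) = B"
      using cell_less[of "m * k"] assms by (simp add: cell_refine)
    finally show ?thesis .
  qed
  then show ?thesis
    unfolding cell_freq_def sum_divide_distrib[symmetric] by (subst sum.swap) simp
qed

lemma card_children:
  assumes "A < m" "B < m"
  shows "card {q \<in> {..<m*k} \<times> {..<m*k}. fst q div k = A \<and> snd q div k = B} = k\<^sup>2"
proof (cases "k = 0")
  case False
  have "c < m * k \<and> c div k = A \<longleftrightarrow> c \<in> {A * k..<A * k + k}" if "A < m" for c A
  proof -
    have "c div k = A \<longleftrightarrow> A * k \<le> c \<and> c < A * k + k"
      using False by (metis add.commute div_nat_eqI dividend_less_times_div div_times_less_eq_dividend mult.commute mult_Suc_right neq0_conv)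
    moreover have "A * k + k \<le> m * k" using that by (metis add.commute mult_Suc mult_le_mono1 Suc_leI)
    ultimately show ?thesis by auto
  qed
  then have "{c. c < m * k \<and> c div k = A} = {A * k..<A * k + k}" if "A < m" for A using that by blast
  moreover have "{q \<in> {..<m*k} \<times> {..<m*k}. fst q div k = A \<and> snd q div k = B} = {c. c < m * k \<and> c div k = A} \<times> {c. c < m * k \<and> c div k = B}"
    by auto
  ultimately show ?thesis using assms by (simp add: power2_eq_square)
qed simp

lemma sum_over_sample_cells:
  fixes f :: "nat \<times> nat \<Rightarrow> real"
  assumes "r > 0"
  shows "(\<Sum>i=1..n. f (cell r (x i $ 1), cell r (x i $ 2))) / real n = (\<Sum>q\<in>{..<r} \<times> {..<r}. cell_freq n x r (fst q) (snd q) * f q)"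
proof -
  let ?q = "\<lambda>i. (cell r (x i $ 1), cell r (x i $ 2))"
  have "f (?q i) = (\<Sum>q\<in>{..<r} \<times> {..<r}. of_bool (cell r (x i $ 1) = fst q \<and> cell r (x i $ 2) = snd q) * f q)" for i
  proof -
    have "(\<Sum>q\<in>{..<r} \<times> {..<r}. of_bool (cell r (x i $ 1) = fst q \<and> cell r (x i $ 2) = snd q) * f q) = (\<Sum>q\<in>{..<r} \<times> {..<r}. if ?q i = q then f q else 0)"
      by (intro sum.cong refl) (auto simp: prod_eq_iff)
    then show ?thesis using cell_less[OF assms] by simp
  qed
  then have "(\<Sum>i=1..n. f (?q i)) = (\<Sum>i=1..n. \<Sum>q\<in>{..<r} \<times> {..<r}. of_bool (cell r (x i $ 1) = fst q \<and> cell r (x i $ 2) = snd q) * f q)"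
    by simp
  also have "\<dots> = (\<Sum>q\<in>{..<r} \<times> {..<r}. \<Sum>i=1..n. of_bool (cell r (x i $ 1) = fst q \<and> cell r (x i $ 2) = snd q) * f q)"
    by (rule sum.swap)
  finally show ?thesis
    by (simp add: cell_freq_def sum_divide_distrib sum_distrib_right)
qed

lemma nn_integral_cell_cell_bounded:
  fixes F :: "nat \<Rightarrow> nat \<Rightarrow> real"
  assumes m: "m > 0" and F: "\<And>a b. 0 \<le> F a b"
    and G: "\<And>y. vec2 y \<in> unit_square \<Longrightarrow> G y \<le> F (cell m (fst y)) (cell m (snd y))"
  shows "(\<integral>\<^sup>+y. ennreal (G y) \<partial>unit_square_pair) \<le> ennreal ((\<Sum>a<m. \<Sum>b<m. F a b) / (real m)\<^sup>2)"
  unfolding nn_integral_cell_cell[OF m F, symmetric]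
  by (rule nn_integral_mono_AE, use AE_unit_square_pair in eventually_elim) (intro ennreal_leI G)

text \<open>Two scales. A point spreads its mass uniformly over fine cells of its own coarse cell,
  following a plan that turns the fine frequencies into equal shares of the coarse one. Mass that
  stays in its fine cell travels at most the diameter of a fine cell; the rest, controlled by the
  mismatch of the frequencies, travels at most the diameter of a coarse one.\<close>

proposition empirical_to_cells:
  fixes x :: "nat \<Rightarrow> real^2"
  assumes n: "n > 0" and m: "m > 0" and k: "k > 0" and x: "\<And>i. i \<in> {1..n} \<Longrightarrow> x i \<in> unit_square"
  defines "r \<equiv> m * k"
  obtains h where "\<And>i. h i \<in> borel_measurable unit_square_pair" "\<And>i y. 0 \<le> h i y"
    "\<And>i. i \<in> {1..n} \<Longrightarrow> (\<integral>\<^sup>+y. ennreal (h i y) \<partial>unit_square_pair) = 1"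
    "\<And>y. (\<Sum>i=1..n. h i y) / real n = (real m)\<^sup>2 * cell_freq n x m (cell m (fst y)) (cell m (snd y))"
    "(\<Sum>i=1..n. \<integral>\<^sup>+y. ennreal (h i y / real n * (norm (x i - vec2 y))\<^sup>2) \<partial>unit_square_pair)
      \<le> ennreal (2 / (real r)\<^sup>2 + 2 / (real m)\<^sup>2 * (\<Sum>c<r. \<Sum>d<r. \<bar>cell_freq n x r c d - cell_freq n x m (c div k) (d div k) / (real k)\<^sup>2\<bar>))"
proof -
  define I where "I = {..<r} \<times> {..<r}"
  define par where "par q = (fst q div k, snd q div k)" for q :: "nat \<times> nat"
  define a where "a q = cell_freq n x r (fst q) (snd q)" for q
  define b where "b q = cell_freq n x m (fst q div k) (snd q div k) / (real k)\<^sup>2" for q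
  have r: "r > 0" using m k by (simp add: r_def)
  have finI: "finite I" by (simp add: I_def)
  have a0: "0 \<le> a q" and b0: "0 \<le> b q" for q by (auto simp: a_def b_def cell_freq_nonneg)
  have eq: "(\<Sum>j\<in>{j\<in>I. par j = par i}. a j) = (\<Sum>j\<in>{j\<in>I. par j = par i}. b j)" if i: "i \<in> I" for i
  proof -
    have J: "{j\<in>I. par j = par i} = {q \<in> {..<m*k} \<times> {..<m*k}. fst q div k = fst (par i) \<and> snd q div k = snd (par i)}"
      by (auto simp: I_def par_def r_def)
    have lt: "fst (par i) < m" "snd (par i) < m" using i k by (auto simp: I_def par_def r_def less_mult_imp_div_less)
    have "(\<Sum>j\<in>{j\<in>I. par j = par i}. b j) = (\<Sum>j\<in>{j\<in>I. par j = par i}. cell_freq n x m (fst (par i)) (snd (par i)) / (real k)\<^sup>2)"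
      by (intro sum.cong refl) (auto simp: b_def par_def)
    also have "\<dots> = cell_freq n x m (fst (par i)) (snd (par i))"
      using card_children[OF lt, of k] k unfolding J by simp
    also have "\<dots> = (\<Sum>j\<in>{j\<in>I. par j = par i}. a j)"
      unfolding J a_def r_def using sum_cell_freq_children[OF m k] by simp
    finally show ?thesis by simp
  qed
  obtain t where t0: "\<And>i j. 0 \<le> t i j" and tpar: "\<And>i j. par i \<noteq> par j \<Longrightarrow> t i j = 0"
    and trow: "\<And>i. i \<in> I \<Longrightarrow> (\<Sum>j\<in>I. t i j) = a i" and tcol: "\<And>j. j \<in> I \<Longrightarrow> (\<Sum>i\<in>I. t i j) = b j"
    and toff: "(\<Sum>i\<in>I. \<Sum>j\<in>I - {i}. t i j) \<le> (\<Sum>i\<in>I. \<bar>a i - b i\<bar>)"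
    by (rule partial_transport[of I a b par]) (use finI a0 b0 eq in \<open>blast+\<close>)
  define q where "q i = (cell r (x i $ 1), cell r (x i $ 2))" for i
  define Q where "Q y = (cell r (fst y), cell r (snd y))" for y :: "real \<times> real"
  have qI: "q i \<in> I" and QI: "Q y \<in> I" for i y using cell_less[OF r] by (auto simp: q_def Q_def I_def)
  have apos: "a (q i) > 0" if i: "i \<in> {1..n}" for i
  proof -
    have "(1::real) \<le> (\<Sum>j=1..n. of_bool (cell r (x j $ 1) = fst (q i) \<and> cell r (x j $ 2) = snd (q i)))"
      using member_le_sum[of i "{1..n}" "\<lambda>j. of_bool (cell r (x j $ 1) = fst (q i) \<and> cell r (x j $ 2) = snd (q i)) :: real"] i
      by (simp add: q_def)
    then show ?thesis using n by (simp add: a_def cell_freq_def divide_pos_pos)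
  qed
  \<comment> \<open>The density of the mass of the \<open>i\<close>-th point on the fine cell
    \<open>q'\<close>. The points in a fine cell share its plan equally, and
    \<open>r\<^sup>2\<close> is the inverse area of the cell; \<open>a (q i)\<close> is positive
    because the cell contains that point.\<close>
  define F where "F i q' = (real r)\<^sup>2 * (t (q i) q' / a (q i))" for i q'
  define h where "h i y = F i (Q y)" for i y
  have F0: "0 \<le> F i q'" for i q' using t0 a0 by (simp add: F_def)
  have hm: "h i \<in> borel_measurable unit_square_pair" for i
    using measurable_cell_cell[of "\<lambda>c d. F i (c, d)" r] by (simp add: h_def[abs_def] Q_def)
  have sumI: "(\<Sum>c<r. \<Sum>d<r. f (c, d)) = (\<Sum>q\<in>I. f q)" for f :: "nat \<times> nat \<Rightarrow> real"
    by (simp add: I_def sum.cartesian_product)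
  have h1: "(\<integral>\<^sup>+y. ennreal (h i y) \<partial>unit_square_pair) = 1" if i: "i \<in> {1..n}" for i
  proof -
    have "(\<integral>\<^sup>+y. ennreal (h i y) \<partial>unit_square_pair) = ennreal ((\<Sum>c<r. \<Sum>d<r. F i (c, d)) / (real r)\<^sup>2)"
      using nn_integral_cell_cell[OF r, of "\<lambda>c d. F i (c, d)"] F0 by (simp add: h_def Q_def)
    also have "(\<Sum>c<r. \<Sum>d<r. F i (c, d)) / (real r)\<^sup>2 = 1"
      using trow[OF qI, of i] apos[OF i] r unfolding sumI by (simp add: F_def sum_distrib_left[symmetric] sum_divide_distrib[symmetric])
    finally show ?thesis by simp
  qed
  have at: "a p * (t p q' / a p) = t p q'" if "p \<in> I" "q' \<in> I" for p q'
  proof (cases "a p = 0")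
    case True
    then have "t p q' = 0" using trow[OF that(1)] t0 that(2) finI by (simp add: sum_nonneg_eq_0_iff)
    then show ?thesis by simp
  qed simp
  have dens: "(\<Sum>i=1..n. h i y) / real n = (real m)\<^sup>2 * cell_freq n x m (cell m (fst y)) (cell m (snd y))" for y
  proof -
    have "(\<Sum>i=1..n. h i y) / real n = (\<Sum>p\<in>I. a p * ((real r)\<^sup>2 * (t p (Q y) / a p)))"
      unfolding h_def F_def q_def I_def a_def by (rule sum_over_sample_cells[OF r])
    also have "\<dots> = (\<Sum>p\<in>I. (real r)\<^sup>2 * t p (Q y))"
      using at[OF _ QI] by (intro sum.cong refl) (metis mult.left_commute)
    also have "\<dots> = (real r)\<^sup>2 * b (Q y)" by (simp add: sum_distrib_left[symmetric] tcol[OF QI])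
    also have "\<dots> = (real m)\<^sup>2 * cell_freq n x m (cell m (fst y)) (cell m (snd y))"
      using k m by (simp add: b_def Q_def r_def cell_refine power_mult_distrib)
    finally show ?thesis .
  qed
  define c where "c p q' = (if p = q' then 2 / (real r)\<^sup>2 else 2 / (real m)\<^sup>2)" for p q' :: "nat \<times> nat"
  have c0: "0 \<le> c p q'" for p q' by (simp add: c_def)
  have one: "(\<integral>\<^sup>+y. ennreal (h i y / real n * (norm (x i - vec2 y))\<^sup>2) \<partial>unit_square_pair)
      \<le> ennreal ((\<Sum>q'\<in>I. t (q i) q' / a (q i) * c (q i) q') / real n)" if i: "i \<in> {1..n}" for i
  proof -
    have "(\<integral>\<^sup>+y. ennreal (h i y / real n * (norm (x i - vec2 y))\<^sup>2) \<partial>unit_square_pair)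
      \<le> ennreal ((\<Sum>c'<r. \<Sum>d<r. F i (c', d) / real n * c (q i) (c', d)) / (real r)\<^sup>2)"
    proof (rule nn_integral_cell_cell_bounded[OF r])
      show "0 \<le> F i (c', d) / real n * c (q i) (c', d)" for c' d using F0 c0 by simp
      fix y assume y: "vec2 y \<in> unit_square"
      have cl: "x i \<in> closure unit_square" "vec2 y \<in> closure unit_square" using x[OF i] y closure_subset by auto
      have "F i (Q y) * (norm (x i - vec2 y))\<^sup>2 \<le> F i (Q y) * c (q i) (Q y)"
      proof (cases "par (q i) = par (Q y)")
        case False
        then show ?thesis using tpar by (simp add: F_def)
      next
        case True
        then have "(norm (x i - vec2 y))\<^sup>2 \<le> 2 / (real m)\<^sup>2"
          using same_cell_dist[OF m cl] m k by (simp add: par_def q_def Q_def r_def cell_refine)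
        moreover have "(norm (x i - vec2 y))\<^sup>2 \<le> 2 / (real r)\<^sup>2" if "q i = Q y"
          using same_cell_dist[OF r cl] that by (simp add: q_def Q_def)
        ultimately show ?thesis using F0 by (intro mult_left_mono) (auto simp: c_def)
      qed
      then show "h i y / real n * (norm (x i - vec2 y))\<^sup>2 \<le> F i (cell r (fst y), cell r (snd y)) / real n * c (q i) (cell r (fst y), cell r (snd y))"
        by (simp add: h_def Q_def divide_right_mono)
    qed
    also have "(\<Sum>c'<r. \<Sum>d<r. F i (c', d) / real n * c (q i) (c', d)) / (real r)\<^sup>2 = (\<Sum>q'\<in>I. t (q i) q' / a (q i) * c (q i) q') / real n"
      unfolding sumI[of "\<lambda>p. F i p / real n * c (q i) p"] sum_divide_distrib using r by (intro sum.cong refl) (simp add: F_def)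
    finally show ?thesis .
  qed
  have "(\<Sum>i=1..n. \<integral>\<^sup>+y. ennreal (h i y / real n * (norm (x i - vec2 y))\<^sup>2) \<partial>unit_square_pair)
      \<le> (\<Sum>i=1..n. ennreal ((\<Sum>q'\<in>I. t (q i) q' / a (q i) * c (q i) q') / real n))" by (intro sum_mono one)
  also have "\<dots> = ennreal (\<Sum>i=1..n. (\<Sum>q'\<in>I. t (q i) q' / a (q i) * c (q i) q') / real n)"
    by (intro sum_ennreal divide_nonneg_nonneg sum_nonneg mult_nonneg_nonneg t0 a0 c0 of_nat_0_le_iff)
  finally have le: "(\<Sum>i=1..n. \<integral>\<^sup>+y. ennreal (h i y / real n * (norm (x i - vec2 y))\<^sup>2) \<partial>unit_square_pair)
      \<le> ennreal (\<Sum>i=1..n. (\<Sum>q'\<in>I. t (q i) q' / a (q i) * c (q i) q') / real n)" .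
  have "(\<Sum>i=1..n. (\<Sum>q'\<in>I. t (q i) q' / a (q i) * c (q i) q') / real n) = (\<Sum>p\<in>I. a p * (\<Sum>q'\<in>I. t p q' / a p * c p q'))"
    using sum_over_sample_cells[OF r, of "\<lambda>p. \<Sum>q'\<in>I. t p q' / a p * c p q'" x n]
    by (simp only: q_def[symmetric] I_def[symmetric] a_def[symmetric] sum_divide_distrib[of _ "{1..n}"])
  also have "\<dots> = (\<Sum>p\<in>I. \<Sum>q'\<in>I. t p q' * c p q')"
  proof (rule sum.cong[OF refl])
    fix p assume p: "p \<in> I"
    have "a p * (\<Sum>q'\<in>I. t p q' / a p * c p q') = (\<Sum>q'\<in>I. (a p * (t p q' / a p)) * c p q')"
      by (simp only: sum_distrib_left mult.assoc)
    also have "\<dots> = (\<Sum>q'\<in>I. t p q' * c p q')" by (intro sum.cong refl) (simp only: at[OF p])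
    finally show "a p * (\<Sum>q'\<in>I. t p q' / a p * c p q') = (\<Sum>q'\<in>I. t p q' * c p q')" .
  qed
  also have "\<dots> = (\<Sum>p\<in>I. t p p * (2 / (real r)\<^sup>2) + (\<Sum>q'\<in>I - {p}. t p q' * (2 / (real m)\<^sup>2)))"
  proof (rule sum.cong[OF refl])
    fix p assume p: "p \<in> I"
    show "(\<Sum>q'\<in>I. t p q' * c p q') = t p p * (2 / (real r)\<^sup>2) + (\<Sum>q'\<in>I - {p}. t p q' * (2 / (real m)\<^sup>2))"
    proof -
      have "(\<Sum>q'\<in>I - {p}. t p q' * c p q') = (\<Sum>q'\<in>I - {p}. t p q' * (2 / (real m)\<^sup>2))"
        by (rule sum.cong) (auto simp: c_def)
      then show ?thesis using sum.remove[OF finI p, of "\<lambda>q'. t p q' * c p q'"] by (simp add: c_def)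
    qed
  qed
  also have "\<dots> = (\<Sum>p\<in>I. t p p) * (2 / (real r)\<^sup>2) + (2 / (real m)\<^sup>2) * (\<Sum>p\<in>I. \<Sum>q'\<in>I - {p}. t p q')"
    by (simp only: sum.distrib sum_distrib_right[symmetric] mult.commute[of "2 / (real m)\<^sup>2"])
  also have "\<dots> \<le> 1 * (2 / (real r)\<^sup>2) + (2 / (real m)\<^sup>2) * (\<Sum>p\<in>I. \<bar>a p - b p\<bar>)"
  proof (intro add_mono mult_right_mono mult_left_mono toff)
    have "(\<Sum>p\<in>I. t p p) \<le> (\<Sum>p\<in>I. a p)"
    proof (rule sum_mono)
      fix p assume p: "p \<in> I"
      show "t p p \<le> a p" unfolding trow[OF p, symmetric] by (rule member_le_sum[OF p t0 finI])
    qed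
    also have "\<dots> = 1"
      using sum_over_sample_cells[OF r, where f = "\<lambda>_. 1" and n = n and x = x] n by (simp add: a_def I_def)
    finally show "(\<Sum>p\<in>I. t p p) \<le> 1" .
  qed auto
  also have "(\<Sum>p\<in>I. \<bar>a p - b p\<bar>) = (\<Sum>c<r. \<Sum>d<r. \<bar>cell_freq n x r c d - cell_freq n x m (c div k) (d div k) / (real k)\<^sup>2\<bar>)"
    unfolding sumI[of "\<lambda>p. \<bar>a p - b p\<bar>", symmetric] by (simp add: a_def b_def)
  finally have "(\<Sum>i=1..n. (\<Sum>q'\<in>I. t (q i) q' / a (q i) * c (q i) q') / real n)
      \<le> 2 / (real r)\<^sup>2 + 2 / (real m)\<^sup>2 * (\<Sum>c<r. \<Sum>d<r. \<bar>cell_freq n x r c d - cell_freq n x m (c div k) (d div k) / (real k)\<^sup>2\<bar>)"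
    by simp
  note cost = order_trans[OF le ennreal_leI[OF this]]
  show ?thesis
  proof (rule that[of h])
    show "0 \<le> h i y" for i y unfolding h_def by (rule F0)
  qed (fact hm h1 dens cost)+
qed

lemma ennreal_mult_add:
  "0 \<le> a \<Longrightarrow> 0 \<le> b \<Longrightarrow> 0 \<le> c \<Longrightarrow> 0 \<le> d \<Longrightarrow> ennreal a * ennreal b + ennreal c * ennreal d = ennreal (a * b + c * d)"
  by (simp add: ennreal_mult ennreal_plus)

text \<open>Spreading is followed by the transport of cell densities. Young's inequality charges the
  factor \<open>1 + 1 / \<eta>\<close> to the spreading, which is of lower order, and only
  \<open>1 + \<eta>\<close> to the main term.\<close>

proposition square_cost_upper:
  fixes x :: "nat \<Rightarrow> real^2" and \<sigma> :: "nat \<Rightarrow> nat \<Rightarrow> real"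
  assumes n: "n > 0" and m: "m > 0" and k: "k > 0" and x: "\<And>i. i \<in> {1..n} \<Longrightarrow> x i \<in> unit_square"
    and t: "0 \<le> t" "t < 1" and \<eta>: "\<eta> > 0"
  defines "\<rho> \<equiv> \<lambda>a b. (real m)\<^sup>2 * cell_freq n x m a b"
  assumes \<rho>: "\<And>a b. a < m \<Longrightarrow> b < m \<Longrightarrow> \<rho> a b \<le> 1 + t"
    and \<sigma>: "\<And>a b. a < m \<Longrightarrow> b < m \<Longrightarrow> 1 - t \<le> \<sigma> a b \<and> \<sigma> a b \<le> 1 + t"
    and rows: "\<And>b. b < m \<Longrightarrow> (\<Sum>a<m. \<rho> a b - \<sigma> a b) = 0"
    and cols: "\<And>a. a < m \<Longrightarrow> (\<Sum>b<m. \<sigma> a b - 1) = 0"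
  shows "square_cost n x \<le> (1 + \<eta>) * ((1 + t) / (1 - t)\<^sup>2) * ((\<Sum>a<m. \<Sum>b<m. (\<Sum>i<a. \<rho> i b - \<sigma> i b)\<^sup>2 + (\<Sum>j<b. \<sigma> a j - 1)\<^sup>2) / real m ^ 4)
    + (1 + 1 / \<eta>) * (2 / (real (m * k))\<^sup>2 + 2 / (real m)\<^sup>2 * (\<Sum>c<m*k. \<Sum>d<m*k. \<bar>cell_freq n x (m * k) c d - cell_freq n x m (c div k) (d div k) / (real k)\<^sup>2\<bar>))"
    (is "_ \<le> _ * _ * ?E + _ * ?L")
proof -
  have L0: "0 \<le> ?L" by (intro add_nonneg_nonneg mult_nonneg_nonneg sum_nonneg) auto
  have E0: "0 \<le> ?E" by (intro divide_nonneg_nonneg sum_nonneg) auto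
  have pos: "0 \<le> 1 + 1 / \<eta>" "0 \<le> ?L" "0 \<le> 1 + \<eta>" "0 \<le> (1 + t) / (1 - t)\<^sup>2" "0 \<le> ?E"
    using L0 E0 \<eta> t by simp_all
  have pos': "0 \<le> (1 + t) / (1 - t)\<^sup>2 * ?E" using pos(4,5) by (rule mult_nonneg_nonneg)
  have \<rho>0: "0 \<le> \<rho> a b" for a b by (simp add: \<rho>_def cell_freq_nonneg)
  obtain h where hm: "\<And>i. h i \<in> borel_measurable unit_square_pair" and h0: "\<And>i y. 0 \<le> h i y"
    and h1: "\<And>i. i \<in> {1..n} \<Longrightarrow> (\<integral>\<^sup>+y. ennreal (h i y) \<partial>unit_square_pair) = 1"
    and hd: "\<And>y. (\<Sum>i=1..n. h i y) / real n = (real m)\<^sup>2 * cell_freq n x m (cell m (fst y)) (cell m (snd y))"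
    and hc: "(\<Sum>i=1..n. \<integral>\<^sup>+y. ennreal (h i y / real n * (norm (x i - vec2 y))\<^sup>2) \<partial>unit_square_pair) \<le> ennreal ?L"
    by (rule empirical_to_cells[OF n m k x]) blast+
  obtain T where Tm: "T \<in> unit_square_pair \<rightarrow>\<^sub>M unit_square_pair" and Tcl: "\<And>y. vec2 (T y) \<in> closure unit_square"
    and push: "distr (density unit_square_pair (\<lambda>y. ennreal (\<rho> (cell m (fst y)) (cell m (snd y))))) unit_square_pair T = unit_square_pair"
    and Tc: "(\<integral>\<^sup>+y. ennreal (\<rho> (cell m (fst y)) (cell m (snd y)) * (norm (vec2 y - vec2 (T y)))\<^sup>2) \<partial>unit_square_pair)
       \<le> ennreal ((1 + t) / (1 - t)\<^sup>2 * ?E)"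
    using cell_transport[OF m t _ \<sigma> rows cols] \<rho> \<rho>0 by blast
  note [measurable] = hm Tm
  have "boundary_cost unit_square 2 (empirical_measure n x) lebesgue_square
     \<le> (\<Sum>i=1..n. \<integral>\<^sup>+y. ennreal (h i y / real n * (norm (x i - vec2 (T y)))\<^sup>2) \<partial>unit_square_pair)"
    using n x closure_subset hm h0 Tm Tcl h1 hd push
    by (intro boundary_cost_empirical_le[where \<rho> = "\<lambda>y. \<rho> (cell m (fst y)) (cell m (snd y))"]) (auto simp: \<rho>_def)
  also have "\<dots> \<le> (\<Sum>i=1..n. \<integral>\<^sup>+y. ennreal (1 + 1 / \<eta>) * ennreal (h i y / real n * (norm (x i - vec2 y))\<^sup>2)
      + ennreal (1 + \<eta>) * ennreal (h i y / real n * (norm (vec2 y - vec2 (T y)))\<^sup>2) \<partial>unit_square_pair)"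
  proof (intro sum_mono nn_integral_mono)
    fix i y
    have "(norm (x i - vec2 (T y)))\<^sup>2 \<le> (1 + \<eta>) * (norm (vec2 y - vec2 (T y)))\<^sup>2 + (1 + 1 / \<eta>) * (norm (x i - vec2 y))\<^sup>2"
      using norm_add_square_le[OF \<eta>, of "vec2 y - vec2 (T y)" "x i - vec2 y"] by simp
    then have "h i y / real n * (norm (x i - vec2 (T y)))\<^sup>2 \<le> h i y / real n * ((1 + \<eta>) * (norm (vec2 y - vec2 (T y)))\<^sup>2 + (1 + 1 / \<eta>) * (norm (x i - vec2 y))\<^sup>2)"
      using h0 by (intro mult_left_mono) auto
    also have "\<dots> = (1 + 1 / \<eta>) * (h i y / real n * (norm (x i - vec2 y))\<^sup>2) + (1 + \<eta>) * (h i y / real n * (norm (vec2 y - vec2 (T y)))\<^sup>2)"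
      by (simp only: distrib_left mult.left_commute add.commute)
    finally have le: "h i y / real n * (norm (x i - vec2 (T y)))\<^sup>2 \<le> (1 + 1 / \<eta>) * (h i y / real n * (norm (x i - vec2 y))\<^sup>2) + (1 + \<eta>) * (h i y / real n * (norm (vec2 y - vec2 (T y)))\<^sup>2)" .
    show "ennreal (h i y / real n * (norm (x i - vec2 (T y)))\<^sup>2) \<le> ennreal (1 + 1 / \<eta>) * ennreal (h i y / real n * (norm (x i - vec2 y))\<^sup>2)
      + ennreal (1 + \<eta>) * ennreal (h i y / real n * (norm (vec2 y - vec2 (T y)))\<^sup>2)"
    proof -
      have nn: "0 \<le> h i y / real n * (norm (x i - vec2 y))\<^sup>2" "0 \<le> h i y / real n * (norm (vec2 y - vec2 (T y)))\<^sup>2"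
        using h0 by simp_all
      show ?thesis unfolding ennreal_mult_add[OF pos(1) nn(1) pos(3) nn(2)] using le by (rule ennreal_leI)
    qed
  qed
  also have "\<dots> = (\<Sum>i=1..n. ennreal (1 + 1 / \<eta>) * (\<integral>\<^sup>+y. ennreal (h i y / real n * (norm (x i - vec2 y))\<^sup>2) \<partial>unit_square_pair)
      + ennreal (1 + \<eta>) * (\<integral>\<^sup>+y. ennreal (h i y / real n * (norm (vec2 y - vec2 (T y)))\<^sup>2) \<partial>unit_square_pair))"
  proof (rule sum.cong[OF refl])
    fix i
    have [measurable]: "(\<lambda>y. ennreal (h i y / real n * (norm (x i - vec2 y))\<^sup>2)) \<in> borel_measurable unit_square_pair"
      "(\<lambda>y. ennreal (h i y / real n * (norm (vec2 y - vec2 (T y)))\<^sup>2)) \<in> borel_measurable unit_square_pair" by measurable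
    show "(\<integral>\<^sup>+y. ennreal (1 + 1 / \<eta>) * ennreal (h i y / real n * (norm (x i - vec2 y))\<^sup>2)
      + ennreal (1 + \<eta>) * ennreal (h i y / real n * (norm (vec2 y - vec2 (T y)))\<^sup>2) \<partial>unit_square_pair) =
      ennreal (1 + 1 / \<eta>) * (\<integral>\<^sup>+y. ennreal (h i y / real n * (norm (x i - vec2 y))\<^sup>2) \<partial>unit_square_pair)
      + ennreal (1 + \<eta>) * (\<integral>\<^sup>+y. ennreal (h i y / real n * (norm (vec2 y - vec2 (T y)))\<^sup>2) \<partial>unit_square_pair)"
      by (subst nn_integral_add, measurable, subst nn_integral_cmult, measurable, subst nn_integral_cmult, measurable)
  qed
  also have "\<dots> = ennreal (1 + 1 / \<eta>) * (\<Sum>i=1..n. \<integral>\<^sup>+y. ennreal (h i y / real n * (norm (x i - vec2 y))\<^sup>2) \<partial>unit_square_pair)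
      + ennreal (1 + \<eta>) * (\<Sum>i=1..n. \<integral>\<^sup>+y. ennreal (h i y / real n * (norm (vec2 y - vec2 (T y)))\<^sup>2) \<partial>unit_square_pair)"
    by (simp only: sum.distrib sum_distrib_left)
  \<comment> \<open>The second leg does not depend on the point from which the mass came, so the
    densities of the points merge into \<open>\<rho>\<close>.\<close>
  also have "(\<Sum>i=1..n. \<integral>\<^sup>+y. ennreal (h i y / real n * (norm (vec2 y - vec2 (T y)))\<^sup>2) \<partial>unit_square_pair)
    = (\<integral>\<^sup>+y. ennreal (\<rho> (cell m (fst y)) (cell m (snd y)) * (norm (vec2 y - vec2 (T y)))\<^sup>2) \<partial>unit_square_pair)"
  proof -
    have "(\<Sum>i=1..n. \<integral>\<^sup>+y. ennreal (h i y / real n * (norm (vec2 y - vec2 (T y)))\<^sup>2) \<partial>unit_square_pair)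
      = (\<integral>\<^sup>+y. (\<Sum>i=1..n. ennreal (h i y / real n * (norm (vec2 y - vec2 (T y)))\<^sup>2)) \<partial>unit_square_pair)"
      by (rule nn_integral_sum[symmetric]) measurable
    also have "\<dots> = (\<integral>\<^sup>+y. ennreal (\<rho> (cell m (fst y)) (cell m (snd y)) * (norm (vec2 y - vec2 (T y)))\<^sup>2) \<partial>unit_square_pair)"
    proof (rule nn_integral_cong)
      fix y
      have "(\<Sum>i=1..n. ennreal (h i y / real n * (norm (vec2 y - vec2 (T y)))\<^sup>2)) = ennreal (\<Sum>i=1..n. h i y / real n * (norm (vec2 y - vec2 (T y)))\<^sup>2)"
        using h0 by (intro sum_ennreal) auto
      also have "(\<Sum>i=1..n. h i y / real n * (norm (vec2 y - vec2 (T y)))\<^sup>2) = (\<Sum>i=1..n. h i y) / real n * (norm (vec2 y - vec2 (T y)))\<^sup>2"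
        by (simp only: sum_distrib_right sum_divide_distrib)
      finally show "(\<Sum>i=1..n. ennreal (h i y / real n * (norm (vec2 y - vec2 (T y)))\<^sup>2)) = ennreal (\<rho> (cell m (fst y)) (cell m (snd y)) * (norm (vec2 y - vec2 (T y)))\<^sup>2)"
        by (simp only: hd \<rho>_def)
    qed
    finally show ?thesis .
  qed
  also have "ennreal (1 + 1 / \<eta>) * (\<Sum>i=1..n. \<integral>\<^sup>+y. ennreal (h i y / real n * (norm (x i - vec2 y))\<^sup>2) \<partial>unit_square_pair)
      + ennreal (1 + \<eta>) * (\<integral>\<^sup>+y. ennreal (\<rho> (cell m (fst y)) (cell m (snd y)) * (norm (vec2 y - vec2 (T y)))\<^sup>2) \<partial>unit_square_pair)
    \<le> ennreal (1 + 1 / \<eta>) * ennreal ?L + ennreal (1 + \<eta>) * ennreal ((1 + t) / (1 - t)\<^sup>2 * ?E)"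
    by (intro add_mono mult_left_mono hc Tc) auto
  also have "\<dots> = ennreal ((1 + 1 / \<eta>) * ?L + (1 + \<eta>) * ((1 + t) / (1 - t)\<^sup>2 * ?E))"
    by (rule ennreal_mult_add) (fact pos pos')+
  finally have "square_cost n x \<le> (1 + 1 / \<eta>) * ?L + (1 + \<eta>) * ((1 + t) / (1 - t)\<^sup>2 * ?E)"
    by (rule square_cost_le) (intro add_nonneg_nonneg mult_nonneg_nonneg pos)
  then show ?thesis by (simp only: mult.assoc add.commute)
qed

section \<open>The expected cost: upper bound\<close>

lemma measurable_cell_cell_vec [measurable]:
  fixes F :: "nat \<Rightarrow> nat \<Rightarrow> real"
  shows "(\<lambda>z :: real^2. F (cell m (z $ 1)) (cell m (z $ 2))) \<in> borel_measurable borel"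
proof -
  have "(\<lambda>z :: real^2. F a (cell m (z $ 2))) \<in> borel_measurable borel" for a
    by (rule measurable_compose[OF measurable_vec_nth_real measurable_comp_cell])
  moreover have "(\<lambda>z :: real^2. cell m (z $ 1)) \<in> borel \<rightarrow>\<^sub>M count_space UNIV" by measurable
  ultimately show ?thesis by (rule measurable_compose_countable)
qed

lemma square_bounded_cell:
  fixes F :: "nat \<Rightarrow> nat \<Rightarrow> real"
  assumes "m > 0"
  shows "square_bounded (\<lambda>z. F (cell m (z $ 1)) (cell m (z $ 2)))"
proof (rule square_boundedI)
  fix z :: "real^2"
  have "\<bar>F (cell m (z $ 1)) (cell m (z $ 2))\<bar> \<le> (\<Sum>q\<in>{..<m} \<times> {..<m}. \<bar>F (fst q) (snd q)\<bar>)"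
    using member_le_sum[of "(cell m (z $ 1), cell m (z $ 2))" "{..<m} \<times> {..<m}" "\<lambda>q. \<bar>F (fst q) (snd q)\<bar>"] cell_less[OF assms] by simp
  then show "\<bar>F (cell m (z $ 1)) (cell m (z $ 2))\<bar> \<le> (\<Sum>q\<in>{..<m} \<times> {..<m}. \<bar>F (fst q) (snd q)\<bar>)" .
qed measurable

lemma integral_cell_indicator:
  assumes "m > 0" "a < m"
  shows "integral {0..1} (\<lambda>t. of_bool (cell m t = a) :: real) = 1 / real m"
  using unit_interval_integral_cell[OF assms(1), of "\<lambda>i. of_bool (i = a)"] assms(2) by simp

lemma integral_lebesgue_square_cell:
  fixes F :: "nat \<Rightarrow> nat \<Rightarrow> real"
  assumes m: "m > 0"
  shows "(\<integral>z. F (cell m (z $ 1)) (cell m (z $ 2)) \<partial>lebesgue_square) = (\<Sum>a<m. \<Sum>b<m. F a b) / (real m)\<^sup>2"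
proof -
  let ?I = "\<lambda>a b z :: real^2. of_bool (cell m (z $ 1) = a) * of_bool (cell m (z $ 2) = b) :: real"
  have "F (cell m (z $ 1)) (cell m (z $ 2)) = (\<Sum>a<m. \<Sum>b<m. F a b * ?I a b z)" for z
  proof -
    have "(\<Sum>a<m. \<Sum>b<m. F a b * ?I a b z) = (\<Sum>a<m. if cell m (z $ 1) = a then (\<Sum>b<m. if cell m (z $ 2) = b then F a b else 0) else 0)"
      by (intro sum.cong refl) (auto intro!: sum.cong)
    then show ?thesis using cell_less[OF m] by simp
  qed
  then have "(\<integral>z. F (cell m (z $ 1)) (cell m (z $ 2)) \<partial>lebesgue_square) = (\<integral>z. (\<Sum>a<m. \<Sum>b<m. F a b * ?I a b z) \<partial>lebesgue_square)" by simp
  also have "\<dots> = (\<Sum>a<m. \<Sum>b<m. F a b * (\<integral>z. ?I a b z \<partial>lebesgue_square))"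
  proof -
    have i: "integrable lebesgue_square (\<lambda>z. F a b * ?I a b z)" for a b
      using square_bounded_cell[OF m, of "\<lambda>a' b'. F a b * (of_bool (a' = a) * of_bool (b' = b))"] by (rule integrable_square_bounded)
    show ?thesis using i by (simp add: Bochner_Integration.integral_sum)
  qed
  also have "\<dots> = (\<Sum>a<m. \<Sum>b<m. F a b * (1 / (real m)\<^sup>2))"
  proof (intro sum.cong refl)
    fix a b assume "a \<in> {..<m}" "b \<in> {..<m}"
    then have "(\<integral>z. ?I a b z \<partial>lebesgue_square) = 1 / (real m)\<^sup>2"
      using integral_square_mult[of "\<lambda>t. of_bool (cell m t = a)" "\<lambda>t. of_bool (cell m t = b)" 1]
        integral_cell_indicator[OF m, of a] integral_cell_indicator[OF m, of b] measurable_comp_cell[of "\<lambda>i. of_bool (i = _)" m]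
      by (simp add: power2_eq_square)
    then show "F a b * (\<integral>z. ?I a b z \<partial>lebesgue_square) = F a b * (1 / (real m)\<^sup>2)" by simp
  qed
  finally show ?thesis by (simp add: sum_divide_distrib)
qed

lemma integral_orthonormal_square:
  fixes e :: "'k \<Rightarrow> real^2 \<Rightarrow> real"
  assumes e: "\<And>K. K \<in> I \<Longrightarrow> square_bounded (e K)" and fin: "finite I"
    and orth: "\<And>K L. K \<in> I \<Longrightarrow> L \<in> I \<Longrightarrow> (\<integral>z. e K z * e L z \<partial>lebesgue_square) = of_bool (K = L)"
  shows "(\<integral>z. (\<Sum>K\<in>I. w K * e K z)\<^sup>2 \<partial>lebesgue_square) = (\<Sum>K\<in>I. (w K)\<^sup>2)"
proof -
  have i: "integrable lebesgue_square (\<lambda>z. w K * w L * (e K z * e L z))" if "K \<in> I" "L \<in> I" for K L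
    using e that by (intro integrable_square_bounded square_bounded_intros)
  have "(\<integral>z. (\<Sum>K\<in>I. w K * e K z)\<^sup>2 \<partial>lebesgue_square) = (\<integral>z. (\<Sum>K\<in>I. \<Sum>L\<in>I. w K * w L * (e K z * e L z)) \<partial>lebesgue_square)"
    by (simp add: power2_eq_square sum_product mult_ac)
  also have "\<dots> = (\<Sum>K\<in>I. \<integral>z. (\<Sum>L\<in>I. w K * w L * (e K z * e L z)) \<partial>lebesgue_square)"
    by (intro Bochner_Integration.integral_sum Bochner_Integration.integrable_sum i)
  also have "\<dots> = (\<Sum>K\<in>I. \<Sum>L\<in>I. \<integral>z. w K * w L * (e K z * e L z) \<partial>lebesgue_square)"
    by (intro sum.cong refl Bochner_Integration.integral_sum i)
  also have "\<dots> = (\<Sum>K\<in>I. \<Sum>L\<in>I. if K = L then w K * w L else 0)"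
    by (intro sum.cong refl) (simp add: orth)
  also have "\<dots> = (\<Sum>K\<in>I. (w K)\<^sup>2)" using fin by (simp add: power2_eq_square)
  finally show ?thesis .
qed

text \<open>Cells have area \<open>1 / m\<^sup>2\<close>, so the factor \<open>m\<close> makes these
  step functions orthonormal with respect to Lebesgue measure on the square.\<close>

definition dct2 :: "nat \<Rightarrow> nat \<Rightarrow> nat \<Rightarrow> real^2 \<Rightarrow> real" where
  "dct2 m j k z = real m * (dct m j (cell m (z $ 1)) * dct m k (cell m (z $ 2)))"

lemma square_bounded_dct2: "m > 0 \<Longrightarrow> square_bounded (dct2 m j k)"
  using square_bounded_cell[of m "\<lambda>a b. real m * (dct m j a * dct m k b)"] by (simp add: dct2_def[abs_def])

lemma dct2_orthonormal:
  assumes "m > 0" "j < m" "k < m" "j' < m" "k' < m"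
  shows "(\<integral>z. dct2 m j k z * dct2 m j' k' z \<partial>lebesgue_square) = of_bool (j = j' \<and> k = k')"
proof -
  have "(\<integral>z. dct2 m j k z * dct2 m j' k' z \<partial>lebesgue_square) =
     (\<Sum>a<m. \<Sum>b<m. (real m)\<^sup>2 * (dct m j a * dct m j' a * (dct m k b * dct m k' b))) / (real m)\<^sup>2"
    unfolding dct2_def using integral_lebesgue_square_cell[OF assms(1), of "\<lambda>a b. (real m)\<^sup>2 * (dct m j a * dct m j' a * (dct m k b * dct m k' b))"]
    by (simp add: power2_eq_square mult_ac)
  also have "\<dots> = (\<Sum>a<m. dct m j a * dct m j' a) * (\<Sum>b<m. dct m k b * dct m k' b)"
    using assms(1) by (simp add: sum_distrib_left[symmetric] sum_product)
  finally show ?thesis using assms by (simp add: dct_orthonormal of_bool_conj)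
qed

lemma abs_dct2_le:
  assumes "m > 0"
  shows "\<bar>dct2 m j k z\<bar> \<le> 2"
proof -
  have "\<bar>dct m j a * dct m k b\<bar> \<le> sqrt (2 / real m) * sqrt (2 / real m)" for a b
    unfolding abs_mult using abs_dct_le[OF assms] by (intro mult_mono) auto
  then have "\<bar>dct m j a * dct m k b\<bar> \<le> 2 / real m" for a b by simp
  then have "real m * \<bar>dct m j (cell m (z $ 1)) * dct m k (cell m (z $ 2))\<bar> \<le> real m * (2 / real m)"
    by (intro mult_left_mono) auto
  then show ?thesis using assms by (simp add: dct2_def abs_mult)
qed

text \<open>Integrating a mode divides its squared norm by the eigenvalue; the prefix sums are exact
  sines, so the discrete version is an identity.\<close>

lemma sum_dct_prefix_square:
  assumes "0 < j" "j < m"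
  shows "(\<Sum>a<m. (\<Sum>i<a. dct m j i)\<^sup>2) = 1 / dct_eigenvalue m j"
proof -
  let ?s = "sin (pi * real j / (2 * real m))"
  have "?s > 0" using sin_pi_frac_pos[of j m] assms by simp
  have "(\<Sum>i<a. dct m j i)\<^sup>2 = (2 / real m) / (4 * ?s\<^sup>2) * (sin (pi * real j * real a / real m))\<^sup>2" for a
    unfolding sum_dct_prefix[OF assms] using assms by (simp add: power_divide power_mult_distrib)
  then have "(\<Sum>a<m. (\<Sum>i<a. dct m j i)\<^sup>2) = (2 / real m) / (4 * ?s\<^sup>2) * (\<Sum>a<m. (sin (pi * real j * real a / real m))\<^sup>2)"
    by (simp only: sum_distrib_left)
  also have "\<dots> = 1 / dct_eigenvalue m j"
    unfolding sum_sin_squared_pi_frac[OF assms] using assms by (simp add: dct_eigenvalue_def)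
  finally show ?thesis .
qed

lemma dct_eigenvalue_nonneg [simp]: "0 \<le> dct_eigenvalue m j"
  by (simp add: dct_eigenvalue_def)

lemma dct_eigenvalue_pos: "0 < j \<Longrightarrow> j < m \<Longrightarrow> 0 < dct_eigenvalue m j"
  using sin_pi_frac_pos[of j m] by (simp add: dct_eigenvalue_def)

lemma sum_dct_eq_0: "0 < j \<Longrightarrow> j < m \<Longrightarrow> (\<Sum>a<m. dct m j a) = 0"
  using sum_dct_prefix[of j m m] by simp

text \<open>The share of the mode \<open>(j, k)\<close> that is transported along the rows; this choice makes the two costs add
  up to the inverse of the sum of the eigenvalues.\<close>

definition first_share :: "nat \<Rightarrow> nat \<Rightarrow> nat \<Rightarrow> real" where
  "first_share m j k = dct_eigenvalue m j / (dct_eigenvalue m j + dct_eigenvalue m k)"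

lemma first_share_bounds: "0 \<le> first_share m j k" "first_share m j k \<le> 1"
proof -
  show "0 \<le> first_share m j k" by (simp add: first_share_def)
  have "0 \<le> dct_eigenvalue m j + dct_eigenvalue m k" "dct_eigenvalue m j \<le> dct_eigenvalue m j + dct_eigenvalue m k" by simp_all
  then show "first_share m j k \<le> 1"
    unfolding first_share_def by (metis divide_eq_0_iff divide_le_eq_1_pos less_eq_real_def zero_le_one)
qed

lemma first_share_0 [simp]: "first_share m 0 k = 0"
  by (simp add: first_share_def)

lemma first_share_add:
  assumes "j < m" "k < m" "(j, k) \<noteq> (0, 0)"
  shows "first_share m j k + first_share m k j = 1"
proof -
  have "0 < dct_eigenvalue m j + dct_eigenvalue m k"
    using assms dct_eigenvalue_pos[of j m] dct_eigenvalue_pos[of k m]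
    by (cases "j = 0"; cases "k = 0") (auto intro: add_pos_nonneg add_nonneg_pos)
  then show ?thesis
    unfolding first_share_def by (simp add: add.commute[of "dct_eigenvalue m k"] add_divide_distrib[symmetric])
qed

lemma sum_square_product_weights:
  fixes w u v :: "nat \<Rightarrow> nat \<Rightarrow> real"
  shows "(\<Sum>a<m. \<Sum>b<m. (\<Sum>j<m. \<Sum>k<m. (w j k * c * (u j a * v k b))\<^sup>2) / N)
    = c\<^sup>2 / N * (\<Sum>j<m. \<Sum>k<m. (w j k)\<^sup>2 * ((\<Sum>a<m. (u j a)\<^sup>2) * (\<Sum>b<m. (v k b)\<^sup>2)))"
proof -
  let ?f = "\<lambda>a b j k. c\<^sup>2 / N * ((w j k)\<^sup>2 * ((u j a)\<^sup>2 * (v k b)\<^sup>2))"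
  have "(\<Sum>a<m. \<Sum>b<m. (\<Sum>j<m. \<Sum>k<m. (w j k * c * (u j a * v k b))\<^sup>2) / N) = (\<Sum>a<m. \<Sum>b<m. \<Sum>j<m. \<Sum>k<m. ?f a b j k)"
    unfolding sum_divide_distrib by (intro sum.cong refl) (simp add: power_mult_distrib)
  also have "\<dots> = (\<Sum>a<m. \<Sum>j<m. \<Sum>b<m. \<Sum>k<m. ?f a b j k)" by (intro sum.cong refl sum.swap)
  also have "\<dots> = (\<Sum>j<m. \<Sum>a<m. \<Sum>b<m. \<Sum>k<m. ?f a b j k)" by (rule sum.swap)
  also have "\<dots> = (\<Sum>j<m. \<Sum>a<m. \<Sum>k<m. \<Sum>b<m. ?f a b j k)" by (intro sum.cong refl sum.swap)
  also have "\<dots> = (\<Sum>j<m. \<Sum>k<m. \<Sum>a<m. \<Sum>b<m. ?f a b j k)" by (intro sum.cong refl sum.swap)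
  also have "\<dots> = c\<^sup>2 / N * (\<Sum>j<m. \<Sum>k<m. (w j k)\<^sup>2 * ((\<Sum>a<m. (u j a)\<^sup>2) * (\<Sum>b<m. (v k b)\<^sup>2)))"
    by (simp only: sum_product) (simp only: sum_distrib_left)
  finally show ?thesis .
qed

section \<open>The two densities in the cosine basis\<close>

context uniform_sample begin

definition dct_coeff :: "nat \<Rightarrow> nat \<Rightarrow> nat \<Rightarrow> nat \<Rightarrow> 'w \<Rightarrow> real" where
  "dct_coeff n m j k \<omega> = fluctuation n (dct2 m j k) \<omega>"

lemma dct_coeff_0:
  assumes "n > 0" "m > 0"
  shows "dct_coeff n m 0 0 \<omega> = 0"
proof -
  have "dct2 m 0 0 = (\<lambda>_. 1)" using assms by (simp add: dct2_def dct_0 fun_eq_iff)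
  then show ?thesis using assms lebesgue_square.prob_space by (simp add: dct_coeff_def fluctuation_def)
qed

lemma fluctuation_dct_lincomb:
  assumes "m > 0"
  shows "fluctuation n (\<lambda>z. \<Sum>j<m. \<Sum>k<m. w j k * dct2 m j k z) \<omega> = (\<Sum>j<m. \<Sum>k<m. w j k * dct_coeff n m j k \<omega>)"
proof -
  have "fluctuation n (\<lambda>z. \<Sum>j<m. \<Sum>k<m. w j k * dct2 m j k z) \<omega> = (\<Sum>j<m. fluctuation n (\<lambda>z. \<Sum>k<m. w j k * dct2 m j k z) \<omega>)"
    using assms by (intro fluctuation_sum square_bounded_intros square_bounded_dct2)
  also have "\<dots> = (\<Sum>j<m. \<Sum>k<m. w j k * dct_coeff n m j k \<omega>)"
    unfolding dct_coeff_def using assms by (intro sum.cong refl fluctuation_lincomb square_bounded_dct2)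
  finally show ?thesis .
qed

lemma square_bounded_dct_lincomb: "m > 0 \<Longrightarrow> square_bounded (\<lambda>z. \<Sum>j<m. \<Sum>k<m. w j k * dct2 m j k z)"
  by (intro square_bounded_intros square_bounded_dct2)

lemma integral_dct_lincomb_square:
  assumes "m > 0"
  shows "(\<integral>z. (\<Sum>j<m. \<Sum>k<m. w j k * dct2 m j k z)\<^sup>2 \<partial>lebesgue_square) = (\<Sum>j<m. \<Sum>k<m. (w j k)\<^sup>2)"
  unfolding sum.cartesian_product case_prod_unfold
  using dct2_orthonormal[OF assms] square_bounded_dct2[OF assms]
  by (intro integral_orthonormal_square) (auto simp: prod_eq_iff)

lemma expectation_dct_lincomb_square_le:
  assumes "n > 0" "m > 0"
  shows "expectation (\<lambda>\<omega>. (\<Sum>j<m. \<Sum>k<m. w j k * dct_coeff n m j k \<omega>)\<^sup>2) \<le> (\<Sum>j<m. \<Sum>k<m. (w j k)\<^sup>2) / real n"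
    and "integrable M (\<lambda>\<omega>. (\<Sum>j<m. \<Sum>k<m. w j k * dct_coeff n m j k \<omega>)\<^sup>2)"
  using variance_fluctuation_le[OF square_bounded_dct_lincomb[OF assms(2), of w] assms(1)]
    variance_fluctuation(2)[OF square_bounded_dct_lincomb[OF assms(2), of w] assms(1)]
  unfolding integral_dct_lincomb_square[OF assms(2)] fluctuation_dct_lincomb[OF assms(2)] by auto

lemma cell_indicator_expansion:
  assumes "m > 0" "a < m" "b < m"
  shows "of_bool (cell m (z $ 1) = a \<and> cell m (z $ 2) = b) = (\<Sum>j<m. \<Sum>k<m. (dct m j a * dct m k b / real m) * dct2 m j k z)"
proof -
  have "(\<Sum>j<m. \<Sum>k<m. (dct m j a * dct m k b / real m) * dct2 m j k z) =
    (\<Sum>j<m. \<Sum>k<m. (dct m j (cell m (z $ 1)) * dct m j a) * (dct m k (cell m (z $ 2)) * dct m k b))"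
    using assms(1) by (intro sum.cong refl) (simp add: dct2_def)
  also have "\<dots> = (\<Sum>j<m. dct m j (cell m (z $ 1)) * dct m j a) * (\<Sum>k<m. dct m k (cell m (z $ 2)) * dct m k b)"
    by (simp add: sum_product)
  also have "\<dots> = of_bool (cell m (z $ 1) = a) * of_bool (cell m (z $ 2) = b)"
    using assms cell_less[OF assms(1)] by (simp add: dct_complete)
  finally show ?thesis by simp
qed

lemma cell_freq_fluctuation:
  assumes n: "n > 0" and m: "m > 0" and ab: "a < m" "b < m"
  shows "cell_freq n (\<lambda>i. X i \<omega>) m a b = 1 / (real m)\<^sup>2 + fluctuation n (\<lambda>z. of_bool (cell m (z $ 1) = a \<and> cell m (z $ 2) = b)) \<omega>"
proof -
  have "(\<integral>z. of_bool (cell m (z $ 1) = a \<and> cell m (z $ 2) = b) \<partial>lebesgue_square) = (\<Sum>a'<m. \<Sum>b'<m. of_bool (a' = a \<and> b' = b)) / (real m)\<^sup>2"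
    by (rule integral_lebesgue_square_cell[OF m])
  also have "(\<Sum>a'<m. \<Sum>b'<m. of_bool (a' = a \<and> b' = b) :: real) = 1"
  proof -
    have "(\<Sum>a'<m. \<Sum>b'<m. of_bool (a' = a \<and> b' = b) :: real) = (\<Sum>a'<m. if a' = a then (\<Sum>b'<m. if b' = b then 1 else 0) else 0)"
      by (intro sum.cong refl) (auto intro!: sum.cong)
    then show ?thesis using ab by simp
  qed
  finally show ?thesis by (simp add: cell_freq_def fluctuation_def)
qed

lemma density_expansion:
  assumes n: "n > 0" and m: "m > 0" and ab: "a < m" "b < m"
  shows "(real m)\<^sup>2 * cell_freq n (\<lambda>i. X i \<omega>) m a b = 1 + (\<Sum>j<m. \<Sum>k<m. (real m * (dct m j a * dct m k b)) * dct_coeff n m j k \<omega>)"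
proof -
  have "(real m)\<^sup>2 * cell_freq n (\<lambda>i. X i \<omega>) m a b = 1 + (real m)\<^sup>2 * (\<Sum>j<m. \<Sum>k<m. (dct m j a * dct m k b / real m) * dct_coeff n m j k \<omega>)"
    unfolding cell_freq_fluctuation[OF assms] cell_indicator_expansion[OF m ab] fluctuation_dct_lincomb[OF m]
    using m by (simp add: distrib_left)
  also have "(real m)\<^sup>2 * (\<Sum>j<m. \<Sum>k<m. (dct m j a * dct m k b / real m) * dct_coeff n m j k \<omega>) = (\<Sum>j<m. \<Sum>k<m. (real m * (dct m j a * dct m k b)) * dct_coeff n m j k \<omega>)"
    unfolding sum_distrib_left using m by (intro sum.cong refl) (simp add: power2_eq_square)
  finally show ?thesis .
qed

text \<open>The exchanged arguments of \<open>first_share\<close> give the complementary share, left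
  for the columns. The constant mode has share 0 and coefficient 0.\<close>

definition mid_density :: "nat \<Rightarrow> nat \<Rightarrow> 'w \<Rightarrow> nat \<Rightarrow> nat \<Rightarrow> real" where
  "mid_density n m \<omega> a b = 1 + (\<Sum>j<m. \<Sum>k<m. (first_share m k j * (real m * (dct m j a * dct m k b))) * dct_coeff n m j k \<omega>)"

lemma density_diff_expansion:
  assumes n: "n > 0" and m: "m > 0" and ab: "a < m" "b < m"
  shows "(real m)\<^sup>2 * cell_freq n (\<lambda>i. X i \<omega>) m a b - mid_density n m \<omega> a b =
    (\<Sum>j<m. \<Sum>k<m. (first_share m j k * (real m * (dct m j a * dct m k b))) * dct_coeff n m j k \<omega>)"
proof -
  have "(real m * (dct m j a * dct m k b)) * dct_coeff n m j k \<omega> - (first_share m k j * (real m * (dct m j a * dct m k b))) * dct_coeff n m j k \<omega> =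
     (first_share m j k * (real m * (dct m j a * dct m k b))) * dct_coeff n m j k \<omega>" if "j < m" "k < m" for j k
  proof (cases "(j, k) = (0, 0)")
    case True
    then show ?thesis using dct_coeff_0[OF n m] by simp
  next
    case False
    then have "1 - first_share m k j = first_share m j k" using first_share_add[OF that] by simp
    then show ?thesis by (metis left_diff_distrib mult.left_neutral)
  qed
  then show ?thesis
    unfolding density_expansion[OF assms] mid_density_def by (simp add: sum_subtractf[symmetric])
qed

text \<open>Modes with \<open>j = 0\<close> have no share in the row step, and all others have zero
  sum along a row; thus each row keeps its mass.\<close>

lemma rows_balanced:
  assumes n: "n > 0" and m: "m > 0" and b: "b < m"
  shows "(\<Sum>a<m. (real m)\<^sup>2 * cell_freq n (\<lambda>i. X i \<omega>) m a b - mid_density n m \<omega> a b) = 0"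
proof -
  have "(\<Sum>a<m. (real m)\<^sup>2 * cell_freq n (\<lambda>i. X i \<omega>) m a b - mid_density n m \<omega> a b) =
    (\<Sum>a<m. \<Sum>j<m. \<Sum>k<m. (first_share m j k * (real m * (dct m j a * dct m k b))) * dct_coeff n m j k \<omega>)"
    using density_diff_expansion[OF n m _ b] by (intro sum.cong refl) simp
  also have "\<dots> = (\<Sum>j<m. \<Sum>a<m. \<Sum>k<m. (first_share m j k * (real m * (dct m j a * dct m k b))) * dct_coeff n m j k \<omega>)"
    by (rule sum.swap)
  also have "\<dots> = (\<Sum>j<m. (\<Sum>a<m. dct m j a) * (\<Sum>k<m. first_share m j k * real m * dct m k b * dct_coeff n m j k \<omega>))"
    by (intro sum.cong refl) (simp add: sum_product mult_ac)
  also have "\<dots> = 0"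
  proof (rule sum.neutral, intro ballI)
    fix j assume "j \<in> {..<m}"
    then show "(\<Sum>a<m. dct m j a) * (\<Sum>k<m. first_share m j k * real m * dct m k b * dct_coeff n m j k \<omega>) = 0"
      using sum_dct_eq_0[of j m] by (cases "j = 0") auto
  qed
  finally show ?thesis .
qed

lemma columns_balanced:
  assumes n: "n > 0" and m: "m > 0" and a: "a < m"
  shows "(\<Sum>b<m. mid_density n m \<omega> a b - 1) = 0"
proof -
  have "(\<Sum>b<m. mid_density n m \<omega> a b - 1) = (\<Sum>b<m. \<Sum>j<m. \<Sum>k<m. (first_share m k j * (real m * (dct m j a * dct m k b))) * dct_coeff n m j k \<omega>)"
    by (simp add: mid_density_def)
  also have "\<dots> = (\<Sum>j<m. \<Sum>b<m. \<Sum>k<m. (first_share m k j * (real m * (dct m j a * dct m k b))) * dct_coeff n m j k \<omega>)"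
    by (rule sum.swap)
  also have "\<dots> = (\<Sum>j<m. \<Sum>k<m. \<Sum>b<m. (first_share m k j * (real m * (dct m j a * dct m k b))) * dct_coeff n m j k \<omega>)"
    by (intro sum.cong refl sum.swap)
  also have "\<dots> = (\<Sum>j<m. \<Sum>k<m. (\<Sum>b<m. dct m k b) * (first_share m k j * real m * dct m j a * dct_coeff n m j k \<omega>))"
    unfolding sum_distrib_right by (intro sum.cong refl) (simp add: mult_ac)
  also have "\<dots> = 0"
  proof (intro sum.neutral ballI)
    fix j k assume "j \<in> {..<m}" "k \<in> {..<m}"
    then show "(\<Sum>b<m. dct m k b) * (first_share m k j * real m * dct m j a * dct_coeff n m j k \<omega>) = 0"
      using sum_dct_eq_0[of k m] by (cases "k = 0") auto
  qed
  finally show ?thesis .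
qed

lemma prefix_first:
  assumes n: "n > 0" and m: "m > 0" and ab: "a < m" "b < m"
  shows "(\<Sum>i<a. (real m)\<^sup>2 * cell_freq n (\<lambda>i. X i \<omega>) m i b - mid_density n m \<omega> i b) =
     (\<Sum>j<m. \<Sum>k<m. (first_share m j k * real m * ((\<Sum>i<a. dct m j i) * dct m k b)) * dct_coeff n m j k \<omega>)"
proof -
  have "(\<Sum>i<a. (real m)\<^sup>2 * cell_freq n (\<lambda>i. X i \<omega>) m i b - mid_density n m \<omega> i b) =
     (\<Sum>i<a. \<Sum>j<m. \<Sum>k<m. (first_share m j k * (real m * (dct m j i * dct m k b))) * dct_coeff n m j k \<omega>)"
    using density_diff_expansion[OF n m _ ab(2)] ab by (intro sum.cong refl) simp
  also have "\<dots> = (\<Sum>j<m. \<Sum>i<a. \<Sum>k<m. (first_share m j k * (real m * (dct m j i * dct m k b))) * dct_coeff n m j k \<omega>)"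
    by (rule sum.swap)
  also have "\<dots> = (\<Sum>j<m. \<Sum>k<m. \<Sum>i<a. (first_share m j k * (real m * (dct m j i * dct m k b))) * dct_coeff n m j k \<omega>)"
    by (intro sum.cong refl sum.swap)
  also have "\<dots> = (\<Sum>j<m. \<Sum>k<m. (first_share m j k * real m * ((\<Sum>i<a. dct m j i) * dct m k b)) * dct_coeff n m j k \<omega>)"
    by (intro sum.cong refl) (simp add: sum_distrib_left sum_distrib_right mult_ac)
  finally show ?thesis .
qed

lemma prefix_second:
  assumes n: "n > 0" and m: "m > 0"
  shows "(\<Sum>i<b. mid_density n m \<omega> a i - 1) =
     (\<Sum>j<m. \<Sum>k<m. (first_share m k j * real m * (dct m j a * (\<Sum>i<b. dct m k i))) * dct_coeff n m j k \<omega>)"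
proof -
  have "(\<Sum>i<b. mid_density n m \<omega> a i - 1) =
     (\<Sum>i<b. \<Sum>j<m. \<Sum>k<m. (first_share m k j * (real m * (dct m j a * dct m k i))) * dct_coeff n m j k \<omega>)"
    by (simp add: mid_density_def)
  also have "\<dots> = (\<Sum>j<m. \<Sum>i<b. \<Sum>k<m. (first_share m k j * (real m * (dct m j a * dct m k i))) * dct_coeff n m j k \<omega>)"
    by (rule sum.swap)
  also have "\<dots> = (\<Sum>j<m. \<Sum>k<m. \<Sum>i<b. (first_share m k j * (real m * (dct m j a * dct m k i))) * dct_coeff n m j k \<omega>)"
    by (intro sum.cong refl sum.swap)
  also have "\<dots> = (\<Sum>j<m. \<Sum>k<m. (first_share m k j * real m * (dct m j a * (\<Sum>i<b. dct m k i))) * dct_coeff n m j k \<omega>)"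
    by (intro sum.cong refl) (simp add: sum_distrib_left sum_distrib_right mult_ac)
  finally show ?thesis .
qed

text \<open>The expected square of a combination of coefficients is at most the sum of its squared
  weights over \<open>n\<close>. Summed over the cells, the prefix direction contributes the inverse
  eigenvalue and the other direction 1; multiplied by the squared share this is
  \<open>dct_eigenvalue m j\<close> over the squared sum of the eigenvalues.\<close>

lemma expectation_prefix_first_le:
  assumes n: "n > 0" and m: "m > 0"
  shows "(\<Sum>a<m. \<Sum>b<m. expectation (\<lambda>\<omega>. (\<Sum>i<a. (real m)\<^sup>2 * cell_freq n (\<lambda>i. X i \<omega>) m i b - mid_density n m \<omega> i b)\<^sup>2))
     \<le> (real m)\<^sup>2 / real n * (\<Sum>j<m. \<Sum>k<m. dct_eigenvalue m j / (dct_eigenvalue m j + dct_eigenvalue m k)\<^sup>2)"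
proof -
  have "(\<Sum>a<m. \<Sum>b<m. expectation (\<lambda>\<omega>. (\<Sum>i<a. (real m)\<^sup>2 * cell_freq n (\<lambda>i. X i \<omega>) m i b - mid_density n m \<omega> i b)\<^sup>2))
    \<le> (\<Sum>a<m. \<Sum>b<m. (\<Sum>j<m. \<Sum>k<m. (first_share m j k * real m * ((\<Sum>i<a. dct m j i) * dct m k b))\<^sup>2) / real n)"
    using expectation_dct_lincomb_square_le(1)[OF n m] by (intro sum_mono) (simp add: prefix_first[OF n m])
  also have "\<dots> = (real m)\<^sup>2 / real n * (\<Sum>j<m. \<Sum>k<m. (first_share m j k)\<^sup>2 * ((\<Sum>a<m. (\<Sum>i<a. dct m j i)\<^sup>2) * (\<Sum>b<m. (dct m k b)\<^sup>2)))"
    by (rule sum_square_product_weights)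
  also have "(\<Sum>j<m. \<Sum>k<m. (first_share m j k)\<^sup>2 * ((\<Sum>a<m. (\<Sum>i<a. dct m j i)\<^sup>2) * (\<Sum>b<m. (dct m k b)\<^sup>2))) = (\<Sum>j<m. \<Sum>k<m. dct_eigenvalue m j / (dct_eigenvalue m j + dct_eigenvalue m k)\<^sup>2)"
  proof (intro sum.cong refl)
    fix j k assume "j \<in> {..<m}" "k \<in> {..<m}"
    then have jk: "j < m" "k < m" by auto
    have "(\<Sum>b<m. (dct m k b)\<^sup>2) = 1" using dct_orthonormal[OF jk(2) jk(2)] by (simp add: power2_eq_square)
    then show "(first_share m j k)\<^sup>2 * ((\<Sum>a<m. (\<Sum>i<a. dct m j i)\<^sup>2) * (\<Sum>b<m. (dct m k b)\<^sup>2)) = dct_eigenvalue m j / (dct_eigenvalue m j + dct_eigenvalue m k)\<^sup>2"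
      using sum_dct_prefix_square[of j m] dct_eigenvalue_pos[of j m] jk
      by (cases "j = 0") (auto simp: first_share_def power_divide power2_eq_square)
  qed
  finally show ?thesis .
qed

lemma expectation_prefix_second_le:
  assumes n: "n > 0" and m: "m > 0"
  shows "(\<Sum>a<m. \<Sum>b<m. expectation (\<lambda>\<omega>. (\<Sum>i<b. mid_density n m \<omega> a i - 1)\<^sup>2))
     \<le> (real m)\<^sup>2 / real n * (\<Sum>j<m. \<Sum>k<m. dct_eigenvalue m k / (dct_eigenvalue m j + dct_eigenvalue m k)\<^sup>2)"
proof -
  have "(\<Sum>a<m. \<Sum>b<m. expectation (\<lambda>\<omega>. (\<Sum>i<b. mid_density n m \<omega> a i - 1)\<^sup>2))
    \<le> (\<Sum>a<m. \<Sum>b<m. (\<Sum>j<m. \<Sum>k<m. (first_share m k j * real m * (dct m j a * (\<Sum>i<b. dct m k i)))\<^sup>2) / real n)"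
    using expectation_dct_lincomb_square_le(1)[OF n m] by (intro sum_mono) (simp add: prefix_second[OF n m])
  also have "\<dots> = (real m)\<^sup>2 / real n * (\<Sum>j<m. \<Sum>k<m. (first_share m k j)\<^sup>2 * ((\<Sum>a<m. (dct m j a)\<^sup>2) * (\<Sum>b<m. (\<Sum>i<b. dct m k i)\<^sup>2)))"
    by (rule sum_square_product_weights)
  also have "(\<Sum>j<m. \<Sum>k<m. (first_share m k j)\<^sup>2 * ((\<Sum>a<m. (dct m j a)\<^sup>2) * (\<Sum>b<m. (\<Sum>i<b. dct m k i)\<^sup>2))) = (\<Sum>j<m. \<Sum>k<m. dct_eigenvalue m k / (dct_eigenvalue m j + dct_eigenvalue m k)\<^sup>2)"
  proof (intro sum.cong refl)
    fix j k assume "j \<in> {..<m}" "k \<in> {..<m}"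
    then have jk: "j < m" "k < m" by auto
    have "(\<Sum>a<m. (dct m j a)\<^sup>2) = 1" using dct_orthonormal[OF jk(1) jk(1)] by (simp add: power2_eq_square)
    then show "(first_share m k j)\<^sup>2 * ((\<Sum>a<m. (dct m j a)\<^sup>2) * (\<Sum>b<m. (\<Sum>i<b. dct m k i)\<^sup>2)) = dct_eigenvalue m k / (dct_eigenvalue m j + dct_eigenvalue m k)\<^sup>2"
      using sum_dct_prefix_square[of k m] dct_eigenvalue_pos[of k m] jk
      by (cases "k = 0") (auto simp: first_share_def power_divide power2_eq_square add.commute)
  qed
  finally show ?thesis .
qed

definition transport_energy :: "nat \<Rightarrow> nat \<Rightarrow> 'w \<Rightarrow> real" where
  "transport_energy n m \<omega> = (\<Sum>a<m. \<Sum>b<m. (\<Sum>i<a. (real m)\<^sup>2 * cell_freq n (\<lambda>i. X i \<omega>) m i b - mid_density n m \<omega> i b)\<^sup>2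
     + (\<Sum>j<b. mid_density n m \<omega> a j - 1)\<^sup>2) / real m ^ 4"

text \<open>Normalising the modes costs two powers of \<open>m\<close> against the four that the
  energy divides by; the two that remain scale the discrete eigenvalues to those of the
  square.\<close>

proposition expectation_transport_energy_le:
  assumes n: "n > 0" and m: "m > 0"
  shows "expectation (transport_energy n m) \<le> neumann_sum m / real n" and "integrable M (transport_energy n m)"
proof -
  let ?F = "\<lambda>a b \<omega>. (\<Sum>i<a. (real m)\<^sup>2 * cell_freq n (\<lambda>i. X i \<omega>) m i b - mid_density n m \<omega> i b)\<^sup>2"
  let ?G = "\<lambda>a b \<omega>. (\<Sum>j<b. mid_density n m \<omega> a j - 1)\<^sup>2"
  have F: "integrable M (?F a b)" if "a < m" "b < m" for a b
    using expectation_dct_lincomb_square_le(2)[OF n m] that by (simp add: prefix_first[OF n m])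
  have G: "integrable M (?G a b)" for a b
    using expectation_dct_lincomb_square_le(2)[OF n m] by (simp add: prefix_second[OF n m])
  have FG: "integrable M (\<lambda>\<omega>. ?F a b \<omega> + ?G a b \<omega>)" if "a < m" "b < m" for a b
    using F[OF that] G by (rule Bochner_Integration.integrable_add)
  show "integrable M (transport_energy n m)"
    unfolding transport_energy_def[abs_def] using FG
    by (intro integrable_divide Bochner_Integration.integrable_sum) auto
  have "expectation (transport_energy n m) = (\<Sum>a<m. \<Sum>b<m. expectation (?F a b) + expectation (?G a b)) / real m ^ 4"
  proof -
    have "expectation (\<lambda>\<omega>. \<Sum>a<m. \<Sum>b<m. ?F a b \<omega> + ?G a b \<omega>) = (\<Sum>a<m. expectation (\<lambda>\<omega>. \<Sum>b<m. ?F a b \<omega> + ?G a b \<omega>))"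
      using FG by (intro Bochner_Integration.integral_sum Bochner_Integration.integrable_sum) auto
    also have "\<dots> = (\<Sum>a<m. \<Sum>b<m. expectation (\<lambda>\<omega>. ?F a b \<omega> + ?G a b \<omega>))"
      using FG by (intro sum.cong refl Bochner_Integration.integral_sum) auto
    also have "\<dots> = (\<Sum>a<m. \<Sum>b<m. expectation (?F a b) + expectation (?G a b))"
      using F G by (intro sum.cong refl Bochner_Integration.integral_add) auto
    finally show ?thesis unfolding transport_energy_def[abs_def] by simp
  qed
  also have "\<dots> \<le> ((real m)\<^sup>2 / real n * (\<Sum>j<m. \<Sum>k<m. dct_eigenvalue m j / (dct_eigenvalue m j + dct_eigenvalue m k)\<^sup>2)
      + (real m)\<^sup>2 / real n * (\<Sum>j<m. \<Sum>k<m. dct_eigenvalue m k / (dct_eigenvalue m j + dct_eigenvalue m k)\<^sup>2)) / real m ^ 4"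
    unfolding sum.distrib by (intro divide_right_mono add_mono expectation_prefix_first_le expectation_prefix_second_le n m) simp
  also have "\<dots> = (\<Sum>j<m. \<Sum>k<m. 1 / ((real m)\<^sup>2 * (dct_eigenvalue m j + dct_eigenvalue m k))) / real n"
  proof -
    have "(\<Sum>j<m. \<Sum>k<m. dct_eigenvalue m j / (dct_eigenvalue m j + dct_eigenvalue m k)\<^sup>2) + (\<Sum>j<m. \<Sum>k<m. dct_eigenvalue m k / (dct_eigenvalue m j + dct_eigenvalue m k)\<^sup>2)
      = (\<Sum>j<m. \<Sum>k<m. 1 / (dct_eigenvalue m j + dct_eigenvalue m k))"
      unfolding sum.distrib[symmetric] add_divide_distrib[symmetric] by (intro sum.cong refl) (simp add: power2_eq_square)
    moreover have "(\<Sum>j<m. \<Sum>k<m. 1 / ((real m)\<^sup>2 * (dct_eigenvalue m j + dct_eigenvalue m k))) = (\<Sum>j<m. \<Sum>k<m. 1 / (dct_eigenvalue m j + dct_eigenvalue m k)) / (real m)\<^sup>2"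
      unfolding sum_divide_distrib by (simp add: mult.commute)
    ultimately show ?thesis
      using m unfolding distrib_left[symmetric] by (simp add: power2_eq_square eval_nat_numeral)
  qed
  \<comment> \<open>The term of the constant mode is a division by zero, hence 0, and can be left
    out.\<close>
  also have "(\<Sum>j<m. \<Sum>k<m. 1 / ((real m)\<^sup>2 * (dct_eigenvalue m j + dct_eigenvalue m k))) = neumann_sum m"
    unfolding neumann_sum_def sum.cartesian_product using m by (intro sum.mono_neutral_right) auto
  finally show "expectation (transport_energy n m) \<le> neumann_sum m / real n" .
qed

section \<open>The expected cost of spreading the sample\<close>

lemma expectation_abs_fluctuation_le:
  assumes \<phi>: "square_bounded \<phi>" and n: "n > 0" and v: "(\<integral>z. (\<phi> z)\<^sup>2 \<partial>lebesgue_square) \<le> 4 / r\<^sup>2" and r: "r > 0"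
  shows "expectation (\<lambda>\<omega>. \<bar>fluctuation n \<phi> \<omega>\<bar>) \<le> 2 / (r * sqrt (real n))" and "integrable M (\<lambda>\<omega>. \<bar>fluctuation n \<phi> \<omega>\<bar>)"
proof -
  note [measurable] = square_bounded_measurable[OF \<phi>]
  \<comment> \<open>The first moment is bounded by the second through
    \<open>\<bar>F\<bar> \<le> (s * F\<^sup>2 + 1 / s) / 2\<close>. This \<open>s\<close> balances
    the two terms, because the second moment is at most \<open>1 / s\<^sup>2\<close>.\<close>
  define s where "s = r * sqrt (real n) / 2"
  have s: "s > 0" using r n by (simp add: s_def)
  note i = variance_fluctuation(2)[OF \<phi> n]
  have le: "\<bar>fluctuation n \<phi> \<omega>\<bar> \<le> (s * (fluctuation n \<phi> \<omega>)\<^sup>2 + 1 / s) / 2" for \<omega>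
  proof -
    have "0 \<le> (s * \<bar>fluctuation n \<phi> \<omega>\<bar> - 1)\<^sup>2" by simp
    then have "2 * s * \<bar>fluctuation n \<phi> \<omega>\<bar> \<le> s\<^sup>2 * (fluctuation n \<phi> \<omega>)\<^sup>2 + 1"
      by (simp add: power2_eq_square algebra_simps)
    then show ?thesis using s by (simp add: field_simps power2_eq_square)
  qed
  have i2: "integrable M (\<lambda>\<omega>. (s * (fluctuation n \<phi> \<omega>)\<^sup>2 + 1 / s) / 2)" using i by simp
  show i3: "integrable M (\<lambda>\<omega>. \<bar>fluctuation n \<phi> \<omega>\<bar>)"
    by (rule Bochner_Integration.integrable_bound[OF i2]) (use le in \<open>auto intro!: AE_I2 order_trans[OF _ abs_ge_self]\<close>)
  have "expectation (\<lambda>\<omega>. \<bar>fluctuation n \<phi> \<omega>\<bar>) \<le> expectation (\<lambda>\<omega>. (s * (fluctuation n \<phi> \<omega>)\<^sup>2 + 1 / s) / 2)"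
    using i3 i2 le by (rule integral_mono)
  also have "\<dots> = (s * expectation (\<lambda>\<omega>. (fluctuation n \<phi> \<omega>)\<^sup>2) + 1 / s) / 2" using i by (simp add: prob_space)
  also have "\<dots> \<le> (s * (4 / r\<^sup>2 / real n) + 1 / s) / 2"
  proof -
    have "expectation (\<lambda>\<omega>. (fluctuation n \<phi> \<omega>)\<^sup>2) \<le> 4 / r\<^sup>2 / real n"
      using variance_fluctuation_le[OF \<phi> n] divide_right_mono[OF v, of "real n"] by simp
    then show ?thesis using s by (intro divide_right_mono add_right_mono mult_left_mono) auto
  qed
  also have "\<dots> = 2 / (r * sqrt (real n))"
  proof -
    have q: "sqrt (real n) > 0" "real n = sqrt (real n) * sqrt (real n)" using n by auto
    define q where "q = sqrt (real n)"
    have "real n = q * q" "q > 0" using q by (auto simp: q_def)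
    then show ?thesis using r unfolding s_def q_def[symmetric] by (simp add: field_simps power2_eq_square)
  qed
  finally show "expectation (\<lambda>\<omega>. \<bar>fluctuation n \<phi> \<omega>\<bar>) \<le> 2 / (r * sqrt (real n))" .
qed

definition local_error :: "nat \<Rightarrow> nat \<Rightarrow> nat \<Rightarrow> 'w \<Rightarrow> real" where
  "local_error n m k \<omega> = 2 / (real (m * k))\<^sup>2 + 2 / (real m)\<^sup>2 * (\<Sum>c<m*k. \<Sum>d<m*k.
     \<bar>cell_freq n (\<lambda>i. X i \<omega>) (m * k) c d - cell_freq n (\<lambda>i. X i \<omega>) m (c div k) (d div k) / (real k)\<^sup>2\<bar>)"

text \<open>The mismatch is the fluctuation of the indicator of the fine cell minus
  \<open>1 / k\<^sup>2\<close> times that of its coarse cell; the means cancel. Each of the two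
  parts contributes at most \<open>2 / (m * k)\<^sup>2\<close> to the second moment.\<close>

lemma refinement_error:
  assumes n: "n > 0" and m: "m > 0" and k: "k > 0" and cd: "c < m * k" "d < m * k"
  defines "D \<equiv> \<lambda>\<omega>. \<bar>cell_freq n (\<lambda>i. X i \<omega>) (m * k) c d - cell_freq n (\<lambda>i. X i \<omega>) m (c div k) (d div k) / (real k)\<^sup>2\<bar>"
  shows "expectation D \<le> 2 / (real (m * k) * sqrt (real n))" "integrable M D"
proof -
  let ?r = "m * k"
  have r: "?r > 0" using m k by simp
  have CD: "c div k < m" "d div k < m" using cd by (auto simp: less_mult_imp_div_less)
  define f where "f z = (of_bool (cell ?r (z $ 1) = c \<and> cell ?r (z $ 2) = d) :: real)" for z :: "real^2"
  define g where "g z = (of_bool (cell m (z $ 1) = c div k \<and> cell m (z $ 2) = d div k) :: real)" for z :: "real^2"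
  define \<phi> where "\<phi> z = f z + (- (1 / (real k)\<^sup>2)) * g z" for z
  have f: "square_bounded f" unfolding f_def[abs_def] by (rule square_bounded_cell[OF r])
  have g: "square_bounded g" unfolding g_def[abs_def] by (rule square_bounded_cell[OF m])
  have \<phi>: "square_bounded \<phi>" unfolding \<phi>_def[abs_def] by (intro square_bounded_intros f g)
  have If: "integral\<^sup>L lebesgue_square f = 1 / (real ?r)\<^sup>2"
    using cell_freq_fluctuation[OF n r cd] unfolding f_def[symmetric] cell_freq_def fluctuation_def f_def[symmetric] by simp
  have Ig: "integral\<^sup>L lebesgue_square g = 1 / (real m)\<^sup>2"
    using cell_freq_fluctuation[OF n m CD] unfolding g_def[symmetric] cell_freq_def fluctuation_def g_def[symmetric] by simp
  have D: "D = (\<lambda>\<omega>. \<bar>fluctuation n \<phi> \<omega>\<bar>)"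
  proof
    fix \<omega>
    have "fluctuation n \<phi> \<omega> = fluctuation n f \<omega> + (- (1 / (real k)\<^sup>2)) * fluctuation n g \<omega>"
      unfolding \<phi>_def using f g by (simp only: fluctuation_add fluctuation_cmult square_bounded_intros)
    then show "D \<omega> = \<bar>fluctuation n \<phi> \<omega>\<bar>"
      unfolding D_def cell_freq_fluctuation[OF n r cd] cell_freq_fluctuation[OF n m CD] f_def[symmetric] g_def[symmetric]
      using k by (simp add: power_mult_distrib diff_divide_distrib add_divide_distrib)
  qed
  have "(\<integral>z. (\<phi> z)\<^sup>2 \<partial>lebesgue_square) \<le> (\<integral>z. 2 * f z + 2 / (real k)^4 * g z \<partial>lebesgue_square)"
  proof (rule integral_mono)
    show "integrable lebesgue_square (\<lambda>z. (\<phi> z)\<^sup>2)" "integrable lebesgue_square (\<lambda>z. 2 * f z + 2 / (real k)^4 * g z)"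
      by (intro integrable_square_bounded square_bounded_intros f g \<phi>)+
    fix z
    have sq: "(f z)\<^sup>2 = f z" "(g z)\<^sup>2 = g z" by (auto simp: f_def g_def)
    have "(\<phi> z)\<^sup>2 \<le> 2 * (f z)\<^sup>2 + 2 * (1 / (real k)\<^sup>2 * g z)\<^sup>2"
    proof -
      have "(a + (- c) * b)\<^sup>2 \<le> 2 * a\<^sup>2 + 2 * (c * b)\<^sup>2" for a b c :: real
        using zero_le_power2[of "a + c * b"] by (simp add: power2_eq_square algebra_simps)
      then show ?thesis unfolding \<phi>_def .
    qed
    also have "\<dots> = 2 * f z + 2 / (real k)^4 * g z"
      by (simp add: sq power_mult_distrib power_divide)
    finally show "(\<phi> z)\<^sup>2 \<le> 2 * f z + 2 / (real k)^4 * g z" .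
  qed
  also have "\<dots> = 2 / (real ?r)\<^sup>2 + 2 / (real k)^4 * (1 / (real m)\<^sup>2)"
    using integrable_square_bounded[OF f] integrable_square_bounded[OF g] by (simp add: If Ig)
  also have "\<dots> \<le> 4 / (real ?r)\<^sup>2"
  proof -
    have "(real k)\<^sup>2 * (real m)\<^sup>2 \<le> (real k)^4 * (real m)\<^sup>2"
      using k by (intro mult_right_mono power_increasing) auto
    then have "2 / ((real k)^4 * (real m)\<^sup>2) \<le> 2 / ((real k)\<^sup>2 * (real m)\<^sup>2)"
      using m k by (intro divide_left_mono) auto
    then show ?thesis by (simp add: power_mult_distrib mult.commute)
  qed
  finally have v: "(\<integral>z. (\<phi> z)\<^sup>2 \<partial>lebesgue_square) \<le> 4 / (real ?r)\<^sup>2" .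
  show "expectation D \<le> 2 / (real ?r * sqrt (real n))" "integrable M D"
    unfolding D using expectation_abs_fluctuation_le[OF \<phi> n v] r by auto
qed

text \<open>The \<open>(m * k)\<^sup>2\<close> fine cells together have an expected mismatch of at
  most \<open>2 * m * k / sqrt n\<close>; each unit of it costs
  \<open>2 / m\<^sup>2\<close>.\<close>

lemma expectation_local_error_le:
  assumes n: "n > 0" and m: "m > 0" and k: "k > 0"
  shows "expectation (local_error n m k) \<le> 2 / (real (m * k))\<^sup>2 + 4 * real k / (real m * sqrt (real n))" "integrable M (local_error n m k)"
proof -
  let ?r = "m * k"
  let ?D = "\<lambda>c d \<omega>. \<bar>cell_freq n (\<lambda>i. X i \<omega>) (m * k) c d - cell_freq n (\<lambda>i. X i \<omega>) m (c div k) (d div k) / (real k)\<^sup>2\<bar>"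
  note D = refinement_error[OF n m k]
  have i: "integrable M (\<lambda>\<omega>. \<Sum>c<?r. \<Sum>d<?r. ?D c d \<omega>)"
    using D(2) by (intro Bochner_Integration.integrable_sum) auto
  then show "integrable M (local_error n m k)" unfolding local_error_def[abs_def] by simp
  have "expectation (\<lambda>\<omega>. \<Sum>c<?r. \<Sum>d<?r. ?D c d \<omega>) = (\<Sum>c<?r. expectation (\<lambda>\<omega>. \<Sum>d<?r. ?D c d \<omega>))"
    using D(2) by (intro Bochner_Integration.integral_sum Bochner_Integration.integrable_sum) auto
  also have "\<dots> = (\<Sum>c<?r. \<Sum>d<?r. expectation (?D c d))"
    using D(2) by (intro sum.cong refl Bochner_Integration.integral_sum) auto
  also have "\<dots> \<le> (\<Sum>c<?r. \<Sum>d<?r. 2 / (real ?r * sqrt (real n)))"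
    using D(1) by (intro sum_mono) auto
  also have "\<dots> = 2 * real ?r / sqrt (real n)" using m k by (simp add: field_simps)
  finally have e: "expectation (\<lambda>\<omega>. \<Sum>c<?r. \<Sum>d<?r. ?D c d \<omega>) \<le> 2 * real ?r / sqrt (real n)" .
  have "expectation (local_error n m k) = 2 / (real ?r)\<^sup>2 + 2 / (real m)\<^sup>2 * expectation (\<lambda>\<omega>. \<Sum>c<?r. \<Sum>d<?r. ?D c d \<omega>)"
    unfolding local_error_def[abs_def] using i by (simp add: prob_space)
  also have "\<dots> \<le> 2 / (real ?r)\<^sup>2 + 2 / (real m)\<^sup>2 * (2 * real ?r / sqrt (real n))"
    by (intro add_left_mono mult_left_mono e) simp
  also have "2 / (real m)\<^sup>2 * (2 * real ?r / sqrt (real n)) = 4 * real k / (real m * sqrt (real n))"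
    using m by (simp add: power2_eq_square)
  finally show "expectation (local_error n m k) \<le> 2 / (real ?r)\<^sup>2 + 4 * real k / (real m * sqrt (real n))" .
qed

text \<open>The supremum is bounded term by term and the second moment by orthonormality, both by
  \<open>4 * m\<^sup>2\<close>; the Bernstein bound multiplies this by 4.\<close>

lemma bernstein_dct_lincomb:
  assumes n: "n > 0" and m: "m > 0" and w: "\<And>j k. \<bar>w j k\<bar> \<le> 2" and t: "0 < t" "t \<le> 1"
  shows "prob {\<omega> \<in> space M. \<bar>\<Sum>j<m. \<Sum>k<m. w j k * dct_coeff n m j k \<omega>\<bar> \<ge> t} \<le> 2 * exp (- real n * t\<^sup>2 / (16 * (real m)\<^sup>2))"
proof -
  have "prob {\<omega> \<in> space M. \<bar>fluctuation n (\<lambda>z. \<Sum>j<m. \<Sum>k<m. w j k * dct2 m j k z) \<omega>\<bar> \<ge> t} \<le> 2 * exp (- real n * t\<^sup>2 / (4 * (4 * (real m)\<^sup>2)))"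
  proof (rule bernstein)
    show "square_bounded (\<lambda>z. \<Sum>j<m. \<Sum>k<m. w j k * dct2 m j k z)" by (rule square_bounded_dct_lincomb[OF m])
    fix z
    have "\<bar>\<Sum>j<m. \<Sum>k<m. w j k * dct2 m j k z\<bar> \<le> (\<Sum>j<m. \<Sum>k<m. \<bar>w j k * dct2 m j k z\<bar>)"
      by (intro order_trans[OF sum_abs] sum_mono sum_abs)
    also have "\<dots> \<le> (\<Sum>j<m. \<Sum>k<m. 2 * 2)"
      unfolding abs_mult using w abs_dct2_le[OF m] by (intro sum_mono mult_mono) auto
    also have "\<dots> = 4 * (real m)\<^sup>2" by (simp add: power2_eq_square)
    finally show "\<bar>\<Sum>j<m. \<Sum>k<m. w j k * dct2 m j k z\<bar> \<le> 4 * (real m)\<^sup>2" .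
  next
    have "(w j k)\<^sup>2 \<le> 2\<^sup>2" for j k using w[of j k] by (metis abs_ge_zero power2_abs power_mono)
    then have "(\<Sum>j<m. \<Sum>k<m. (w j k)\<^sup>2) \<le> (\<Sum>j<m. \<Sum>k<m. 2\<^sup>2)" by (intro sum_mono) auto
    then show "(\<integral>z. (\<Sum>j<m. \<Sum>k<m. w j k * dct2 m j k z)\<^sup>2 \<partial>lebesgue_square) \<le> 4 * (real m)\<^sup>2"
      unfolding integral_dct_lincomb_square[OF m] by (simp add: power2_eq_square)
  qed (use m t n in auto)
  then show ?thesis unfolding fluctuation_dct_lincomb[OF m] by simp
qed

text \<open>By \<open>density_expansion\<close> and \<open>mid_density\<close>, the two sums are the
  deviations from 1 of the sample density and of the intermediate density, which the deterministic
  bound needs to be small in every cell.\<close>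

definition bad_event :: "nat \<Rightarrow> nat \<Rightarrow> real \<Rightarrow> 'w set" where
  "bad_event n m t = (\<Union>a<m. \<Union>b<m.
     {\<omega> \<in> space M. \<bar>\<Sum>j<m. \<Sum>k<m. (real m * (dct m j a * dct m k b)) * dct_coeff n m j k \<omega>\<bar> \<ge> t} \<union>
     {\<omega> \<in> space M. \<bar>\<Sum>j<m. \<Sum>k<m. (first_share m k j * (real m * (dct m j a * dct m k b))) * dct_coeff n m j k \<omega>\<bar> \<ge> t})"

lemma prob_bad_event_le:
  assumes n: "n > 0" and m: "m > 0" and t: "0 < t" "t \<le> 1"
  shows "prob (bad_event n m t) \<le> 4 * (real m)\<^sup>2 * exp (- real n * t\<^sup>2 / (16 * (real m)\<^sup>2))" and "bad_event n m t \<in> events"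
proof -
  let ?e = "exp (- real n * t\<^sup>2 / (16 * (real m)\<^sup>2))"
  define A where "A a b = {\<omega> \<in> space M. \<bar>\<Sum>j<m. \<Sum>k<m. (real m * (dct m j a * dct m k b)) * dct_coeff n m j k \<omega>\<bar> \<ge> t}" for a b
  define B where "B a b = {\<omega> \<in> space M. \<bar>\<Sum>j<m. \<Sum>k<m. (first_share m k j * (real m * (dct m j a * dct m k b))) * dct_coeff n m j k \<omega>\<bar> \<ge> t}" for a b
  have [measurable]: "dct_coeff n m j k \<in> borel_measurable M" for j k
    unfolding dct_coeff_def[abs_def] by (rule measurable_fluctuation[OF square_bounded_measurable[OF square_bounded_dct2[OF m]]])
  have [measurable]: "A a b \<in> events" "B a b \<in> events" for a b unfolding A_def B_def by measurable
  have w: "\<bar>real m * (dct m j a * dct m k b)\<bar> \<le> 2" for j k a b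
  proof -
    have "\<bar>dct m j a * dct m k b\<bar> \<le> sqrt (2 / real m) * sqrt (2 / real m)"
      unfolding abs_mult using abs_dct_le[OF m] by (intro mult_mono) auto
    then have "real m * \<bar>dct m j a * dct m k b\<bar> \<le> real m * (2 / real m)" by (intro mult_left_mono) auto
    then show ?thesis using m by (simp add: abs_mult)
  qed
  have w': "\<bar>first_share m k j * (real m * (dct m j a * dct m k b))\<bar> \<le> 2" for j k a b
    using mult_mono[OF first_share_bounds(2)[of m k j] w[of j a k b]] first_share_bounds(1)[of m k j] by (simp add: abs_mult)
  have AB: "prob (A a b \<union> B a b) \<le> 4 * ?e" for a b
  proof -
    have "prob (A a b) \<le> 2 * ?e" "prob (B a b) \<le> 2 * ?e"
      unfolding A_def B_def using w w' by (intro bernstein_dct_lincomb n m t; simp)+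
    then show ?thesis using measure_Un_le[of "A a b" M "B a b"] by simp
  qed
  have eq: "bad_event n m t = (\<Union>a<m. \<Union>b<m. A a b \<union> B a b)"
    by (simp add: bad_event_def A_def B_def)
  show "bad_event n m t \<in> events" unfolding eq by measurable
  have "prob (bad_event n m t) \<le> (\<Sum>a<m. prob (\<Union>b<m. A a b \<union> B a b))"
    unfolding eq by (intro finite_measure_subadditive_finite) auto
  also have "\<dots> \<le> (\<Sum>a<m. \<Sum>b<m. prob (A a b \<union> B a b))"
    by (intro sum_mono finite_measure_subadditive_finite) auto
  also have "\<dots> \<le> (\<Sum>a<m. \<Sum>b<m. 4 * ?e)" by (intro sum_mono AB)
  also have "\<dots> = 4 * (real m)\<^sup>2 * ?e" by (simp add: power2_eq_square)
  finally show "prob (bad_event n m t) \<le> 4 * (real m)\<^sup>2 * ?e" .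
qed

text \<open>Outside \<open>bad_event\<close> the deterministic bound applies; inside it the cost is
  at most 2, so only the probability of that event enters.\<close>

proposition expectation_square_cost_upper:
  assumes n: "n > 0" and m: "m > 0" and k: "k > 0" and t: "0 < t" "t < 1" and \<eta>: "\<eta> > 0"
  shows "expectation (\<lambda>\<omega>. square_cost n (\<lambda>i. X i \<omega>)) \<le>
     (1 + \<eta>) * ((1 + t) / (1 - t)\<^sup>2) * (neumann_sum m / real n)
     + (1 + 1 / \<eta>) * (2 / (real (m * k))\<^sup>2 + 4 * real k / (real m * sqrt (real n)))
     + 8 * (real m)\<^sup>2 * exp (- real n * t\<^sup>2 / (16 * (real m)\<^sup>2))"
proof -
  define K where "K = (1 + \<eta>) * ((1 + t) / (1 - t)\<^sup>2)"
  define H where "H = 1 + 1 / \<eta>"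
  have K: "K \<ge> 0" and H: "H \<ge> 0" using t \<eta> by (auto simp: K_def H_def)
  note bad = prob_bad_event_le[OF n m t(1) less_imp_le[OF t(2)]]
  have E0: "0 \<le> transport_energy n m \<omega>" for \<omega> unfolding transport_energy_def by (intro divide_nonneg_nonneg sum_nonneg) auto
  have L0: "0 \<le> local_error n m k \<omega>" for \<omega> unfolding local_error_def by (intro add_nonneg_nonneg mult_nonneg_nonneg sum_nonneg) auto
  let ?U = "\<lambda>\<omega>. K * transport_energy n m \<omega> + H * local_error n m k \<omega> + 2 * indicator (bad_event n m t) \<omega>"
  have le: "AE \<omega> in M. square_cost n (\<lambda>i. X i \<omega>) \<le> ?U \<omega>"
    using AE_sample_all AE_space
  proof eventually_elim
    case (elim \<omega>)
    have X: "\<And>i. i \<in> {1..n} \<Longrightarrow> X i \<omega> \<in> unit_square" using elim by auto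
    show ?case
    proof (cases "\<omega> \<in> bad_event n m t")
      case True
      have "square_cost n (\<lambda>i. X i \<omega>) \<le> 2" using n X closure_subset by (intro square_cost_le_2) auto
      moreover have "0 \<le> K * transport_energy n m \<omega> + H * local_error n m k \<omega>" using K H E0 L0 by simp
      ultimately show ?thesis using True by simp
    next
      case False
      have good: "\<bar>\<Sum>j<m. \<Sum>k<m. (real m * (dct m j a * dct m k b)) * dct_coeff n m j k \<omega>\<bar> < t"
        "\<bar>\<Sum>j<m. \<Sum>k<m. (first_share m k j * (real m * (dct m j a * dct m k b))) * dct_coeff n m j k \<omega>\<bar> < t"
        if "a < m" "b < m" for a b
        using False elim(2) that unfolding bad_event_def by (auto simp: not_le)
      have "square_cost n (\<lambda>i. X i \<omega>) \<le> (1 + \<eta>) * ((1 + t) / (1 - t)\<^sup>2) * transport_energy n m \<omega> + (1 + 1 / \<eta>) * local_error n m k \<omega>"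
        unfolding transport_energy_def local_error_def
      proof (rule square_cost_upper[OF n m k])
        fix a b assume ab: "a < m" "b < m"
        show "(real m)\<^sup>2 * cell_freq n (\<lambda>i. X i \<omega>) m a b \<le> 1 + t"
          using good(1)[OF ab] unfolding density_expansion[OF n m ab] by linarith
        show "1 - t \<le> mid_density n m \<omega> a b \<and> mid_density n m \<omega> a b \<le> 1 + t"
          using good(2)[OF ab] unfolding mid_density_def by linarith
      qed (use X t \<eta> rows_balanced[OF n m] columns_balanced[OF n m] in auto)
      then show ?thesis using False by (simp add: K_def H_def)
    qed
  qed
  note ET = expectation_transport_energy_le[OF n m] and EL = expectation_local_error_le[OF n m k]
  have ib: "integrable M (\<lambda>\<omega>. indicator (bad_event n m t) \<omega> :: real)" using bad(2) by (simp add: emeasure_eq_measure)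
  have iU: "integrable M ?U" using ET(2) EL(2) ib by simp
  have "expectation (\<lambda>\<omega>. square_cost n (\<lambda>i. X i \<omega>)) \<le> expectation ?U"
  proof (rule integral_mono_AE)
    show "integrable M (\<lambda>\<omega>. square_cost n (\<lambda>i. X i \<omega>))"
      by (rule Bochner_Integration.integrable_bound[OF iU]) (use le in \<open>auto elim!: eventually_mono intro: order_trans[OF _ abs_ge_self]\<close>)
  qed (use iU le in auto)
  also have "\<dots> = K * expectation (transport_energy n m) + H * expectation (local_error n m k) + 2 * prob (bad_event n m t)"
    using ET(2) EL(2) ib bad(2) by simp
  also have "\<dots> \<le> K * (neumann_sum m / real n) + H * (2 / (real (m * k))\<^sup>2 + 4 * real k / (real m * sqrt (real n)))
      + 2 * (4 * (real m)\<^sup>2 * exp (- real n * t\<^sup>2 / (16 * (real m)\<^sup>2)))"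
    using K H ET(1) EL(1) bad(1) by (intro add_mono mult_left_mono) auto
  finally show ?thesis by (simp add: K_def H_def)
qed

end

section \<open>Cut-off Dirichlet modes\<close>

lemma bounded_on_unit_interval:
  assumes "continuous_on UNIV (f :: real \<Rightarrow> real)"
  shows "\<exists>B. \<forall>x\<in>{0..1}. \<bar>f x\<bar> \<le> B"
proof -
  have "compact (f ` {0..1})" by (intro compact_continuous_image continuous_on_subset[OF assms]) auto
  then show ?thesis using compact_imp_bounded by (force simp: bounded_iff)
qed

text \<open>Two derivatives control the Hessian of the cut-off modes, the third controls how fast
  that Hessian varies. The mass missing from the cutoff, at most \<open>\<delta>\<close>, is what
  the linear term of the dual functional loses.\<close>

locale boundary_cutoff =
  fixes \<eta>0 \<eta>1 \<eta>2 \<eta>3 :: "real \<Rightarrow> real" and C \<delta> :: real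
  assumes deriv0: "\<And>x. (\<eta>0 has_real_derivative \<eta>1 x) (at x)"
    and deriv1: "\<And>x. (\<eta>1 has_real_derivative \<eta>2 x) (at x)"
    and deriv2: "\<And>x. (\<eta>2 has_real_derivative \<eta>3 x) (at x)"
    and cont3: "continuous_on UNIV \<eta>3"
    and range: "\<And>x. x \<in> {0..1} \<Longrightarrow> 0 \<le> \<eta>0 x \<and> \<eta>0 x \<le> 1"
    and bound: "\<And>x. x \<in> {0..1} \<Longrightarrow> \<bar>\<eta>1 x\<bar> \<le> C \<and> \<bar>\<eta>2 x\<bar> \<le> C \<and> \<bar>\<eta>3 x\<bar> \<le> C"
    and C: "C \<ge> 1"
    and vanish: "\<eta>0 0 = 0" "\<eta>0 1 = 0"
    and mass: "integral {0..1} (\<lambda>x. 1 - \<eta>0 x) \<le> \<delta>"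

text \<open>The polynomial \<open>1 - (2 * x - 1) ^ (2 * p)\<close> serves: it vanishes at both
  ends, its missing mass is \<open>1 / (2 * p + 1)\<close>, and all derivatives are polynomials,
  hence bounded on the interval.\<close>

lemma boundary_cutoff_exists:
  assumes "\<delta> > 0"
  shows "\<exists>\<eta>0 \<eta>1 \<eta>2 \<eta>3 C. boundary_cutoff \<eta>0 \<eta>1 \<eta>2 \<eta>3 C \<delta>"
proof -
  obtain p :: nat where p: "p > 0" "1 / \<delta> < real p" using reals_Archimedean2[of "1 / \<delta>"] assms
    by (metis divide_pos_pos less_trans of_nat_0_less_iff zero_less_one)
  define P :: "real poly" where "P = 1 - [:-1, 2:] ^ (2 * p)"
  have P: "poly P x = 1 - (2 * x - 1) ^ (2 * p)" for x by (simp add: P_def algebra_simps)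
  have "\<exists>B. \<forall>x\<in>{0..1}. \<bar>poly Q x\<bar> \<le> B" for Q :: "real poly"
    by (intro bounded_on_unit_interval continuous_intros)
  then have "\<forall>Q :: real poly. \<exists>B. \<forall>x\<in>{0..1}. \<bar>poly Q x\<bar> \<le> B" by blast
  from choice[OF this] obtain B where B: "\<And>Q x. x \<in> {0..1::real} \<Longrightarrow> \<bar>poly Q x\<bar> \<le> B Q" by blast
  define C where "C = 1 + \<bar>B (pderiv P)\<bar> + \<bar>B (pderiv (pderiv P))\<bar> + \<bar>B (pderiv (pderiv (pderiv P)))\<bar>"
  have C: "1 \<le> C" "B (pderiv P) \<le> C" "B (pderiv (pderiv P)) \<le> C" "B (pderiv (pderiv (pderiv P))) \<le> C"
    by (auto simp: C_def)
  have sq: "0 \<le> (2 * x - 1) ^ (2 * p) \<and> (2 * x - 1) ^ (2 * p) \<le> 1" if "x \<in> {0..1}" for x :: real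
  proof -
    have "\<bar>2 * x - 1\<bar> \<le> 1" using that by (auto simp: abs_le_iff)
    then have "(2 * x - 1)\<^sup>2 \<le> 1" by (simp add: abs_square_le_1)
    then show ?thesis by (simp add: power_mult power_le_one)
  qed
  have "boundary_cutoff (poly P) (poly (pderiv P)) (poly (pderiv (pderiv P))) (poly (pderiv (pderiv (pderiv P)))) C \<delta>"
  proof
    show "integral {0..1} (\<lambda>x. 1 - poly P x) \<le> \<delta>"
    proof -
      let ?F = "\<lambda>x. (2 * x - 1) ^ Suc (2 * p) / (2 * real (Suc (2 * p)))"
      have "((\<lambda>x. (2 * x - 1) ^ (2 * p)) has_integral ?F 1 - ?F 0) {0..1::real}"
      proof (rule fundamental_theorem_of_calculus)
        fix x :: real
        have "((\<lambda>x. (2 * x - 1) ^ Suc q) has_real_derivative real (Suc q) * (2 * x - 1) ^ q * 2) (at x)" for q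
          by (rule derivative_eq_intros refl | simp)+
        from DERIV_cdivide[OF this[of "2 * p"], of "2 * real (Suc (2 * p))"]
        moreover have "real (Suc (2 * p)) * (2 * x - 1) ^ (2 * p) * 2 / (2 * real (Suc (2 * p))) = (2 * x - 1) ^ (2 * p)"
          by (simp del: of_nat_Suc)
        ultimately have "(?F has_real_derivative (2 * x - 1) ^ (2 * p)) (at x)" by metis
        then show "(?F has_vector_derivative (2 * x - 1) ^ (2 * p)) (at x within {0..1})"
          by (simp add: has_real_derivative_iff_has_vector_derivative has_vector_derivative_at_within)
      qed simp
      moreover have "?F 1 - ?F 0 = 1 / real (2 * p + 1)" by (simp add: field_simps)
      ultimately have int: "((\<lambda>x. (2 * x - 1) ^ (2 * p)) has_integral 1 / real (2 * p + 1)) {0..1::real}" by simp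
      then have "integral {0..1} (\<lambda>x. 1 - poly P x) = 1 / real (2 * p + 1)"
        unfolding P by (simp add: integral_unique[OF int])
      also have "\<dots> \<le> 1 / real p" using p by (intro divide_left_mono) auto
      also have "\<dots> \<le> \<delta>" using p assms by (simp add: field_simps)
      finally show ?thesis .
    qed
    show "0 \<le> poly P x \<and> poly P x \<le> 1" if "x \<in> {0..1}" for x using sq[OF that] by (simp add: P)
    show "\<bar>poly (pderiv P) x\<bar> \<le> C \<and> \<bar>poly (pderiv (pderiv P)) x\<bar> \<le> C \<and> \<bar>poly (pderiv (pderiv (pderiv P))) x\<bar> \<le> C" if "x \<in> {0..1}" for x
      using order_trans[OF B[OF that] C(2)] order_trans[OF B[OF that] C(3)] order_trans[OF B[OF that] C(4)] by blast
    show "poly P 0 = 0" "poly P 1 = 0" using p by (simp_all add: P)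
  qed (use C in \<open>auto intro!: poly_DERIV continuous_intros\<close>)
  then show ?thesis by blast
qed

section \<open>Derivatives of the cut-off modes\<close>

context boundary_cutoff begin

definition s0 :: "nat \<Rightarrow> real \<Rightarrow> real" where
  "s0 j x = \<eta>0 x * sin (pi * real j * x)"
definition s1 :: "nat \<Rightarrow> real \<Rightarrow> real" where
  "s1 j x = \<eta>1 x * sin (pi * real j * x) + \<eta>0 x * (pi * real j) * cos (pi * real j * x)"
definition s2 :: "nat \<Rightarrow> real \<Rightarrow> real" where
  "s2 j x = \<eta>2 x * sin (pi * real j * x) + 2 * \<eta>1 x * (pi * real j) * cos (pi * real j * x)
     - \<eta>0 x * (pi * real j)\<^sup>2 * sin (pi * real j * x)"
definition s3 :: "nat \<Rightarrow> real \<Rightarrow> real" where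
  "s3 j x = \<eta>3 x * sin (pi * real j * x) + 3 * \<eta>2 x * (pi * real j) * cos (pi * real j * x)
     - 3 * \<eta>1 x * (pi * real j)\<^sup>2 * sin (pi * real j * x) - \<eta>0 x * (pi * real j) ^ 3 * cos (pi * real j * x)"

lemma deriv_s:
  "(s0 j has_real_derivative s1 j x) (at x)"
  "(s1 j has_real_derivative s2 j x) (at x)"
  "(s2 j has_real_derivative s3 j x) (at x)"
proof -
  define \<alpha> where "\<alpha> = pi * real j"
  have S: "((\<lambda>x. sin (\<alpha> * x)) has_real_derivative cos (\<alpha> * x) * \<alpha>) (at x)"
    and K: "((\<lambda>x. cos (\<alpha> * x)) has_real_derivative - sin (\<alpha> * x) * \<alpha>) (at x)" for x
    by (auto intro!: derivative_eq_intros)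
  note S0 = DERIV_mult[OF deriv0 S] and S1 = DERIV_mult[OF deriv1 S] and S2 = DERIV_mult[OF deriv2 S]
  note K0 = DERIV_mult[OF deriv0 K] and K1 = DERIV_mult[OF deriv1 K]
  have e0: "s0 j = (\<lambda>x. \<eta>0 x * sin (\<alpha> * x))" by (simp add: s0_def \<alpha>_def fun_eq_iff)
  have e1: "s1 j = (\<lambda>x. \<eta>1 x * sin (\<alpha> * x) + \<alpha> * (\<eta>0 x * cos (\<alpha> * x)))" by (simp add: s1_def \<alpha>_def fun_eq_iff)
  have e2: "s2 j = (\<lambda>x. \<eta>2 x * sin (\<alpha> * x) + 2 * \<alpha> * (\<eta>1 x * cos (\<alpha> * x)) + (- \<alpha>\<^sup>2) * (\<eta>0 x * sin (\<alpha> * x)))"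
    by (simp add: s2_def \<alpha>_def fun_eq_iff)
  show "(s0 j has_real_derivative s1 j x) (at x)"
    unfolding e0 by (rule DERIV_cong[OF S0]) (simp add: e1 algebra_simps)
  show "(s1 j has_real_derivative s2 j x) (at x)"
    unfolding e1 by (rule DERIV_cong[OF DERIV_add[OF S1 DERIV_cmult[OF K0]]]) (simp add: e2 algebra_simps power2_eq_square)
  show "(s2 j has_real_derivative s3 j x) (at x)"
    unfolding e2 by (rule DERIV_cong[OF DERIV_add[OF DERIV_add[OF S2 DERIV_cmult[OF K1]] DERIV_cmult[OF S0]]])
      (simp add: s3_def \<alpha>_def[symmetric] algebra_simps power2_eq_square power3_eq_cube)
qed

lemma continuous_s:
  "continuous_on UNIV (s0 j)" "continuous_on UNIV (s1 j)" "continuous_on UNIV (s2 j)"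
  by (rule continuous_at_imp_continuous_on, intro ballI, rule DERIV_isCont, rule deriv_s)+

text \<open>The cutoff and the sine both vanish at the ends, so their product has a double zero;
  this makes the gradient of the potential vanish on the boundary.\<close>

lemma s_boundary: "s0 j 0 = 0" "s0 j 1 = 0" "s1 j 0 = 0" "s1 j 1 = 0"
proof -
  have "sin (pi * real j) = 0" by (simp add: mult.commute)
  then show "s0 j 0 = 0" "s0 j 1 = 0" "s1 j 0 = 0" "s1 j 1 = 0" by (simp_all add: s0_def s1_def vanish)
qed

text \<open>By the Leibniz rule each term of the \<open>p\<close>-th derivative is at most
  \<open>C\<close> times the \<open>p\<close>-th power of the frequency
  \<open>pi * j \<ge> 1\<close>, times a binomial coefficient; for \<open>p = 3\<close> these
  coefficients add up to 8.\<close>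

lemma abs_s_le:
  assumes x: "x \<in> {0..1}" and j: "j \<ge> 1"
  shows "\<bar>s0 j x\<bar> \<le> 1" "\<bar>s1 j x\<bar> \<le> 8 * C * (pi * real j)" "\<bar>s2 j x\<bar> \<le> 8 * C * (pi * real j)\<^sup>2" "\<bar>s3 j x\<bar> \<le> 8 * C * (pi * real j) ^ 3"
proof -
  define \<alpha> where "\<alpha> = pi * real j"
  have "1 * 1 \<le> pi * real j" using pi_gt3 j by (intro mult_mono) auto
  then have a: "1 \<le> \<alpha>" by (simp add: \<alpha>_def)
  have a2: "\<alpha> \<le> \<alpha>\<^sup>2" "1 \<le> \<alpha>\<^sup>2" "1 \<le> \<alpha> ^ 3" "\<alpha> \<le> \<alpha> ^ 3" "\<alpha>\<^sup>2 \<le> \<alpha> ^ 3"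
    using a power_increasing[of 1 2 \<alpha>] power_increasing[of 0 2 \<alpha>] power_increasing[of 0 3 \<alpha>] power_increasing[of 1 3 \<alpha>] power_increasing[of 2 3 \<alpha>] by auto
  have e: "\<bar>\<eta>0 x\<bar> \<le> C" "\<bar>\<eta>0 x\<bar> \<le> 1" "\<bar>\<eta>1 x\<bar> \<le> C" "\<bar>\<eta>2 x\<bar> \<le> C" "\<bar>\<eta>3 x\<bar> \<le> C" using range[OF x] bound[OF x] C by auto
  have t: "\<bar>u * v * w\<bar> \<le> C * b" if "\<bar>u\<bar> \<le> C" "0 \<le> v" "v \<le> b" "\<bar>w\<bar> \<le> 1" for u v w b
  proof -
    have "\<bar>u * v * w\<bar> \<le> (C * b) * 1" unfolding abs_mult using that C by (intro mult_mono) auto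
    then show ?thesis by simp
  qed
  show "\<bar>s0 j x\<bar> \<le> 1" unfolding s0_def abs_mult using e by (intro mult_le_one) auto
  have "\<bar>\<eta>1 x * 1 * sin (\<alpha> * x)\<bar> \<le> C * \<alpha>" "\<bar>\<eta>0 x * \<alpha> * cos (\<alpha> * x)\<bar> \<le> C * \<alpha>"
    by (intro t e; use a in simp)+
  moreover have "0 \<le> C * \<alpha>" using C a by simp
  ultimately show "\<bar>s1 j x\<bar> \<le> 8 * C * (pi * real j)" unfolding s1_def \<alpha>_def[symmetric] by simp
  have "\<bar>\<eta>2 x * 1 * sin (\<alpha> * x)\<bar> \<le> C * \<alpha>\<^sup>2" "\<bar>\<eta>1 x * \<alpha> * cos (\<alpha> * x)\<bar> \<le> C * \<alpha>\<^sup>2" "\<bar>\<eta>0 x * \<alpha>\<^sup>2 * sin (\<alpha> * x)\<bar> \<le> C * \<alpha>\<^sup>2"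
    by (intro t e; use a a2 in simp)+
  moreover have "0 \<le> C * \<alpha>\<^sup>2" using C by simp
  ultimately show "\<bar>s2 j x\<bar> \<le> 8 * C * (pi * real j)\<^sup>2" unfolding s2_def \<alpha>_def[symmetric] by simp
  have "\<bar>\<eta>3 x * 1 * sin (\<alpha> * x)\<bar> \<le> C * \<alpha> ^ 3" "\<bar>\<eta>2 x * \<alpha> * cos (\<alpha> * x)\<bar> \<le> C * \<alpha> ^ 3" "\<bar>\<eta>1 x * \<alpha>\<^sup>2 * sin (\<alpha> * x)\<bar> \<le> C * \<alpha> ^ 3"
    "\<bar>\<eta>0 x * \<alpha> ^ 3 * cos (\<alpha> * x)\<bar> \<le> C * \<alpha> ^ 3"
    by (intro t e; use a a2 in simp)+
  then show "\<bar>s3 j x\<bar> \<le> 8 * C * (pi * real j) ^ 3" unfolding s3_def \<alpha>_def[symmetric] by simp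
qed

end

section \<open>Trigonometric integrals over the unit interval\<close>

lemma integral_sin_sin:
  assumes "j \<ge> 1" "k \<ge> 1"
  shows "integral {0..1} (\<lambda>x. sin (pi * real j * x) * sin (pi * real k * x)) = (if j = k then 1 / 2 else 0)"
proof (cases "j = k")
  case True
  let ?F = "\<lambda>x. x / 2 - sin (2 * (pi * real j * x)) / (4 * pi * real j)"
  have "((\<lambda>x. sin (pi * real j * x) * sin (pi * real j * x)) has_integral ?F 1 - ?F 0) {0..1}"
  proof (rule fundamental_theorem_of_calculus)
    fix x :: real
    have e: "sin a * sin a = (1 - cos (2 * a)) / 2" for a :: real
      by (simp add: cos_double_sin power2_eq_square)
    have "(?F has_real_derivative (1 - cos (2 * (pi * real j * x))) / 2) (at x)"
      using assms by (auto intro!: derivative_eq_intros simp: field_simps)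
    then show "(?F has_vector_derivative sin (pi * real j * x) * sin (pi * real j * x)) (at x within {0..1})"
      by (simp add: e has_real_derivative_iff_has_vector_derivative has_vector_derivative_at_within)
  qed simp
  moreover have "sin (2 * (pi * real j)) = 0" using sin_npi[of "2 * j"] by (simp add: mult_ac)
  ultimately show ?thesis using True by (simp add: integral_unique)
next
  case False
  define u where "u = real j - real k"
  define v where "v = real j + real k"
  have uv: "u \<noteq> 0" "v \<noteq> 0" using False assms by (auto simp: u_def v_def)
  let ?F = "\<lambda>x. sin (pi * u * x) / (2 * pi * u) - sin (pi * v * x) / (2 * pi * v)"
  have "((\<lambda>x. sin (pi * real j * x) * sin (pi * real k * x)) has_integral ?F 1 - ?F 0) {0..1}"
  proof (rule fundamental_theorem_of_calculus)
    fix x :: real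
    have e: "sin (pi * real j * x) * sin (pi * real k * x) = (cos (pi * u * x) - cos (pi * v * x)) / 2"
      unfolding sin_times_sin u_def v_def by (simp add: algebra_simps)
    have "(?F has_real_derivative (cos (pi * u * x) - cos (pi * v * x)) / 2) (at x)"
      using uv by (auto intro!: derivative_eq_intros simp: field_simps)
    then show "(?F has_vector_derivative sin (pi * real j * x) * sin (pi * real k * x)) (at x within {0..1})"
      by (simp add: e has_real_derivative_iff_has_vector_derivative has_vector_derivative_at_within)
  qed simp
  moreover have "sin (pi * u) = 0" "sin (pi * v) = 0"
    unfolding u_def v_def right_diff_distrib distrib_left sin_diff sin_add by (simp_all add: mult.commute)
  ultimately show ?thesis using False by (simp add: integral_unique)
qed

lemma integral_cos_square:
  assumes "j \<ge> 1"
  shows "integral {0..1} (\<lambda>x. (cos (pi * real j * x))\<^sup>2) = 1 / 2"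
proof -
  have "integral {0..1} (\<lambda>x. (cos (pi * real j * x))\<^sup>2) = integral {0..1} (\<lambda>x. 1 - sin (pi * real j * x) * sin (pi * real j * x))"
    by (intro Henstock_Kurzweil_Integration.integral_cong) (simp add: cos_squared_eq power2_eq_square[of "sin _"])
  also have "\<dots> = 1 - 1 / 2"
    using integral_sin_sin[OF assms assms]
    by (subst Henstock_Kurzweil_Integration.integral_diff) (auto intro!: integrable_continuous_real continuous_intros)
  finally show ?thesis by simp
qed

lemma abs_integral_sin_le:
  assumes "j \<ge> 1"
  shows "\<bar>integral {0..1} (\<lambda>x. sin (pi * real j * x))\<bar> \<le> 1 / real j"
proof -
  let ?F = "\<lambda>x. - cos (pi * real j * x) / (pi * real j)"
  have "((\<lambda>x. sin (pi * real j * x)) has_integral ?F 1 - ?F 0) {0..1}"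
  proof (rule fundamental_theorem_of_calculus)
    fix x :: real
    have "(?F has_real_derivative sin (pi * real j * x)) (at x)"
      using assms by (auto intro!: derivative_eq_intros simp: field_simps)
    then show "(?F has_vector_derivative sin (pi * real j * x)) (at x within {0..1})"
      by (simp add: has_real_derivative_iff_has_vector_derivative has_vector_derivative_at_within)
  qed simp
  then have "integral {0..1} (\<lambda>x. sin (pi * real j * x)) = (1 - cos (pi * real j)) / (pi * real j)"
    by (simp add: integral_unique diff_divide_distrib)
  moreover have "\<bar>(1 - cos (pi * real j)) / (pi * real j)\<bar> \<le> 2 / (pi * real j)"
    unfolding abs_divide using assms cos_ge_minus_one[of "pi * real j"] cos_le_one[of "pi * real j"]
    by (simp add: divide_right_mono abs_mult)
  moreover have "2 / (pi * real j) \<le> 1 / real j" using pi_gt3 assms by (simp add: field_simps)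
  ultimately show ?thesis by simp
qed

section \<open>The dual potential\<close>

lemma empirical_measure_eq_distr:
  assumes "n > 0"
  shows "empirical_measure n x = distr (uniform_count_measure {1..n}) borel x"
proof (rule measure_eqI)
  fix A assume "A \<in> sets (empirical_measure n x)"
  then have A: "A \<in> sets borel" by simp
  have "emeasure (distr (uniform_count_measure {1..n}) borel x) A = emeasure (uniform_count_measure {1..n}) (x -` A \<inter> {1..n})"
    using A by (subst emeasure_distr) (auto simp: space_uniform_count_measure)
  also have "\<dots> = of_nat (card (x -` A \<inter> {1..n})) / of_nat n"
    using assms by (subst emeasure_uniform_count_measure) (auto simp: ennreal_of_nat_eq_real_of_nat divide_ennreal)
  also have "\<dots> = (\<Sum>i=1..n. ennreal (1 / real n) * indicator A (x i))"
  proof -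
    have "(\<Sum>i=1..n. ennreal (1 / real n) * indicator A (x i)) = ennreal (1 / real n) * of_nat (card {i \<in> {1..n}. x i \<in> A})"
      by (simp add: sum_distrib_left[symmetric] indicator_def Int_def)
    also have "{i \<in> {1..n}. x i \<in> A} = x -` A \<inter> {1..n}" by auto
    finally show ?thesis
      using assms by (simp add: ennreal_of_nat_eq_real_of_nat divide_ennreal ennreal_mult[symmetric])
  qed
  finally show "emeasure (empirical_measure n x) A = emeasure (distr (uniform_count_measure {1..n}) borel x) A"
    using A by (simp add: nn_integral_empirical_set)
qed simp

lemma integral_empirical_measure:
  fixes f :: "'a::topological_space \<Rightarrow> real"
  assumes "n > 0" "f \<in> borel_measurable borel"
  shows "integral\<^sup>L (empirical_measure n x) f = (\<Sum>i=1..n. f (x i)) / real n" and "integrable (empirical_measure n x) f"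
proof -
  have [measurable]: "x \<in> uniform_count_measure {1..n} \<rightarrow>\<^sub>M borel"
    by (auto simp: measurable_def space_uniform_count_measure sets_uniform_count_measure)
  show "integral\<^sup>L (empirical_measure n x) f = (\<Sum>i=1..n. f (x i)) / real n"
    unfolding empirical_measure_eq_distr[OF assms(1)] using assms
    by (subst integral_distr, measurable) (simp_all add: integral_uniform_count_measure)
  show "integrable (empirical_measure n x) f"
    unfolding empirical_measure_eq_distr[OF assms(1)] using assms
    by (subst integrable_distr_eq, measurable) (simp_all add: uniform_count_measure_def integrable_point_measure_finite)
qed

text \<open>Taking partial derivatives stays within this form: the family \<open>a\<close> or
  \<open>b\<close> is replaced by its derivative.\<close>

definition tensor_sum :: "nat \<Rightarrow> (nat \<Rightarrow> nat \<Rightarrow> real) \<Rightarrow> (nat \<Rightarrow> real \<Rightarrow> real) \<Rightarrow> (nat \<Rightarrow> real \<Rightarrow> real) \<Rightarrow> real \<Rightarrow> real \<Rightarrow> real" where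
  "tensor_sum m \<beta> a b x y = (\<Sum>j=1..m. \<Sum>k=1..m. \<beta> j k * (a j x * b k y))"

lemma tensor_sum_line_deriv:
  assumes "\<And>j x. (a j has_real_derivative a' j x) (at x)" "\<And>j x. (b j has_real_derivative b' j x) (at x)"
  shows "((\<lambda>\<tau>. tensor_sum m \<beta> a b (x + \<tau> * c) (y + \<tau> * d)) has_real_derivative
     c * tensor_sum m \<beta> a' b (x + \<tau> * c) (y + \<tau> * d) + d * tensor_sum m \<beta> a b' (x + \<tau> * c) (y + \<tau> * d)) (at \<tau>)"
proof -
  have A: "((\<lambda>\<tau>. a j (x + \<tau> * c)) has_real_derivative a' j (x + \<tau> * c) * c) (at \<tau>)" for j
    by (rule DERIV_chain2[OF assms(1)]) (auto intro!: derivative_eq_intros)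
  have B: "((\<lambda>\<tau>. b j (y + \<tau> * d)) has_real_derivative b' j (y + \<tau> * d) * d) (at \<tau>)" for j
    by (rule DERIV_chain2[OF assms(2)]) (auto intro!: derivative_eq_intros)
  have "((\<lambda>\<tau>. tensor_sum m \<beta> a b (x + \<tau> * c) (y + \<tau> * d)) has_real_derivative
     (\<Sum>j=1..m. \<Sum>k=1..m. \<beta> j k * (a' j (x + \<tau> * c) * c * b k (y + \<tau> * d) + b' k (y + \<tau> * d) * d * a j (x + \<tau> * c)))) (at \<tau>)"
    unfolding tensor_sum_def by (intro DERIV_sum DERIV_cmult DERIV_mult A B)
  moreover have "(\<Sum>j=1..m. \<Sum>k=1..m. \<beta> j k * (a' j (x + \<tau> * c) * c * b k (y + \<tau> * d) + b' k (y + \<tau> * d) * d * a j (x + \<tau> * c)))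
     = c * tensor_sum m \<beta> a' b (x + \<tau> * c) (y + \<tau> * d) + d * tensor_sum m \<beta> a b' (x + \<tau> * c) (y + \<tau> * d)"
    unfolding tensor_sum_def sum_distrib_left sum.distrib[symmetric] by (intro sum.cong refl) (simp add: algebra_simps)
  ultimately show ?thesis by simp
qed

text \<open>Taylor's formula with a one-sided bound on the second derivative: first
  \<open>h'\<close>, then \<open>h\<close>, is compared with its polynomial by monotonicity.\<close>

lemma second_order_upper_bound:
  fixes h h' h'' :: "real \<Rightarrow> real"
  assumes h: "\<And>\<tau>. (h has_real_derivative h' \<tau>) (at \<tau>)" and h': "\<And>\<tau>. (h' has_real_derivative h'' \<tau>) (at \<tau>)"
    and K: "\<And>\<tau>. 0 \<le> \<tau> \<Longrightarrow> \<tau> \<le> 1 \<Longrightarrow> h'' \<tau> \<le> K"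
  shows "h 1 \<le> h 0 + h' 0 + K / 2"
proof -
  define g' where "g' \<tau> = h' \<tau> - h' 0 - K * \<tau>" for \<tau>
  have g'0: "g' \<tau> \<le> 0" if "0 \<le> \<tau>" "\<tau> \<le> 1" for \<tau>
  proof -
    have "g' \<tau> \<le> g' 0"
    proof (rule DERIV_nonpos_imp_nonincreasing[OF that(1), of g'])
      fix s assume s: "0 \<le> s" "s \<le> \<tau>"
      have "(g' has_real_derivative h'' s - K) (at s)"
        unfolding g'_def by (auto intro!: derivative_eq_intros h')
      then show "\<exists>y. (g' has_real_derivative y) (at s) \<and> y \<le> 0" using K[of s] s that by (intro exI[of _ "h'' s - K"]) auto
    qed
    then show ?thesis by (simp add: g'_def)
  qed
  define g where "g s = h s - h' 0 * s - K * s\<^sup>2 / 2" for s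
  have "g 1 \<le> g 0"
  proof (rule DERIV_nonpos_imp_nonincreasing[of 0 1 g])
    fix s :: real assume s: "0 \<le> s" "s \<le> 1"
    have "(g has_real_derivative g' s) (at s)"
      unfolding g'_def g_def by (auto intro!: derivative_eq_intros h)
    then show "\<exists>y. (g has_real_derivative y) (at s) \<and> y \<le> 0" using g'0[OF s] by blast
  qed simp
  then show ?thesis by (simp add: g_def)
qed

context boundary_cutoff begin

text \<open>Along the segment the second derivative is the Hessian form. With all entries bounded by
  \<open>t\<close> it is at most \<open>2 * t * (c\<^sup>2 + d\<^sup>2)\<close>, and Taylor's
  formula halves this.\<close>

lemma potential_semiconcave:
  assumes H: "\<And>x y. x \<in> {0..1} \<Longrightarrow> y \<in> {0..1} \<Longrightarrow> \<bar>tensor_sum m \<beta> s2 s0 x y\<bar> \<le> t \<and> \<bar>tensor_sum m \<beta> s1 s1 x y\<bar> \<le> t \<and> \<bar>tensor_sum m \<beta> s0 s2 x y\<bar> \<le> t"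
    and u: "u1 \<in> {0..1}" "u2 \<in> {0..1}" and v: "v1 \<in> {0..1}" "v2 \<in> {0..1}"
  shows "tensor_sum m \<beta> s0 s0 u1 u2 \<le> tensor_sum m \<beta> s0 s0 v1 v2
    + (u1 - v1) * tensor_sum m \<beta> s1 s0 v1 v2 + (u2 - v2) * tensor_sum m \<beta> s0 s1 v1 v2 + t * ((u1 - v1)\<^sup>2 + (u2 - v2)\<^sup>2)"
proof -
  define c d where "c = u1 - v1" and "d = u2 - v2"
  define h where "h \<tau> = tensor_sum m \<beta> s0 s0 (v1 + \<tau> * c) (v2 + \<tau> * d)" for \<tau>
  define h' where "h' \<tau> = c * tensor_sum m \<beta> s1 s0 (v1 + \<tau> * c) (v2 + \<tau> * d) + d * tensor_sum m \<beta> s0 s1 (v1 + \<tau> * c) (v2 + \<tau> * d)" for \<tau>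
  define h'' where "h'' \<tau> = c * (c * tensor_sum m \<beta> s2 s0 (v1 + \<tau> * c) (v2 + \<tau> * d) + d * tensor_sum m \<beta> s1 s1 (v1 + \<tau> * c) (v2 + \<tau> * d))
    + d * (c * tensor_sum m \<beta> s1 s1 (v1 + \<tau> * c) (v2 + \<tau> * d) + d * tensor_sum m \<beta> s0 s2 (v1 + \<tau> * c) (v2 + \<tau> * d))" for \<tau>
  have "h 1 \<le> h 0 + h' 0 + (2 * t * (c\<^sup>2 + d\<^sup>2)) / 2"
  proof (rule second_order_upper_bound[where h'' = h''])
    show "(h has_real_derivative h' \<tau>) (at \<tau>)" for \<tau>
      unfolding h_def h'_def by (rule tensor_sum_line_deriv[OF deriv_s(1) deriv_s(1)])
    show "(h' has_real_derivative h'' \<tau>) (at \<tau>)" for \<tau>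
      unfolding h'_def h''_def
      by (intro DERIV_add DERIV_cmult tensor_sum_line_deriv[OF deriv_s(2) deriv_s(1)] tensor_sum_line_deriv[OF deriv_s(1) deriv_s(2)])
    fix \<tau> :: real assume \<tau>: "0 \<le> \<tau>" "\<tau> \<le> 1"
    have "v1 + \<tau> * c = (1 - \<tau>) * v1 + \<tau> * u1" "v2 + \<tau> * d = (1 - \<tau>) * v2 + \<tau> * u2" by (simp_all add: c_def d_def algebra_simps)
    then have in01: "v1 + \<tau> * c \<in> {0..1}" "v2 + \<tau> * d \<in> {0..1}"
      using u v \<tau> convex_bound_le[of v1 1 u1 "1 - \<tau>" \<tau>] convex_bound_le[of v2 1 u2 "1 - \<tau>" \<tau>] by auto
    define A B D where "A = tensor_sum m \<beta> s2 s0 (v1 + \<tau> * c) (v2 + \<tau> * d)" and "B = tensor_sum m \<beta> s1 s1 (v1 + \<tau> * c) (v2 + \<tau> * d)"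
      and "D = tensor_sum m \<beta> s0 s2 (v1 + \<tau> * c) (v2 + \<tau> * d)"
    have ABD: "\<bar>A\<bar> \<le> t" "\<bar>B\<bar> \<le> t" "\<bar>D\<bar> \<le> t" using H[OF in01] by (auto simp: A_def B_def D_def)
    have "c\<^sup>2 * A \<le> c\<^sup>2 * t" "d\<^sup>2 * D \<le> d\<^sup>2 * t" using ABD by (intro mult_left_mono; simp)+
    moreover have "2 * (c * d) * B \<le> (c\<^sup>2 + d\<^sup>2) * t"
    proof -
      have "2 * (c * d) * B \<le> \<bar>2 * (c * d)\<bar> * \<bar>B\<bar>" by (metis abs_ge_self abs_mult)
      also have "\<dots> \<le> (c\<^sup>2 + d\<^sup>2) * t"
        using ABD zero_le_power2[of "c - d"] zero_le_power2[of "c + d"]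
        by (intro mult_mono) (auto simp: abs_le_iff power2_eq_square algebra_simps)
      finally show ?thesis .
    qed
    moreover have "h'' \<tau> = c\<^sup>2 * A + 2 * (c * d) * B + d\<^sup>2 * D"
      by (simp add: h''_def A_def B_def D_def power2_eq_square algebra_simps)
    ultimately show "h'' \<tau> \<le> 2 * t * (c\<^sup>2 + d\<^sup>2)" by (simp add: algebra_simps)
  qed
  then show ?thesis by (simp add: h_def h'_def c_def d_def)
qed

lemma tensor_sum_bounded:
  assumes "\<And>j. continuous_on UNIV (a j)" "\<And>j. continuous_on UNIV (b j)"
  shows "square_bounded (\<lambda>z. tensor_sum m \<beta> a b (z $ 1) (z $ 2))"
  unfolding tensor_sum_def
proof (intro square_bounded_intros)
  have *: "square_bounded (\<lambda>z. f (z $ i))" if f: "continuous_on UNIV f" for f :: "real \<Rightarrow> real" and i :: 2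
  proof -
    obtain B where B: "\<And>x. x \<in> {0..1} \<Longrightarrow> \<bar>f x\<bar> \<le> B" using bounded_on_unit_interval[OF f] by blast
    have [measurable]: "f \<in> borel_measurable borel" using f by (rule borel_measurable_continuous_onI)
    show ?thesis by (rule square_boundedI[where B = B]) (auto intro!: B simp: unit_square_def less_imp_le)
  qed
  show "square_bounded (\<lambda>z. a j (z $ 1))" "square_bounded (\<lambda>z. b j (z $ 2))" for j by (rule *[OF assms(1)], rule *[OF assms(2)])
qed

text \<open>Semiconcavity bounds \<open>f y\<close> by the expansion of \<open>f\<close> at
  \<open>z\<close> plus \<open>t\<close> times the squared distance. Young's inequality splits the
  gradient term into \<open>1 - t\<close> times the squared distance and
  \<open>G z / (4 * (1 - t))\<close>; the latter is absorbed by the second potential, so the pair is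
  admissible.\<close>

proposition square_cost_lower:
  fixes x :: "nat \<Rightarrow> real^2"
  assumes n: "n > 0" and x: "\<And>i. i \<in> {1..n} \<Longrightarrow> x i \<in> unit_square" and t: "0 < t" "t < 1"
    and H: "\<And>x y. x \<in> {0..1} \<Longrightarrow> y \<in> {0..1} \<Longrightarrow> \<bar>tensor_sum m \<beta> s2 s0 x y\<bar> \<le> t \<and> \<bar>tensor_sum m \<beta> s1 s1 x y\<bar> \<le> t \<and> \<bar>tensor_sum m \<beta> s0 s2 x y\<bar> \<le> t"
  defines "f \<equiv> \<lambda>z :: real^2. tensor_sum m \<beta> s0 s0 (z $ 1) (z $ 2)"
    and "G \<equiv> \<lambda>z :: real^2. (tensor_sum m \<beta> s1 s0 (z $ 1) (z $ 2))\<^sup>2 + (tensor_sum m \<beta> s0 s1 (z $ 1) (z $ 2))\<^sup>2"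
  shows "(\<Sum>i=1..n. f (x i)) / real n - (\<integral>z. f z \<partial>lebesgue_square) - (\<integral>z. G z \<partial>lebesgue_square) / (4 * (1 - t)) \<le> square_cost n x"
proof -
  have fb: "square_bounded f" unfolding f_def by (intro tensor_sum_bounded continuous_s)
  have Gb: "square_bounded G" unfolding G_def by (intro square_bounded_intros tensor_sum_bounded continuous_s)
  define g where "g z = - f z - G z / (4 * (1 - t))" for z
  have gb: "square_bounded g"
    unfolding g_def[abs_def] using square_bounded_diff[OF square_bounded_mult[OF square_bounded_const[of "-1"] fb] square_bounded_divide[OF Gb]] by simp
  note [measurable] = square_bounded_measurable[OF fb] square_bounded_measurable[OF gb]
  have bd: "z $ 1 = 0 \<or> z $ 1 = 1 \<or> z $ 2 = 0 \<or> z $ 2 = 1" if "z \<in> closure unit_square - unit_square" for z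
    using that by (auto simp: closure_unit_square_iff unit_square_iff)
  have f0: "f z = 0" and G0: "G z = 0" if "z \<in> closure unit_square - unit_square" for z
    using bd[OF that] by (auto simp: f_def G_def tensor_sum_def s_boundary)
  have fg: "f y + g z \<le> (norm (y - z))\<^sup>2" if "y \<in> closure unit_square" "z \<in> closure unit_square" for y z
  proof -
    define c d p q where "c = y $ 1 - z $ 1" and "d = y $ 2 - z $ 2" and "p = tensor_sum m \<beta> s1 s0 (z $ 1) (z $ 2)" and "q = tensor_sum m \<beta> s0 s1 (z $ 1) (z $ 2)"
    have *: "a * b \<le> (1 - t) * a\<^sup>2 + b\<^sup>2 / (4 * (1 - t))" for a b :: real
    proof -
      have "0 \<le> (2 * (1 - t) * a - b)\<^sup>2 / (4 * (1 - t))" using t by simp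
      also have "\<dots> = (1 - t) * a\<^sup>2 + b\<^sup>2 / (4 * (1 - t)) - a * b"
        using t by (simp add: field_simps power2_eq_square)
      finally show ?thesis by simp
    qed
    have "f y \<le> f z + c * p + d * q + t * (c\<^sup>2 + d\<^sup>2)"
      unfolding f_def c_def d_def p_def q_def using that by (intro potential_semiconcave H) (auto simp: closure_unit_square_iff)
    also have "\<dots> \<le> f z + ((1 - t) * c\<^sup>2 + p\<^sup>2 / (4 * (1 - t))) + ((1 - t) * d\<^sup>2 + q\<^sup>2 / (4 * (1 - t))) + t * (c\<^sup>2 + d\<^sup>2)"
      using *[of c p] *[of d q] by simp
    also have "\<dots> = f z + G z / (4 * (1 - t)) + (c\<^sup>2 + d\<^sup>2)"
      by (simp add: G_def p_def q_def add_divide_distrib algebra_simps)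
    finally show ?thesis by (simp add: g_def norm_vec2_diff c_def d_def)
  qed
  have int1: "(\<integral>z. indicator unit_square z * f z \<partial>empirical_measure n x) = (\<Sum>i=1..n. f (x i)) / real n"
    "integrable (empirical_measure n x) (\<lambda>z. indicator unit_square z * f z)"
    using x by (simp_all add: integral_empirical_measure[OF n])
  have "(\<integral>z. indicator unit_square z * g z \<partial>lebesgue_square) = (\<integral>z. g z \<partial>lebesgue_square)"
    by (intro integral_cong_AE) (auto intro: eventually_mono[OF AE_lebesgue_square])
  also have "\<dots> = - (\<integral>z. f z \<partial>lebesgue_square) - (\<integral>z. G z \<partial>lebesgue_square) / (4 * (1 - t))"
    unfolding g_def using integrable_square_bounded[OF fb] integrable_square_bounded[OF Gb] by simp
  finally have int2: "(\<integral>z. indicator unit_square z * g z \<partial>lebesgue_square) = \<dots>" .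
  have int3: "integrable lebesgue_square (\<lambda>z. indicator unit_square z * g z)"
    by (intro integrable_square_bounded square_bounded_mult[OF _ gb] square_boundedI[where B = 1]) auto
  have "ennreal ((\<Sum>i=1..n. f (x i)) / real n + (- (\<integral>z. f z \<partial>lebesgue_square) - (\<integral>z. G z \<partial>lebesgue_square) / (4 * (1 - t))))
     \<le> boundary_cost unit_square 2 (empirical_measure n x) lebesgue_square"
    unfolding int1(1)[symmetric] int2[symmetric]
  proof (rule boundary_cost_2_duality)
    show "g z = 0" if "z \<in> closure unit_square - unit_square" for z using f0[OF that] G0[OF that] by (simp add: g_def)
  qed (use f0 fg int1 int3 in auto)
  moreover have "boundary_cost unit_square 2 (empirical_measure n x) lebesgue_square < \<top>"
  proof -
    have "boundary_cost unit_square 2 (empirical_measure n x) lebesgue_square \<le> 2"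
      using x closure_subset by (intro boundary_cost_empirical_le_2[OF n]) blast
    then show ?thesis by (rule le_less_trans) simp
  qed
  ultimately have "enn2real (ennreal ((\<Sum>i=1..n. f (x i)) / real n + (- (\<integral>z. f z \<partial>lebesgue_square) - (\<integral>z. G z \<partial>lebesgue_square) / (4 * (1 - t))))) \<le> square_cost n x"
    unfolding square_cost_def by (intro enn2real_mono)
  \<comment> \<open>If the dual value is negative, \<open>ennreal\<close> truncates it to 0, which
    only increases it.\<close>
  moreover have "a \<le> enn2real (ennreal a)" for a by (cases "0 \<le> a") (auto intro: order_trans[OF _ enn2real_nonneg])
  ultimately show ?thesis by (smt (verit))
qed

end

section \<open>The expected cost: lower bound\<close>

context uniform_sample begin

text \<open>The covariance of two fluctuations is \<open>of_bool (K = L)\<close> minus the product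
  of the two means, over \<open>n\<close>. The products of means assemble into minus the integral of
  a square, which is dropped.\<close>

lemma expectation_quadratic_le:
  fixes e g :: "'k \<Rightarrow> real^2 \<Rightarrow> real"
  assumes e: "\<And>K. K \<in> I \<Longrightarrow> square_bounded (e K)" and g: "\<And>K. K \<in> I \<Longrightarrow> square_bounded (g K)" and fin: "finite I" and n: "n > 0"
    and orth: "\<And>K L. K \<in> I \<Longrightarrow> L \<in> I \<Longrightarrow> (\<integral>z. e K z * e L z \<partial>lebesgue_square) = of_bool (K = L)"
  defines "Q \<equiv> \<lambda>\<omega>. \<integral>z. (\<Sum>K\<in>I. fluctuation n (e K) \<omega> * g K z)\<^sup>2 \<partial>lebesgue_square"
  shows "expectation Q \<le> (\<Sum>K\<in>I. \<integral>z. (g K z)\<^sup>2 \<partial>lebesgue_square) / real n" and "integrable M Q"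
proof -
  define G where "G K L = (\<integral>z. g K z * g L z \<partial>lebesgue_square)" for K L
  have expand: "(\<integral>z. (\<Sum>K\<in>I. w K * g K z)\<^sup>2 \<partial>lebesgue_square) = (\<Sum>K\<in>I. \<Sum>L\<in>I. w K * w L * G K L)" for w
  proof -
    have i: "integrable lebesgue_square (\<lambda>z. w K * w L * (g K z * g L z))" if "K \<in> I" "L \<in> I" for K L
      using g that by (intro integrable_square_bounded square_bounded_intros)
    have "(\<integral>z. (\<Sum>K\<in>I. w K * g K z)\<^sup>2 \<partial>lebesgue_square) = (\<integral>z. (\<Sum>K\<in>I. \<Sum>L\<in>I. w K * w L * (g K z * g L z)) \<partial>lebesgue_square)"
      by (simp add: power2_eq_square sum_product mult_ac)
    also have "\<dots> = (\<Sum>K\<in>I. \<integral>z. (\<Sum>L\<in>I. w K * w L * (g K z * g L z)) \<partial>lebesgue_square)"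
      by (intro Bochner_Integration.integral_sum Bochner_Integration.integrable_sum i)
    also have "\<dots> = (\<Sum>K\<in>I. \<Sum>L\<in>I. \<integral>z. w K * w L * (g K z * g L z) \<partial>lebesgue_square)"
      by (intro sum.cong refl Bochner_Integration.integral_sum i)
    finally show ?thesis by (simp add: G_def)
  qed
  have Q: "Q = (\<lambda>\<omega>. \<Sum>K\<in>I. \<Sum>L\<in>I. fluctuation n (e K) \<omega> * fluctuation n (e L) \<omega> * G K L)"
    unfolding Q_def expand ..
  note cov = covariance_fluctuation[OF e e n]
  have i: "integrable M (\<lambda>\<omega>. fluctuation n (e K) \<omega> * fluctuation n (e L) \<omega> * G K L)" if "K \<in> I" "L \<in> I" for K L
    using cov(2)[OF that] by simp
  show "integrable M Q" unfolding Q by (intro Bochner_Integration.integrable_sum i)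
  have "expectation Q = (\<Sum>K\<in>I. expectation (\<lambda>\<omega>. \<Sum>L\<in>I. fluctuation n (e K) \<omega> * fluctuation n (e L) \<omega> * G K L))"
    unfolding Q by (intro Bochner_Integration.integral_sum Bochner_Integration.integrable_sum i)
  also have "\<dots> = (\<Sum>K\<in>I. \<Sum>L\<in>I. expectation (\<lambda>\<omega>. fluctuation n (e K) \<omega> * fluctuation n (e L) \<omega> * G K L))"
    by (intro sum.cong refl Bochner_Integration.integral_sum i)
  also have "\<dots> = (\<Sum>K\<in>I. \<Sum>L\<in>I. (of_bool (K = L) * G K L - integral\<^sup>L lebesgue_square (e K) * integral\<^sup>L lebesgue_square (e L) * G K L) / real n)"
    by (intro sum.cong refl) (simp add: cov(1) orth left_diff_distrib)
  also have "\<dots> = ((\<Sum>K\<in>I. \<Sum>L\<in>I. of_bool (K = L) * G K L) - (\<Sum>K\<in>I. \<Sum>L\<in>I. integral\<^sup>L lebesgue_square (e K) * integral\<^sup>L lebesgue_square (e L) * G K L)) / real n"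
    by (simp only: sum_divide_distrib[symmetric] sum_subtractf)
  also have "(\<Sum>K\<in>I. \<Sum>L\<in>I. integral\<^sup>L lebesgue_square (e K) * integral\<^sup>L lebesgue_square (e L) * G K L) = (\<integral>z. (\<Sum>K\<in>I. integral\<^sup>L lebesgue_square (e K) * g K z)\<^sup>2 \<partial>lebesgue_square)"
    by (rule expand[symmetric])
  also have "(\<Sum>K\<in>I. \<Sum>L\<in>I. of_bool (K = L) * G K L) = (\<Sum>K\<in>I. G K K)"
  proof (rule sum.cong[OF refl])
    fix K assume "K \<in> I"
    have "(\<Sum>L\<in>I. of_bool (K = L) * G K L) = (\<Sum>L\<in>I. if K = L then G K L else 0)" by (intro sum.cong refl) auto
    then show "(\<Sum>L\<in>I. of_bool (K = L) * G K L) = G K K" using fin \<open>K \<in> I\<close> by simp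
  qed
  also have "((\<Sum>K\<in>I. G K K) - (\<integral>z. (\<Sum>K\<in>I. integral\<^sup>L lebesgue_square (e K) * g K z)\<^sup>2 \<partial>lebesgue_square)) / real n \<le> (\<Sum>K\<in>I. G K K) / real n"
    by (intro divide_right_mono) auto
  finally show "expectation Q \<le> (\<Sum>K\<in>I. \<integral>z. (g K z)\<^sup>2 \<partial>lebesgue_square) / real n"
    by (simp add: G_def power2_eq_square)
qed

end

section \<open>Sine modes and Dirichlet eigenvalues\<close>

definition sine2 :: "nat \<Rightarrow> nat \<Rightarrow> real^2 \<Rightarrow> real" where
  "sine2 j k z = 2 * (sin (pi * real j * z $ 1) * sin (pi * real k * z $ 2))"

lemma abs_sine2_le: "\<bar>sine2 j k z\<bar> \<le> 2"
proof -
  have "\<bar>sin (pi * real j * z $ 1)\<bar> * \<bar>sin (pi * real k * z $ 2)\<bar> \<le> 1" by (intro mult_le_one) auto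
  then show ?thesis by (simp add: sine2_def abs_mult)
qed

lemma square_bounded_sine2: "square_bounded (sine2 j k)"
proof (rule square_boundedI[where B = 2])
  show "sine2 j k \<in> borel_measurable borel"
    unfolding sine2_def[abs_def] by (intro borel_measurable_continuous_onI continuous_intros)
qed (rule abs_sine2_le)

lemma sine2_orthonormal:
  assumes "j \<ge> 1" "k \<ge> 1" "j' \<ge> 1" "k' \<ge> 1"
  shows "(\<integral>z. sine2 j k z * sine2 j' k' z \<partial>lebesgue_square) = of_bool (j = j' \<and> k = k')"
proof -
  let ?f = "\<lambda>x. 4 * (sin (pi * real j * x) * sin (pi * real j' * x))" and ?g = "\<lambda>y. sin (pi * real k * y) * sin (pi * real k' * y)"
  have b: "\<bar>sin a * sin b\<bar> \<le> 1" for a b :: real unfolding abs_mult by (intro mult_le_one) auto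
  have "(\<integral>z. sine2 j k z * sine2 j' k' z \<partial>lebesgue_square) = (\<integral>z. ?f (z $ 1) * ?g (z $ 2) \<partial>lebesgue_square)"
    by (simp add: sine2_def mult_ac)
  also have "\<dots> = integral {0..1} ?f * integral {0..1} ?g"
  proof (rule integral_square_mult[where B = 4])
    show "\<bar>?f x\<bar> \<le> 4" "\<bar>?g x\<bar> \<le> 4" for x
      using b[of "pi * real j * x" "pi * real j' * x"] b[of "pi * real k * x" "pi * real k' * x"] by (simp_all add: abs_le_iff)
  qed (intro borel_measurable_continuous_onI continuous_intros)+
  also have "\<dots> = of_bool (j = j' \<and> k = k')"
    using integral_sin_sin[OF assms(1,3)] integral_sin_sin[OF assms(2,4)] by simp
  finally show ?thesis .
qed

text \<open>The sine modes do not have mean zero, so covariances carry a product of means as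
  correction. This decay makes the corrections summable against the inverse eigenvalues.\<close>

lemma integral_sine2_le:
  assumes "j \<ge> 1" "k \<ge> 1"
  shows "\<bar>integral\<^sup>L lebesgue_square (sine2 j k)\<bar> \<le> 2 / (real j * real k)"
proof -
  have "integral\<^sup>L lebesgue_square (sine2 j k) = 2 * (\<integral>z. sin (pi * real j * z $ 1) * sin (pi * real k * z $ 2) \<partial>lebesgue_square)"
    by (simp add: sine2_def[abs_def])
  also have "(\<integral>z. sin (pi * real j * z $ 1) * sin (pi * real k * z $ 2) \<partial>lebesgue_square)
     = integral {0..1} (\<lambda>x. sin (pi * real j * x)) * integral {0..1} (\<lambda>y. sin (pi * real k * y))"
    by (rule integral_square_mult[where B = 1]) (auto intro!: borel_measurable_continuous_onI continuous_intros)
  also have "\<bar>2 * (integral {0..1} (\<lambda>x. sin (pi * real j * x)) * integral {0..1} (\<lambda>y. sin (pi * real k * y)))\<bar> \<le> 2 * (1 / real j * (1 / real k))"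
    unfolding abs_mult using abs_integral_sin_le[OF assms(1)] abs_integral_sin_le[OF assms(2)] by (intro mult_mono) auto
  finally show ?thesis by simp
qed

definition dirichlet_eigenvalue :: "nat \<Rightarrow> nat \<Rightarrow> real" where
  "dirichlet_eigenvalue j k = pi\<^sup>2 * ((real j)\<^sup>2 + (real k)\<^sup>2)"

lemma dirichlet_eigenvalue_ge:
  assumes "j \<ge> 1" "k \<ge> 1"
  shows "1 \<le> dirichlet_eigenvalue j k" "18 * (real j * real k) \<le> dirichlet_eigenvalue j k"
    "(pi * real j)\<^sup>2 \<le> dirichlet_eigenvalue j k" "(pi * real k)\<^sup>2 \<le> dirichlet_eigenvalue j k" "pi * real j * (pi * real k) \<le> dirichlet_eigenvalue j k"
proof -
  have p: "9 \<le> pi\<^sup>2" using power_mono[of 3 pi 2] pi_gt3 by simp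
  have jk: "2 * (real j * real k) \<le> (real j)\<^sup>2 + (real k)\<^sup>2"
    using zero_le_power2[of "real j - real k"] by (simp add: power2_eq_square algebra_simps)
  have one: "1 \<le> real j * real k" using mult_mono[of 1 "real j" 1 "real k"] assms by simp
  have "9 * (2 * (real j * real k)) \<le> pi\<^sup>2 * ((real j)\<^sup>2 + (real k)\<^sup>2)" using p jk by (intro mult_mono) auto
  then show *: "18 * (real j * real k) \<le> dirichlet_eigenvalue j k" by (simp add: dirichlet_eigenvalue_def)
  then show "1 \<le> dirichlet_eigenvalue j k" using one by linarith
  show "(pi * real j)\<^sup>2 \<le> dirichlet_eigenvalue j k" "(pi * real k)\<^sup>2 \<le> dirichlet_eigenvalue j k"
    by (simp_all add: dirichlet_eigenvalue_def power_mult_distrib)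
  have "pi\<^sup>2 * (real j * real k) \<le> pi\<^sup>2 * ((real j)\<^sup>2 + (real k)\<^sup>2)" using jk one by (intro mult_left_mono) auto
  then show "pi * real j * (pi * real k) \<le> dirichlet_eigenvalue j k" by (simp add: dirichlet_eigenvalue_def power2_eq_square mult_ac)
qed

lemma sum_inverse_eigenvalue: "(\<Sum>j=1..m. \<Sum>k=1..m. 1 / dirichlet_eigenvalue j k) = lattice_sum m / pi\<^sup>2"
  by (simp add: lattice_sum_def dirichlet_eigenvalue_def sum_divide_distrib mult.commute)

lemma sum_inverse_products_le: "(\<Sum>j=1..m. \<Sum>k=1..m. 1 / ((real j)\<^sup>2 * (real k)\<^sup>2)) \<le> 4"
proof -
  have "(\<Sum>j=1..m. \<Sum>k=1..m. 1 / ((real j)\<^sup>2 * (real k)\<^sup>2)) = (\<Sum>j=1..m. 1 / (real j)\<^sup>2) * (\<Sum>k=1..m. 1 / (real k)\<^sup>2)"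
    by (simp add: sum_product)
  also have "\<dots> \<le> 2 * 2" using sum_inverse_squares_le[of m] by (intro mult_mono) (auto intro: sum_nonneg)
  finally show ?thesis by simp
qed

lemma sum_inverse_eigenvalue_square_le: "(\<Sum>j=1..m. \<Sum>k=1..m. 1 / (dirichlet_eigenvalue j k)\<^sup>2) \<le> 1"
proof -
  have "1 / (dirichlet_eigenvalue j k)\<^sup>2 \<le> 1 / 4 * (1 / ((real j)\<^sup>2 * (real k)\<^sup>2))" if "j \<ge> 1" "k \<ge> 1" for j k
  proof -
    have "2 * (real j * real k) \<le> dirichlet_eigenvalue j k"
      using dirichlet_eigenvalue_ge(2)[OF that] by (smt (verit) mult_nonneg_nonneg of_nat_0_le_iff)
    then have "(2 * (real j * real k))\<^sup>2 \<le> (dirichlet_eigenvalue j k)\<^sup>2" by (intro power_mono) auto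
    moreover have "0 < (2 * (real j * real k))\<^sup>2" using that by simp
    ultimately have "1 / (dirichlet_eigenvalue j k)\<^sup>2 \<le> 1 / (2 * (real j * real k))\<^sup>2" by (intro frac_le) auto
    then show ?thesis by (simp add: power_mult_distrib)
  qed
  then have "(\<Sum>j=1..m. \<Sum>k=1..m. 1 / (dirichlet_eigenvalue j k)\<^sup>2) \<le> (\<Sum>j=1..m. \<Sum>k=1..m. 1 / 4 * (1 / ((real j)\<^sup>2 * (real k)\<^sup>2)))"
    by (intro sum_mono) auto
  also have "\<dots> = 1 / 4 * (\<Sum>j=1..m. \<Sum>k=1..m. 1 / ((real j)\<^sup>2 * (real k)\<^sup>2))" by (simp only: sum_distrib_left)
  also have "\<dots> \<le> 1" using sum_inverse_products_le[of m] by simp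
  finally show ?thesis .
qed

section \<open>Inner products and energies of the cut-off modes\<close>

context boundary_cutoff begin

lemma integral_s0_square_le:
  assumes "k \<ge> 1"
  shows "integral {0..1} (\<lambda>x. (s0 k x)\<^sup>2) \<le> 1 / 2"
proof -
  have "integral {0..1} (\<lambda>x. (s0 k x)\<^sup>2) \<le> integral {0..1} (\<lambda>x. sin (pi * real k * x) * sin (pi * real k * x))"
  proof (rule integral_le)
    show "(\<lambda>x. (s0 k x)\<^sup>2) integrable_on {0..1}"
      by (intro integrable_continuous_real continuous_intros continuous_on_subset[OF continuous_s(1)]) auto
    show "(\<lambda>x. sin (pi * real k * x) * sin (pi * real k * x)) integrable_on {0..1}"
      by (intro integrable_continuous_real continuous_intros)
    fix x :: real assume x: "x \<in> {0..1}"
    have "(\<eta>0 x)\<^sup>2 \<le> 1" using range[OF x] by (simp add: power_le_one)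
    then have "(\<eta>0 x)\<^sup>2 * (sin (pi * real k * x))\<^sup>2 \<le> 1 * (sin (pi * real k * x))\<^sup>2" by (intro mult_right_mono) auto
    then show "(s0 k x)\<^sup>2 \<le> sin (pi * real k * x) * sin (pi * real k * x)"
      by (simp add: s0_def power_mult_distrib power2_eq_square[of "sin _"])
  qed
  then show ?thesis using integral_sin_sin[OF assms assms] by simp
qed

text \<open>Of the two terms of the product rule, the one that differentiates the sine grows with
  \<open>j\<close> and gets the factor \<open>1 + \<theta>\<close>; the one that differentiates the
  cutoff is bounded uniformly in \<open>j\<close>.\<close>

lemma integral_s1_square_le:
  assumes j: "j \<ge> 1" and \<theta>: "\<theta> > 0"
  shows "integral {0..1} (\<lambda>x. (s1 j x)\<^sup>2) \<le> (1 + \<theta>) * (pi * real j)\<^sup>2 / 2 + (1 + 1 / \<theta>) * C\<^sup>2"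
proof -
  let ?\<alpha> = "pi * real j"
  have "integral {0..1} (\<lambda>x. (s1 j x)\<^sup>2) \<le> integral {0..1} (\<lambda>x. (1 + \<theta>) * ?\<alpha>\<^sup>2 * (cos (?\<alpha> * x))\<^sup>2 + (1 + 1 / \<theta>) * C\<^sup>2)"
  proof (rule integral_le)
    show "(\<lambda>x. (s1 j x)\<^sup>2) integrable_on {0..1}"
      by (intro integrable_continuous_real continuous_intros continuous_on_subset[OF continuous_s(2)]) auto
    show "(\<lambda>x. (1 + \<theta>) * ?\<alpha>\<^sup>2 * (cos (?\<alpha> * x))\<^sup>2 + (1 + 1 / \<theta>) * C\<^sup>2) integrable_on {0..1}"
      by (intro integrable_continuous_real continuous_intros)
    fix x :: real assume x: "x \<in> {0..1}"
    define u where "u = \<eta>0 x * ?\<alpha> * cos (?\<alpha> * x)"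
    define v where "v = \<eta>1 x * sin (?\<alpha> * x)"
    have "(s1 j x)\<^sup>2 \<le> (1 + \<theta>) * u\<^sup>2 + (1 + 1 / \<theta>) * v\<^sup>2"
      using norm_add_square_le[OF \<theta>, of u v] by (simp add: s1_def u_def v_def add.commute)
    moreover have "(1 + \<theta>) * u\<^sup>2 \<le> (1 + \<theta>) * (?\<alpha>\<^sup>2 * (cos (?\<alpha> * x))\<^sup>2)"
    proof (intro mult_left_mono)
      have "(\<eta>0 x)\<^sup>2 * (?\<alpha>\<^sup>2 * (cos (?\<alpha> * x))\<^sup>2) \<le> 1 * (?\<alpha>\<^sup>2 * (cos (?\<alpha> * x))\<^sup>2)"
        using range[OF x] by (intro mult_right_mono) (auto simp: power_le_one)
      then show "u\<^sup>2 \<le> ?\<alpha>\<^sup>2 * (cos (?\<alpha> * x))\<^sup>2" by (simp add: u_def power_mult_distrib mult.assoc)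
    qed (use \<theta> in auto)
    moreover have "(1 + 1 / \<theta>) * v\<^sup>2 \<le> (1 + 1 / \<theta>) * C\<^sup>2"
    proof (intro mult_left_mono)
      have "\<bar>v\<bar> \<le> C * 1" unfolding v_def abs_mult using bound[OF x] C by (intro mult_mono) auto
      then have "\<bar>v\<bar>\<^sup>2 \<le> C\<^sup>2" by (intro power_mono) auto
      then show "v\<^sup>2 \<le> C\<^sup>2" by simp
    qed (use \<theta> in auto)
    ultimately show "(s1 j x)\<^sup>2 \<le> (1 + \<theta>) * ?\<alpha>\<^sup>2 * (cos (?\<alpha> * x))\<^sup>2 + (1 + 1 / \<theta>) * C\<^sup>2" by (simp only: mult.assoc)
  qed
  also have "\<dots> = (1 + \<theta>) * ?\<alpha>\<^sup>2 * integral {0..1} (\<lambda>x. (cos (?\<alpha> * x))\<^sup>2) + (1 + 1 / \<theta>) * C\<^sup>2"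
    by (subst Henstock_Kurzweil_Integration.integral_add) (auto intro!: integrable_continuous_real continuous_intros)
  finally show ?thesis unfolding integral_cos_square[OF j] by simp
qed

text \<open>Replacing the sine by its cut-off version removes \<open>(1 - \<eta>0 x)\<close> times a
  squared sine, hence at most the missing mass.\<close>

lemma integral_sin_s0_ge:
  assumes "j \<ge> 1"
  shows "1 / 2 - \<delta> \<le> integral {0..1} (\<lambda>x. sin (pi * real j * x) * s0 j x)"
proof -
  have c: "continuous_on {0..1} \<eta>0" using deriv0 by (meson DERIV_isCont continuous_at_imp_continuous_on)
  have "1 / 2 - \<delta> \<le> integral {0..1} (\<lambda>x. sin (pi * real j * x) * sin (pi * real j * x)) - integral {0..1} (\<lambda>x. 1 - \<eta>0 x)"
    using integral_sin_sin[OF assms assms] mass by simp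
  also have "\<dots> = integral {0..1} (\<lambda>x. sin (pi * real j * x) * sin (pi * real j * x) - (1 - \<eta>0 x))"
    by (intro Henstock_Kurzweil_Integration.integral_diff[symmetric] integrable_continuous_real continuous_intros c)
  also have "\<dots> \<le> integral {0..1} (\<lambda>x. sin (pi * real j * x) * s0 j x)"
  proof (rule integral_le)
    show "(\<lambda>x. sin (pi * real j * x) * sin (pi * real j * x) - (1 - \<eta>0 x)) integrable_on {0..1}"
      "(\<lambda>x. sin (pi * real j * x) * s0 j x) integrable_on {0..1}"
      by (intro integrable_continuous_real continuous_intros c continuous_on_subset[OF continuous_s(1)]; auto)+
    fix x :: real assume x: "x \<in> {0..1}"
    have "(1 - \<eta>0 x) * (sin (pi * real j * x))\<^sup>2 \<le> (1 - \<eta>0 x) * 1"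
      using range[OF x] by (intro mult_left_mono) (auto simp: abs_square_le_1)
    then show "sin (pi * real j * x) * sin (pi * real j * x) - (1 - \<eta>0 x) \<le> sin (pi * real j * x) * s0 j x"
      by (simp add: s0_def power2_eq_square algebra_simps)
  qed
  finally show ?thesis .
qed

text \<open>The mode \<open>sine2 j k\<close> multiplied by the cutoff in each variable.\<close>

definition bump :: "nat \<Rightarrow> nat \<Rightarrow> real^2 \<Rightarrow> real" where
  "bump j k z = 2 * (s0 j (z $ 1) * s0 k (z $ 2))"

lemma square_bounded_s_product:
  assumes "continuous_on UNIV f" "continuous_on UNIV g"
  shows "square_bounded (\<lambda>z. c * (f (z $ 1) * g (z $ 2)))"
proof -
  have "square_bounded (\<lambda>z. tensor_sum 1 (\<lambda>_ _. c) (\<lambda>_. f) (\<lambda>_. g) (z $ 1) (z $ 2))"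
    using assms by (intro tensor_sum_bounded)
  then show ?thesis by (simp add: tensor_sum_def)
qed

lemma square_bounded_bump: "square_bounded (bump j k)"
  unfolding bump_def[abs_def] by (intro square_bounded_s_product continuous_s)

lemma abs_bump_le:
  assumes "j \<ge> 1" "k \<ge> 1" "z \<in> unit_square"
  shows "\<bar>bump j k z\<bar> \<le> 2"
proof -
  have "\<bar>s0 j (z $ 1)\<bar> * \<bar>s0 k (z $ 2)\<bar> \<le> 1"
    using abs_s_le(1)[of "z $ 1" j] abs_s_le(1)[of "z $ 2" k] assms by (intro mult_le_one) (auto simp: unit_square_iff)
  then show ?thesis by (simp add: bump_def abs_mult)
qed

lemma integral_square_mult_continuous:
  fixes f g :: "real \<Rightarrow> real"
  assumes "continuous_on UNIV f" "continuous_on UNIV g"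
  shows "(\<integral>z. f (z $ 1) * g (z $ 2) \<partial>lebesgue_square) = integral {0..1} f * integral {0..1} g"
proof -
  obtain A B where "\<And>x. x \<in> {0..1} \<Longrightarrow> \<bar>f x\<bar> \<le> A" "\<And>x. x \<in> {0..1} \<Longrightarrow> \<bar>g x\<bar> \<le> B"
    using bounded_on_unit_interval assms by metis
  then show ?thesis
    using assms by (intro integral_square_mult[where B = "max A B"] borel_measurable_continuous_onI) (auto simp: le_max_iff_disj)
qed

lemma integral_sine2_bump_ge:
  assumes "j \<ge> 1" "k \<ge> 1" "\<delta> \<le> 1 / 2"
  shows "1 - 4 * \<delta> \<le> (\<integral>z. sine2 j k z * bump j k z \<partial>lebesgue_square)"
proof -
  have "(\<integral>z. sine2 j k z * bump j k z \<partial>lebesgue_square) = (\<integral>z. 4 * ((sin (pi * real j * z $ 1) * s0 j (z $ 1)) * (sin (pi * real k * z $ 2) * s0 k (z $ 2))) \<partial>lebesgue_square)"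
    by (simp add: sine2_def bump_def mult_ac)
  also have "\<dots> = 4 * (\<integral>z. (sin (pi * real j * z $ 1) * s0 j (z $ 1)) * (sin (pi * real k * z $ 2) * s0 k (z $ 2)) \<partial>lebesgue_square)"
    by (rule integral_mult_right_zero)
  also have "\<dots> = 4 * (integral {0..1} (\<lambda>x. sin (pi * real j * x) * s0 j x) * integral {0..1} (\<lambda>x. sin (pi * real k * x) * s0 k x))"
    by (intro arg_cong[where f = "\<lambda>x. 4 * x"] integral_square_mult_continuous continuous_intros continuous_s)
  also have "\<dots> \<ge> 4 * ((1 / 2 - \<delta>) * (1 / 2 - \<delta>))"
    using integral_sin_s0_ge[OF assms(1)] integral_sin_s0_ge[OF assms(2)] assms(3) by (intro mult_left_mono mult_mono) auto
  moreover have "4 * ((1 / 2 - \<delta>) * (1 / 2 - \<delta>)) \<ge> 1 - 4 * \<delta>"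
    using zero_le_power2[of \<delta>] by (simp add: algebra_simps power2_eq_square)
  ultimately show ?thesis by linarith
qed

lemma abs_integral_bump_le:
  assumes "j \<ge> 1" "k \<ge> 1"
  shows "\<bar>integral\<^sup>L lebesgue_square (bump j k)\<bar> \<le> 2"
proof -
  have "\<bar>integral\<^sup>L lebesgue_square (bump j k)\<bar> \<le> (\<integral>z. \<bar>bump j k z\<bar> \<partial>lebesgue_square)"
    using integral_norm_bound[of lebesgue_square "bump j k"] by simp
  also have "\<dots> \<le> (\<integral>z. 2 \<partial>lebesgue_square)"
    using abs_bump_le[OF assms] integrable_square_bounded[OF square_bounded_bump]
    by (intro integral_mono_AE) (auto intro: eventually_mono[OF AE_lebesgue_square])
  finally show ?thesis using lebesgue_square.prob_space by simp
qed

text \<open>Up to \<open>1 + \<theta>\<close> the energy is that of the mode without cutoff, namely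
  its eigenvalue. The price of the cutoff does not grow with the mode, so it is summable after
  division by the squared eigenvalue.\<close>

lemma integral_gradient_bump_le:
  assumes "j \<ge> 1" "k \<ge> 1" and \<theta>: "\<theta> > 0"
  shows "(\<integral>z. (2 * (s1 j (z $ 1) * s0 k (z $ 2)))\<^sup>2 \<partial>lebesgue_square) + (\<integral>z. (2 * (s0 j (z $ 1) * s1 k (z $ 2)))\<^sup>2 \<partial>lebesgue_square)
    \<le> (1 + \<theta>) * dirichlet_eigenvalue j k + 4 * (1 + 1 / \<theta>) * C\<^sup>2"
proof -
  have eq: "(\<integral>z. (2 * (f (z $ 1) * g (z $ 2)))\<^sup>2 \<partial>lebesgue_square) = 4 * (integral {0..1} (\<lambda>x. (f x)\<^sup>2) * integral {0..1} (\<lambda>x. (g x)\<^sup>2))"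
    if "continuous_on UNIV f" "continuous_on UNIV g" for f g :: "real \<Rightarrow> real"
  proof -
    have "(\<integral>z. (2 * (f (z $ 1) * g (z $ 2)))\<^sup>2 \<partial>lebesgue_square) = 4 * (\<integral>z. (f (z $ 1))\<^sup>2 * (g (z $ 2))\<^sup>2 \<partial>lebesgue_square)"
      by (simp add: power_mult_distrib)
    then show ?thesis using that by (subst (asm) integral_square_mult_continuous) (auto intro!: continuous_intros)
  qed
  have nn: "0 \<le> integral {0..1} (\<lambda>x. (s1 j x)\<^sup>2)" for j
    by (intro Henstock_Kurzweil_Integration.integral_nonneg integrable_continuous_real continuous_intros continuous_on_subset[OF continuous_s(2)]) auto
  have "integral {0..1} (\<lambda>x. (s1 j x)\<^sup>2) * integral {0..1} (\<lambda>x. (s0 k x)\<^sup>2) \<le> ((1 + \<theta>) * (pi * real j)\<^sup>2 / 2 + (1 + 1 / \<theta>) * C\<^sup>2) * (1 / 2)"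
    using integral_s1_square_le[OF assms(1) \<theta>] integral_s0_square_le[OF assms(2)] nn \<theta>
    by (intro mult_mono') (auto intro!: Henstock_Kurzweil_Integration.integral_nonneg integrable_continuous_real continuous_intros continuous_on_subset[OF continuous_s(1)])
  moreover have "integral {0..1} (\<lambda>x. (s0 j x)\<^sup>2) * integral {0..1} (\<lambda>x. (s1 k x)\<^sup>2) \<le> (1 / 2) * ((1 + \<theta>) * (pi * real k)\<^sup>2 / 2 + (1 + 1 / \<theta>) * C\<^sup>2)"
    using integral_s1_square_le[OF assms(2) \<theta>] integral_s0_square_le[OF assms(1)] nn \<theta>
    by (intro mult_mono') (auto intro!: Henstock_Kurzweil_Integration.integral_nonneg integrable_continuous_real continuous_intros continuous_on_subset[OF continuous_s(1)])
  moreover have "(1 + \<theta>) * dirichlet_eigenvalue j k = (1 + \<theta>) * (pi * real j)\<^sup>2 + (1 + \<theta>) * (pi * real k)\<^sup>2"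
    by (simp add: dirichlet_eigenvalue_def power_mult_distrib algebra_simps)
  moreover define A where "A = (1 + 1 / \<theta>) * C\<^sup>2"
  moreover have "4 * (1 + 1 / \<theta>) * C\<^sup>2 = 4 * A" by (simp add: A_def)
  moreover have "4 * x + 4 * y \<le> l + r" if "x \<le> (a / 2 + A) * (1 / 2)" "y \<le> 1 / 2 * (b / 2 + A)" "l = a + b" "r = 4 * A" for x y a b l r :: real
    using that by simp
  ultimately show ?thesis
    unfolding eq[OF continuous_s(2,1)] eq[OF continuous_s(1,2)] by blast
qed

end

context uniform_sample begin

definition sine_coeff :: "nat \<Rightarrow> nat \<Rightarrow> nat \<Rightarrow> 'w \<Rightarrow> real" where
  "sine_coeff n j k \<omega> = fluctuation n (sine2 j k) \<omega>"

lemma measurable_sine_coeff [measurable]: "sine_coeff n j k \<in> borel_measurable M"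
  unfolding sine_coeff_def[abs_def] by (rule measurable_fluctuation[OF square_bounded_measurable[OF square_bounded_sine2]])

lemma abs_sine_coeff_le:
  assumes "n > 0" "\<And>i. i \<in> {1..n} \<Longrightarrow> X i \<omega> \<in> unit_square"
  shows "\<bar>sine_coeff n j k \<omega>\<bar> \<le> 4"
  using abs_fluctuation_le[OF square_bounded_sine2 abs_sine2_le assms(2,1)] by (simp add: sine_coeff_def)

lemma bernstein_sine_lincomb:
  assumes n: "n > 0" and m: "m > 0" and w: "\<And>j k. j \<in> {1..m} \<Longrightarrow> k \<in> {1..m} \<Longrightarrow> \<bar>w j k\<bar> \<le> W" and W: "W \<ge> 1" and t: "0 < t" "t \<le> 1"
  shows "prob {\<omega> \<in> space M. \<bar>\<Sum>j=1..m. \<Sum>k=1..m. w j k * sine_coeff n j k \<omega>\<bar> \<ge> t} \<le> 2 * exp (- real n * t\<^sup>2 / (8 * W\<^sup>2 * (real m)\<^sup>2))"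
proof -
  define \<phi> where "\<phi> z = (\<Sum>j=1..m. \<Sum>k=1..m. w j k * sine2 j k z)" for z
  have \<phi>: "square_bounded \<phi>" unfolding \<phi>_def[abs_def] by (intro square_bounded_intros square_bounded_sine2)
  have fl: "fluctuation n \<phi> \<omega> = (\<Sum>j=1..m. \<Sum>k=1..m. w j k * sine_coeff n j k \<omega>)" for \<omega>
  proof -
    have "fluctuation n \<phi> \<omega> = (\<Sum>j=1..m. fluctuation n (\<lambda>z. \<Sum>k=1..m. w j k * sine2 j k z) \<omega>)"
      unfolding \<phi>_def by (intro fluctuation_sum square_bounded_intros square_bounded_sine2)
    also have "\<dots> = (\<Sum>j=1..m. \<Sum>k=1..m. w j k * sine_coeff n j k \<omega>)"
      unfolding sine_coeff_def by (intro sum.cong refl fluctuation_lincomb square_bounded_sine2)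
    finally show ?thesis .
  qed
  have "prob {\<omega> \<in> space M. \<bar>fluctuation n \<phi> \<omega>\<bar> \<ge> t} \<le> 2 * exp (- real n * t\<^sup>2 / (4 * (2 * W\<^sup>2 * (real m)\<^sup>2)))"
  proof (rule bernstein[OF \<phi>])
    fix z
    have "\<bar>\<phi> z\<bar> \<le> (\<Sum>j=1..m. \<Sum>k=1..m. \<bar>w j k * sine2 j k z\<bar>)"
      unfolding \<phi>_def by (intro order_trans[OF sum_abs] sum_mono sum_abs)
    also have "\<dots> \<le> (\<Sum>j=1..m. \<Sum>k=1..m. W * 2)"
      unfolding abs_mult using w abs_sine2_le W by (intro sum_mono mult_mono) auto
    also have "\<dots> = 2 * W * (real m)\<^sup>2" by (simp add: power2_eq_square)
    also have "\<dots> \<le> 2 * W\<^sup>2 * (real m)\<^sup>2" using W by (intro mult_right_mono mult_left_mono) (auto simp: power2_eq_square)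
    finally show "\<bar>\<phi> z\<bar> \<le> 2 * W\<^sup>2 * (real m)\<^sup>2" .
  next
    have "(\<integral>z. (\<phi> z)\<^sup>2 \<partial>lebesgue_square) = (\<Sum>j=1..m. \<Sum>k=1..m. (w j k)\<^sup>2)"
      unfolding \<phi>_def sum.cartesian_product case_prod_unfold using sine2_orthonormal square_bounded_sine2
      by (intro integral_orthonormal_square) (auto simp: prod_eq_iff)
    also have "\<dots> \<le> (\<Sum>j=1..m. \<Sum>k=1..m. W\<^sup>2)"
      using w by (intro sum_mono) (metis abs_ge_zero power2_abs power_mono)
    also have "\<dots> = W\<^sup>2 * (real m)\<^sup>2" by (simp add: power2_eq_square)
    also have "\<dots> \<le> 2 * W\<^sup>2 * (real m)\<^sup>2" by simp
    finally show "(\<integral>z. (\<phi> z)\<^sup>2 \<partial>lebesgue_square) \<le> 2 * W\<^sup>2 * (real m)\<^sup>2" .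
  qed (use m t n W in auto)
  then show ?thesis unfolding fl by (simp only: mult.assoc[symmetric]) simp
qed

end

section \<open>Uniform control of the second derivatives of the potential\<close>

locale lower_bound = uniform_sample M X + boundary_cutoff \<eta>0 \<eta>1 \<eta>2 \<eta>3 C \<delta>
  for M :: "'w measure" and X :: "nat \<Rightarrow> 'w \<Rightarrow> real^2" and \<eta>0 \<eta>1 \<eta>2 \<eta>3 :: "real \<Rightarrow> real" and C \<delta> :: real
begin

text \<open>Up to cutoff and \<open>t\<close>, a mode with eigenvalue \<open>l\<close> and
  fluctuation \<open>c\<close>, taken with coefficient \<open>w * c\<close>, contributes
  \<open>(w - w\<^sup>2 * l / 4) * c\<^sup>2\<close> to the dual value. This is largest for
  \<open>w = 2 / l\<close>, where it equals \<open>c\<^sup>2 / l\<close>; another factor 2 is the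
  normalisation of the mode.\<close>

definition potential_coeff :: "nat \<Rightarrow> 'w \<Rightarrow> nat \<Rightarrow> nat \<Rightarrow> real" where
  "potential_coeff n \<omega> j k = 4 / dirichlet_eigenvalue j k * sine_coeff n j k \<omega>"

text \<open>The factor 4 of the coefficients times two factors \<open>8 * C\<close> from the bounds
  on the modes: a uniform bound on the weights with which the fluctuations enter the second
  derivatives.\<close>

definition W :: real where "W = 256 * C\<^sup>2"

lemma W_ge: "W \<ge> 1"
proof -
  have "1 \<le> C\<^sup>2" using C by (simp add: one_le_power)
  then show ?thesis by (simp add: W_def)
qed

text \<open>\<open>mode_bound p a a'\<close>: \<open>a j\<close> behaves like a \<open>p\<close>-th derivative of the \<open>j\<close>-th mode.\<close>

definition mode_bound :: "nat \<Rightarrow> (nat \<Rightarrow> real \<Rightarrow> real) \<Rightarrow> (nat \<Rightarrow> real \<Rightarrow> real) \<Rightarrow> bool" where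
  "mode_bound p a a' \<longleftrightarrow> (\<forall>j\<ge>1. \<forall>x. (a j has_real_derivative a' j x) (at x)) \<and>
     (\<forall>j\<ge>1. \<forall>x\<in>{0..1}. \<bar>a j x\<bar> \<le> 8 * C * (pi * real j) ^ p \<and> \<bar>a' j x\<bar> \<le> 8 * C * (pi * real j) ^ Suc p)"

lemma mode_boundD:
  assumes "mode_bound p a a'" "j \<ge> 1" "x \<in> {0..1}"
  shows "\<bar>a j x\<bar> \<le> 8 * C * (pi * real j) ^ p" "\<bar>a' j x\<bar> \<le> 8 * C * (pi * real j) ^ Suc p"
  using assms unfolding mode_bound_def by blast+

lemma mode_bounds: "mode_bound 0 s0 s1" "mode_bound 1 s1 s2" "mode_bound 2 s2 s3"
proof -
  have "\<bar>s0 j x\<bar> \<le> 8 * C" if "x \<in> {0..1}" "j \<ge> 1" for x j using abs_s_le(1)[OF that] C by linarith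
  then show "mode_bound 0 s0 s1" "mode_bound 1 s1 s2" "mode_bound 2 s2 s3"
    using abs_s_le deriv_s by (auto simp: mode_bound_def eval_nat_numeral)
qed

lemma mode_lipschitz:
  assumes a: "mode_bound p a a'" and j: "j \<ge> 1" and xy: "x \<in> {0..1}" "y \<in> {0..1}"
  shows "\<bar>a j x - a j y\<bar> \<le> 8 * C * (pi * real j) ^ Suc p * \<bar>x - y\<bar>"
proof -
  have *: "\<bar>a j x - a j y\<bar> \<le> 8 * C * (pi * real j) ^ Suc p * \<bar>x - y\<bar>" if "x < y" "x \<in> {0..1}" "y \<in> {0..1}" for x y
  proof -
    have "\<exists>z>x. z < y \<and> a j y - a j x = (y - x) * a' j z"
      using a j that unfolding mode_bound_def by (intro MVT2) blast+
    then obtain z where z: "x < z" "z < y" "a j y - a j x = (y - x) * a' j z" by auto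
    have "\<bar>a' j z\<bar> \<le> 8 * C * (pi * real j) ^ Suc p" using z that by (intro mode_boundD(2)[OF a j]) auto
    then have "\<bar>y - x\<bar> * \<bar>a' j z\<bar> \<le> \<bar>y - x\<bar> * (8 * C * (pi * real j) ^ Suc p)" by (intro mult_left_mono) auto
    then show ?thesis using z(3) by (metis abs_minus_commute abs_mult mult.commute)
  qed
  show ?thesis using *[of x y] *[of y x] xy by (cases x y rule: linorder_cases) (auto simp: abs_minus_commute)
qed

lemma mode_product_le:
  assumes "j \<ge> 1" "k \<ge> 1" "p + q = 2"
  shows "(pi * real j) ^ p * (pi * real k) ^ q \<le> dirichlet_eigenvalue j k"
proof -
  have "p = 0 \<and> q = 2 \<or> p = 1 \<and> q = 1 \<or> p = 2 \<and> q = 0" using assms(3) by auto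
  then show ?thesis using dirichlet_eigenvalue_ge[OF assms(1,2)] by auto
qed

lemma weight_le:
  assumes a: "mode_bound p a a'" and b: "mode_bound q b b'" and pq: "p + q = 2" and jk: "j \<ge> 1" "k \<ge> 1" and xy: "x \<in> {0..1}" "y \<in> {0..1}"
  shows "\<bar>4 / dirichlet_eigenvalue j k * (a j x * b k y)\<bar> \<le> W"
proof -
  have l: "dirichlet_eigenvalue j k \<ge> 1" by (rule dirichlet_eigenvalue_ge[OF jk])
  have "\<bar>a j x\<bar> * \<bar>b k y\<bar> \<le> (8 * C * (pi * real j) ^ p) * (8 * C * (pi * real k) ^ q)"
    using C by (intro mult_mono mode_boundD(1)[OF a jk(1) xy(1)] mode_boundD(1)[OF b jk(2) xy(2)]) auto
  also have "\<dots> = 64 * C\<^sup>2 * ((pi * real j) ^ p * (pi * real k) ^ q)" by (simp add: power2_eq_square)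
  also have "\<dots> \<le> 64 * C\<^sup>2 * dirichlet_eigenvalue j k" by (intro mult_left_mono mode_product_le jk pq) auto
  finally have "\<bar>a j x * b k y\<bar> \<le> 64 * C\<^sup>2 * dirichlet_eigenvalue j k" by (simp add: abs_mult)
  then have "4 / dirichlet_eigenvalue j k * \<bar>a j x * b k y\<bar> \<le> 4 / dirichlet_eigenvalue j k * (64 * C\<^sup>2 * dirichlet_eigenvalue j k)"
    using l by (intro mult_left_mono) auto
  then show ?thesis using l by (simp add: W_def abs_mult)
qed

text \<open>One further derivative costs a factor \<open>pi * j\<close>, which is at most
  \<open>4 * m\<close>.\<close>

lemma weight_lipschitz:
  assumes a: "mode_bound p a a'" and b: "mode_bound q b b'" and pq: "p + q = 2" and jk: "j \<in> {1..m}" "k \<in> {1..m}"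
    and x: "x \<in> {0..1}" "x' \<in> {0..1}" and y: "y \<in> {0..1}" "y' \<in> {0..1}"
  shows "\<bar>4 / dirichlet_eigenvalue j k * (a j x * b k y) - 4 / dirichlet_eigenvalue j k * (a j x' * b k y')\<bar> \<le> 4 * W * real m * (\<bar>x - x'\<bar> + \<bar>y - y'\<bar>)"
proof -
  have jk1: "j \<ge> 1" "k \<ge> 1" using jk by auto
  have l: "dirichlet_eigenvalue j k \<ge> 1" by (rule dirichlet_eigenvalue_ge[OF jk1])
  define A where "A = (pi * real j) ^ p" define B where "B = (pi * real k) ^ q"
  have AB: "A * B \<le> dirichlet_eigenvalue j k" unfolding A_def B_def by (rule mode_product_le[OF jk1 pq])
  have AB0: "0 \<le> A * B" "0 \<le> A" "0 \<le> B" by (simp_all add: A_def B_def)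
  have pm: "pi * real j \<le> 4 * real m" "pi * real k \<le> 4 * real m" using pi_less_4 jk by (intro mult_mono; simp)+
  have "a j x * b k y - a j x' * b k y' = (a j x - a j x') * b k y + a j x' * (b k y - b k y')" by (simp add: algebra_simps)
  then have "\<bar>a j x * b k y - a j x' * b k y'\<bar> \<le> \<bar>a j x - a j x'\<bar> * \<bar>b k y\<bar> + \<bar>a j x'\<bar> * \<bar>b k y - b k y'\<bar>"
    using abs_triangle_ineq[of "(a j x - a j x') * b k y" "a j x' * (b k y - b k y')"] by (simp only: abs_mult)
  also have "\<dots> \<le> (8 * C * (pi * real j * A) * \<bar>x - x'\<bar>) * (8 * C * B) + (8 * C * A) * (8 * C * (pi * real k * B) * \<bar>y - y'\<bar>)"
  proof (intro add_mono mult_mono)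
    show "\<bar>a j x - a j x'\<bar> \<le> 8 * C * (pi * real j * A) * \<bar>x - x'\<bar>"
      using mode_lipschitz[OF a jk1(1) x] by (simp add: A_def)
    show "\<bar>b k y - b k y'\<bar> \<le> 8 * C * (pi * real k * B) * \<bar>y - y'\<bar>"
      using mode_lipschitz[OF b jk1(2) y] by (simp add: B_def)
    show "\<bar>b k y\<bar> \<le> 8 * C * B" unfolding B_def by (rule mode_boundD(1)[OF b jk1(2) y(1)])
    show "\<bar>a j x'\<bar> \<le> 8 * C * A" unfolding A_def by (rule mode_boundD(1)[OF a jk1(1) x(2)])
  qed (use C AB0 in \<open>auto intro!: mult_nonneg_nonneg\<close>)
  also have "\<dots> = 64 * C\<^sup>2 * (A * B) * (pi * real j * \<bar>x - x'\<bar> + pi * real k * \<bar>y - y'\<bar>)"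
    by (simp add: power2_eq_square algebra_simps)
  also have "\<dots> \<le> 64 * C\<^sup>2 * dirichlet_eigenvalue j k * (4 * real m * \<bar>x - x'\<bar> + 4 * real m * \<bar>y - y'\<bar>)"
  proof (rule mult_mono)
    show "64 * C\<^sup>2 * (A * B) \<le> 64 * C\<^sup>2 * dirichlet_eigenvalue j k" using AB by (intro mult_left_mono) auto
    show "pi * real j * \<bar>x - x'\<bar> + pi * real k * \<bar>y - y'\<bar> \<le> 4 * real m * \<bar>x - x'\<bar> + 4 * real m * \<bar>y - y'\<bar>"
      by (intro add_mono mult_right_mono pm) auto
  qed (use l in auto)
  finally have "4 / dirichlet_eigenvalue j k * \<bar>a j x * b k y - a j x' * b k y'\<bar> \<le> 4 / dirichlet_eigenvalue j k * (64 * C\<^sup>2 * dirichlet_eigenvalue j k * (4 * real m * \<bar>x - x'\<bar> + 4 * real m * \<bar>y - y'\<bar>))"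
    using l by (intro mult_left_mono) auto
  also have "\<dots> = 4 * W * real m * (\<bar>x - x'\<bar> + \<bar>y - y'\<bar>)" using l by (simp add: W_def algebra_simps)
  finally have "\<bar>4 / dirichlet_eigenvalue j k * (a j x * b k y - a j x' * b k y')\<bar> \<le> 4 * W * real m * (\<bar>x - x'\<bar> + \<bar>y - y'\<bar>)"
    unfolding abs_mult[of "4 / dirichlet_eigenvalue j k"] using l by simp
  then show ?thesis by (simp only: right_diff_distrib)
qed

lemma tensor_potential: "tensor_sum m (potential_coeff n \<omega>) a b x y = (\<Sum>j=1..m. \<Sum>k=1..m. (4 / dirichlet_eigenvalue j k * (a j x * b k y)) * sine_coeff n j k \<omega>)"
  unfolding tensor_sum_def potential_coeff_def by (intro sum.cong refl) (simp add: mult_ac)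

text \<open>The second derivatives have to be small at all points of the square, whereas a union
  bound reaches finitely many. The threshold \<open>t / 2\<close> at the grid points leaves the
  other half of \<open>t\<close> to the variation between them.\<close>

definition grid_event :: "nat \<Rightarrow> nat \<Rightarrow> real \<Rightarrow> nat \<Rightarrow> (nat \<Rightarrow> real \<Rightarrow> real) \<Rightarrow> (nat \<Rightarrow> real \<Rightarrow> real) \<Rightarrow> 'w set" where
  "grid_event n m t G a b = (\<Union>i\<le>G. \<Union>l\<le>G. {\<omega> \<in> space M. \<bar>tensor_sum m (potential_coeff n \<omega>) a b (real i / real G) (real l / real G)\<bar> \<ge> t / 2})"

lemma prob_grid_event_le:
  assumes n: "n > 0" and m: "m > 0" and G: "G > 0" and t: "0 < t" "t \<le> 1"
    and a: "mode_bound p a a'" and b: "mode_bound q b b'" and pq: "p + q = 2"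
  shows "prob (grid_event n m t G a b) \<le> 2 * (real G + 1)\<^sup>2 * exp (- real n * t\<^sup>2 / (32 * W\<^sup>2 * (real m)\<^sup>2))" and "grid_event n m t G a b \<in> events"
proof -
  define E where "E i l = {\<omega> \<in> space M. \<bar>tensor_sum m (potential_coeff n \<omega>) a b (real i / real G) (real l / real G)\<bar> \<ge> t / 2}" for i l
  have [measurable]: "E i l \<in> events" for i l unfolding E_def tensor_potential by measurable
  have E: "prob (E i l) \<le> 2 * exp (- real n * t\<^sup>2 / (32 * W\<^sup>2 * (real m)\<^sup>2))" if "i \<le> G" "l \<le> G" for i l
  proof -
    have "prob (E i l) \<le> 2 * exp (- real n * (t / 2)\<^sup>2 / (8 * W\<^sup>2 * (real m)\<^sup>2))"
      unfolding E_def tensor_potential using weight_le[OF a b pq] that G t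
      by (intro bernstein_sine_lincomb n m W_ge) auto
    moreover have "- real n * (t / 2)\<^sup>2 / (8 * W\<^sup>2 * (real m)\<^sup>2) = - real n * t\<^sup>2 / (32 * W\<^sup>2 * (real m)\<^sup>2)" by (simp add: power_divide mult.assoc)
    ultimately show ?thesis by simp
  qed
  have eq: "grid_event n m t G a b = (\<Union>i\<le>G. \<Union>l\<le>G. E i l)" by (simp add: grid_event_def E_def)
  show "grid_event n m t G a b \<in> events" unfolding eq by measurable
  have "prob (grid_event n m t G a b) \<le> (\<Sum>i\<le>G. prob (\<Union>l\<le>G. E i l))"
    unfolding eq by (intro finite_measure_subadditive_finite) auto
  also have "\<dots> \<le> (\<Sum>i\<le>G. \<Sum>l\<le>G. prob (E i l))"
    by (intro sum_mono finite_measure_subadditive_finite) auto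
  also have "\<dots> \<le> (\<Sum>i\<le>G. \<Sum>l\<le>G. 2 * exp (- real n * t\<^sup>2 / (32 * W\<^sup>2 * (real m)\<^sup>2)))" by (intro sum_mono E) auto
  also have "\<dots> = 2 * (real G + 1)\<^sup>2 * exp (- real n * t\<^sup>2 / (32 * W\<^sup>2 * (real m)\<^sup>2))" by (simp add: power2_eq_square add.commute)
  finally show "prob (grid_event n m t G a b) \<le> 2 * (real G + 1)\<^sup>2 * exp (- real n * t\<^sup>2 / (32 * W\<^sup>2 * (real m)\<^sup>2))" .
qed

text \<open>Between neighbouring points, \<open>m\<^sup>2\<close> modes with coefficients at most 4
  and weights of Lipschitz constant \<open>4 * W * m\<close> vary by at most
  \<open>32 * W * m ^ 3 / G\<close> in total; the condition on \<open>G\<close> makes this at most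
  \<open>t / 2\<close>.\<close>

lemma outside_grid_event:
  assumes n: "n > 0" and m: "m > 0" and G: "G > 0" "64 * W * real m ^ 3 \<le> t * real G"
    and a: "mode_bound p a a'" and b: "mode_bound q b b'" and pq: "p + q = 2"
    and \<omega>: "\<omega> \<in> space M" "\<omega> \<notin> grid_event n m t G a b" and X: "\<And>i. i \<in> {1..n} \<Longrightarrow> X i \<omega> \<in> unit_square" and xy: "x \<in> {0..1}" "y \<in> {0..1}"
  shows "\<bar>tensor_sum m (potential_coeff n \<omega>) a b x y\<bar> \<le> t"
proof -
  have grid: "\<exists>i\<le>G. \<bar>x - real i / real G\<bar> \<le> 1 / real G \<and> real i / real G \<in> {0..1}" if x: "x \<in> {0..1}" for x
  proof -
    define i where "i = nat \<lfloor>real G * x\<rfloor>"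
    have i: "real i = of_int \<lfloor>real G * x\<rfloor>" using x by (simp add: i_def)
    have i2: "real i \<le> real G * x" "real G * x < real i + 1" unfolding i by linarith+
    have "real G * x \<le> real G" using x by (simp add: mult_left_le)
    then have "i \<le> G" using i2 by linarith
    moreover have "\<bar>x - real i / real G\<bar> \<le> 1 / real G"
    proof -
      have "x - real i / real G = (real G * x - real i) / real G" using G by (simp add: diff_divide_distrib)
      then show ?thesis using i2 by (simp add: abs_divide divide_right_mono)
    qed
    ultimately show ?thesis using G by (intro exI[of _ i]) (auto simp: field_simps)
  qed
  obtain i l where il: "i \<le> G" "l \<le> G" "\<bar>x - real i / real G\<bar> \<le> 1 / real G" "real i / real G \<in> {0..1}" "\<bar>y - real l / real G\<bar> \<le> 1 / real G" "real l / real G \<in> {0..1}"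
    using grid[OF xy(1)] grid[OF xy(2)] by blast
  let ?x = "real i / real G" and ?y = "real l / real G"
  let ?T = "tensor_sum m (potential_coeff n \<omega>) a b"
  have "\<bar>?T ?x ?y\<bar> < t / 2" using \<omega> il(1,2) by (force simp: grid_event_def)
  moreover have "\<bar>?T x y - ?T ?x ?y\<bar> \<le> t / 2"
  proof -
    let ?w = "\<lambda>j k x y. 4 / dirichlet_eigenvalue j k * (a j x * b k y)"
    have "?T x y - ?T ?x ?y = (\<Sum>j=1..m. \<Sum>k=1..m. (?w j k x y - ?w j k ?x ?y) * sine_coeff n j k \<omega>)"
      by (simp only: tensor_potential sum_subtractf left_diff_distrib)
    then have "\<bar>?T x y - ?T ?x ?y\<bar> \<le> (\<Sum>j=1..m. \<Sum>k=1..m. \<bar>(?w j k x y - ?w j k ?x ?y) * sine_coeff n j k \<omega>\<bar>)"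
      by (simp only:) (intro order_trans[OF sum_abs] sum_mono sum_abs)
    also have "\<dots> \<le> (\<Sum>j=1..m. \<Sum>k=1..m. (4 * W * real m * (1 / real G + 1 / real G)) * 4)"
    proof (intro sum_mono)
      fix j k assume jk: "j \<in> {1..m}" "k \<in> {1..m}"
      have "\<bar>?w j k x y - ?w j k ?x ?y\<bar> \<le> 4 * W * real m * (\<bar>x - ?x\<bar> + \<bar>y - ?y\<bar>)"
        by (rule weight_lipschitz[OF a b pq jk xy(1) il(4) xy(2) il(6)])
      also have "\<dots> \<le> 4 * W * real m * (1 / real G + 1 / real G)"
        using W_ge by (intro mult_left_mono add_mono il(3,5)) simp
      finally have *: "\<bar>?w j k x y - ?w j k ?x ?y\<bar> \<le> 4 * W * real m * (1 / real G + 1 / real G)" .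
      show "\<bar>(?w j k x y - ?w j k ?x ?y) * sine_coeff n j k \<omega>\<bar> \<le> (4 * W * real m * (1 / real G + 1 / real G)) * 4"
        unfolding abs_mult using W_ge by (intro mult_mono[OF * abs_sine_coeff_le[OF n X]]) simp_all
    qed
    also have "\<dots> = 32 * W * real m ^ 3 / real G" by (simp add: power3_eq_cube)
    also have "\<dots> \<le> t / 2" using G by (simp add: divide_le_eq)
    finally show ?thesis .
  qed
  ultimately show ?thesis by linarith
qed

section \<open>The dual functional and its expectation\<close>

abbreviation modes :: "nat \<Rightarrow> (nat \<times> nat) set" where "modes m \<equiv> {1..m} \<times> {1..m}"

abbreviation eigenvalue :: "nat \<times> nat \<Rightarrow> real" where "eigenvalue K \<equiv> dirichlet_eigenvalue (fst K) (snd K)"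

text \<open>Half the contribution of a mode to the partial derivative: the factor 2 of the optimal
  coefficient is kept outside, and its square cancels the 4 in the dual bound.\<close>

definition gradient1 :: "nat \<times> nat \<Rightarrow> real^2 \<Rightarrow> real" where
  "gradient1 K z = 1 / eigenvalue K * (2 * (s1 (fst K) (z $ 1) * s0 (snd K) (z $ 2)))"

definition gradient2 :: "nat \<times> nat \<Rightarrow> real^2 \<Rightarrow> real" where
  "gradient2 K z = 1 / eigenvalue K * (2 * (s0 (fst K) (z $ 1) * s1 (snd K) (z $ 2)))"

definition linear_part :: "nat \<Rightarrow> nat \<Rightarrow> 'w \<Rightarrow> real" where
  "linear_part n m \<omega> = (\<Sum>K\<in>modes m. 2 / eigenvalue K * (fluctuation n (sine2 (fst K) (snd K)) \<omega> * fluctuation n (bump (fst K) (snd K)) \<omega>))"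

definition energy_part :: "nat \<Rightarrow> nat \<Rightarrow> (nat \<times> nat \<Rightarrow> real^2 \<Rightarrow> real) \<Rightarrow> 'w \<Rightarrow> real" where
  "energy_part n m g \<omega> = (\<integral>z. (\<Sum>K\<in>modes m. fluctuation n (sine2 (fst K) (snd K)) \<omega> * g K z)\<^sup>2 \<partial>lebesgue_square)"

lemma energy_part_nonneg: "0 \<le> energy_part n m g \<omega>"
  by (simp add: energy_part_def)

lemma square_bounded_gradient: "square_bounded (gradient1 K)" "square_bounded (gradient2 K)"
  unfolding gradient1_def[abs_def] gradient2_def[abs_def]
  by (intro square_bounded_mult square_bounded_const square_bounded_s_product continuous_s)+

lemma eigenvalue_ge_1: "K \<in> modes m \<Longrightarrow> 1 \<le> eigenvalue K"
  by (cases K) (auto intro: dirichlet_eigenvalue_ge)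

lemma lower_functional_le_cost:
  assumes n: "n > 0" and X: "\<And>i. i \<in> {1..n} \<Longrightarrow> X i \<omega> \<in> unit_square" and t: "0 < t" "t < 1"
    and H: "\<And>x y. x \<in> {0..1} \<Longrightarrow> y \<in> {0..1} \<Longrightarrow> \<bar>tensor_sum m (potential_coeff n \<omega>) s2 s0 x y\<bar> \<le> t \<and> \<bar>tensor_sum m (potential_coeff n \<omega>) s1 s1 x y\<bar> \<le> t \<and> \<bar>tensor_sum m (potential_coeff n \<omega>) s0 s2 x y\<bar> \<le> t"
  shows "linear_part n m \<omega> - (energy_part n m gradient1 \<omega> + energy_part n m gradient2 \<omega>) / (1 - t) \<le> square_cost n (\<lambda>i. X i \<omega>)"
proof -
  let ?c = "\<lambda>K. fluctuation n (sine2 (fst K) (snd K)) \<omega>"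
  let ?T = "\<lambda>a b z. tensor_sum m (potential_coeff n \<omega>) a b (z $ 1) (z $ 2)"
  have f: "?T s0 s0 z = (\<Sum>K\<in>modes m. 2 / eigenvalue K * ?c K * bump (fst K) (snd K) z)" for z :: "real^2"
    unfolding tensor_sum_def sum.cartesian_product case_prod_unfold
    by (intro sum.cong refl) (simp add: potential_coeff_def sine_coeff_def bump_def)
  have g: "?T s1 s0 z = 2 * (\<Sum>K\<in>modes m. ?c K * gradient1 K z)" "?T s0 s1 z = 2 * (\<Sum>K\<in>modes m. ?c K * gradient2 K z)" for z :: "real^2"
    unfolding tensor_sum_def sum.cartesian_product case_prod_unfold sum_distrib_left
    by (intro sum.cong refl; simp add: potential_coeff_def sine_coeff_def gradient1_def gradient2_def)+
  have sb: "square_bounded (\<lambda>z. (\<Sum>K\<in>modes m. ?c K * g K z)\<^sup>2)" if "\<And>K. square_bounded (g K)" for g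
    by (intro square_bounded_power2 square_bounded_sum square_bounded_mult square_bounded_const that)
  note i = integrable_square_bounded[OF sb[OF square_bounded_gradient(1)]] integrable_square_bounded[OF sb[OF square_bounded_gradient(2)]]
  have "(\<integral>z. (?T s1 s0 z)\<^sup>2 + (?T s0 s1 z)\<^sup>2 \<partial>lebesgue_square) = (\<integral>z. 4 * ((\<Sum>K\<in>modes m. ?c K * gradient1 K z)\<^sup>2 + (\<Sum>K\<in>modes m. ?c K * gradient2 K z)\<^sup>2) \<partial>lebesgue_square)"
    unfolding g power_mult_distrib by simp
  also have "\<dots> = 4 * (energy_part n m gradient1 \<omega> + energy_part n m gradient2 \<omega>)"
    unfolding energy_part_def using i by simp
  finally have G: "(\<integral>z. (?T s1 s0 z)\<^sup>2 + (?T s0 s1 z)\<^sup>2 \<partial>lebesgue_square) = 4 * (energy_part n m gradient1 \<omega> + energy_part n m gradient2 \<omega>)" .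
  have "fluctuation n (?T s0 s0) \<omega> = linear_part n m \<omega>"
    unfolding f linear_part_def by (subst fluctuation_lincomb) (simp_all add: square_bounded_bump mult.assoc)
  then have L: "(\<Sum>i=1..n. ?T s0 s0 (X i \<omega>)) / real n - (\<integral>z. ?T s0 s0 z \<partial>lebesgue_square) = linear_part n m \<omega>"
    by (simp add: fluctuation_def)
  have "(\<Sum>i=1..n. ?T s0 s0 (X i \<omega>)) / real n - (\<integral>z. ?T s0 s0 z \<partial>lebesgue_square) - (\<integral>z. (?T s1 s0 z)\<^sup>2 + (?T s0 s1 z)\<^sup>2 \<partial>lebesgue_square) / (4 * (1 - t)) \<le> square_cost n (\<lambda>i. X i \<omega>)"
    by (rule square_cost_lower[OF n X t H])
  moreover have "4 * q / (4 * (1 - t)) = q / (1 - t)" for q by (rule mult_divide_mult_cancel_left) simp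
  ultimately show ?thesis unfolding L G by metis
qed

text \<open>A crude bound for exceptional events: since the cost is nonnegative, subtracting
  \<open>32 * m\<^sup>2\<close> there keeps the dual functional below it.\<close>

lemma linear_part_le:
  assumes n: "n > 0" and X: "\<And>i. i \<in> {1..n} \<Longrightarrow> X i \<omega> \<in> unit_square"
  shows "linear_part n m \<omega> \<le> 32 * (real m)\<^sup>2"
proof -
  have "linear_part n m \<omega> \<le> (\<Sum>K\<in>modes m. 2 * (4 * 4))"
    unfolding linear_part_def
  proof (rule sum_mono)
    fix K assume K: "K \<in> modes m"
    let ?a = "2 / eigenvalue K" and ?b = "fluctuation n (sine2 (fst K) (snd K)) \<omega>" and ?d = "fluctuation n (bump (fst K) (snd K)) \<omega>"
    have jk: "1 \<le> fst K" "1 \<le> snd K" using K by auto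
    have "\<bar>?b\<bar> \<le> 4" using abs_fluctuation_le[OF square_bounded_sine2 abs_sine2_le X n] by simp
    moreover have "\<bar>?d\<bar> \<le> 4" using abs_fluctuation_le[OF square_bounded_bump abs_bump_le[OF jk] X n] by simp
    moreover have "0 \<le> ?a" "?a \<le> 2" using eigenvalue_ge_1[OF K] by (simp_all add: divide_le_eq)
    ultimately have "\<bar>?a\<bar> * (\<bar>?b\<bar> * \<bar>?d\<bar>) \<le> 2 * (4 * 4)" by (intro mult_mono) auto
    then have "\<bar>?a * (?b * ?d)\<bar> \<le> 2 * (4 * 4)" by (simp only: abs_mult)
    then show "?a * (?b * ?d) \<le> 2 * (4 * 4)" by linarith
  qed
  also have "\<dots> = 32 * (real m)\<^sup>2" by (simp add: power2_eq_square)
  finally show ?thesis .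
qed

text \<open>The covariance of a mode with its cut-off version is at least
  \<open>1 - 4 * \<delta>\<close> minus the product of the means, which is at most
  \<open>4 / (j * k)\<close>, over \<open>n\<close>. Weighted by twice the inverse eigenvalue,
  itself at most \<open>1 / (18 * j * k)\<close>, the corrections sum to at most 2.\<close>

lemma expectation_linear_part_ge:
  assumes n: "n > 0" and \<delta>: "\<delta> \<le> 1 / 2"
  shows "(2 * (1 - 4 * \<delta>) * (lattice_sum m / pi\<^sup>2) - 2) / real n \<le> expectation (linear_part n m)" and "integrable M (linear_part n m)"
proof -
  let ?c = "\<lambda>K \<omega>. fluctuation n (sine2 (fst K) (snd K)) \<omega> * fluctuation n (bump (fst K) (snd K)) \<omega>"
  note cov = covariance_fluctuation[OF square_bounded_sine2 square_bounded_bump n]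
  have L: "linear_part n m = (\<lambda>\<omega>. \<Sum>K\<in>modes m. 2 / eigenvalue K * ?c K \<omega>)" by (simp add: linear_part_def[abs_def])
  show "integrable M (linear_part n m)" unfolding L using cov(2) by simp
  have "(2 * (1 - 4 * \<delta>) * (lattice_sum m / pi\<^sup>2) - 2) / real n
      \<le> (2 * (1 - 4 * \<delta>) * (\<Sum>K\<in>modes m. 1 / eigenvalue K) - 4 / 9 * (\<Sum>K\<in>modes m. 1 / ((real (fst K))\<^sup>2 * (real (snd K))\<^sup>2))) / real n"
    using sum_inverse_eigenvalue[of m] sum_inverse_products_le[of m]
    unfolding sum.cartesian_product case_prod_unfold by (intro divide_right_mono diff_mono) auto
  also have "\<dots> = (\<Sum>K\<in>modes m. (2 * (1 - 4 * \<delta>) * (1 / eigenvalue K) - 4 / 9 * (1 / ((real (fst K))\<^sup>2 * (real (snd K))\<^sup>2))) / real n)"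
    by (simp only: sum_divide_distrib[symmetric] sum_subtractf sum_distrib_left)
  also have "\<dots> \<le> (\<Sum>K\<in>modes m. 2 / eigenvalue K * expectation (?c K))"
  proof (rule sum_mono)
    fix K assume K: "K \<in> modes m"
    define j k where "j = fst K" and "k = snd K"
    have jk: "1 \<le> j" "1 \<le> k" using K by (auto simp: j_def k_def)
    define l where "l = dirichlet_eigenvalue j k"
    define P where "P = real j * real k"
    have P: "P > 0" using jk by (simp add: P_def)
    have l: "1 \<le> l" "18 * P \<le> l" using dirichlet_eigenvalue_ge[OF jk] by (simp_all add: l_def P_def)
    have "\<bar>integral\<^sup>L lebesgue_square (sine2 j k) * integral\<^sup>L lebesgue_square (bump j k)\<bar> \<le> 2 / P * 2"
      unfolding abs_mult P_def by (intro mult_mono integral_sine2_le abs_integral_bump_le jk) auto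
    then have "(1 - 4 * \<delta>) - 4 / P \<le> (\<integral>z. sine2 j k z * bump j k z \<partial>lebesgue_square) - integral\<^sup>L lebesgue_square (sine2 j k) * integral\<^sup>L lebesgue_square (bump j k)"
      using integral_sine2_bump_ge[OF jk \<delta>] by (simp add: abs_le_iff)
    then have "((1 - 4 * \<delta>) - 4 / P) / real n \<le> expectation (?c K)"
      unfolding cov(1) j_def[symmetric] k_def[symmetric] by (intro divide_right_mono) auto
    then have 1: "2 / l * (((1 - 4 * \<delta>) - 4 / P) / real n) \<le> 2 / l * expectation (?c K)" using l by (intro mult_left_mono) auto
    have "8 / (l * P) \<le> 8 / (18 * P * P)" using l P by (intro divide_left_mono mult_right_mono) auto
    then have "2 * (1 - 4 * \<delta>) * (1 / l) - 4 / 9 * (1 / P\<^sup>2) \<le> 2 / l * ((1 - 4 * \<delta>) - 4 / P)"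
      by (simp add: power2_eq_square right_diff_distrib diff_divide_distrib)
    then have "(2 * (1 - 4 * \<delta>) * (1 / l) - 4 / 9 * (1 / P\<^sup>2)) / real n \<le> 2 / l * ((1 - 4 * \<delta>) - 4 / P) / real n" by (intro divide_right_mono) auto
    then have "(2 * (1 - 4 * \<delta>) * (1 / l) - 4 / 9 * (1 / P\<^sup>2)) / real n \<le> 2 / l * expectation (?c K)" using 1 by simp
    then show "(2 * (1 - 4 * \<delta>) * (1 / eigenvalue K) - 4 / 9 * (1 / ((real (fst K))\<^sup>2 * (real (snd K))\<^sup>2))) / real n \<le> 2 / eigenvalue K * expectation (?c K)"
      by (simp add: j_def k_def l_def P_def power_mult_distrib)
  qed
  also have "\<dots> = expectation (linear_part n m)" unfolding L using cov(2) by simp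
  finally show "(2 * (1 - 4 * \<delta>) * (lattice_sum m / pi\<^sup>2) - 2) / real n \<le> expectation (linear_part n m)" .
qed

text \<open>In expectation only the diagonal terms remain. Dividing the energy of a mode by its
  squared eigenvalue leaves the inverse eigenvalue, up to \<open>1 + \<theta>\<close>, and a cutoff
  term that is summable.\<close>

lemma expectation_energy_part_le:
  assumes n: "n > 0" and \<theta>: "\<theta> > 0"
  shows "expectation (energy_part n m gradient1) + expectation (energy_part n m gradient2) \<le> ((1 + \<theta>) * (lattice_sum m / pi\<^sup>2) + 4 * (1 + 1 / \<theta>) * C\<^sup>2) / real n"
    and "integrable M (energy_part n m gradient1)" "integrable M (energy_part n m gradient2)"
proof -
  have orth: "(\<integral>z. sine2 (fst K) (snd K) z * sine2 (fst L) (snd L) z \<partial>lebesgue_square) = of_bool (K = L)" if "K \<in> modes m" "L \<in> modes m" for K L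
    using that by (subst sine2_orthonormal) (auto simp: prod_eq_iff)
  have E: "expectation (energy_part n m g) \<le> (\<Sum>K\<in>modes m. \<integral>z. (g K z)\<^sup>2 \<partial>lebesgue_square) / real n" "integrable M (energy_part n m g)"
    if "\<And>K. square_bounded (g K)" for g
    unfolding energy_part_def[abs_def]
    using expectation_quadratic_le[of "modes m" "\<lambda>K. sine2 (fst K) (snd K)" g n, OF square_bounded_sine2 that _ n orth] by simp_all
  show "integrable M (energy_part n m gradient1)" "integrable M (energy_part n m gradient2)"
    by (rule E(2)[OF square_bounded_gradient(1)], rule E(2)[OF square_bounded_gradient(2)])
  have "expectation (energy_part n m gradient1) + expectation (energy_part n m gradient2)
     \<le> (\<Sum>K\<in>modes m. \<integral>z. (gradient1 K z)\<^sup>2 \<partial>lebesgue_square) / real n + (\<Sum>K\<in>modes m. \<integral>z. (gradient2 K z)\<^sup>2 \<partial>lebesgue_square) / real n"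
    by (intro add_mono E square_bounded_gradient)
  also have "\<dots> = (\<Sum>K\<in>modes m. (\<integral>z. (gradient1 K z)\<^sup>2 \<partial>lebesgue_square) + (\<integral>z. (gradient2 K z)\<^sup>2 \<partial>lebesgue_square)) / real n"
    by (simp add: sum.distrib add_divide_distrib)
  also have "\<dots> \<le> (\<Sum>K\<in>modes m. (1 + \<theta>) * (1 / eigenvalue K) + 4 * (1 + 1 / \<theta>) * C\<^sup>2 * (1 / (eigenvalue K)\<^sup>2)) / real n"
  proof (intro divide_right_mono sum_mono)
    fix K assume K: "K \<in> modes m"
    define l where "l = eigenvalue K"
    have jk: "1 \<le> fst K" "1 \<le> snd K" using K by auto
    have l: "1 \<le> l" unfolding l_def by (rule eigenvalue_ge_1[OF K])
    have "(\<integral>z. (gradient1 K z)\<^sup>2 \<partial>lebesgue_square) + (\<integral>z. (gradient2 K z)\<^sup>2 \<partial>lebesgue_square)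
      = (1 / l)\<^sup>2 * ((\<integral>z. (2 * (s1 (fst K) (z $ 1) * s0 (snd K) (z $ 2)))\<^sup>2 \<partial>lebesgue_square) + (\<integral>z. (2 * (s0 (fst K) (z $ 1) * s1 (snd K) (z $ 2)))\<^sup>2 \<partial>lebesgue_square))"
      unfolding gradient1_def gradient2_def l_def[symmetric] power_mult_distrib[of "1 / l"] integral_mult_right_zero by (rule distrib_left[symmetric])
    also have "\<dots> \<le> (1 / l)\<^sup>2 * ((1 + \<theta>) * l + 4 * (1 + 1 / \<theta>) * C\<^sup>2)"
      unfolding l_def by (intro mult_left_mono integral_gradient_bump_le jk \<theta>) auto
    also have "\<dots> = (1 + \<theta>) * (1 / l) + 4 * (1 + 1 / \<theta>) * C\<^sup>2 * (1 / l\<^sup>2)"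
      using l by (simp add: power2_eq_square distrib_left)
    finally show "(\<integral>z. (gradient1 K z)\<^sup>2 \<partial>lebesgue_square) + (\<integral>z. (gradient2 K z)\<^sup>2 \<partial>lebesgue_square) \<le> (1 + \<theta>) * (1 / eigenvalue K) + 4 * (1 + 1 / \<theta>) * C\<^sup>2 * (1 / (eigenvalue K)\<^sup>2)"
      unfolding l_def .
  qed auto
  also have "\<dots> = ((1 + \<theta>) * (\<Sum>K\<in>modes m. 1 / eigenvalue K) + 4 * (1 + 1 / \<theta>) * C\<^sup>2 * (\<Sum>K\<in>modes m. 1 / (eigenvalue K)\<^sup>2)) / real n"
    by (simp only: sum.distrib sum_distrib_left)
  also have "\<dots> \<le> ((1 + \<theta>) * (lattice_sum m / pi\<^sup>2) + 4 * (1 + 1 / \<theta>) * C\<^sup>2 * 1) / real n"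
    using sum_inverse_eigenvalue[of m] sum_inverse_eigenvalue_square_le[of m] \<theta>
    unfolding sum.cartesian_product case_prod_unfold by (intro divide_right_mono add_mono mult_left_mono mult_nonneg_nonneg) auto
  finally show "expectation (energy_part n m gradient1) + expectation (energy_part n m gradient2) \<le> ((1 + \<theta>) * (lattice_sum m / pi\<^sup>2) + 4 * (1 + 1 / \<theta>) * C\<^sup>2) / real n"
    by simp
qed

text \<open>The linear part contributes twice the sum of the inverse eigenvalues and the energy
  removes it once. The factor 192 is 32 for the exceptional bound, 3 for the entries of the Hessian
  and 2 for the two-sided tail.\<close>

proposition expectation_square_cost_lower:
  assumes n: "n > 0" and m: "m > 0" and G: "G > 0" "64 * W * real m ^ 3 \<le> t * real G"
    and t: "0 < t" "t < 1" and \<theta>: "\<theta> > 0" and \<delta>: "\<delta> \<le> 1 / 2"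
  shows "(2 * (1 - 4 * \<delta>) * (lattice_sum m / pi\<^sup>2) - 2 - ((1 + \<theta>) * (lattice_sum m / pi\<^sup>2) + 4 * (1 + 1 / \<theta>) * C\<^sup>2) / (1 - t)) / real n
      - 192 * (real m)\<^sup>2 * (real G + 1)\<^sup>2 * exp (- real n * t\<^sup>2 / (32 * W\<^sup>2 * (real m)\<^sup>2))
    \<le> expectation (\<lambda>\<omega>. square_cost n (\<lambda>i. X i \<omega>))"
proof -
  let ?p = "2 * (real G + 1)\<^sup>2 * exp (- real n * t\<^sup>2 / (32 * W\<^sup>2 * (real m)\<^sup>2))"
  let ?bad = "grid_event n m t G s2 s0 \<union> grid_event n m t G s1 s1 \<union> grid_event n m t G s0 s2"
  let ?Q = "\<lambda>\<omega>. energy_part n m gradient1 \<omega> + energy_part n m gradient2 \<omega>"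
  let ?F = "\<lambda>\<omega>. linear_part n m \<omega> - ?Q \<omega> / (1 - t) - 32 * (real m)\<^sup>2 * indicator ?bad \<omega>"
  note pr = prob_grid_event_le[OF n m G(1) t(1) less_imp_le[OF t(2)]]
  note pr1 = pr[OF mode_bounds(3) mode_bounds(1)] and pr2 = pr[OF mode_bounds(2) mode_bounds(2)] and pr3 = pr[OF mode_bounds(1) mode_bounds(3)]
  have bad: "?bad \<in> events" using pr1(2) pr2(2) pr3(2) by simp
  have "prob ?bad \<le> prob (grid_event n m t G s2 s0 \<union> grid_event n m t G s1 s1) + prob (grid_event n m t G s0 s2)"
    using pr1(2) pr2(2) pr3(2) by (intro measure_Un_le) simp_all
  also have "\<dots> \<le> prob (grid_event n m t G s2 s0) + prob (grid_event n m t G s1 s1) + prob (grid_event n m t G s0 s2)"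
    using pr1(2) pr2(2) by (intro add_right_mono measure_Un_le) simp_all
  also have "\<dots> \<le> ?p + ?p + ?p" using pr1(1) pr2(1) pr3(1) by (intro add_mono) simp_all
  finally have pbad: "prob ?bad \<le> 3 * ?p" by simp
  have le: "AE \<omega> in M. ?F \<omega> \<le> square_cost n (\<lambda>i. X i \<omega>)"
    using AE_sample_all AE_space
  proof eventually_elim
    case (elim \<omega>)
    have X: "\<And>i. i \<in> {1..n} \<Longrightarrow> X i \<omega> \<in> unit_square" using elim by auto
    show ?case
    proof (cases "\<omega> \<in> ?bad")
      case True
      have "0 \<le> ?Q \<omega> / (1 - t)" using t energy_part_nonneg by (intro divide_nonneg_nonneg add_nonneg_nonneg) auto
      then show ?thesis using True linear_part_le[OF n X] square_cost_nonneg[of n "\<lambda>i. X i \<omega>"] by (smt (verit) indicator_eq_1_iff mult_cancel_left1)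
    next
      case False
      have out: "\<bar>tensor_sum m (potential_coeff n \<omega>) a b x y\<bar> \<le> t"
        if "mode_bound p a a'" "mode_bound q b b'" "p + q = 2" "\<omega> \<notin> grid_event n m t G a b" "x \<in> {0..1}" "y \<in> {0..1}" for p q a a' b b' x y
        by (rule outside_grid_event[OF n m G that(1-3) elim(2) that(4) X that(5,6)])
      have "linear_part n m \<omega> - ?Q \<omega> / (1 - t) \<le> square_cost n (\<lambda>i. X i \<omega>)"
      proof (rule lower_functional_le_cost[OF n X t])
        fix x y :: real assume xy: "x \<in> {0..1}" "y \<in> {0..1}"
        have nb: "\<omega> \<notin> grid_event n m t G s2 s0" "\<omega> \<notin> grid_event n m t G s1 s1" "\<omega> \<notin> grid_event n m t G s0 s2" using False by auto
        show "\<bar>tensor_sum m (potential_coeff n \<omega>) s2 s0 x y\<bar> \<le> t \<and> \<bar>tensor_sum m (potential_coeff n \<omega>) s1 s1 x y\<bar> \<le> t \<and> \<bar>tensor_sum m (potential_coeff n \<omega>) s0 s2 x y\<bar> \<le> t"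
          using out[OF mode_bounds(3) mode_bounds(1) _ nb(1) xy] out[OF mode_bounds(2) mode_bounds(2) _ nb(2) xy] out[OF mode_bounds(1) mode_bounds(3) _ nb(3) xy] by simp
      qed
      then show ?thesis using False by simp
    qed
  qed
  note EL = expectation_linear_part_ge[OF n \<delta>] and EQ = expectation_energy_part_le[OF n \<theta>]
  have ib: "integrable M (\<lambda>\<omega>. indicator ?bad \<omega> :: real)" using bad by (simp add: emeasure_eq_measure)
  have iF: "integrable M ?F" using EL(2) EQ(2,3) ib by simp
  have "(2 * (1 - 4 * \<delta>) * (lattice_sum m / pi\<^sup>2) - 2) / real n - (((1 + \<theta>) * (lattice_sum m / pi\<^sup>2) + 4 * (1 + 1 / \<theta>) * C\<^sup>2) / real n) / (1 - t) - 32 * (real m)\<^sup>2 * (3 * ?p)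
    \<le> expectation (linear_part n m) - (expectation (energy_part n m gradient1) + expectation (energy_part n m gradient2)) / (1 - t) - 32 * (real m)\<^sup>2 * prob ?bad"
    using t by (intro diff_mono EL(1) divide_right_mono EQ(1) mult_left_mono pbad) auto
  also have "\<dots> = expectation ?F" using EL(2) EQ(2,3) ib bad by simp
  also have "\<dots> \<le> expectation (\<lambda>\<omega>. square_cost n (\<lambda>i. X i \<omega>))"
  proof (rule integral_mono_AE[OF iF _ le])
    show "integrable M (\<lambda>\<omega>. square_cost n (\<lambda>i. X i \<omega>))"
    proof (rule integrable_const_bound[where B = 2])
      show "AE \<omega> in M. norm (square_cost n (\<lambda>i. X i \<omega>)) \<le> 2"
        using AE_sample_all
      proof eventually_elim
        case (elim \<omega>)
        then have "square_cost n (\<lambda>i. X i \<omega>) \<le> 2" using n closure_subset by (intro square_cost_le_2) auto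
        then show ?case by simp
      qed
    qed measurable
  qed
  finally show ?thesis by (simp add: diff_divide_distrib mult_ac)
qed

end

section \<open>Asymptotics\<close>

text \<open>The exponent exceeds 1, so that \<open>n / m\<^sup>2\<close> grows faster than
  \<open>ln n\<close> and the Bernstein bounds beat every power of \<open>n\<close>; the logarithm
  of the mesh changes only by a multiple of \<open>ln (ln n)\<close>.\<close>

definition mesh :: "nat \<Rightarrow> nat" where
  "mesh n = nat \<lfloor>sqrt (real n / ln (real n) powr (5 / 4))\<rfloor>"

text \<open>For \<open>k\<close> of order \<open>(ln n) powr b\<close> the two spreading errors,
  multiplied by \<open>n\<close>, are of order \<open>(ln n) powr (5 / 4 - 2 * b)\<close> and
  \<open>(ln n) powr (5 / 8 + b)\<close>. Both exponents are below 1 for \<open>b\<close> between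
  \<open>1 / 8\<close> and \<open>3 / 8\<close>.\<close>

definition refinement :: "nat \<Rightarrow> nat" where
  "refinement n = nat \<lceil>ln (real n) powr (1 / 4)\<rceil>"

lemma power_times_exp_tendsto_0:
  assumes "c > 0"
  shows "(\<lambda>n. real n ^ p * exp (- c * ln (real n) powr (5 / 4))) \<longlonglongrightarrow> 0"
  using assms by real_asymp

lemma mesh_bounds:
  "\<forall>\<^sub>F n in sequentially. 1 \<le> ln (real n) \<and> 0 < mesh n \<and> real (mesh n) \<le> real n \<and>
     real n \<le> 4 * (real (mesh n))\<^sup>2 * ln (real n) powr (5 / 4) \<and>
     (real (mesh n))\<^sup>2 * ln (real n) powr (5 / 4) \<le> real n \<and>
     ln (real (mesh n)) \<le> ln (real n) / 2 \<and> ln (real n) / 2 - 5 / 8 * ln (ln (real n)) \<le> ln (real (mesh n) + 1)"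
proof -
  have r: "\<forall>\<^sub>F n in sequentially. 2 \<le> sqrt (real n / ln (real n) powr (5 / 4))" by real_asymp
  have l: "\<forall>\<^sub>F n in sequentially. 1 \<le> ln (real n)" by real_asymp
  show ?thesis using r l
  proof eventually_elim
    case (elim n)
    define L where "L = ln (real n)"
    define r where "r = sqrt (real n / L powr (5 / 4))"
    have L: "1 \<le> L" "1 \<le> L powr (5 / 4)" using elim by (simp_all add: L_def ge_one_powr_ge_zero)
    have n: "n > 0" using elim by (cases n) auto
    have r2: "r\<^sup>2 * L powr (5 / 4) = real n" using L by (simp add: r_def)
    have r: "2 \<le> r" using elim by (simp add: r_def L_def)
    have m: "real (mesh n) \<le> r" "r < real (mesh n) + 1" using r unfolding mesh_def L_def[symmetric] r_def[symmetric] by linarith+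
    \<comment> \<open>As \<open>r \<ge> 2\<close>, rounding down loses at most half of
      \<open>r\<close>; this is the 4 in the bound on \<open>n\<close>.\<close>
    then have m1: "1 \<le> real (mesh n)" "r \<le> 2 * real (mesh n)" using r by linarith+
    have "(real (mesh n))\<^sup>2 \<le> r\<^sup>2" using m by (intro power_mono) auto
    then have up: "(real (mesh n))\<^sup>2 * L powr (5 / 4) \<le> real n" unfolding r2[symmetric] by (intro mult_right_mono) auto
    have "r\<^sup>2 \<le> (2 * real (mesh n))\<^sup>2" using m1 r by (intro power_mono) auto
    then have lo: "real n \<le> 4 * (real (mesh n))\<^sup>2 * L powr (5 / 4)" unfolding r2[symmetric] by (intro mult_right_mono) (auto simp: power_mult_distrib)
    have "real (mesh n) * 1 \<le> (real (mesh n))\<^sup>2 * L powr (5 / 4)"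
      unfolding power2_eq_square using m1 L by (intro mult_mono) auto
    then have mn: "real (mesh n) \<le> real n" using up by simp
    have lr: "ln r = L / 2 - 5 / 8 * ln L"
    proof -
      have "ln (r\<^sup>2 * L powr (5 / 4)) = L" unfolding r2 by (simp add: L_def)
      moreover have "ln (r\<^sup>2 * L powr (5 / 4)) = 2 * ln r + 5 / 4 * ln L" using r L by (simp add: ln_mult ln_powr ln_realpow)
      ultimately show ?thesis by simp
    qed
    have "ln (real (mesh n)) \<le> ln r" "ln r \<le> ln (real (mesh n) + 1)" using m m1 by simp_all
    moreover have "0 \<le> ln L" using L(1) by (rule ln_ge_zero)
    ultimately have "ln (real (mesh n)) \<le> L / 2 \<and> L / 2 - 5 / 8 * ln L \<le> ln (real (mesh n) + 1)" using lr by linarith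
    then show ?case using L(1) m1 mn up lo unfolding L_def by simp
  qed
qed

lemma refinement_bounds:
  "\<forall>\<^sub>F n in sequentially. 0 < refinement n \<and> ln (real n) powr (1 / 4) \<le> real (refinement n) \<and> real (refinement n) \<le> 2 * ln (real n) powr (1 / 4)"
proof -
  have l: "\<forall>\<^sub>F n in sequentially. 1 \<le> ln (real n) powr (1 / 4)" by real_asymp
  then show ?thesis by eventually_elim (unfold refinement_def, linarith)
qed

section \<open>The limit superior of the rescaled cost\<close>

context uniform_sample begin

text \<open>The one parameter \<open>s\<close> serves as density tolerance, as Young parameter and
  as relative error of the eigenvalue sum; the constant in the hypothesis tends to
  \<open>1 / (4 * pi)\<close> as \<open>s\<close> tends to 0.\<close>

lemma eventually_cost_upper:
  assumes s: "0 < s" "s < 1" and c: "(1 + s) * ((1 + s) / (1 - s)\<^sup>2) * ((1 + s) / (4 * pi)) < c"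
  shows "\<forall>\<^sub>F n in sequentially. real n / ln (real n) * expectation (\<lambda>\<omega>. square_cost n (\<lambda>i. X i \<omega>)) < c"
proof -
  obtain B where B: "\<And>m. m > 0 \<Longrightarrow> neumann_sum m \<le> (1 + s) / (2 * pi) * ln (real m) + B" using neumann_sum_le[OF s(1)] by blast
  define A where "A = (1 + s) * ((1 + s) / (1 - s)\<^sup>2)"
  define H where "H = 1 + 1 / s"
  have A: "A \<ge> 0" and H: "H \<ge> 0" using s by (simp_all add: A_def H_def)
  \<comment> \<open>A termwise majorant of the rescaled expected cost; only the constant in its
    first summand survives in the limit.\<close>
  define u where "u n = A * ((1 + s) / (4 * pi) + B / ln (real n)) + H * (8 * ln (real n) powr (- 1 / 4) + 16 * ln (real n) powr (- 1 / 8)) + 8 * (real n ^ 3 * exp (- (s\<^sup>2 / 16) * ln (real n) powr (5 / 4)))" for n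
  have "(\<lambda>n. B / ln (real n)) \<longlonglongrightarrow> 0" "(\<lambda>n. ln (real n) powr (- 1 / 4)) \<longlonglongrightarrow> 0" "(\<lambda>n. ln (real n) powr (- 1 / 8)) \<longlonglongrightarrow> 0" by real_asymp+
  then have "u \<longlonglongrightarrow> A * ((1 + s) / (4 * pi) + 0) + H * (8 * 0 + 16 * 0) + 8 * 0"
    unfolding u_def using s by (intro tendsto_intros power_times_exp_tendsto_0) auto
  then have "u \<longlonglongrightarrow> A * ((1 + s) / (4 * pi))" by simp
  moreover have "A * ((1 + s) / (4 * pi)) < c" using c by (simp add: A_def)
  ultimately have "\<forall>\<^sub>F n in sequentially. u n < c" by (rule order_tendstoD)
  then show ?thesis using mesh_bounds refinement_bounds
  proof eventually_elim
    case (elim n)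
    define L m k where "L = ln (real n)" and "m = mesh n" and "k = refinement n"
    have L: "1 \<le> L" and m: "m > 0" and mn: "real m \<le> real n" and lo: "real n \<le> 4 * (real m)\<^sup>2 * L powr (5 / 4)" and up: "(real m)\<^sup>2 * L powr (5 / 4) \<le> real n" and lm: "ln (real m) \<le> L / 2"
      using elim(2) unfolding L_def m_def by blast+
    have k: "k > 0" "L powr (1 / 4) \<le> real k" "real k \<le> 2 * L powr (1 / 4)" using elim(3) unfolding L_def k_def by blast+
    have n: "n > 0" using mn m by simp
    have nL: "0 \<le> real n / L" using L by simp
    have 1: "real n / L * (neumann_sum m / real n) \<le> (1 + s) / (4 * pi) + B / L"
    proof -
      have "neumann_sum m \<le> (1 + s) / (2 * pi) * (L / 2) + B" using B[OF m] mult_left_mono[OF lm, of "(1 + s) / (2 * pi)"] s by simp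
      then have "neumann_sum m / L \<le> ((1 + s) / (2 * pi) * (L / 2) + B) / L" using L by (intro divide_right_mono) auto
      then show ?thesis using L n by (simp add: add_divide_distrib)
    qed
    have 2: "real n / L * (2 / (real (m * k))\<^sup>2) \<le> 8 * L powr (- 1 / 4)"
    proof -
      have "L powr (1 / 2) = (L powr (1 / 4))\<^sup>2" using L by (simp add: powr_power)
      also have "\<dots> \<le> (real k)\<^sup>2" using k by (intro power_mono) auto
      finally have k2: "L powr (1 / 2) \<le> (real k)\<^sup>2" .
      have "real n * 2 \<le> 8 * (real m)\<^sup>2 * L powr (5 / 4)" using lo by simp
      also have "L powr (5 / 4) = L powr (- 1 / 4) * L * L powr (1 / 2)"
      proof -
        have "L powr (- 1 / 4) * L powr 1 * L powr (1 / 2) = L powr (5 / 4)" unfolding powr_add[symmetric] by simp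
        then show ?thesis using L by simp
      qed
      also have "8 * (real m)\<^sup>2 * (L powr (- 1 / 4) * L * L powr (1 / 2)) \<le> 8 * (real m)\<^sup>2 * (L powr (- 1 / 4) * L * (real k)\<^sup>2)"
        using k2 L by (intro mult_left_mono) auto
      finally show ?thesis using L m k(1) by (simp add: divide_le_eq power_mult_distrib mult_ac)
    qed
    have 3: "real n / L * (4 * real k / (real m * sqrt (real n))) \<le> 16 * L powr (- 1 / 8)"
    proof -
      have "sqrt (real n) \<le> sqrt ((2 * real m * L powr (5 / 8))\<^sup>2)"
        using lo L by (intro real_sqrt_le_mono) (simp add: power_mult_distrib powr_power)
      then have sn: "sqrt (real n) \<le> 2 * real m * L powr (5 / 8)" by simp
      have "real n / L * (4 * real k / (real m * sqrt (real n))) = sqrt (real n) * (4 * real k / (L * real m))"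
        using n L m real_sqrt_mult_self[of "real n"] by (simp add: field_simps)
      also have "\<dots> \<le> (2 * real m * L powr (5 / 8)) * (4 * (2 * L powr (1 / 4)) / (L * real m))"
        using sn k L m by (intro mult_mono divide_right_mono) auto
      also have "\<dots> = 16 * (L powr (5 / 8) * L powr (1 / 4) / L)" using m by simp
      also have "L powr (5 / 8) * L powr (1 / 4) / L = L powr (- 1 / 8)"
        using L powr_diff[of L "7 / 8" 1] by (simp add: powr_add[symmetric])
      finally show ?thesis .
    qed
    have 4: "real n / L * (8 * (real m)\<^sup>2 * exp (- real n * s\<^sup>2 / (16 * (real m)\<^sup>2))) \<le> 8 * (real n ^ 3 * exp (- (s\<^sup>2 / 16) * L powr (5 / 4)))"
    proof -
      have "L powr (5 / 4) \<le> real n / (real m)\<^sup>2" using up m by (simp add: le_divide_eq mult.commute)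
      then have "(s\<^sup>2 / 16) * L powr (5 / 4) \<le> (s\<^sup>2 / 16) * (real n / (real m)\<^sup>2)" by (intro mult_left_mono) auto
      then have e: "exp (- real n * s\<^sup>2 / (16 * (real m)\<^sup>2)) \<le> exp (- (s\<^sup>2 / 16) * L powr (5 / 4))" by (simp add: mult_ac)
      have "real n / L \<le> real n" using L n by (simp add: divide_le_eq)
      then have "real n / L * (8 * (real m)\<^sup>2 * exp (- real n * s\<^sup>2 / (16 * (real m)\<^sup>2))) \<le> real n * (8 * (real n)\<^sup>2 * exp (- (s\<^sup>2 / 16) * L powr (5 / 4)))"
        using mn by (intro mult_mono e power_mono) auto
      then show ?thesis by (simp add: power2_eq_square power3_eq_cube mult_ac)
    qed
    have "real n / L * expectation (\<lambda>\<omega>. square_cost n (\<lambda>i. X i \<omega>)) \<le> real n / L *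
      (A * (neumann_sum m / real n) + H * (2 / (real (m * k))\<^sup>2 + 4 * real k / (real m * sqrt (real n))) + 8 * (real m)\<^sup>2 * exp (- real n * s\<^sup>2 / (16 * (real m)\<^sup>2)))"
      using expectation_square_cost_upper[OF n m k(1) s s(1)] nL unfolding A_def H_def by (intro mult_left_mono) auto
    also have "\<dots> = A * (real n / L * (neumann_sum m / real n)) + H * (real n / L * (2 / (real (m * k))\<^sup>2) + real n / L * (4 * real k / (real m * sqrt (real n))))
        + real n / L * (8 * (real m)\<^sup>2 * exp (- real n * s\<^sup>2 / (16 * (real m)\<^sup>2)))" by (simp only: distrib_left mult.left_commute)
    also have "\<dots> \<le> u n" unfolding u_def L_def[symmetric] using A H by (intro add_mono mult_left_mono 1 2 3 4) auto
    also have "\<dots> < c" by (rule elim(1))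
    finally show ?case by (simp add: L_def)
  qed
qed

end

lemma tendsto_at_right_less_E:
  fixes g :: "real \<Rightarrow> real"
  assumes "(g \<longlongrightarrow> l) (at_right 0)" "l < c"
  obtains s where "0 < s" "s < 1 / 2" "g s < c"
proof -
  have "\<forall>\<^sub>F s in at_right 0. 0 < s \<and> s < (1 / 2 :: real)" by (auto simp: eventually_at_right_field intro!: exI[of _ "1 / 2"])
  then have "\<forall>\<^sub>F s in at_right 0. 0 < s \<and> s < 1 / 2 \<and> g s < c" using order_tendstoD(2)[OF assms] by eventually_elim auto
  then show ?thesis using that eventually_happens'[OF trivial_limit_at_right_real] by blast
qed

section \<open>The limit inferior of the rescaled cost\<close>

context lower_bound begin

text \<open>The parameter \<open>s\<close> bounds the second derivatives and is the Young parameter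
  of the energy. The difference in the hypothesis, from 2 for the linear part and 1 for the energy,
  tends to 1 as \<open>s\<close> and \<open>\<delta>\<close> tend to 0.\<close>

lemma eventually_cost_lower:
  assumes s: "0 < s" "s < 1" and \<delta>: "\<delta> \<le> 1 / 2"
    and D0: "0 \<le> 2 * (1 - 4 * \<delta>) - (1 + s) / (1 - s)" and c: "c < (2 * (1 - 4 * \<delta>) - (1 + s) / (1 - s)) / (4 * pi)"
  shows "\<forall>\<^sub>F n in sequentially. c < real n / ln (real n) * expectation (\<lambda>\<omega>. square_cost n (\<lambda>i. X i \<omega>))"
proof -
  define D where "D = 2 * (1 - 4 * \<delta>) - (1 + s) / (1 - s)"
  define E where "E = 3 / pi\<^sup>2 * D + 2 + 4 * (1 + 1 / s) * C\<^sup>2 / (1 - s)"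
  define K where "K = 64 * W / s + 2"
  define b where "b = s\<^sup>2 / (32 * W\<^sup>2)"
  have b: "b > 0" using s W_ge by (simp add: b_def)
  have K: "K \<ge> 0" using s W_ge by (simp add: K_def)
  have D: "0 \<le> D" using D0 by (simp add: D_def)
  define u where "u n = D / (2 * pi) * (1 / 2 - 5 / 8 * (ln (ln (real n)) / ln (real n))) - E / ln (real n) - 192 * K\<^sup>2 * (real n ^ 9 * exp (- b * ln (real n) powr (5 / 4)))" for n
  have "(\<lambda>n. ln (ln (real n)) / ln (real n)) \<longlonglongrightarrow> 0" "(\<lambda>n. E / ln (real n)) \<longlonglongrightarrow> 0" by real_asymp+
  then have "u \<longlonglongrightarrow> D / (2 * pi) * (1 / 2 - 5 / 8 * 0) - 0 - 192 * K\<^sup>2 * 0"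
    unfolding u_def by (intro tendsto_intros power_times_exp_tendsto_0 b)
  then have "u \<longlonglongrightarrow> D / (4 * pi)" by simp
  moreover have "c < D / (4 * pi)" using c by (simp add: D_def)
  ultimately have "\<forall>\<^sub>F n in sequentially. c < u n" by (rule order_tendstoD)
  then show ?thesis using mesh_bounds
  proof eventually_elim
    case (elim n)
    define L m where "L = ln (real n)" and "m = mesh n"
    have L: "1 \<le> L" and m: "m > 0" and mn: "real m \<le> real n" and up: "(real m)\<^sup>2 * L powr (5 / 4) \<le> real n" and lm: "L / 2 - 5 / 8 * ln L \<le> ln (real m + 1)"
      using elim(2) unfolding L_def m_def by blast+
    have n: "n > 0" using mn m by simp
    \<comment> \<open>Fine enough for the Lipschitz argument, yet polynomial in \<open>n\<close>, so
      that the union bound over the grid is harmless.\<close>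
    define G where "G = nat \<lceil>64 * W * real m ^ 3 / s\<rceil>"
    have G: "64 * W * real m ^ 3 / s \<le> real G" "real G \<le> 64 * W * real m ^ 3 / s + 1"
      using W_ge s unfolding G_def by (simp_all add: of_nat_ceiling)
    have Gp: "0 < G"
    proof -
      have "0 < 64 * W * real m ^ 3 / s" using W_ge s m by simp
      then have "0 < real G" using G(1) by linarith
      then show ?thesis by simp
    qed
    have G': "64 * W * real m ^ 3 \<le> s * real G" using G(1) s by (simp add: divide_le_eq mult.commute)
    let ?e = "exp (- real n * s\<^sup>2 / (32 * W\<^sup>2 * (real m)\<^sup>2))"
    let ?S = "lattice_sum m / pi\<^sup>2"
    let ?l = "(2 * (1 - 4 * \<delta>) * ?S - 2 - ((1 + s) * ?S + 4 * (1 + 1 / s) * C\<^sup>2) / (1 - s)) / real n"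
    have low: "?l - 192 * (real m)\<^sup>2 * (real G + 1)\<^sup>2 * ?e \<le> expectation (\<lambda>\<omega>. square_cost n (\<lambda>i. X i \<omega>))"
      by (rule expectation_square_cost_lower[OF n m Gp G' s s(1) \<delta>])
    have 1: "D / (2 * pi) * (1 / 2 - 5 / 8 * (ln L / L)) - E / L \<le> real n / L * ?l"
    proof -
      have "pi / 2 * (L / 2 - 5 / 8 * ln L) - 3 \<le> pi / 2 * ln (real m + 1) - 3" using lm by (intro diff_right_mono mult_left_mono) auto
      also have "\<dots> \<le> lattice_sum m" by (rule lattice_sum_ge)
      finally have "(pi / 2 * (L / 2 - 5 / 8 * ln L) - 3) / pi\<^sup>2 \<le> ?S" by (intro divide_right_mono) auto
      then have "1 / (2 * pi) * (L / 2 - 5 / 8 * ln L) - 3 / pi\<^sup>2 \<le> ?S" by (simp add: diff_divide_distrib power2_eq_square)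
      then have "D * (1 / (2 * pi) * (L / 2 - 5 / 8 * ln L) - 3 / pi\<^sup>2) \<le> D * ?S" using D by (rule mult_left_mono)
      then have "D / (2 * pi) * (L / 2 - 5 / 8 * ln L) - E \<le> D * ?S - 2 - 4 * (1 + 1 / s) * C\<^sup>2 / (1 - s)"
        by (simp add: E_def right_diff_distrib)
      then have "(D / (2 * pi) * (L / 2 - 5 / 8 * ln L) - E) / L \<le> (D * ?S - 2 - 4 * (1 + 1 / s) * C\<^sup>2 / (1 - s)) / L"
        using L by (intro divide_right_mono) auto
      moreover have "(D / (2 * pi) * (L / 2 - 5 / 8 * ln L) - E) / L = D / (2 * pi) * (1 / 2 - 5 / 8 * (ln L / L)) - E / L"
      proof -
        have "(p * (L / 2 - 5 / 8 * ln L) - E) / L = p * (1 / 2 - 5 / 8 * (ln L / L)) - E / L" for p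
          using L by (simp add: field_simps)
        then show ?thesis .
      qed
      moreover have "real n / L * ?l = (D * ?S - 2 - 4 * (1 + 1 / s) * C\<^sup>2 / (1 - s)) / L"
      proof -
        have "a * x - 2 - (p * x + q) / (1 - s) = (a - p / (1 - s)) * x - 2 - q / (1 - s)" for a p q x
          by (simp add: add_divide_distrib left_diff_distrib)
        moreover have "real n / L * (y / real n) = y / L" for y using n by simp
        ultimately show ?thesis unfolding D_def by metis
      qed
      ultimately show ?thesis by linarith
    qed
    \<comment> \<open>The ninth power is one from the rescaling, two from \<open>m\<^sup>2\<close>
      and six from the number of grid points, as \<open>G\<close> is of order
      \<open>m ^ 3\<close>.\<close>
    have 2: "real n / L * (192 * (real m)\<^sup>2 * (real G + 1)\<^sup>2 * ?e) \<le> 192 * K\<^sup>2 * (real n ^ 9 * exp (- b * L powr (5 / 4)))"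
    proof -
      have "L powr (5 / 4) \<le> real n / (real m)\<^sup>2" using up m by (simp add: le_divide_eq mult.commute)
      then have "b * L powr (5 / 4) \<le> b * (real n / (real m)\<^sup>2)" using b by (intro mult_left_mono) auto
      then have e: "?e \<le> exp (- b * L powr (5 / 4))" by (simp add: b_def mult_ac)
      have "1 \<le> real n ^ 3" using n by (simp add: one_le_power)
      have "real m ^ 3 \<le> real n ^ 3" using mn by (intro power_mono) auto
      then have "64 * W / s * real m ^ 3 \<le> 64 * W / s * real n ^ 3" using W_ge s by (intro mult_left_mono) auto
      then have "real G + 1 \<le> K * real n ^ 3" using G(2) \<open>1 \<le> real n ^ 3\<close> by (simp add: K_def distrib_right)
      then have G2: "(real G + 1)\<^sup>2 \<le> (K * real n ^ 3)\<^sup>2" by (intro power_mono) auto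
      have "real n / L \<le> real n" using L n by (simp add: divide_le_eq)
      then have "real n / L * (192 * (real m)\<^sup>2 * (real G + 1)\<^sup>2 * ?e) \<le> real n * (192 * (real n)\<^sup>2 * (K * real n ^ 3)\<^sup>2 * exp (- b * L powr (5 / 4)))"
        using mn G2 K by (intro mult_mono e power_mono) auto
      also have "\<dots> = 192 * K\<^sup>2 * ((real n * (real n)\<^sup>2 * (real n ^ 3)\<^sup>2) * exp (- b * L powr (5 / 4)))" by (simp add: power_mult_distrib)
      also have "real n * (real n)\<^sup>2 * (real n ^ 3)\<^sup>2 = real n ^ 9" by (simp add: power_mult[symmetric] power_add[symmetric] flip: power_Suc)
      finally show ?thesis .
    qed
    have "c < u n" by (rule elim(1))
    also have "\<dots> \<le> real n / L * ?l - real n / L * (192 * (real m)\<^sup>2 * (real G + 1)\<^sup>2 * ?e)"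
      unfolding u_def L_def[symmetric] by (intro diff_mono 1 2)
    also have "\<dots> = real n / L * (?l - 192 * (real m)\<^sup>2 * (real G + 1)\<^sup>2 * ?e)" by (simp only: right_diff_distrib)
    also have "\<dots> \<le> real n / L * expectation (\<lambda>\<omega>. square_cost n (\<lambda>i. X i \<omega>))" using L by (intro mult_left_mono low) auto
    finally show ?case by (simp add: L_def)
  qed
qed

end

lemma (in uniform_sample) cost_asymptotics:
  "(\<lambda>n. real n / ln (real n) * expectation (\<lambda>\<omega>. square_cost n (\<lambda>i. X i \<omega>))) \<longlonglongrightarrow> 1 / (4 * pi)"
proof (rule order_tendstoI)
  fix c :: real assume c: "1 / (4 * pi) < c"
  have "((\<lambda>s. (1 + s) * ((1 + s) / (1 - s)\<^sup>2) * ((1 + s) / (4 * pi))) \<longlongrightarrow> (1 + 0) * ((1 + 0) / (1 - 0)\<^sup>2) * ((1 + 0) / (4 * pi))) (at_right (0 :: real))"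
    by (intro tendsto_intros) auto
  then have "((\<lambda>s. (1 + s) * ((1 + s) / (1 - s)\<^sup>2) * ((1 + s) / (4 * pi))) \<longlongrightarrow> 1 / (4 * pi)) (at_right (0 :: real))" by simp
  then obtain s :: real where s: "0 < s" "s < 1 / 2" "(1 + s) * ((1 + s) / (1 - s)\<^sup>2) * ((1 + s) / (4 * pi)) < c"
    using tendsto_at_right_less_E c by blast
  then show "\<forall>\<^sub>F n in sequentially. real n / ln (real n) * expectation (\<lambda>\<omega>. square_cost n (\<lambda>i. X i \<omega>)) < c"
    by (intro eventually_cost_upper[of s]) auto
next
  fix c :: real assume c: "c < 1 / (4 * pi)"
  \<comment> \<open>The missing mass of the cutoff and the parameter of the estimate are both set to
    \<open>s\<close>. The sign is changed below to use the selection rule for upper bounds.\<close>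
  let ?D = "\<lambda>s. (2 * (1 - 4 * s) - (1 + s) / (1 - s))"
  have "((\<lambda>s. - ?D s) \<longlongrightarrow> - (2 * (1 - 4 * 0) - (1 + 0) / (1 - 0))) (at_right (0 :: real))"
    by (intro tendsto_intros) auto
  then have "((\<lambda>s. - ?D s) \<longlongrightarrow> - 1) (at_right (0 :: real))" by simp
  \<comment> \<open>The maximum with 0 also secures the nonnegativity of \<open>?D s\<close> when
    \<open>c\<close> is negative.\<close>
  moreover have "- 1 < - max 0 (4 * pi * c)" using c by (simp add: field_simps)
  ultimately obtain s :: real where s: "0 < s" "s < 1 / 2" "- ?D s < - max 0 (4 * pi * c)"
    using tendsto_at_right_less_E by blast
  obtain \<eta>0 \<eta>1 \<eta>2 \<eta>3 C where "boundary_cutoff \<eta>0 \<eta>1 \<eta>2 \<eta>3 C s" using boundary_cutoff_exists[OF s(1)] by blast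
  then interpret lower_bound M X \<eta>0 \<eta>1 \<eta>2 \<eta>3 C s
    by (intro lower_bound.intro uniform_sample_axioms)
  show "\<forall>\<^sub>F n in sequentially. c < real n / ln (real n) * expectation (\<lambda>\<omega>. square_cost n (\<lambda>i. X i \<omega>))"
  proof (rule eventually_cost_lower[of s])
    have "0 < ?D s" "4 * pi * c < ?D s" using s(3) by simp_all
    then show "0 \<le> ?D s" "c < ?D s / (4 * pi)" by (simp_all add: less_divide_eq mult.commute)
  qed (use s in auto)
qed

theorem proposition3p1:
  fixes M :: "'w measure" and X :: "nat \<Rightarrow> 'w \<Rightarrow> real^2"
  assumes "prob_space M"
    and "prob_space.indep_vars M (\<lambda>_. borel) X {1..}"
    and "\<And>i. i \<ge> 1 \<Longrightarrow> distr M borel (X i) = uniform_measure lborel unit_square"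
  shows "(\<lambda>n. real n / ln (real n) *
            prob_space.expectation M (\<lambda>\<omega>.
              (enn2real (Wb unit_square 2
                 (empirical_measure n (\<lambda>i. X i \<omega>)) lebesgue_square))\<^sup>2))
          \<longlonglongrightarrow> 1 / (4 * pi)"
proof -
  interpret prob_space M by fact
  interpret uniform_sample M X
    using assms(2,3) by unfold_locales (simp_all add: uniform_measure_unit_square)
  show ?thesis using cost_asymptotics unfolding Wb_2_square square_cost_def .
qed

end
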